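(* Let $(J,E)\in D$ be such that $\det(\mathcal{H}_{J,E})<0$. Then the periodic wave profile $Q_{J,E}$ is a stable equilibrium of $$iQ_t+4ipkQ_z+4k^2Q_{zz}-(1+p^2)Q+|Q|^2Q=0,\qquad k=k(J,E),\ p=p(J,E),$$ in the following sense: there exist $C_0>0$ and $\epsilon_0>0$ such that, if $Q_0\in X$ satisfies $\rho(Q_0,Q_{J,E})\le\epsilon$ for some $\epsilon\le\epsilon_0$, then the solution $Q(z,t)$ of this equation with initial data $Q_0$ satisfies $\rho(Q(\cdot,t),Q_{J,E})\le C_0\epsilon$ for all $t\in\mathbb{R}$.
   Context: **Profiles.** Consider $W_{xx}-W+|W|^2W=0$ ($W:\mathbb{R}\to\mathbb{C}$), with conserved quantities $J=\mathrm{Im}(\overline{W}W_x)$ and $E=\frac12|W_x|^2-\frac12|W|^2+\frac14|W|^4$. Write $J=q(1+q^2)$ with $q\in\mathbb{R}$, set $E_-(J)=\frac14(q^2+1)(3q^2-1)$ and $D=\{(J,E)\in\mathbb{R}^2\mid E>E_-(J)\}\setminus\{(0,0)\}$, $\Gamma_+=\{(0,E)\mid E>0\}$, $\Gamma_-=\{(0,E)\mid-1/4<E<0\}$. For $(J,E)\in D$ let $y_3\le0\le y_1<y_2$ be the roots of $-y^3+2y^2+4Ey-2J^2$, $s(\varphi)=y_1\cos^2\varphi+y_2\sin^2\varphi$, and $$T=2\sqrt2\int_0^{\pi/2}\frac{d\varphi}{\sqrt{s(\varphi)-y_3}},\qquad \Phi=2\sqrt2\int_0^{\pi/2}\frac{J}{s(\varphi)}\frac{d\varphi}{\sqrt{s(\varphi)-y_3}}\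 \text{ on }D\setminus\Gamma_+,$$ $$\Psi=-2\sqrt2\,J\int_0^{\pi/2}\frac{d\varphi}{\sqrt{-y_3}\sqrt{s(\varphi)-y_3}(\sqrt{-y_3}+\sqrt{s(\varphi)-y_3})}\ \text{ on }D\setminus\Gamma_-,$$ so that $\Psi=\Phi-\pi\,\mathrm{sign}(J)$ for $J\neq0$ ($T$ is the minimal period of $|W|$, $\Phi$ the phase increment of $W$ over a period). Put $k=k(J,E)=\pi/T$. The number $p$ is defined, in a neighborhood of the point of $D$ under consideration, by $p=(\pi+\Psi)/T$ if that point is not on $\Gamma_-$, and by $p=\Phi/T$ if that point is on $\Gamma_-$; it is then a smooth function near that point. Let $W_{J,E}$ be a solution with invariants $(J,E)$ which is nonconstant in modulus (unique up to a translation and a constant phase factor), and define $Q_{J,E}$ by $W_{J,E}(x)=e^{ipx}Q_{J,E}(2kx)$; $Q_{J,E}$ is $2\pi$-periodic. **Function space.** $X=H^1_{\mathrm{per}}([0,2\pi],\mathbb{C})$ is the space of $2\pi$-periodic functions in $H^1_{\mathrm{loc}}(\mathbb{R},\mathbb{C})$ with $\|u\|_X^2=\int_0^{2\pi}(|u|^2+|u_z|^2)\,dz$, and $\rho(u,v)=\inf_{\phi,\xi\in\mathbb{R}/2\pi\mathbb{Z}}\|u-e^{-i\phi}v(\cdot+\xi)\|_X$. The Cauchy problem for the evolution equation is globally well-posed in $X$. **The matrix $\mathcal{H}_{J,E}$.** On $X$ let $N(Q)=\frac12\int_0^{2\pi}|Q|^2dz$, $M(Q)=\frac{i}{2}\int_0^{2\pi}\overline{Q}Q_z\,dz$,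 $\mathcal{E}(Q)=\int_0^{2\pi}\bigl(2k^2|Q_z|^2-\frac14|Q|^4\bigr)dz$, and, for fixed $(J,E)\in D$ with $k=k(J,E)$, $p=p(J,E)$, $\mathcal{E}_{J,E}(Q)=\mathcal{E}(Q)+(1+p^2)N(Q)-4pkM(Q)$. For $(\omega,c)\in\mathbb{R}^2$ sufficiently close to $(0,0)$ there is a unique $(J',E')\in D$ in a neighborhood of $(J,E)$ such that, with $k'=k(J',E')$, $p'=p(J',E')$, $\lambda=k/k'$, $$\omega=(1+p^2)-\lambda^2(1+p'^2),\qquad c=4\lambda^2k'p'-4kp.$$ Set $Q^{\omega,c}_{J,E}=\lambda Q_{J',E'}$ and $d_{J,E}(\omega,c)=\mathcal{E}_{J,E}(Q^{\omega,c}_{J,E})-\omega N(Q^{\omega,c}_{J,E})-cM(Q^{\omega,c}_{J,E})$. Then $\mathcal{H}_{J,E}$ is the $2\times2$ Hessian matrix of $d_{J,E}$ with respect to $(\omega,c)$ at $(\omega,c)=(0,0)$. *)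

theory Defs
  imports "HOL-Analysis.Analysis"
begin

section \<open>Travelling and rotating waves of the cubic focusing NLS equation\<close>

definition q_of :: "real \<Rightarrow> real" where
  "q_of J = (THE q. J = q * (1 + q\<^sup>2))"

definition E_minus :: "real \<Rightarrow> real" where
  "E_minus J = ((q_of J)\<^sup>2 + 1) * (3 * (q_of J)\<^sup>2 - 1) / 4"

definition D_set :: "(real \<times> real) set" where
  "D_set = {(J, E). E > E_minus J} - {(0, 0)}"

definition Gamma_minus :: "(real \<times> real) set" where
  "Gamma_minus = {(J, E). J = 0 \<and> -1/4 < E \<and> E < 0}"

text \<open>The ordered triple \<open>(y\<^sub>1, y\<^sub>2, y\<^sub>3)\<close> of roots, counted with multiplicity.\<close>

definition roots3 :: "real \<times> real \<Rightarrow> real \<times> real \<times> real" where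
  "roots3 = (\<lambda>(J, E). THE (y1, y2, y3). y3 \<le> 0 \<and> 0 \<le> y1 \<and> y1 < y2 \<and>
     (\<forall>y. - (y^3) + 2 * y\<^sup>2 + 4 * E * y - 2 * J\<^sup>2 = - ((y - y1) * (y - y2) * (y - y3))))"

definition y1_of :: "real \<times> real \<Rightarrow> real" where "y1_of P = fst (roots3 P)"
definition y2_of :: "real \<times> real \<Rightarrow> real" where "y2_of P = fst (snd (roots3 P))"
definition y3_of :: "real \<times> real \<Rightarrow> real" where "y3_of P = snd (snd (roots3 P))"

definition s_of :: "real \<times> real \<Rightarrow> real \<Rightarrow> real" where
  "s_of P \<phi> = y1_of P * (cos \<phi>)\<^sup>2 + y2_of P * (sin \<phi>)\<^sup>2"

definition T_of :: "real \<times> real \<Rightarrow> real" where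
  "T_of P = 2 * sqrt 2 * integral {0..pi/2} (\<lambda>\<phi>. 1 / sqrt (s_of P \<phi> - y3_of P))"

text \<open>\<open>Phi_of\<close> is meaningful on \<open>D_set\<close> away from the half-line \<open>J = 0, E > 0\<close>, and
  \<open>Psi_of\<close> on \<open>D_set - Gamma_minus\<close>.\<close>

definition Phi_of :: "real \<times> real \<Rightarrow> real" where
  "Phi_of P = 2 * sqrt 2 * integral {0..pi/2}
     (\<lambda>\<phi>. fst P / s_of P \<phi> * (1 / sqrt (s_of P \<phi> - y3_of P)))"

definition Psi_of :: "real \<times> real \<Rightarrow> real" where
  "Psi_of P = - 2 * sqrt 2 * fst P * integral {0..pi/2}
     (\<lambda>\<phi>. 1 / (sqrt (- y3_of P) * sqrt (s_of P \<phi> - y3_of P) *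
                (sqrt (- y3_of P) + sqrt (s_of P \<phi> - y3_of P))))"

definition k_of :: "real \<times> real \<Rightarrow> real" where
  "k_of P = pi / T_of P"

text \<open>\<open>p_of b P\<close> is the value at \<open>P\<close> of the branch of \<open>p\<close> that is used near the base point \<open>b\<close>.\<close>

definition p_of :: "real \<times> real \<Rightarrow> real \<times> real \<Rightarrow> real" where
  "p_of b P = (if b \<notin> Gamma_minus then (pi + Psi_of P) / T_of P else Phi_of P / T_of P)"

definition is_wave :: "real \<times> real \<Rightarrow> (real \<Rightarrow> complex) \<Rightarrow> bool" where
  "is_wave = (\<lambda>(J, E) W. \<exists>W' W''.
     (\<forall>x. (W has_vector_derivative W' x) (at x)) \<and>
     (\<forall>x. (W' has_vector_derivative W'' x) (at x)) \<and>
     (\<forall>x. W'' x - W x + of_real ((cmod (W x))\<^sup>2) * W x = 0) \<and>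
     (\<forall>x. Im (cnj (W x) * W' x) = J) \<and>
     (\<forall>x. (cmod (W' x))\<^sup>2 / 2 - (cmod (W x))\<^sup>2 / 2 + (cmod (W x))^4 / 4 = E) \<and>
     (\<exists>x y. cmod (W x) \<noteq> cmod (W y)))"

text \<open>A choice of the wave, which is unique up to a translation and a constant phase factor;
  all quantities below are insensitive to this choice.\<close>

definition W_of :: "real \<times> real \<Rightarrow> real \<Rightarrow> complex" where
  "W_of P = (SOME W. is_wave P W)"

text \<open>The relation \<open>W x = exp (\<i> p x) * Q (2 k x)\<close> solved for \<open>Q\<close>.\<close>

definition Q_of :: "real \<times> real \<Rightarrow> real \<times> real \<Rightarrow> real \<Rightarrow> complex" where
  "Q_of b P z = exp (- \<i> * of_real (p_of b P * (z / (2 * k_of P)))) * W_of P (z / (2 * k_of P))"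


section \<open>The space of periodic \<open>H\<^sup>1\<close> functions\<close>

text \<open>Elements are represented by functions; two functions that agree almost everywhere
  represent the same element.\<close>

definition test_function :: "(real \<Rightarrow> real) \<Rightarrow> bool" where
  "test_function \<phi> \<longleftrightarrow> (\<forall>n x. (deriv ^^ n) \<phi> field_differentiable at x) \<and>
     (\<exists>a b. \<forall>x. x \<notin> {a..b} \<longrightarrow> \<phi> x = 0)"

definition L2_loc :: "(real \<Rightarrow> complex) \<Rightarrow> bool" where
  "L2_loc u \<longleftrightarrow> u \<in> borel_measurable lebesgue \<and>
     (\<forall>a b. (\<lambda>x. (cmod (u x))\<^sup>2) integrable_on {a..b})"

definition has_weak_deriv :: "(real \<Rightarrow> complex) \<Rightarrow> (real \<Rightarrow> complex) \<Rightarrow> bool" where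
  "has_weak_deriv u g \<longleftrightarrow> (\<forall>\<phi>. test_function \<phi> \<longrightarrow>
     integral UNIV (\<lambda>x. u x * of_real (deriv \<phi> x)) = - integral UNIV (\<lambda>x. g x * of_real (\<phi> x)))"

definition H1_loc :: "(real \<Rightarrow> complex) \<Rightarrow> bool" where
  "H1_loc u \<longleftrightarrow> L2_loc u \<and> (\<exists>g. L2_loc g \<and> has_weak_deriv u g)"

definition weak_deriv :: "(real \<Rightarrow> complex) \<Rightarrow> real \<Rightarrow> complex" where
  "weak_deriv u = (SOME g. L2_loc g \<and> has_weak_deriv u g)"

definition X_space :: "(real \<Rightarrow> complex) set" where
  "X_space = {u. (\<forall>z. u (z + 2 * pi) = u z) \<and> H1_loc u}"

definition X_norm :: "(real \<Rightarrow> complex) \<Rightarrow> real" where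
  "X_norm u = sqrt (integral {0..2*pi} (\<lambda>z. (cmod (u z))\<^sup>2 + (cmod (weak_deriv u z))\<^sup>2))"

text \<open>For periodic \<open>v\<close> the norm below is \<open>2\<pi>\<close>-periodic in \<open>\<phi>\<close> and in \<open>\<xi>\<close>, so the infimum over
  \<open>\<real>\<close> is the infimum over \<open>\<real>/2\<pi>\<int>\<close>.\<close>

definition rho :: "(real \<Rightarrow> complex) \<Rightarrow> (real \<Rightarrow> complex) \<Rightarrow> real" where
  "rho u v = (INF (\<phi>, \<xi>) \<in> (UNIV :: (real \<times> real) set).
     X_norm (\<lambda>z. u z - exp (- \<i> * of_real \<phi>) * v (z + \<xi>)))"


section \<open>The evolution equation\<close>

text \<open>\<open>is_solution k p u\<close>: the map \<open>t \<mapsto> u t\<close> is continuous from \<open>\<real>\<close> to \<open>X\<close> and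
  \<open>\<i> Q\<^sub>t + 4 \<i> p k Q\<^sub>z + 4 k\<^sup>2 Q\<^sub>z\<^sub>z - (1 + p\<^sup>2) Q + |Q|\<^sup>2 Q = 0\<close> holds for all times as an identity
  in the dual space of \<open>X\<close>, the term \<open>Q\<^sub>z\<^sub>z\<close> being integrated by parts once.\<close>

definition is_solution :: "real \<Rightarrow> real \<Rightarrow> (real \<Rightarrow> real \<Rightarrow> complex) \<Rightarrow> bool" where
  "is_solution k p u \<longleftrightarrow>
     (\<forall>t. u t \<in> X_space) \<and>
     (\<forall>t. ((\<lambda>s. X_norm (\<lambda>z. u s z - u t z)) \<longlongrightarrow> 0) (at t)) \<and>
     (\<forall>v\<in>X_space. \<forall>t. \<exists>m.
        ((\<lambda>s. integral {0..2*pi} (\<lambda>z. u s z * cnj (v z))) has_vector_derivative m) (at t) \<and>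
        \<i> * m
        + 4 * \<i> * of_real (p * k) * integral {0..2*pi} (\<lambda>z. weak_deriv (u t) z * cnj (v z))
        - 4 * of_real (k\<^sup>2) * integral {0..2*pi} (\<lambda>z. weak_deriv (u t) z * cnj (weak_deriv v z))
        - of_real (1 + p\<^sup>2) * integral {0..2*pi} (\<lambda>z. u t z * cnj (v z))
        + integral {0..2*pi} (\<lambda>z. of_real ((cmod (u t z))\<^sup>2) * u t z * cnj (v z)) = 0)"


section \<open>The matrix \<open>\<H>\<close>\<close>

definition N_fun :: "(real \<Rightarrow> complex) \<Rightarrow> real" where
  "N_fun Q = integral {0..2*pi} (\<lambda>z. (cmod (Q z))\<^sup>2) / 2"

text \<open>The complex number below is real for periodic \<open>Q\<close>; \<open>Re\<close> only serves as a conversion.\<close>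

definition M_fun :: "(real \<Rightarrow> complex) \<Rightarrow> real" where
  "M_fun Q = Re (\<i> / 2 * integral {0..2*pi} (\<lambda>z. cnj (Q z) * weak_deriv Q z))"

definition E_fun :: "real \<Rightarrow> (real \<Rightarrow> complex) \<Rightarrow> real" where
  "E_fun k Q = integral {0..2*pi} (\<lambda>z. 2 * k\<^sup>2 * (cmod (weak_deriv Q z))\<^sup>2 - (cmod (Q z))^4 / 4)"

definition E_JE :: "real \<times> real \<Rightarrow> (real \<Rightarrow> complex) \<Rightarrow> real" where
  "E_JE b Q = E_fun (k_of b) Q + (1 + (p_of b b)\<^sup>2) * N_fun Q - 4 * p_of b b * k_of b * M_fun Q"

definition lambda_of :: "real \<times> real \<Rightarrow> real \<times> real \<Rightarrow> real" where
  "lambda_of b P = k_of b / k_of P"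

text \<open>The parameters \<open>(\<omega>, c)\<close> corresponding to a point \<open>P = (J', E')\<close> near \<open>b = (J, E)\<close>.\<close>

definition omega_c :: "real \<times> real \<Rightarrow> real \<times> real \<Rightarrow> real \<times> real" where
  "omega_c b P =
     ((1 + (p_of b b)\<^sup>2) - (lambda_of b P)\<^sup>2 * (1 + (p_of b P)\<^sup>2),
      4 * (lambda_of b P)\<^sup>2 * k_of P * p_of b P - 4 * k_of b * p_of b b)"

text \<open>The local inverse of \<open>omega_c b\<close> near \<open>b\<close>. Only its germ at \<open>(0, 0)\<close> is determined, which
  is all that the Hessian below depends on.\<close>

definition is_local_inverse ::
    "real \<times> real \<Rightarrow> (real \<times> real \<Rightarrow> real \<times> real) \<Rightarrow> bool" where
  "is_local_inverse b G \<longleftrightarrow> (\<exists>U V. open U \<and> b \<in> U \<and> U \<subseteq> D_set \<and> open V \<and> (0, 0) \<in> V \<and>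
     (\<forall>v\<in>V. G v \<in> U \<and> omega_c b (G v) = v \<and> (\<forall>P\<in>U. omega_c b P = v \<longrightarrow> P = G v)))"

definition P_of :: "real \<times> real \<Rightarrow> real \<times> real \<Rightarrow> real \<times> real" where
  "P_of b = (SOME G. is_local_inverse b G)"

definition Q_oc :: "real \<times> real \<Rightarrow> real \<times> real \<Rightarrow> real \<Rightarrow> complex" where
  "Q_oc b v z = of_real (lambda_of b (P_of b v)) * Q_of b (P_of b v) z"

definition d_JE :: "real \<times> real \<Rightarrow> real \<Rightarrow> real \<Rightarrow> real" where
  "d_JE b \<omega> c = E_JE b (Q_oc b (\<omega>, c)) - \<omega> * N_fun (Q_oc b (\<omega>, c)) - c * M_fun (Q_oc b (\<omega>, c))"

definition partial_deriv :: "'n \<Rightarrow> (real ^ 'n \<Rightarrow> real) \<Rightarrow> real ^ 'n \<Rightarrow> real" where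
  "partial_deriv i f x = deriv (\<lambda>s. f (x + s *\<^sub>R axis i 1)) 0"

definition hessian :: "(real ^ 'n \<Rightarrow> real) \<Rightarrow> real ^ 'n \<Rightarrow> real ^ 'n ^ 'n" where
  "hessian f x = (\<chi> i j. partial_deriv i (partial_deriv j f) x)"

definition H_JE :: "real \<times> real \<Rightarrow> real ^ 2 ^ 2" where
  "H_JE b = hessian (\<lambda>v. d_JE b (v $ 1) (v $ 2)) 0"

end

theory Submission
  imports Defs "HOL-Complex_Analysis.Complex_Analysis"
begin

text \<open>Mass, momentum and energy are conserved, so stability follows once the second variation of
  the energy at the profile is coercive on perturbations orthogonal to the gradients of mass and momentum
  and to the two symmetry directions. Writing a perturbation as \<open>W * (a + i * b)\<close> and eliminating
  \<open>b\<close> leaves a scalar quadratic form in \<open>a\<close> with a rank one correction. Its Jacobi equation is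
  solved explicitly in terms of \<open>y = |W|^2\<close>, its derivative and its primitive, and all
  signs reduce to those of the cubic \<open>f y = - (y^3) + 2*y^2 + 4*E*y - 2*J^2\<close> and of \<open>f'\<close> at the mean of \<open>y\<close>.
  Coercivity follows from positivity by compactness. Modulating by a closest point of the orbit
  makes the perturbation orthogonal to the symmetry directions.\<close>

section \<open>Square integrable functions\<close>

text \<open>The translation mode \<open>psi = y'/y\<close> lies in the kernel of the scalar form and
  vanishes exactly at the extrema of the modulus. Jacobi's identity therefore gives positivity only
  on functions vanishing at two points of the period, a space of codimension two; the missing
  directions are controlled by explicit functions whose images under the Jacobi operator are
  combinations of \<open>y\<close> and \<open>1/y\<close>, that is, of the weights of the
  constraints. Dividing by \<open>W\<close> is impossible when the modulus has zeros
  (\<open>J = 0\<close>, \<open>E > 0\<close>). There the wave is real, the two components of a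
  perturbation decouple, and a parallel argument applies; \<open>good_wave\<close> is the common
  interface. A solution is only continuous into the energy space, with the equation in the dual, so
  momentum and energy must be regularised before they can be differentiated in time. The initial
  datum does not share mass and momentum with the profile: the constraints enter coercivity as a
  penalty and the invariants are compared with those of the datum, which keeps the final bound
  linear in the initial distance.\<close>

definition sqint :: "real => real => (real => 'a::euclidean_space) => bool" where
  "sqint a b g \<longleftrightarrow> g absolutely_integrable_on {a..b} & (%x. (norm (g x))^2) integrable_on {a..b}"

lemma sqint_measurable: "sqint a b g ==> g \<in> borel_measurable (lebesgue_on {a..b})"
  by (simp add: sqint_def absolutely_integrable_measurable)

lemma sqint_sq_abs: "sqint a b g ==> (%x. (norm (g x))^2) absolutely_integrable_on {a..b}"
  by (simp add: sqint_def nonnegative_absolutely_integrable_1)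

lemma sqint_abs: "sqint a b g ==> g absolutely_integrable_on {a..b}"
  and sqint_int: "sqint a b g ==> g integrable_on {a..b}"
  and sqint_sq: "sqint a b g ==> (%x. (norm (g x))^2) integrable_on {a..b}"
  by (auto simp: sqint_def set_lebesgue_integral_eq_integral(1))

lemma sqintI:
  fixes g :: "real => 'a::euclidean_space"
  assumes "g \<in> borel_measurable (lebesgue_on {a..b})" "h integrable_on {a..b}"
    "!!x. x \<in> {a..b} ==> (norm (g x))^2 <= h x"
  shows "sqint a b g"
proof -
  have "(%x. (norm (g x))^2) absolutely_integrable_on {a..b}"
    by (rule measurable_bounded_by_integrable_imp_absolutely_integrable[OF _ _ assms(2)]) (use assms in auto)
  then have sq: "(%x. (norm (g x))^2) integrable_on {a..b}" by (simp add: set_lebesgue_integral_eq_integral(1))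
  have "norm (g x) <= 1 + (norm (g x))^2" for x using zero_le_power2[of "norm (g x) - 1"] norm_ge_zero[of "g x"]
    by (simp add: power2_eq_square algebra_simps del: norm_ge_zero)
  then have "g absolutely_integrable_on {a..b}"
    by (intro measurable_bounded_by_integrable_imp_absolutely_integrable[where g="%x. 1 + (norm (g x))^2"] assms
        integrable_add sq) auto
  with sq show ?thesis by (simp add: sqint_def)
qed

lemma sqint_mult_bounded:
  fixes f g :: "real => 'a::{euclidean_space, real_normed_field}"
  assumes "continuous_on {a..b} f" "sqint a b g"
  shows "sqint a b (%x. f x*g x)"
proof -
  have "bounded (f ` {a..b})" by (rule compact_imp_bounded[OF compact_continuous_image[OF assms(1) compact_Icc]])
  then obtain B where B: "!!x. x \<in> {a..b} ==> norm (f x) <= B" unfolding bounded_iff by blast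
  show ?thesis
  proof (rule sqintI[where h="%x. B^2*(norm (g x))^2"])
    show "(%x. f x*g x) \<in> borel_measurable (lebesgue_on {a..b})"
      by (intro borel_measurable_times continuous_imp_measurable_on_sets_lebesgue sqint_measurable assms) auto
    show "(%x. B^2*(norm (g x))^2) integrable_on {a..b}"
      using assms(2) by (auto simp: sqint_def intro: integrable_on_mult_right)
    show "(norm (f x*g x))^2 <= B^2*(norm (g x))^2" if "x \<in> {a..b}" for x
      using B[OF that] by (auto simp: norm_mult power_mult_distrib intro!: mult_right_mono power_mono)
  qed
qed

lemma sqint_continuous:
  fixes f :: "real => 'a::euclidean_space"
  assumes "continuous_on {a..b} f"
  shows "sqint a b f" by (rule sqintI[where h="%x. (norm (f x))^2"])
     (use assms in \<open>auto intro!: continuous_imp_measurable_on_sets_lebesgue integrable_continuous_real continuous_intros\<close>)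

lemma sqint_add:
  fixes f g :: "real => 'a::euclidean_space"
  assumes "sqint a b f" "sqint a b g"
  shows "sqint a b (%x. f x + g x)"
proof (rule sqintI[where h="%x. 2*(norm (f x))^2 + 2*(norm (g x))^2"])
  show "(norm (f x + g x))^2 <= 2*(norm (f x))^2 + 2*(norm (g x))^2" for x
  proof -
    have "(norm (f x + g x))^2 <= (norm (f x) + norm (g x))^2" by (intro power_mono norm_triangle_ineq) auto
    also have "... <= 2*(norm (f x))^2 + 2*(norm (g x))^2"
      using zero_le_power2[of "norm (f x) - norm (g x)"] by (simp add: power2_eq_square algebra_simps)
    finally show ?thesis .
  qed
qed (intro borel_measurable_add sqint_measurable integrable_add integrable_on_mult_right sqint_sq assms)+

lemma sqint_scaleR:
  fixes g :: "real => 'a::euclidean_space"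
  assumes "sqint a b g" shows "sqint a b (%x. c *\<^sub>R g x)" by (rule sqintI[where h="%x. c^2*(norm (g x))^2"])
     (use assms in \<open>auto simp: sqint_def power_mult_distrib intro!: borel_measurable_scaleR integrable_on_mult_right dest: absolutely_integrable_measurable[THEN iffD1, rotated]\<close>)

lemma sqint_uminus:
  fixes g :: "real => 'a::euclidean_space"
  shows "sqint a b g ==> sqint a b (%x. - g x)" using sqint_scaleR[of a b g "-1"] by simp

lemma sqint_diff:
  fixes f g :: "real => 'a::euclidean_space"
  shows "sqint a b f ==> sqint a b g ==> sqint a b (%x. f x - g x)"
  using sqint_add[OF _ sqint_uminus, of a b f g] by simp

lemma sqint_linear:
  fixes g :: "real => 'a::euclidean_space" and L :: "'a => 'b::euclidean_space"
  assumes "sqint a b g" "bounded_linear L"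
  shows "sqint a b (%x. L (g x))"
proof -
  obtain K where K: "!!x. norm (L x) <= norm x*K" using bounded_linear.bounded[OF assms(2)] by auto
  show ?thesis
  proof (rule sqintI[where h="%x. K^2*(norm (g x))^2"])
    show "(%x. L (g x)) \<in> borel_measurable (lebesgue_on {a..b})"
      using borel_measurable_continuous_onI[OF linear_continuous_on[OF assms(2)]] sqint_measurable[OF assms(1)]
      by (rule measurable_compose[rotated])
    show "(norm (L (g x)))^2 <= K^2*(norm (g x))^2" for x
      using power_mono[OF K[of "g x"], of 2] by (simp add: power_mult_distrib mult.commute)
  qed (use assms in \<open>auto simp: sqint_def intro: integrable_on_mult_right\<close>)
qed

lemma sqint_times_abs:
  fixes f g :: "real => 'a::{euclidean_space, real_normed_field}"
  assumes "sqint a b f" "sqint a b g"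
  shows "(%x. f x*g x) absolutely_integrable_on {a..b}"
proof (rule measurable_bounded_by_integrable_imp_absolutely_integrable
    [where g="%x. (norm (f x))^2 + (norm (g x))^2"])
  show "norm (f x*g x) <= (norm (f x))^2 + (norm (g x))^2" for x
    using sum_squares_bound[of "norm (f x)" "norm (g x)"] mult_nonneg_nonneg[OF norm_ge_zero[of "f x"] norm_ge_zero[of "g x"]]
    unfolding norm_mult by linarith
  show "(%x. (norm (f x))^2 + (norm (g x))^2) integrable_on {a..b}" by (intro integrable_add sqint_sq assms)
qed (intro borel_measurable_times sqint_measurable assms, simp)

lemma sqint_times_integrable:
  fixes f g :: "real => 'a::{euclidean_space, real_normed_field}"
  shows "sqint a b f ==> sqint a b g ==> (%x. f x*g x) integrable_on {a..b}"
  using sqint_times_abs set_lebesgue_integral_eq_integral(1) by blast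

lemma sqint_subset:
  assumes "sqint a b g" "{c..d} <= {a..b}"
  shows "sqint c d g" using assms unfolding sqint_def
  by (meson absolutely_integrable_on_subinterval integrable_on_subinterval)

lemma sqint_norm: 
  fixes g :: "real => 'a::euclidean_space"
  shows "sqint a b g ==> sqint a b (%x. norm (g x))" by (rule sqintI[where h="%x. (norm (g x))^2"])
     (auto simp: sqint_sq intro: measurable_compose[OF sqint_measurable borel_measurable_norm])

lemma sqint_combine:
  assumes "sqint a c g" "sqint c b g" "a <= c" "c <= b"
  shows "sqint a b g" using assms unfolding sqint_def
  by (meson absolutely_integrable_on_combine Henstock_Kurzweil_Integration.integrable_combine)

text \<open>For \<open>A = 0\<close> the expression is affine in \<open>t\<close> and stays
  nonnegative only if \<open>B = 0\<close>; otherwise the minimum at \<open>t = B/A\<close> is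
  tested.\<close>

lemma discriminant_le:
  fixes A B C :: real
  assumes "!!t. 0 <= A*t^2 - 2*B*t + C" "A >= 0"
  shows "B^2 <= A*C"
proof (cases "A = 0")
  case True
  then have "B = 0" using assms(1)[of "(C + 1)/(2*B)"] by (cases "B = 0") (auto simp: field_simps)
  then show ?thesis using True by simp
next
  case False
  then show ?thesis using assms(1)[of "B/A"] assms(2) by (simp add: field_simps power2_eq_square)
qed

lemma Cauchy_Schwarz_integral:
  fixes f g :: "real => real"
  assumes "sqint a b f" "sqint a b g"
  shows "(integral {a..b} (%x. f x*g x))^2 <= integral {a..b} (%x. (f x)^2)*integral {a..b} (%x. (g x)^2)"
proof (rule discriminant_le)
  have i: "(%x. (f x)^2) integrable_on {a..b}" "(%x. (g x)^2) integrable_on {a..b}"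
    "(%x. f x*g x) integrable_on {a..b}"
    using sqint_sq[OF assms(1)] sqint_sq[OF assms(2)] sqint_times_integrable[OF assms] by auto
  show "0 <= integral {a..b} (%x. (f x)^2)" by (intro integral_nonneg i) auto
  fix t
  have "0 <= integral {a..b} (%x. (f x*t - g x)^2)"
    using sqint_sq[OF sqint_diff[OF sqint_scaleR[OF assms(1), of t] assms(2)]]
    by (intro integral_nonneg) (auto simp: mult.commute)
  also have "... = integral {a..b} (%x. (f x)^2*t^2 - (f x*g x)*(2*t) + (g x)^2)"
    by (simp add: power2_eq_square algebra_simps)
  also have "... = integral {a..b} (%x. (f x)^2)*t^2 - integral {a..b} (%x. f x*g x)*(2*t)
      + integral {a..b} (%x. (g x)^2)"
    using i by (simp add: integral_add integral_diff integrable_add integrable_diff integrable_on_mult_left)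
  finally show "0 <= integral {a..b} (%x. (f x)^2)*t^2 - 2*integral {a..b} (%x. f x*g x)*t
      + integral {a..b} (%x. (g x)^2)" by (simp add: algebra_simps)
qed

lemma Cauchy_Schwarz_norm:
  fixes f g :: "real => 'a::{euclidean_space, real_normed_field}"
  assumes "sqint a b f" "sqint a b g"
  shows "norm (integral {a..b} (%x. f x*g x))
    <= sqrt (integral {a..b} (%x. (norm (f x))^2)) * sqrt (integral {a..b} (%x. (norm (g x))^2))"
proof -
  have "norm (integral {a..b} (%x. f x*g x)) <= integral {a..b} (%x. norm (f x)*norm (g x))"
    using sqint_times_integrable[OF assms] sqint_times_integrable[OF sqint_norm[OF assms(1)] sqint_norm[OF assms(2)]]
    by (intro integral_norm_bound_integral) (auto simp: norm_mult)
  also have "... <= sqrt (integral {a..b} (%x. (norm (f x))^2)*integral {a..b} (%x. (norm (g x))^2))"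
    by (rule real_le_rsqrt) (rule Cauchy_Schwarz_integral[OF sqint_norm[OF assms(1)] sqint_norm[OF assms(2)]])
  finally show ?thesis by (simp add: real_sqrt_mult)
qed

lemma integral_norm_le_sqrt:
  fixes g :: "real => 'a::{euclidean_space, real_normed_field}"
  assumes "sqint a b g" "a <= b"
  shows "norm (integral {a..b} g) <= sqrt (b - a) * sqrt (integral {a..b} (%x. (norm (g x))^2))"
  using Cauchy_Schwarz_norm[OF sqint_continuous[OF continuous_on_const[of _ 1]] assms(1)] assms(2) by simp

subsection \<open>Absolutely continuous functions with square integrable derivative\<close>

text \<open>Absolute continuity is encoded through the pair \<open>u\<close>, \<open>g\<close>: the
  derivative is known only through its integrals, hence up to null sets, which is the form in which
  weak derivatives appear later.\<close>

definition acd :: "real => real => (real => 'a) => (real => 'a::euclidean_space) => bool" where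
  "acd a b u g \<longleftrightarrow> sqint a b g & (ALL x:{a..b}. u x = u a + integral {a..x} g)"

lemma acd_sqint: "acd a b u g ==> sqint a b g" by (simp add: acd_def)

lemma acd_val: "acd a b u g ==> x \<in> {a..b} ==> u x = u a + integral {a..x} g" unfolding acd_def by blast

lemma acd_eq:
  assumes "acd a b u g" "a <= x" "x <= y" "y <= b"
  shows "u y - u x = integral {x..y} g"
proof -
  have "integral {a..x} g + integral {x..y} g = integral {a..y} g"
    using assms sqint_int[OF sqint_subset[OF acd_sqint[OF assms(1)], of a y]]
    by (intro Henstock_Kurzweil_Integration.integral_combine) auto
  moreover have "u x = u a + integral {a..x} g" "u y = u a + integral {a..y} g" using assms by (auto intro: acd_val)
  ultimately show ?thesis by (metis add_diff_cancel_left add_diff_cancel_left')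
qed

lemma acd_subset:
  assumes "acd a b u g" "a <= c" "d <= b"
  shows "acd c d u g"
proof -
  have "u x = u c + integral {c..x} g" if "x \<in> {c..d}" for x
    using acd_eq[OF assms(1), of c x] that assms by (auto simp: algebra_simps)
  moreover have "sqint c d g" by (rule sqint_subset[OF acd_sqint[OF assms(1)]]) (use assms in auto)
  ultimately show ?thesis unfolding acd_def by blast
qed

lemma acd_continuous:
  assumes "acd a b u g" shows "continuous_on {a..b} u"
proof -
  have "continuous_on {a..b} (%x. u a + integral {a..x} g)"
    by (intro continuous_intros indefinite_integral_continuous_1 sqint_int[OF acd_sqint[OF assms]])
  then show ?thesis by (rule continuous_on_eq) (metis acd_val[OF assms])
qed

lemma acd_sqint_fun: "acd a b u g ==> sqint a b u" by (rule sqint_continuous[OF acd_continuous])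

lemma acdI:
  assumes "!!x. x \<in> {a..b} ==> (u has_vector_derivative u' x) (at x within {a..b})"
    "continuous_on {a..b} u'"
  shows "acd a b u u'" unfolding acd_def
proof (intro conjI ballI)
  show "sqint a b u'" by (rule sqint_continuous[OF assms(2)])
  fix x assume x: "x \<in> {a..b}"
  have "(u' has_integral (u x - u a)) {a..x}" using x by (intro fundamental_theorem_of_calculus)
      (auto intro: has_vector_derivative_within_subset[OF assms(1)])
  then show "u x = u a + integral {a..x} u'" by (simp add: integral_unique)
qed

lemma acd_add:
  assumes "acd a b u g" "acd a b v h"
  shows "acd a b (%x. u x + v x) (%x. g x + h x)" unfolding acd_def
proof (intro conjI ballI)
  show "sqint a b (%x. g x + h x)" using assms by (simp add: sqint_add acd_sqint)
  fix x assume x: "x \<in> {a..b}"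
  have "g integrable_on {a..x}" "h integrable_on {a..x}"
    using assms x by (auto intro!: sqint_int[OF sqint_subset[OF acd_sqint]])
  then show "u x + v x = u a + v a + integral {a..x} (%x. g x + h x)"
    using acd_val[OF assms(1) x] acd_val[OF assms(2) x] by (simp add: integral_add)
qed

lemma acd_linear:
  fixes u g :: "real => 'a::euclidean_space" and L :: "'a => 'b::euclidean_space"
  assumes "acd a b u g" "bounded_linear L"
  shows "acd a b (%x. L (u x)) (%x. L (g x))" unfolding acd_def
proof (intro conjI ballI)
  show "sqint a b (%x. L (g x))" using assms by (simp add: sqint_linear acd_sqint)
  fix x assume x: "x \<in> {a..b}"
  have "g integrable_on {a..x}" using assms x by (auto intro!: sqint_int[OF sqint_subset[OF acd_sqint]])
  then have "integral {a..x} (%x. L (g x)) = L (integral {a..x} g)"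
    using integral_linear[OF _ assms(2), of g "{a..x}"] by (simp add: o_def)
  then show "L (u x) = L (u a) + integral {a..x} (%x. L (g x))"
    unfolding acd_val[OF assms(1) x] by (simp add: linear_simps[OF assms(2)])
qed

lemma acd_scaleR:
  fixes u g :: "real => 'a::euclidean_space"
  shows "acd a b u g ==> acd a b (%x. c *\<^sub>R u x) (%x. c *\<^sub>R g x)"
  by (rule acd_linear[OF _ bounded_linear_scaleR_right])

lemma acd_cmult:
  fixes u g :: "real => 'a::{euclidean_space, real_normed_field}"
  shows "acd a b u g ==> acd a b (%x. c*u x) (%x. c*g x)" by (rule acd_linear[OF _ bounded_linear_mult_right])

lemma acd_uminus:
  fixes u g :: "real => 'a::euclidean_space"
  shows "acd a b u g ==> acd a b (%x. - u x) (%x. - g x)" using acd_scaleR[of a b u g "-1"] by simp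

lemma acd_diff:
  assumes "acd a b u g" "acd a b v h"
  shows "acd a b (%x. u x - v x) (%x. g x - h x)" using acd_add[OF assms(1) acd_uminus[OF assms(2)]] by simp

lemma acd_const: "acd a b (%x. c) (%x. 0)" by (rule acdI) auto

text \<open>Errors of second order disappear under refinement: over \<open>n\<close> equal pieces
  the bounds telescope to \<open>(b - a)*(mu b - mu a)/n\<close>. This replaces the mean value
  theorem for functions without a pointwise derivative.\<close>

lemma eq_of_quadratic_increments:
  fixes F :: "real => 'a::real_normed_vector"
  assumes "a <= b" and F: "!!x y. a <= x ==> x <= y ==> y <= b ==> norm (F y - F x) <= (y - x)*(mu y - mu x)"
  shows "F b = F a"
proof -
  have "real n*norm (F b - F a) <= (b - a)*(mu b - mu a)" if n: "n > 0" for n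
  proof -
    define d x where "d = (b - a)/real n" and "x i = a + real i*d" for i
    have d: "0 <= d" "real n*d = b - a" using assms(1) n by (simp_all add: d_def)
    have x: "x 0 = a" "x n = b" "x (Suc i) - x i = d" for i using d(2) by (simp_all add: x_def algebra_simps)
    have "norm (\<Sum>i<n. F (x (Suc i)) - F (x i)) <= (\<Sum>i<n. d*(mu (x (Suc i)) - mu (x i)))"
    proof (rule sum_norm_le)
      fix i assume "i \<in> {..<n}"
      then have "real (Suc i)*d <= real n*d" by (intro mult_right_mono d) auto
      then have "x (Suc i) <= b" using d(2) by (simp add: x_def)
      then show "norm (F (x (Suc i)) - F (x i)) <= d*(mu (x (Suc i)) - mu (x i))"
        using F[of "x i" "x (Suc i)"] d(1) x(3)[of i] by (simp add: x_def)
    qed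
    then have "norm (F b - F a) <= d*(mu b - mu a)"
      unfolding sum_distrib_left[symmetric] using sum_lessThan_telescope[of "%i. F (x i)" n]
        sum_lessThan_telescope[of "%i. mu (x i)" n] by (simp add: x)
    then show ?thesis using n by (simp add: d_def field_simps)
  qed
  moreover from this[of 1] have "0 <= (b - a)*(mu b - mu a)" using norm_ge_zero[of "F b - F a"] by linarith
  ultimately show ?thesis using real_archimedian_rdiv_eq_0[of "norm (F b - F a)" "(b - a)*(mu b - mu a)"] by simp
qed

text \<open>The defect \<open>F\<close> between the product and the integral of the expected
  derivative changes over \<open>[y, z]\<close> by at most \<open>2*A*B\<close>, with
  \<open>A\<close> and \<open>B\<close> the integrals of \<open>norm (g s)\<close> and
  \<open>norm (h s)\<close>. By Cauchy-Schwarz this is at most \<open>z - y\<close> times the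
  increment of the additive quantity \<open>mu\<close>, so \<open>eq_of_quadratic_increments\<close>
  makes \<open>F\<close> constant.\<close>

lemma acd_mult:
  fixes u v g h :: "real => 'a::{euclidean_space, real_normed_field}"
  assumes ug: "acd a b u g" and vh: "acd a b v h"
  shows "acd a b (%x. u x * v x) (%x. g x * v x + u x*h x)"
proof -
  define k where "k = (%x. g x * v x + u x*h x)"
  define m where "m = (%x. (norm (g x))^2 + (norm (h x))^2)"
  have s: "sqint a b g" "sqint a b h" "sqint a b k"
    using sqint_mult_bounded[OF acd_continuous[OF ug] acd_sqint[OF vh]] sqint_mult_bounded[OF acd_continuous[OF vh] acd_sqint[OF ug]]
    by (auto simp: k_def acd_sqint[OF ug] acd_sqint[OF vh] mult.commute intro!: sqint_add)
  have "u x * v x = u a * v a + integral {a..x} k" if x: "x \<in> {a..b}" for x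
  proof -
    define F where "F y = u y * v y - integral {a..y} k" for y
    define mu where "mu y = integral {a..y} m" for y
    have "F x = F a"
    proof (rule eq_of_quadratic_increments[where mu=mu])
      fix y z assume yz: "a <= y" "y <= z" "z <= x"
      have sub: "{y..z} <= {a..b}" "{a..z} <= {a..b}" using yz x by auto
      note sg = sqint_subset[OF s(1) sub(1)] and sh = sqint_subset[OF s(2) sub(1)]
      note ig = sqint_int[OF sg] sqint_int[OF sh] sqint_int[OF sqint_subset[OF s(3) sub(1)]]
      have n: "(%s. norm (g s)) integrable_on {y..z}" "(%s. norm (h s)) integrable_on {y..z}"
        by (intro sqint_int[OF sqint_norm] sg sh)+
      have mi: "m integrable_on {a..z}"
        unfolding m_def by (intro integrable_add sqint_sq sqint_subset[OF s(1) sub(2)] sqint_subset[OF s(2) sub(2)])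
      have inc: "norm (w r - w t) <= integral {y..z} (%s. norm (f s))"
        if "acd a b w f" "y <= t" "t <= r" "r <= z" for w f :: "real => 'a" and t r
      proof -
        have f: "sqint y z f" by (rule sqint_subset[OF acd_sqint[OF that(1)] sub(1)])
        have tr: "{t..r} <= {y..z}" using that by auto
        have "norm (integral {t..r} f) <= integral {t..r} (%s. norm (f s))"
          by (intro integral_norm_bound_integral sqint_int sqint_norm sqint_subset[OF f tr]) auto
        also have "... <= integral {y..z} (%s. norm (f s))"
          by (intro integral_subset_le tr sqint_int sqint_norm sqint_subset[OF f tr] f) auto
        finally show ?thesis using acd_eq[OF that(1), of t r] that yz x by simp
      qed
      define A B where "A = integral {y..z} (%s. norm (g s))" and "B = integral {y..z} (%s. norm (h s))"
      have AB: "norm (u y - u s) <= A" "norm (v z - v s) <= B" if "s \<in> {y..z}" for s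
        using inc[OF ug, of y s] inc[OF vh, of s z] that by (auto simp: A_def B_def norm_minus_commute)
      have "integral {a..y} k + integral {y..z} k = integral {a..z} k"
        using yz by (intro Henstock_Kurzweil_Integration.integral_combine sqint_int[OF sqint_subset[OF s(3) sub(2)]]) auto
      \<comment> \<open>Freezing \<open>v\<close> at the right end and \<open>u\<close> at the left
        end turns the increment of the product into a single integral, whose integrand differs from
        \<open>k\<close> only by products of an oscillation with a derivative.\<close>
      then have "F z - F y = (u z - u y) * v z + u y*(v z - v y) - integral {y..z} k"
        by (simp add: F_def algebra_simps)
      also have "... = integral {y..z} (%s. g s * v z + u y*h s) - integral {y..z} k"
        using acd_eq[OF ug, of y z] acd_eq[OF vh, of y z] yz x ig
        by (simp add: integral_add integrable_on_mult_left integrable_on_mult_right)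
      also have "... = integral {y..z} (%s. (g s * v z + u y*h s) - k s)"
        by (intro integral_diff[symmetric] integrable_add integrable_on_mult_left integrable_on_mult_right ig)
      also have "norm ... <= integral {y..z} (%s. B*norm (g s) + A*norm (h s))"
      proof (rule integral_norm_bound_integral)
        fix t assume t: "t \<in> {y..z}"
        have "(g t * v z + u y*h t) - k t = g t*(v z - v t) + (u y - u t)*h t" by (simp add: k_def algebra_simps)
        also have "norm ... <= norm (g t)*B + A*norm (h t)"
          using AB[OF t] order_trans[OF norm_ge_zero AB(1)[OF t]] by (intro norm_triangle_le add_mono) (auto simp: norm_mult intro!: mult_mono)
        finally show "norm ((g t * v z + u y*h t) - k t) <= B*norm (g t) + A*norm (h t)" by (simp add: mult.commute)
      qed (intro integrable_diff integrable_add integrable_on_mult_left integrable_on_mult_right ig n)+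
      also have "... = 2*A*B" using n by (simp add: integral_add integrable_on_mult_right A_def B_def)
      also have "... <= A^2 + B^2" by (rule sum_squares_bound)
      also have "... <= (z - y)*integral {y..z} (%s. (norm (g s))^2) + (z - y)*integral {y..z} (%s. (norm (h s))^2)"
        using Cauchy_Schwarz_integral[OF sqint_continuous[OF continuous_on_const[of _ 1]] sqint_norm[OF sg]]
          Cauchy_Schwarz_integral[OF sqint_continuous[OF continuous_on_const[of _ 1]] sqint_norm[OF sh]] yz(2)
        by (intro add_mono) (simp_all add: A_def B_def)
      also have "... = (z - y)*integral {y..z} m"
        unfolding m_def distrib_left[symmetric] by (simp add: integral_add sqint_sq[OF sg] sqint_sq[OF sh])
      also have "integral {y..z} m = mu z - mu y"
        using Henstock_Kurzweil_Integration.integral_combine[OF yz(1,2) mi] by (simp add: mu_def)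
      finally show "norm (F z - F y) <= (z - y)*(mu z - mu y)" .
    qed (use x in simp)
    then show ?thesis by (simp add: F_def algebra_simps)
  qed
  with s(3) show ?thesis unfolding acd_def k_def by blast
qed

lemma acd_parts:
  fixes u v g h :: "real => 'a::{euclidean_space, real_normed_field}"
  assumes "acd a b u g" "acd a b v h" "a <= b"
  shows "integral {a..b} (%x. g x * v x + u x*h x) = u b * v b - u a * v a"
  using acd_eq[OF acd_mult[OF assms(1,2)], of a b] assms(3) by simp

lemma acdI_real:
  fixes u :: "real => real"
  assumes "!!x. x \<in> {a..b} ==> (u has_real_derivative u' x) (at x)" "continuous_on {a..b} u'"
  shows "acd a b u u'" using assms
  by (intro acdI) (auto simp: has_real_derivative_iff_has_vector_derivative[symmetric] intro: has_field_derivative_at_within)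

lemma acd_parts_C1:
  fixes a g p r :: "real => real"
  assumes "!!x. x \<in> {al..be} ==> (p has_real_derivative - r x) (at x)" "continuous_on {al..be} r"
    "acd al be a g" "al <= be"
  shows "integral {al..be} (%x. p x*g x - r x*a x) = p be*a be - p al*a al"
proof -
  have "acd al be p (%x. - r x)" using assms(1,2) by (intro acdI_real continuous_intros)
  from acd_parts[OF this assms(3,4)] show ?thesis by simp
qed

section \<open>Jacobi's identity for quadratic forms on an interval\<close>

lemma integral_continuous_pos:
  fixes f :: "real => real"
  assumes "continuous_on {a..b} f" "!!x. x \<in> {a..b} ==> f x >= 0" "c \<in> {a..b}" "f c > 0" "a < b"
  shows "integral {a..b} f > 0"
proof (rule ccontr)
  assume "~ ?thesis"
  moreover have "integral {a..b} f >= 0" by (intro integral_nonneg integrable_continuous_real assms)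
  ultimately have "integral {a..b} f = 0" by simp
  then have "(f has_integral 0) (cbox a b)"
    using integrable_integral[OF integrable_continuous_real[OF assms(1)]] by simp
  from has_integral_0_cbox_imp_0[OF _ _ this, of c] assms show False by auto
qed

text \<open>The quotient \<open>R = P*psi'/psi\<close> solves the Riccati equation
  \<open>R' = - V - W - P*(psi'/psi)^2\<close>, so completing the square in \<open>g\<close> leaves
  \<open>W*a^2\<close> and the total derivative of \<open>R*a^2\<close>. \<open>W\<close> measures
  by how much \<open>psi\<close> fails to solve the Jacobi equation of the form.\<close>

lemma jacobi_identity:
  fixes a g P V W psi psi' :: "real => real"
  assumes ab: "al <= be" and ag: "acd al be a g"
    and cont: "continuous_on {al..be} P" "continuous_on {al..be} V" "continuous_on {al..be} W"
      "continuous_on {al..be} psi'"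
    and nz: "!!x. x \<in> {al..be} ==> psi x ~= 0"
    and d1: "!!x. x \<in> {al..be} ==> (psi has_real_derivative psi' x) (at x)"
    and d2: "!!x. x \<in> {al..be} ==> ((%x. P x*psi' x) has_real_derivative - (V x + W x)*psi x) (at x)"
  shows "(%x. P x*(g x - psi' x/psi x*a x)^2 + W x*(a x)^2) integrable_on {al..be}" (is ?A)
    and "integral {al..be} (%x. P x*(g x)^2 - V x*(a x)^2)
      = integral {al..be} (%x. P x*(g x - psi' x/psi x*a x)^2 + W x*(a x)^2)
        + P be*psi' be/psi be*(a be)^2 - P al*psi' al/psi al*(a al)^2" (is ?B)
proof -
  define rh where "rh x = psi' x/psi x" for x
  have cpsi: "continuous_on {al..be} psi" using d1 by (intro continuous_at_imp_continuous_on ballI DERIV_isCont) auto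
  have crh: "continuous_on {al..be} rh" unfolding rh_def using cont cpsi nz by (intro continuous_intros) auto
  have ca: "continuous_on {al..be} a" by (rule acd_continuous[OF ag])
  have R: "acd al be (%x. P x*psi' x/psi x) (%x. - V x - W x - P x*(rh x)^2)"
  proof (rule acdI_real)
    fix x assume x: "x \<in> {al..be}"
    have "((%x. P x*psi' x/psi x) has_real_derivative
        ((- (V x + W x)*psi x)*psi x - P x*psi' x*psi' x)/(psi x*psi x)) (at x)"
      by (rule DERIV_divide[OF d2[OF x] d1[OF x] nz[OF x]])
    moreover have "((- (V x + W x)*psi x)*psi x - P x*psi' x*psi' x)/(psi x*psi x) = - V x - W x - P x*(rh x)^2"
      using nz[OF x] by (simp add: rh_def field_simps power2_eq_square)
    ultimately show "((%x. P x*psi' x/psi x) has_real_derivative - V x - W x - P x*(rh x)^2) (at x)" by simp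
  qed (use cont crh in \<open>intro continuous_intros; simp\<close>)
  have parts: "integral {al..be} (%x. (- V x - W x - P x*(rh x)^2)*(a x*a x) + P x*psi' x/psi x*(g x*a x + a x*g x))
     = P be*psi' be/psi be*(a be*a be) - P al*psi' al/psi al*(a al*a al)"
    by (rule acd_parts[OF R acd_mult[OF ag ag] ab])
  have sg: "sqint al be g" by (rule acd_sqint[OF ag])
  have sr: "sqint al be (%x. g x - rh x*a x)" using crh ca by (intro sqint_diff sg sqint_continuous continuous_intros)
  have i1: "(%x. P x*(g x - rh x*a x)^2) integrable_on {al..be}"
    using sqint_times_integrable[OF sqint_mult_bounded[OF cont(1) sr] sr] by (simp add: power2_eq_square mult.assoc)
  have i2: "(%x. W x*(a x)^2) integrable_on {al..be}"
    using cont ca by (intro integrable_continuous_real continuous_intros)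
  show A: ?A using integrable_add[OF i1 i2] by (simp add: rh_def)
  have i3: "(%x. (- V x - W x - P x*(rh x)^2)*(a x*a x) + P x*psi' x/psi x*(g x*a x + a x*g x)) integrable_on {al..be}"
    by (rule sqint_int[OF acd_sqint[OF acd_mult[OF R acd_mult[OF ag ag]]]])
  have "integral {al..be} (%x. P x*(g x)^2 - V x*(a x)^2)
    = integral {al..be} (%x. (P x*(g x - psi' x/psi x*a x)^2 + W x*(a x)^2) +
       ((- V x - W x - P x*(rh x)^2)*(a x*a x) + P x*psi' x/psi x*(g x*a x + a x*g x)))"
    by (rule arg_cong[of _ _ "integral _"]) (auto simp: fun_eq_iff rh_def algebra_simps power2_eq_square)
  also have "... = integral {al..be} (%x. P x*(g x - psi' x/psi x*a x)^2 + W x*(a x)^2)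
      + (P be*psi' be/psi be*(a be*a be) - P al*psi' al/psi al*(a al*a al))" using integral_add[OF A i3] parts by simp
  finally show ?B by (simp add: power2_eq_square)
qed

lemma sq_le_energy_left:
  fixes a g :: "real => real"
  assumes "acd al be a g" "al <= s" "s <= t" "t <= be"
  shows "(a t - a s)^2 <= (t - s)*integral {s..t} (%x. (g x)^2)"
proof -
  have sg: "sqint s t g" by (rule sqint_subset[OF acd_sqint[OF assms(1)]]) (use assms in auto)
  have "(integral {s..t} (%x. 1*g x))^2 <= integral {s..t} (%x. 1^2)*integral {s..t} (%x. (g x)^2)"
    by (rule Cauchy_Schwarz_integral[OF sqint_continuous sg]) auto
  then show ?thesis using acd_eq[OF assms] assms by simp
qed

text \<open>The identity is applied on \<open>[al + ep, be - ep]\<close>. Near an end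
  \<open>psi\<close> is bounded below by a multiple of the distance, so the boundary term is at most
  of order \<open>a^2\<close> over the distance; as \<open>a\<close> vanishes at the end,
  \<open>a^2\<close> is at most the distance times the integral of \<open>g^2\<close> near the end.
  Both boundary terms thus tend to 0 with \<open>ep\<close>.\<close>

lemma jacobi_le:
  fixes a g P V W psi psi' :: "real => real"
  assumes ab: "al < be" and ag: "acd al be a g" and a0: "a al = 0" "a be = 0"
    and cont: "continuous_on {al..be} P" "continuous_on {al..be} V" "continuous_on {al..be} W"
      "continuous_on {al..be} psi'"
    and nn: "!!x. x \<in> {al..be} ==> 0 <= P x" "!!x. x \<in> {al..be} ==> 0 <= W x"
    and c: "c > 0" "!!x. x \<in> {al..be} ==> c*((x - al)*(be - x)) <= \<bar>psi x\<bar>"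
    and d1: "!!x. x \<in> {al..be} ==> (psi has_real_derivative psi' x) (at x)"
    and d2: "!!x. x \<in> {al..be} ==> ((%x. P x*psi' x) has_real_derivative - (V x + W x)*psi x) (at x)"
    and st: "al < s" "s <= t" "t < be"
  shows "integral {s..t} (%x. P x*(g x - psi' x/psi x*a x)^2 + W x*(a x)^2)
     <= integral {al..be} (%x. P x*(g x)^2 - V x*(a x)^2)"
proof -
  define h where "h x = P x*(g x)^2 - V x*(a x)^2" for x
  define k where "k x = P x*(g x - psi' x/psi x*a x)^2 + W x*(a x)^2" for x
  have ca: "continuous_on {al..be} a" by (rule acd_continuous[OF ag])
  have sg: "sqint al be g" by (rule acd_sqint[OF ag])
  have hi: "h integrable_on {al..be}"
  proof -
    have "(%x. P x*(g x)^2) integrable_on {al..be}"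
      using sqint_times_integrable[OF sqint_mult_bounded[OF cont(1) sg] sg] by (simp add: power2_eq_square mult.assoc)
    moreover have "(%x. V x*(a x)^2) integrable_on {al..be}"
      using cont ca by (intro integrable_continuous_real continuous_intros)
    ultimately show ?thesis unfolding h_def by (rule integrable_diff)
  qed
  have g2: "(%x. (g x)^2) integrable_on {al..be}" using sqint_sq[OF sg] by simp
  define H where "H x = integral {al..x} h" for x
  define Gam where "Gam x = integral {al..x} (%x. (g x)^2)" for x
  have cH: "continuous_on {al..be} H" and cGam: "continuous_on {al..be} Gam"
    unfolding H_def Gam_def using hi g2 by (auto intro: indefinite_integral_continuous_1)
  have "bounded ((%x. P x*psi' x) ` {al..be})"
    using cont by (intro compact_imp_bounded compact_continuous_image continuous_intros) auto
  then obtain M where M: "!!x. x \<in> {al..be} ==> \<bar>P x*psi' x\<bar> <= M"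
    unfolding bounded_iff real_norm_def by blast
  then have M0: "M >= 0" using ab by (meson abs_ge_zero atLeastAtMost_iff less_imp_le order_refl order_trans)
  \<comment> \<open>From \<open>(x - al)*(be - x) >= ep*(be - al)/2\<close> at distance
    \<open>ep\<close> from an end, valid once \<open>ep\<close> is at most half the length.\<close>
  define K where "K = 2*M/(c*(be - al))"
  have K0: "K >= 0" using M0 c ab by (simp add: K_def)
  have psi0: "psi x ~= 0" if "al < x" "x < be" for x
  proof -
    have "0 < c*((x - al)*(be - x))" using that c by simp
    also have "... <= \<bar>psi x\<bar>" using that by (intro c) auto
    finally show ?thesis by auto
  qed
  \<comment> \<open>The upper bound for given \<open>ep\<close>, written with primitives so that it
    is continuous in \<open>ep\<close> and equals the full form at 0.\<close>
  define F where "F ep = H (be - ep) - H (al + ep) + K*Gam (al + ep) + K*(Gam be - Gam (be - ep))" for ep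
  have R: "\<bar>P x*psi' x/psi x\<bar>*ep <= K"
    if x: "x = al + ep | x = be - ep" "0 < ep" "ep <= (be - al)/2" for x ep
  proof -
    have xi: "al < x" "x < be" using that ab by (auto simp: field_simps)
    have "c*(ep*((be - al)/2)) <= c*((x - al)*(be - x))"
    proof (rule mult_left_mono)
      have "(x - al)*(be - x) = ep*(be - al - ep)" using x(1) by (auto simp: algebra_simps)
      also have "... >= ep*((be - al)/2)" using x by (intro mult_left_mono) auto
      finally show "ep*((be - al)/2) <= (x - al)*(be - x)" .
    qed (use c in auto)
    also have "... <= \<bar>psi x\<bar>" using xi by (intro c) auto
    finally have le: "c*(ep*((be - al)/2)) <= \<bar>psi x\<bar>" .
    have pos: "0 < c*(ep*((be - al)/2))" using c x ab by auto
    have "\<bar>P x*psi' x/psi x\<bar>*ep = \<bar>P x*psi' x\<bar>*ep/\<bar>psi x\<bar>" by (simp add: abs_divide)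
    also have "... <= M*ep/(c*(ep*((be - al)/2)))"
      using M[of x] xi le pos x M0 by (intro frac_le mult_right_mono mult_nonneg_nonneg) auto
    also have "... = K" using x by (simp add: K_def)
    finally show ?thesis .
  qed
  have key: "integral {s..t} k <= F ep" if ep: "0 < ep" "ep <= s - al" "ep <= be - t" "ep <= (be - al)/2" for ep
  proof -
    let ?s = "al + ep" and ?t = "be - ep"
    have sub: "{?s..?t} <= {al..be}" using ep by auto
    have le: "?s <= ?t" using ep by (simp add: field_simps)
    have J: "k integrable_on {?s..?t}"
        "integral {?s..?t} h = integral {?s..?t} k + P ?t*psi' ?t/psi ?t*(a ?t)^2 - P ?s*psi' ?s/psi ?s*(a ?s)^2"
      unfolding h_def k_def
      by (rule jacobi_identity[OF le acd_subset[OF ag] cont[THEN continuous_on_subset[OF _ sub]]];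
          use ep psi0 d1 d2 in \<open>force\<close>)+
    have kn: "k x >= 0" if "x \<in> {?s..?t}" for x using that sub nn[of x] by (auto simp: k_def)
    have "integral {s..t} k <= integral {?s..?t} k"
      using ep J(1) kn st by (intro integral_subset_le integrable_on_subinterval[OF J(1)]) auto
    also have "... <= integral {?s..?t} h + \<bar>P ?t*psi' ?t/psi ?t\<bar>*(a ?t)^2 + \<bar>P ?s*psi' ?s/psi ?s\<bar>*(a ?s)^2"
    proof -
      have "- (P ?t*psi' ?t/psi ?t*(a ?t)^2) <= \<bar>P ?t*psi' ?t/psi ?t\<bar>*(a ?t)^2"
        by (metis abs_ge_minus_self abs_mult abs_power2)
      moreover have "P ?s*psi' ?s/psi ?s*(a ?s)^2 <= \<bar>P ?s*psi' ?s/psi ?s\<bar>*(a ?s)^2"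
        by (intro mult_right_mono abs_ge_self) auto
      ultimately show ?thesis using J(2) by linarith
    qed
    also have "... <= (H ?t - H ?s) + K*(Gam be - Gam ?t) + K*Gam ?s"
    proof (intro add_mono)
      have "H ?s + integral {?s..?t} h = H ?t" unfolding H_def using ep le
        by (intro Henstock_Kurzweil_Integration.integral_combine integrable_on_subinterval[OF hi]) auto
      then show "integral {?s..?t} h <= H ?t - H ?s" by simp
      have Gamt: "Gam ?t + integral {?t..be} (%x. (g x)^2) = Gam be" unfolding Gam_def using ep ab le
        by (intro Henstock_Kurzweil_Integration.integral_combine g2) auto
      then have "(a ?t)^2 <= ep*(Gam be - Gam ?t)"
        using sq_le_energy_left[OF ag, of ?t be] ep ab a0 le by (simp flip: Gamt)
      then have "\<bar>P ?t*psi' ?t/psi ?t\<bar>*(a ?t)^2 <= \<bar>P ?t*psi' ?t/psi ?t\<bar>*(ep*(Gam be - Gam ?t))"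
        by (intro mult_left_mono) auto
      also have "... = \<bar>P ?t*psi' ?t/psi ?t\<bar>*ep*(Gam be - Gam ?t)" by simp
      also have "... <= K*(Gam be - Gam ?t)"
      proof (intro mult_right_mono R)
        show "0 <= Gam be - Gam ?t" using \<open>(a ?t)\<^sup>2 \<le> ep * (Gam be - Gam ?t)\<close> ep(1)
          by (meson order_trans zero_le_mult_iff zero_le_power2 not_less)
      qed (use ep in auto)
      finally show "\<bar>P ?t*psi' ?t/psi ?t\<bar>*(a ?t)^2 <= K*(Gam be - Gam ?t)" .
      have a2: "(a ?s)^2 <= ep*Gam ?s" using sq_le_energy_left[OF ag, of al ?s] ep ab a0 le by (auto simp: Gam_def)
      then have "\<bar>P ?s*psi' ?s/psi ?s\<bar>*(a ?s)^2 <= \<bar>P ?s*psi' ?s/psi ?s\<bar>*(ep*Gam ?s)"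
        by (intro mult_left_mono) auto
      also have "... = \<bar>P ?s*psi' ?s/psi ?s\<bar>*ep*Gam ?s" by simp
      also have "... <= K*Gam ?s"
      proof (intro mult_right_mono R)
        show "0 <= Gam ?s" using a2 ep(1) by (meson order_trans zero_le_mult_iff zero_le_power2 not_less)
      qed (use ep in auto)
      finally show "\<bar>P ?s*psi' ?s/psi ?s\<bar>*(a ?s)^2 <= K*Gam ?s" .
    qed
    also have "... = F ep" by (simp add: F_def)
    finally show ?thesis .
  qed
  have "continuous_on {0..be-al} F" unfolding F_def
    by (intro continuous_intros continuous_on_compose2[OF cH] continuous_on_compose2[OF cGam]) auto
  then have "(F \<longlongrightarrow> F 0) (at 0 within {0..be-al})" using ab by (simp add: continuous_on)
  then have lim: "(F \<longlongrightarrow> F 0) (at_right 0)" using ab by (simp add: at_within_Icc_at_right)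
  have F0: "F 0 = integral {al..be} h" by (simp add: F_def H_def Gam_def)
  have "integral {s..t} k <= F 0"
  proof (rule tendsto_lowerbound[OF lim])
    define d where "d = min (s - al) (min (be - t) ((be - al)/2))"
    have "d > 0" using st ab by (auto simp: d_def)
    then show "\<forall>\<^sub>F ep in at_right 0. integral {s..t} k <= F ep" unfolding eventually_at_right_field
      by (intro exI[of _ d]) (auto intro!: key simp: d_def)
  qed simp
  then show ?thesis unfolding F0 h_def k_def .
qed

text \<open>The derivative of \<open>a/psi\<close> is \<open>(g - psi'/psi*a)/psi\<close>, and a
  vanishing square integral of the numerator makes the quotient constant. This is the equality case
  of \<open>jacobi_le\<close>.\<close>

lemma jacobi_eq:
  fixes a g psi psi' P W :: "real => real"
  assumes ag: "acd s t a g" and st: "s <= t"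
    and c: "continuous_on {s..t} psi'" "continuous_on {s..t} P" "continuous_on {s..t} W"
    and pos: "!!x. x \<in> {s..t} ==> P x > 0" "!!x. x \<in> {s..t} ==> W x >= 0" "!!x. x \<in> {s..t} ==> psi x ~= 0"
    and d1: "!!x. x \<in> {s..t} ==> (psi has_real_derivative psi' x) (at x)"
    and z: "integral {s..t} (%x. P x*(g x - psi' x/psi x*a x)^2 + W x*(a x)^2) <= 0"
  shows "a t/psi t = a s/psi s"
proof -
  have cpsi: "continuous_on {s..t} psi" using d1 by (intro continuous_at_imp_continuous_on ballI DERIV_isCont) auto
  have ca: "continuous_on {s..t} a" by (rule acd_continuous[OF ag])
  obtain p where p: "p > 0" "!!x. x \<in> {s..t} ==> p <= P x"
  proof -
    obtain x0 where "x0 \<in> {s..t}" "ALL x:{s..t}. P x0 <= P x"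
      using continuous_attains_inf[OF compact_Icc _ c(2)] st by auto
    then show ?thesis using that[of "P x0"] pos(1) by auto
  qed
  have crh: "continuous_on {s..t} (%x. psi' x/psi x)" using c cpsi pos(3) by (intro continuous_intros) auto
  have sr: "sqint s t (%x. g x - psi' x/psi x*a x)"
    by (intro sqint_diff acd_sqint[OF ag] sqint_continuous continuous_on_mult crh ca)
  have r2: "(%x. (g x - psi' x/psi x*a x)^2) integrable_on {s..t}" using sqint_sq[OF sr] by simp
  have i1: "(%x. P x*(g x - psi' x/psi x*a x)^2) integrable_on {s..t}"
    using sqint_times_integrable[OF sqint_mult_bounded[OF c(2) sr] sr] by (simp add: power2_eq_square mult.assoc)
  have i2: "(%x. W x*(a x)^2) integrable_on {s..t}" using c ca by (intro integrable_continuous_real continuous_intros)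
  have "integral {s..t} (%x. p*(g x - psi' x/psi x*a x)^2) <=
      integral {s..t} (%x. P x*(g x - psi' x/psi x*a x)^2 + W x*(a x)^2)"
  proof (rule integral_le)
    fix x assume "x \<in> {s..t}"
    then show "p*(g x - psi' x/psi x*a x)^2 <= P x*(g x - psi' x/psi x*a x)^2 + W x*(a x)^2"
      using mult_right_mono[OF p(2), of x "(g x - psi' x/psi x*a x)^2"] mult_nonneg_nonneg[OF pos(2)[of x] zero_le_power2[of "a x"]] by auto
  qed (use r2 i1 i2 in \<open>auto intro: integrable_add integrable_on_mult_right\<close>)
  then have "integral {s..t} (%x. (g x - psi' x/psi x*a x)^2) <= 0"
    using z p(1) by (subst (asm) integral_mult_right) (smt (verit) mult_le_0_iff)
  then have z0: "integral {s..t} (%x. (g x - psi' x/psi x*a x)^2) = 0" using integral_nonneg[OF r2] by force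
  have ci: "continuous_on {s..t} (%x. 1/psi x)" using cpsi pos(3) by (intro continuous_intros) auto
  have "acd s t (%x. 1/psi x) (%x. - psi' x/(psi x)^2)" using c cpsi pos(3) d1
    by (intro acdI_real continuous_intros) (auto intro!: derivative_eq_intros simp: power2_eq_square)
  from acd_mult[OF ag this]
  have "acd s t (%x. a x*(1/psi x)) (%x. g x*(1/psi x) + a x*(- psi' x/(psi x)^2))" .
  from acd_eq[OF this, of s t] st
  have "a t/psi t - a s/psi s = integral {s..t} (%x. g x*(1/psi x) + a x*(- psi' x/(psi x)^2))" by simp
  also have "... = integral {s..t} (%x. (1/psi x)*(g x - psi' x/psi x*a x))"
    by (intro Henstock_Kurzweil_Integration.integral_cong) (use pos(3) in \<open>auto simp: field_simps power2_eq_square\<close>)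
  also have "... = 0" using Cauchy_Schwarz_integral[OF sqint_continuous[OF ci] sr] z0 by simp
  finally show ?thesis by simp
qed

section \<open>Positivity of the second variation\<close>

type_synonym rpair = "(real => real) \<times> (real => real)"

definition cmb :: "rpair => real => rpair => rpair" where
  "cmb p t r = (%x. fst p x + t*fst r x, %x. snd p x + t * snd r x)"

text \<open>\<open>y\<close> is the squared modulus over a period centred at its minimum
  \<open>y1\<close>, with the maximum \<open>y2\<close> half a period away. The assumption
  \<open>low\<close> states that \<open>y'\<close> has simple zeros quantitatively, which makes
  \<open>psi\<close> a Jacobi field fit for \<open>jacobi_le\<close>; \<open>0 < y1\<close> excludes
  zeros of the modulus.\<close>

locale orbit =
  fixes y y' :: "real => real" and J E l y1 y2 y3 c0 :: real
  assumes l: "l > 0"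
    and dy: "!!x. (y has_real_derivative y' x) (at x)"
    and dy': "!!x. (y' has_real_derivative - 3*(y x)^2 + 4*y x + 4*E) (at x)"
    and fi0: "!!x. (y' x)^2 = 2*((y x - y1)*(y2 - y x)*(y x - y3))"
    and roots: "y1 + y2 + y3 = 2" "y1*y2 + y1*y3 + y2*y3 = - 4*E" "y1*y2*y3 = - 2*J^2"
    and ord: "0 < y1" "y1 < y2" "y3 <= 0"
    and yb: "!!x. y1 <= y x" "!!x. y x <= y2"
    and y0: "y 0 = y1" "y l = y2"
    and even: "!!x. y (- x) = y x"
    and low: "c0 > 0" "!!x. 0 <= x ==> x <= l ==> c0*(x*(l - x)) <= y' x"
begin

definition "T = 2*l"
definition "Y1 = integral {-l..l} y"
definition "Yn = integral {-l..l} (%x. 1/y x)"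
text \<open>The potential after elimination of \<open>b\<close>: completing the square in
  \<open>2*J*a + y*b'\<close> subtracts \<open>4*J^2*a^2/y\<close>, which is added to the original
  \<open>2*y^2*a^2\<close>.\<close>

definition "V x = 2*(y x)^2 + 4*J^2/y x"
text \<open>Twice the real part of \<open>W'/W\<close>, hence the modulus component of the
  infinitesimal translation. The function \<open>ett\<close> below is \<open>y*psi'\<close>.\<close>

definition "psi x = y' x/y x"
definition "ett x = - (y x)\<^sup>2 - 4*E + 4*J^2/y x"
text \<open>The primitive of \<open>y\<close> with value 0 at 0; basing it at \<open>-l-1\<close>
  makes it differentiable at both ends of the period.\<close>

definition "Yf x = integral {-l-1..x} y - integral {-l-1..0} y"

definition "adm p \<longleftrightarrow> acd (-l) l (fst p) (snd p) & fst p (-l) = fst p l"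
definition "Sb p r = integral {-l..l} (%x. y x*(snd p x * snd r x) - V x*(fst p x*fst r x))"
text \<open>\<open>A\<close> is the moment through which the momentum constraint acts after
  \<open>b\<close> is eliminated; \<open>B p = 0\<close> is the mass constraint to first
  order.\<close>

definition "A p = integral {-l..l} (%x. fst p x/y x)"
definition "B p = integral {-l..l} (%x. y x*fst p x)"

lemma ypos: "y x > 0" using yb(1)[of x] ord(1) by linarith

lemma ynz: "y x ~= 0" using ypos[of x] by simp

lemma fi: "(y' x)^2 = 2*(- ((y x)^3) + 2*(y x)^2 + 4*E*y x - 2*J^2)"
proof -
  have "(y x - y1)*(y2 - y x)*(y x - y3)
    = - ((y x)^3) + (y1 + y2 + y3)*(y x)^2 - (y1*y2 + y1*y3 + y2*y3)*y x + y1*y2*y3"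
    by (simp add: algebra_simps power2_eq_square power3_eq_cube)
  then show ?thesis unfolding fi0 roots by simp
qed

lemma cy: "continuous_on S y" and cy': "continuous_on S y'"
  using dy dy' by (auto intro!: continuous_at_imp_continuous_on DERIV_isCont)

lemma yml: "y (-l) = y2" using even[of l] y0 by simp

lemma y'0: "y' 0 = 0" "y' l = 0" "y' (-l) = 0" using fi0[of 0] fi0[of l] fi0[of "-l"] y0 yml by auto

lemma cV: "continuous_on S V" and cpsi: "continuous_on S psi" and cett: "continuous_on S ett"
  unfolding V_def psi_def ett_def by (auto intro!: continuous_intros cy cy' simp: ynz)

lemma dpsi: "(psi has_real_derivative ett x/y x) (at x)"
proof -
  have "(psi has_real_derivative ((- 3*(y x)^2 + 4*y x + 4*E)*y x - y' x*y' x)/(y x*y x)) (at x)"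
    unfolding psi_def by (rule DERIV_divide[OF dy' dy ynz])
  moreover have "((- 3*(y x)^2 + 4*y x + 4*E)*y x - y' x*y' x)/(y x*y x) = ett x/y x"
    using fi[of x] ynz[of x] by (simp add: ett_def field_simps power2_eq_square power3_eq_cube)
  ultimately show ?thesis by simp
qed

text \<open>With \<open>dpsi\<close> this is the Jacobi equation \<open>(y*psi')' = - V*psi\<close>,
  the infinitesimal form of translation invariance.\<close>

lemma dett: "(ett has_real_derivative - V x*psi x) (at x)" unfolding ett_def V_def psi_def
  by (rule derivative_eq_intros dy ynz refl)+ (simp add: ynz field_simps power2_eq_square)

lemma ypsi: "y x*psi x = y' x" using ynz[of x] by (simp add: psi_def)

lemma yint: "y integrable_on {a..b}" by (intro integrable_continuous_real cy)

lemma dYf: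
  assumes "x > -l-1" shows "(Yf has_real_derivative y x) (at x)"
proof -
  have "((%t. integral {-l-1..t} y) has_real_derivative y x) (at x within {-l-1..x+1})"
    using assms by (intro integral_has_real_derivative cy) auto
  moreover have "(at x within {-l-1..x+1}) = at x" using assms by (intro at_within_interior) auto
  ultimately have "((%t. integral {-l-1..t} y) has_real_derivative y x) (at x)" by simp
  from DERIV_diff[OF this DERIV_const] show ?thesis unfolding Yf_def by simp
qed

lemma cYf: "continuous_on {-l..l} Yf"
  using dYf by (intro continuous_at_imp_continuous_on ballI) (force intro: DERIV_isCont)

lemma half: "integral {-l..0} y = integral {0..l} y"
proof -
  have "integral {-l..-0} (%x. y (- x)) = integral {0..l} y"
    by (rule Henstock_Kurzweil_Integration.integral_reflect_real)
  then show ?thesis by (simp add: even)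
qed

lemma Y1_half: "integral {0..l} y = Y1/2"
proof -
  have "integral {-l..0} y + integral {0..l} y = Y1"
    unfolding Y1_def using l by (intro Henstock_Kurzweil_Integration.integral_combine yint) auto
  then show ?thesis using half by simp
qed

lemma Yfl: "Yf l = Y1/2"
proof -
  have "integral {-l-1..0} y + integral {0..l} y = integral {-l-1..l} y"
    using l by (intro Henstock_Kurzweil_Integration.integral_combine yint) auto
  then show ?thesis using Y1_half by (simp add: Yf_def)
qed

lemma Yfml: "Yf (-l) = - Y1/2"
proof -
  have "integral {-l-1..-l} y + integral {-l..0} y = integral {-l-1..0} y"
    using l by (intro Henstock_Kurzweil_Integration.integral_combine yint) auto
  then show ?thesis using Y1_half half by (simp add: Yf_def)
qed

lemma T0: "T > 0" using l by (simp add: T_def)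

lemma adm_acd: "adm p ==> acd (-l) l (fst p) (snd p)" by (simp add: adm_def)

lemma adm_cont: "adm p ==> continuous_on {-l..l} (fst p)" using acd_continuous adm_acd by blast

lemma adm_cmb: "adm p ==> adm r ==> adm (cmb p t r)" unfolding adm_def cmb_def by (auto intro!: acd_add acd_cmult)

lemma Sb_integrable:
  assumes "adm p" "adm r"
  shows "(%x. y x*(snd p x * snd r x) - V x*(fst p x*fst r x)) integrable_on {-l..l}"
proof (rule integrable_diff)
  show "(%x. y x*(snd p x * snd r x)) integrable_on {-l..l}"
    using sqint_times_integrable[OF sqint_mult_bounded[OF cy acd_sqint[OF adm_acd[OF assms(1)]]] acd_sqint[OF adm_acd[OF assms(2)]]]
    by (simp add: mult.assoc)
  show "(%x. V x*(fst p x*fst r x)) integrable_on {-l..l}"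
    by (intro integrable_continuous_real continuous_intros cV adm_cont assms)
qed

lemma A_integrable: "adm p ==> (%x. fst p x/y x) integrable_on {-l..l}"
  by (intro integrable_continuous_real continuous_intros cy adm_cont) (auto simp: ynz)

lemma B_integrable: "adm p ==> (%x. y x*fst p x) integrable_on {-l..l}"
  by (intro integrable_continuous_real continuous_intros cy adm_cont)

lemma Sb_sym: "Sb p r = Sb r p" by (simp add: Sb_def mult.commute)

lemma Sb_cmb_left:
  assumes "adm p" "adm q" "adm r"
  shows "Sb (cmb p t q) r = Sb p r + t*Sb q r"
proof -
  have "Sb (cmb p t q) r = integral {-l..l} (%x. (y x*(snd p x * snd r x) - V x*(fst p x*fst r x))
     + t*(y x*(snd q x * snd r x) - V x*(fst q x*fst r x)))"
    unfolding Sb_def by (rule arg_cong[of _ _ "integral _"]) (auto simp: cmb_def fun_eq_iff algebra_simps)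
  also have "... = Sb p r + t*Sb q r" unfolding Sb_def using Sb_integrable[OF assms(1,3)] Sb_integrable[OF assms(2,3)]
    by (subst integral_add) (auto intro!: integrable_on_mult_right)
  finally show ?thesis .
qed

lemma Sb_cmb_right:
  assumes "adm p" "adm q" "adm r"
  shows "Sb r (cmb p t q) = Sb r p + t*Sb r q" using Sb_cmb_left[OF assms] by (simp add: Sb_sym)

lemma A_cmb: assumes "adm p" "adm q" shows "A (cmb p t q) = A p + t*A q"
proof -
  have "A (cmb p t q) = integral {-l..l} (%x. fst p x/y x + t*(fst q x/y x))"
    unfolding A_def by (rule arg_cong[of _ _ "integral _"]) (auto simp: cmb_def add_divide_distrib)
  also have "... = A p + integral {-l..l} (%x. t*(fst q x/y x))"
    unfolding A_def by (intro integral_add A_integrable integrable_on_mult_right assms)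
  finally show ?thesis by (simp add: A_def integral_mult_right del: times_divide_eq_right)
qed

lemma B_cmb: "adm p ==> adm q ==> B (cmb p t q) = B p + t*B q" unfolding B_def
  by (subst integral_mult_right[symmetric], subst integral_add[symmetric])
     (auto intro!: B_integrable integrable_on_mult_right simp: cmb_def algebra_simps)

text \<open>Integration by parts: \<open>R\<close> is the source left when the Jacobi operator acts
  on \<open>e\<close>, and the boundary term records the jump of \<open>y*e'\<close> from one end of
  the period to the other.\<close>

lemma Sb_C1:
  assumes "!!x. x \<in> {-l..l} ==> ((%x. y x*e' x) has_real_derivative - (V x*e x + R x)) (at x)"
    "continuous_on {-l..l} R" "continuous_on {-l..l} e" "adm p"
  shows "Sb (e, e') p = integral {-l..l} (%x. R x*fst p x)
      + (y l*e' l*fst p l - y (-l)*e' (-l)*fst p (-l))"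
proof -
  have c: "continuous_on {-l..l} (%x. V x*e x + R x)" by (intro continuous_intros cV assms)
  have "acd (-l) l (%x. y x*e' x) (%x. - (V x*e x + R x))" using assms(1) c by (intro acdI_real continuous_on_minus)
  from sqint_int[OF acd_sqint[OF acd_mult[OF this adm_acd[OF assms(4)]]]]
  have i0: "(%x. - (V x*e x + R x)*fst p x + y x*e' x * snd p x) integrable_on {-l..l}" .
  have i1: "(%x. (V x*e x + R x)*fst p x) integrable_on {-l..l}"
    by (intro integrable_continuous_real continuous_intros c adm_cont assms)
  have i2: "(%x. R x*fst p x) integrable_on {-l..l}"
    by (intro integrable_continuous_real continuous_intros assms adm_cont)
  have "Sb (e, e') p = integral {-l..l} (%x. (y x*e' x * snd p x - (V x*e x + R x)*fst p x) + R x*fst p x)"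
    unfolding Sb_def by (rule arg_cong[of _ _ "integral _"]) (auto simp: algebra_simps)
  also have "... = integral {-l..l} (%x. y x*e' x * snd p x - (V x*e x + R x)*fst p x) + integral {-l..l} (%x. R x*fst p x)"
    using i0 i2 by (intro integral_add) (auto simp: algebra_simps)
  also have "integral {-l..l} (%x. y x*e' x * snd p x - (V x*e x + R x)*fst p x)
      = y l*e' l*fst p l - y (-l)*e' (-l)*fst p (-l)"
    using l by (intro acd_parts_C1[OF assms(1) c adm_acd[OF assms(4)]]) auto
  finally show ?thesis by simp
qed

lemma lin_AB:
  assumes "adm p"
  shows "integral {-l..l} (%x. (al*y x + be/y x)*fst p x) = al*B p + be*A p"
proof -
  have "integral {-l..l} (%x. (al*y x + be/y x)*fst p x)
    = integral {-l..l} (%x. al*(y x*fst p x) + be*(fst p x/y x))"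
    by (rule arg_cong[of _ _ "integral _"]) (auto simp: algebra_simps)
  also have "... = integral {-l..l} (%x. al*(y x*fst p x)) + integral {-l..l} (%x. be*(fst p x/y x))"
    by (intro integral_add A_integrable B_integrable integrable_on_mult_right assms)
  finally show ?thesis by (simp add: A_def B_def integral_mult_right del: times_divide_eq_right)
qed

text \<open>One of three even functions whose source lies in the span of \<open>y\<close> and
  \<open>1/y\<close>; here it is \<open>- 3*y - 4*E/y\<close>. The others are
  \<open>1 + x*psi/2\<close>, with source \<open>- 2*y - 6*J^2/y\<close>, and
  \<open>psi*Yf - 2*y + 4\<close>, with source \<open>16*E*y - 16*J^2/y\<close>.\<close>

definition "e1 = (%x. 1/y x, %x. - psi x/y x)"

text \<open>This is \<open>2*Y1\<close> times \<open>1 + x*psi/2\<close> minus \<open>T\<close>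
  times \<open>psi*Yf - 2*y + 4\<close>. The secular factor \<open>Y1*x - T*Yf x\<close> vanishes at
  both ends of the period, so the derivative is periodic too and no jump remains.\<close>

definition "u2 = (%x. 2*Y1 - 4*T + 2*T*y x + psi x*(Y1*x - T*Yf x),
   %x. (2*T*y x*y' x + ett x*(Y1*x - T*Yf x) + y' x*(Y1 - T*y x))/y x)"

text \<open>Half the cross product that eliminates the three sources: with these coefficients the
  combination \<open>uu\<close> has no source and is a second solution of the Jacobi equation, at
  the price of a jump of its derivative across the ends of the period.\<close>

definition "pp1 = 16*J^2*(1 + 3*E)"
definition "pp2 = - (32*E^2 + 24*J^2)"
definition "pp3 = 9*J^2 - 4*E"

definition "uu = (%x. pp1/y x + pp2*(1 + x*psi x/2) + pp3*(psi x*Yf x - 2*y x + 4),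
   %x. (- pp1*psi x + pp2*(y' x + x*ett x)/2 + pp3*(ett x*Yf x - y x*y' x))/y x)"

text \<open>\<open>m0\<close> is the value of \<open>ett\<close> at 0, and \<open>ml\<close> that of
  \<open>- ett\<close> at \<open>l\<close>: the weights with which a broken multiple of
  \<open>psi\<close> evaluates functions at its breaks.\<close>

definition "m0 = (y2 - y1)*(y1 - y3)"
definition "ml = (y2 - y1)*(y2 - y3)"
text \<open>\<open>G\<close> is the coefficient of \<open>1/y\<close>, up to the factor -4, in the
  source of the combination of \<open>e1\<close> and \<open>u2\<close> on which \<open>B\<close>
  vanishes. \<open>D0\<close> is a quarter of the determinant formed by the sources of
  \<open>e1\<close> and \<open>u2\<close>. Their signs govern the case distinctions below.\<close>

definition "G = E*Y1^2 + 4*E^2*T^2 - 3*J^2*T*Y1 + 4*J^2*T^2"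
definition "D0 = (9*J^2 - 4*E)*Y1 - (12*J^2 + 16*E^2)*T"

lemma adm_e1: "adm e1"
proof -
  have "acd (-l) l (fst e1) (snd e1)"
  proof (rule acdI_real)
    show "(fst e1 has_real_derivative snd e1 x) (at x)" for x unfolding e1_def fst_conv snd_conv
      by (auto intro!: derivative_eq_intros dy simp: ynz psi_def power2_eq_square)
    show "continuous_on {-l..l} (snd e1)"
      unfolding e1_def snd_conv by (intro continuous_intros cy cpsi) (simp add: ynz)
  qed
  then show ?thesis by (simp add: adm_def e1_def yml y0)
qed

lemma adm_u2: "adm u2"
proof -
  have "acd (-l) l (fst u2) (snd u2)"
  proof (rule acdI_real)
    show "(fst u2 has_real_derivative snd u2 x) (at x)" if "x \<in> {-l..l}" for x
      unfolding u2_def fst_conv snd_conv using that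
      by (auto intro!: derivative_eq_intros dy dpsi dYf simp: field_simps ynz) (simp add: psi_def ynz field_simps)
    show "continuous_on {-l..l} (snd u2)"
      unfolding u2_def snd_conv by (intro continuous_intros cy cy' cett cYf) (simp add: ynz)
  qed
  then show ?thesis by (simp add: adm_def u2_def yml y0 psi_def y'0)
qed

lemma adm_uu: "adm uu"
proof -
  have "acd (-l) l (fst uu) (snd uu)"
  proof (rule acdI_real)
    show "(fst uu has_real_derivative snd uu x) (at x)" if "x \<in> {-l..l}" for x
      unfolding uu_def fst_conv snd_conv using that
      by (auto intro!: derivative_eq_intros dy dpsi dYf simp: field_simps ynz) (simp add: psi_def ynz field_simps)
    show "continuous_on {-l..l} (snd uu)"
      unfolding uu_def snd_conv by (intro continuous_intros cy cy' cpsi cett cYf) (simp_all add: ynz)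
  qed
  then show ?thesis by (simp add: adm_def uu_def yml y0 psi_def y'0)
qed

lemma Sb_e1: assumes "adm p" shows "Sb e1 p = - 3*B p - 4*E*A p"
proof -
  have "Sb (fst e1, snd e1) p = integral {-l..l} (%x. (-3*y x + (- 4*E)/y x)*fst p x)
     + (y l * snd e1 l*fst p l - y (-l) * snd e1 (-l)*fst p (-l))"
  proof (rule Sb_C1)
    fix x
    have "((%x. - psi x) has_real_derivative - (ett x/y x)) (at x)" by (rule DERIV_minus[OF dpsi])
    moreover have "(%x. y x * snd e1 x) = (%x. - psi x)" by (auto simp: e1_def ynz)
    moreover have "- (ett x/y x) = - (V x*fst e1 x + (-3*y x + (- 4*E)/y x))"
      using ynz[of x] by (simp add: ett_def V_def e1_def field_simps power2_eq_square)
    ultimately show "((%x. y x * snd e1 x) has_real_derivative - (V x*fst e1 x + (-3*y x + (- 4*E)/y x))) (at x)"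
      by simp
  qed (auto intro!: continuous_intros cy adm_cont[OF adm_e1] assms simp: ynz)
  then show ?thesis using lin_AB[OF assms, of "-3" "-4*E"] by (simp add: e1_def psi_def y'0)
qed

lemma Sb_u2: assumes "adm p"
  shows "Sb u2 p = - 4*(Y1 + 4*E*T)*B p - 4*J^2*(3*Y1 - 4*T)*A p"
proof -
  define R where "R x = (- 4*(Y1 + 4*E*T))*y x + (- 4*J^2*(3*Y1 - 4*T))/y x" for x
  have "Sb (fst u2, snd u2) p = integral {-l..l} (%x. R x*fst p x)
     + (y l * snd u2 l*fst p l - y (-l) * snd u2 (-l)*fst p (-l))"
  proof (rule Sb_C1)
    fix x assume x: "x \<in> {-l..l}"
    have "((%x. 2*T*y x*y' x + ett x*(Y1*x - T*Yf x) + y' x*(Y1 - T*y x)) has_real_derivative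
       2*T*(y' x*y' x + y x*(- 3*(y x)^2 + 4*y x + 4*E))
       + ((- V x*psi x)*(Y1*x - T*Yf x) + ett x*(Y1 - T*y x))
       + ((- 3*(y x)^2 + 4*y x + 4*E)*(Y1 - T*y x) + y' x*(- T*y' x))) (at x)"
      using x by (auto intro!: derivative_eq_intros dy dy' dett dYf simp: algebra_simps)
    moreover have "(%x. y x * snd u2 x) = (%x. 2*T*y x*y' x + ett x*(Y1*x - T*Yf x) + y' x*(Y1 - T*y x))"
      by (auto simp: u2_def ynz)
    moreover have "2*T*(y' x*y' x + y x*(- 3*(y x)^2 + 4*y x + 4*E))
       + ((- V x*psi x)*(Y1*x - T*Yf x) + ett x*(Y1 - T*y x))
       + ((- 3*(y x)^2 + 4*y x + 4*E)*(Y1 - T*y x) + y' x*(- T*y' x)) = - (V x*fst u2 x + R x)"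
    proof -
      have "2*T*(y' x*y' x + y x*(- 3*(y x)^2 + 4*y x + 4*E))
         + ((- V x*psi x)*(Y1*x - T*Yf x) + ett x*(Y1 - T*y x))
         + ((- 3*(y x)^2 + 4*y x + 4*E)*(Y1 - T*y x) + y' x*(- T*y' x))
       = T*(y' x)^2 + 2*T*y x*(- 3*(y x)^2 + 4*y x + 4*E)
         - V x*(psi x*(Y1*x - T*Yf x)) + (ett x - 3*(y x)^2 + 4*y x + 4*E)*(Y1 - T*y x)"
        by (simp add: algebra_simps power2_eq_square)
      also have "... = - (V x*fst u2 x + R x)" unfolding fi using ynz[of x]
        by (simp add: u2_def R_def ett_def V_def divide_simps) (simp add: algebra_simps power2_eq_square power3_eq_cube)
      finally show ?thesis .
    qed
    ultimately show "((%x. y x * snd u2 x) has_real_derivative - (V x*fst u2 x + R x)) (at x)" by simp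
  qed (auto simp: R_def ynz intro!: continuous_intros cy adm_cont[OF adm_u2] assms)
  moreover have "snd u2 l = 0" "snd u2 (-l) = 0" by (simp_all add: u2_def y'0 Yfl Yfml T_def)
  ultimately show ?thesis using lin_AB[OF assms, of "- 4*(Y1 + 4*E*T)" "- 4*J^2*(3*Y1 - 4*T)"] by (simp add: R_def)
qed

lemma Esub: "E = - (y1*y2 + y1*y3 + y2*y3)/4" and Jsub: "J^2 = - (y1*y2*y3)/2"
  and y3sub: "y3 = 2 - y1 - y2" using roots by auto

lemma snd_uu_l: "y2 * snd uu l = - ml*D0/2 & y2 * snd uu (-l) = ml*D0/2"
proof -
  have ettl: "ett l*y2 = - ml*y2" "ett (-l) = ett l"
  proof -
    have "ett l*y2 = - (y2^3) - 4*E*y2 + 4*J^2"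
      using ord by (simp add: ett_def y0 field_simps power2_eq_square power3_eq_cube)
    also have "... = - ml*y2" unfolding ml_def unfolding Esub Jsub
      by (simp add: y3sub field_simps power2_eq_square power3_eq_cube)
    finally show "ett l*y2 = - ml*y2" .
    show "ett (-l) = ett l" by (simp add: ett_def even)
  qed
  have y2: "y2 ~= 0" using ord by auto
  then have ettl': "ett l = - ml" using ettl(1) by (metis mult_right_cancel)
  have "y2 * snd uu l = pp2*l*ett l/2 + pp3*ett l*Y1/2" using y2 by (simp add: uu_def y'0 Yfl y0 psi_def)
  moreover have "y2 * snd uu (-l) = - (pp2*l*ett l/2 + pp3*ett l*Y1/2)"
    using y2 ettl(2) by (simp add: uu_def y'0 Yfml yml psi_def field_simps)
  moreover have "pp2*l*ett l/2 + pp3*ett l*Y1/2 = - ml*D0/2"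
    unfolding ettl' pp2_def pp3_def D0_def T_def by (simp add: field_simps)
  ultimately show ?thesis by simp
qed

text \<open>No source is left inside the period; only the jump of \<open>y*uu'\<close> across the
  ends contributes, and it equals \<open>- ml*D0\<close>.\<close>

lemma Sb_uu: assumes "adm p" shows "Sb uu p = - ml*D0*fst p l"
proof -
  have "Sb (fst uu, snd uu) p = integral {-l..l} (%x. 0*fst p x)
     + (y l * snd uu l*fst p l - y (-l) * snd uu (-l)*fst p (-l))"
  proof (rule Sb_C1)
    fix x assume x: "x \<in> {-l..l}"
    have "((%x. - pp1*psi x + pp2*(y' x + x*ett x)/2 + pp3*(ett x*Yf x - y x*y' x)) has_real_derivative
       - pp1*(ett x/y x) + pp2*((- 3*(y x)^2 + 4*y x + 4*E) + (ett x + x*(- V x*psi x)))/2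
       + pp3*(((- V x*psi x)*Yf x + ett x*y x) - (y' x*y' x + y x*(- 3*(y x)^2 + 4*y x + 4*E)))) (at x)"
      using x by (auto intro!: derivative_eq_intros dy dy' dett dpsi dYf simp: field_simps)
    moreover have "(%x. y x * snd uu x) = (%x. - pp1*psi x + pp2*(y' x + x*ett x)/2 + pp3*(ett x*Yf x - y x*y' x))"
      by (auto simp: uu_def ynz)
    moreover have "- pp1*(ett x/y x) + pp2*((- 3*(y x)^2 + 4*y x + 4*E) + (ett x + x*(- V x*psi x)))/2
       + pp3*(((- V x*psi x)*Yf x + ett x*y x) - (y' x*y' x + y x*(- 3*(y x)^2 + 4*y x + 4*E))) = - (V x*fst uu x + 0)"
    proof -
      have "- pp1*(ett x/y x) + pp2*((- 3*(y x)^2 + 4*y x + 4*E) + (ett x + x*(- V x*psi x)))/2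
         + pp3*(((- V x*psi x)*Yf x + ett x*y x) - (y' x*y' x + y x*(- 3*(y x)^2 + 4*y x + 4*E)))
         = - pp1*(ett x/y x) + pp2*((- 3*(y x)^2 + 4*y x + 4*E) + ett x)/2 - V x*(pp2*x*psi x/2 + pp3*psi x*Yf x)
          + pp3*(ett x*y x - (y' x)^2 - y x*(- 3*(y x)^2 + 4*y x + 4*E))" by (simp add: field_simps power2_eq_square)
      also have "... = - (V x*fst uu x + 0)" unfolding fi using ynz[of x]
        by (simp add: uu_def ett_def V_def pp1_def pp2_def pp3_def divide_simps) (simp add: algebra_simps power2_eq_square power3_eq_cube)
      finally show ?thesis .
    qed
    ultimately show "((%x. y x * snd uu x) has_real_derivative - (V x*fst uu x + 0)) (at x)" by simp
  qed (auto intro!: adm_cont[OF adm_uu] assms)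
  then show ?thesis using snd_uu_l assms by (simp add: yml y0 adm_def field_simps)
qed

lemma uu_vals: "fst uu 0 = (y2 - y1)*(y1 - y3)*(y2 - y3)^2"
    "fst uu l = - ((y2 - y1)*(y2 - y3)*(y1 - y3)^2)"
proof -
  have "y1*fst uu 0 = pp1 + (pp2 + pp3*(4 - 2*y1))*y1" using ord by (simp add: uu_def y0 y'0 psi_def field_simps)
  also have "... = y1*((y2 - y1)*(y1 - y3)*(y2 - y3)^2)" unfolding pp1_def pp2_def pp3_def unfolding Esub Jsub
    by (simp add: y3sub field_simps power2_eq_square)
  finally show "fst uu 0 = (y2 - y1)*(y1 - y3)*(y2 - y3)^2" by (subst (asm) mult_left_cancel) (use ord in auto)
  have "y2*fst uu l = pp1 + (pp2 + pp3*(4 - 2*y2))*y2" using ord by (simp add: uu_def y0 y'0 psi_def field_simps)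
  also have "... = y2*(- ((y2 - y1)*(y2 - y3)*(y1 - y3)^2))" unfolding pp1_def pp2_def pp3_def unfolding Esub Jsub
    by (simp add: y3sub field_simps power2_eq_square)
  finally show "fst uu l = - ((y2 - y1)*(y2 - y3)*(y1 - y3)^2)" by (subst (asm) mult_left_cancel) (use ord in auto)
qed

end

section \<open>Signs of polynomials at the mean of \<open>y\<close>\<close>

lemma sign_Pi:
  fixes m E J :: real
  assumes "- (m^3) + 2 * m^2 + 4*E * m - 2*J^2 > 0" "- 3 * m^2 + 4 * m + 4*E > 0" "J ~= 0"
  shows "(m^2 + 4*E)^2 - 16*J^2*(m - 1) > 0"
proof (cases "m < 1")
  case True
  then have "0 < 16*J^2*(1 - m)" using assms(3) by simp
  moreover have "16*J^2*(1 - m) = - (16*J^2*(m - 1))" by (simp add: algebra_simps)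
  ultimately show ?thesis using zero_le_power2[of "m^2 + 4*E"] by linarith
next
  case False
  \<comment> \<open>For \<open>m >= 1\<close> the polynomial is the square of the derivative of the
    cubic plus \<open>8*(m - 1)\<close> times the cubic, both evaluated at \<open>m\<close>.\<close>
  have "(m^2 + 4*E)^2 - 16*J^2*(m - 1) = (- 3 * m^2 + 4 * m + 4*E)^2 + 8*(m - 1)*(- (m^3) + 2 * m^2 + 4*E * m - 2*J^2)"
    by (simp add: algebra_simps power2_eq_square power3_eq_cube)
  moreover have "(- 3 * m^2 + 4 * m + 4*E)^2 > 0" using assms(2) by simp
  moreover have "8*(m - 1)*(- (m^3) + 2 * m^2 + 4*E * m - 2*J^2) >= 0"
    using assms(1) False by (intro mult_nonneg_nonneg) auto
  ultimately show ?thesis by linarith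
qed

text \<open>With \<open>f\<close> the cubic, three identities decide: \<open>g\<close> equals
  \<open>f'*(f' + m^2)/4 + (3*m - 4)*f/2\<close> as well as
  \<open>E*(m^2 + 4*E) + J^2*(4 - 3*m)\<close>, and \<open>d = - 3*g - E*f'\<close>. If
  \<open>g <= 0\<close>, the first forces \<open>m < 4/3\<close>, the second then restricts the sign
  of \<open>E\<close>, and the third gives the sign of \<open>d\<close>.\<close>

lemma sign_G_D:
  fixes m E J :: real
  defines "g \<equiv> E * m^2 + 4*E^2 - 3*J^2 * m + 4*J^2"
    and "d \<equiv> (9*J^2 - 4*E) * m - (12*J^2 + 16*E^2)"
  assumes f: "- (m^3) + 2 * m^2 + 4*E * m - 2*J^2 > 0" and fp: "- 3 * m^2 + 4 * m + 4*E > 0"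
    and m: "m > 0" and JE: "J ~= 0 | E < 0"
  shows "g < 0 ==> d > 0" and "d <= 0 ==> g > 0"
proof -
  define fm where "fm = - (m^3) + 2 * m^2 + 4*E * m - 2*J^2"
  define fpm where "fpm = - 3 * m^2 + 4 * m + 4*E"
  have pos: "fm > 0" "fpm > 0" using f fp by (auto simp: fm_def fpm_def)
  have g1: "g = fpm*(fpm + m^2)/4 + (3 * m - 4)*fm/2"
    by (simp add: g_def fm_def fpm_def field_simps power2_eq_square power3_eq_cube)
  have g2: "g = E*(m^2 + 4*E) + J^2*(4 - 3 * m)" by (simp add: g_def field_simps power2_eq_square)
  have d1: "d = - 3*g - E*fpm" by (simp add: d_def g_def fpm_def field_simps power2_eq_square)
  have P: "0 < fpm*(fpm + m^2)/4" using pos by (simp add: add_pos_nonneg)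
  have m43: "m < 4/3" if "g <= 0"
  proof (rule ccontr)
    assume "~ m < 4/3"
    then have "0 <= (3 * m - 4)*fm/2" using pos by simp
    with P g1 that show False by linarith
  qed
  have E0: "E < 0" if "g < 0"
  proof (rule ccontr)
    assume "~ E < 0"
    then have "0 <= E*(m^2 + 4*E)" by simp
    moreover have "0 <= J^2*(4 - 3 * m)" using m43 that by simp
    ultimately show False using g2 that by linarith
  qed
  show gd: "d > 0" if "g < 0" using E0[OF that] mult_neg_pos[OF E0[OF that] pos(2)] that d1 by linarith
  show "g > 0" if "d <= 0"
  proof (rule ccontr)
    assume "~ g > 0"
    then have g0: "g = 0" using gd that by force
    then have "E*fpm >= 0" using d1 that by linarith
    then have E: "E >= 0" using pos(2) by (simp add: zero_le_mult_iff)
    then have J: "J^2 > 0" using JE by simp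
    have "0 <= E*(m^2 + 4*E)" using E by simp
    moreover have "0 < J^2*(4 - 3 * m)" using m43 g0 J by simp
    ultimately show False using g2 g0 by linarith
  qed
qed

lemma integral_FTC:
  fixes F f :: "real => real"
  assumes "a <= b" "!!x. (F has_real_derivative f x) (at x)"
  shows "integral {a..b} f = F b - F a" using assms by (intro integral_unique fundamental_theorem_of_calculus)
    (auto simp: has_real_derivative_iff_has_vector_derivative[symmetric] intro: has_field_derivative_at_within)

context orbit
begin

text \<open>Otherwise \<open>y3 = 0\<close> and \<open>y1*y2 = - 4*E <= 0\<close>, although both
  roots are positive.\<close>

lemma JE: "J ~= 0 | E < 0"
proof (rule ccontr)
  assume "~ ?thesis"
  then have "J = 0" "E >= 0" by auto
  then have "y3 = 0" using roots(3) ord by auto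
  then have "y1*y2 = - 4*E" using roots(2) by simp
  moreover have "y1*y2 > 0" using ord by simp
  ultimately show False using \<open>E \<ge> 0\<close> by simp
qed

definition "Y2 = integral {-l..l} (%x. (y x)^2)"

lemma hY: "(y has_integral Y1) {-l..l}" and hY2: "((%x. (y x)^2) has_integral Y2) {-l..l}"
  and hYn: "((%x. 1/y x) has_integral Yn) {-l..l}" unfolding Y1_def Y2_def Yn_def
  by (auto intro!: integrable_integral integrable_continuous_real continuous_intros cy simp: ynz)

lemma hc: "((%x. c) has_integral T*c) {-l..l}" using has_integral_const_real[of c "-l" l] l by (simp add: T_def)

text \<open>The second derivative of \<open>y\<close> integrates to 0 over the period.\<close>

lemma Y2_eq: "3*Y2 = 4*Y1 + 4*E*T"
proof -
  have "((%x. - 3*(y x)^2 + 4*y x + 4*E) has_integral y' l - y' (-l)) {-l..l}"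
    using l dy' by (intro fundamental_theorem_of_calculus)
      (auto simp: has_real_derivative_iff_has_vector_derivative[symmetric] intro: has_field_derivative_at_within)
  moreover have "((%x. - 3*(y x)^2 + 4*y x + 4*E) has_integral - 3*Y2 + 4*Y1 + T*(4*E)) {-l..l}"
    by (intro has_integral_add has_integral_mult_right hY hY2 hc)
  ultimately have "- 3*Y2 + 4*Y1 + T*(4*E) = y' l - y' (-l)" by (rule has_integral_unique[rotated])
  then show ?thesis using y'0 by (simp add: algebra_simps)
qed

definition "m = Y1/T"
definition "n = Yn/T"

lemma Y1m: "Y1 = m*T" and Ynn: "Yn = n*T" using T0 by (auto simp: m_def n_def)

lemma m_gt: "m > y1" and m_lt: "m < y2"
proof -
  have "integral {-l..l} (%x. y x - y1) > 0"
    using l ord y0 by (intro integral_continuous_pos[where c=l] continuous_intros cy) (auto simp: yb)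
  moreover have "((%x. y x - y1) has_integral Y1 - T*y1) {-l..l}" by (intro has_integral_diff hY hc)
  ultimately have "T*y1 < m*T" using Y1m by (simp add: integral_unique)
  then show "m > y1" using T0 by (simp add: mult.commute)
  have "integral {-l..l} (%x. y2 - y x) > 0"
    using l ord y0 by (intro integral_continuous_pos[where c=0] continuous_intros cy) (auto simp: yb)
  moreover have "((%x. y2 - y x) has_integral T*y2 - Y1) {-l..l}" by (intro has_integral_diff hY hc)
  ultimately have "m*T < T*y2" using Y1m by (simp add: integral_unique)
  then show "m < y2" using T0 by (simp add: mult.commute)
qed

lemma m0': "m > 0" using m_gt ord by simp

lemma fm: "- (m^3) + 2 * m^2 + 4*E * m - 2*J^2 > 0"
proof -
  have "(m - y1)*(y2 - m)*(m - y3) > 0" using m_gt m_lt ord by simp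
  moreover have "(m - y1)*(y2 - m)*(m - y3)
    = - (m^3) + (y1 + y2 + y3) * m^2 - (y1*y2 + y1*y3 + y2*y3) * m + y1*y2*y3"
    by (simp add: algebra_simps power2_eq_square power3_eq_cube)
  ultimately show ?thesis unfolding roots by simp
qed

text \<open>By \<open>Y2_eq\<close> the left side is three times the variance of \<open>y\<close>
  over the period.\<close>

lemma fpm: "- 3 * m^2 + 4 * m + 4*E > 0"
proof -
  have "integral {-l..l} (%x. (y x - m)^2) > 0"
    using l y0 m_gt by (intro integral_continuous_pos[where c=0] continuous_intros cy) auto
  moreover have "((%x. (y x)^2 - 2 * m*y x + m^2) has_integral Y2 - 2 * m*Y1 + T * m^2) {-l..l}"
    by (intro has_integral_add has_integral_diff has_integral_mult_right hY hY2 hc)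
  moreover have "(%x. (y x - m)^2) = (%x. (y x)^2 - 2 * m*y x + m^2)" by (auto simp: power2_eq_square algebra_simps)
  ultimately have "0 < 3*(Y2 - 2 * m*Y1 + T * m^2)" by (simp add: integral_unique)
  also have "... = T*(- 3 * m^2 + 4 * m + 4*E)" using Y2_eq by (simp add: Y1m algebra_simps power2_eq_square)
  finally show ?thesis using T0 by (simp add: zero_less_mult_iff)
qed

text \<open>Strict Cauchy-Schwarz for the means of \<open>y\<close> and \<open>1/y\<close>, obtained
  from the positive integral of \<open>(y - m)^2/y\<close>.\<close>

lemma mn: "m*n > 1"
proof -
  have "integral {-l..l} (%x. (y x - m)^2/y x) > 0"
    using l y0 m_gt ypos less_imp_le[OF ypos] ynz by (intro integral_continuous_pos[where c=0] continuous_intros cy) auto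
  moreover have "((%x. y x - 2 * m + m^2*(1/y x)) has_integral Y1 - T*(2 * m) + m^2*Yn) {-l..l}"
    by (intro has_integral_add has_integral_diff has_integral_mult_right hY hYn hc)
  moreover have "(%x. (y x - m)^2/y x) = (%x. y x - 2 * m + m^2*(1/y x))"
    using ynz by (auto simp: power2_eq_square field_simps fun_eq_iff)
  ultimately have "0 < Y1 - T*(2 * m) + m^2*Yn" by (simp add: integral_unique)
  also have "... = T * m*(m*n - 1)" by (simp add: Y1m Ynn algebra_simps power2_eq_square)
  finally show ?thesis using mult_pos_pos[OF T0 m0'] by (simp add: zero_less_mult_iff)
qed

lemma B_e1: "B e1 = T" using integral_unique[OF hc[of 1]] ynz by (simp add: B_def e1_def)

text \<open>\<open>psi' = - y - 4*E/y + 4*J^2/y^2\<close> integrates to 0 over the period.\<close>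

lemma A_e1: "4*J^2*A e1 = Y1 + 4*E*Yn"
proof -
  have "((%x. ett x/y x) has_integral psi l - psi (-l)) {-l..l}"
    using l dpsi by (intro fundamental_theorem_of_calculus)
      (auto simp: has_real_derivative_iff_has_vector_derivative[symmetric] intro: has_field_derivative_at_within)
  moreover have "((%x. - y x - 4*E*(1/y x) + 4*J^2*(fst e1 x/y x)) has_integral - Y1 - 4*E*Yn + 4*J^2*A e1) {-l..l}"
    unfolding A_def
    by (intro has_integral_add has_integral_diff has_integral_mult_right has_integral_neg hY hYn integrable_integral A_integrable adm_e1)
  moreover have "(%x. ett x/y x) = (%x. - y x - 4*E*(1/y x) + 4*J^2*(fst e1 x/y x))"
    using ynz by (auto simp: ett_def e1_def field_simps fun_eq_iff power2_eq_square)
  ultimately have "- Y1 - 4*E*Yn + 4*J^2*A e1 = psi l - psi (-l)" by (metis has_integral_unique)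
  then show ?thesis by (simp add: psi_def y'0)
qed

text \<open>The secular factor \<open>Y1*x - T*Yf x\<close> vanishes at both ends, so the derivative
  can be moved onto it. The moments of \<open>u2\<close> are thereby evaluated although
  \<open>Yf\<close> has no closed form.\<close>

lemma u2_parts:
  assumes "acd (-l) l a g"
  shows "integral {-l..l} (%x. (Y1*x - T*Yf x)*g x) = - integral {-l..l} (%x. (Y1 - T*y x)*a x)"
proof -
  have ca: "continuous_on {-l..l} a" by (rule acd_continuous[OF assms])
  have cg: "sqint (-l) l g" by (rule acd_sqint[OF assms])
  have "integral {-l..l} (%x. (Y1*x - T*Yf x)*g x - (- (Y1 - T*y x))*a x)
     = (Y1*l - T*Yf l)*a l - (Y1*(-l) - T*Yf (-l))*a (-l)"
  proof (rule acd_parts_C1[OF _ _ assms])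
    show "((%x. Y1*x - T*Yf x) has_real_derivative - (- (Y1 - T*y x))) (at x)" if "x \<in> {-l..l}" for x
      using that by (auto intro!: derivative_eq_intros dYf)
  qed (use l in \<open>auto intro!: continuous_intros cy\<close>)
  also have "... = 0" by (simp add: Yfl Yfml T_def)
  finally have z: "integral {-l..l} (%x. (Y1*x - T*Yf x)*g x - (- (Y1 - T*y x))*a x) = 0" .
  have "integral {-l..l} (%x. (Y1*x - T*Yf x)*g x - (- (Y1 - T*y x))*a x)
    = integral {-l..l} (%x. (Y1*x - T*Yf x)*g x) - integral {-l..l} (%x. (- (Y1 - T*y x))*a x)"
  proof (rule integral_diff)
    have "continuous_on {-l..l} (%x. Y1*x - T*Yf x)" by (intro continuous_intros cYf)
    then show "(%x. (Y1*x - T*Yf x)*g x) integrable_on {-l..l}" by (rule sqint_int[OF sqint_mult_bounded[OF _ cg]])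
    show "(%x. (- (Y1 - T*y x))*a x) integrable_on {-l..l}"
      by (intro integrable_continuous_real continuous_intros cy ca)
  qed
  then show ?thesis using z by (simp del: minus_diff_eq)
qed

lemma B_u2: "B u2 = Y1^2 + 4*E*T^2"
proof -
  have "acd (-l) l y y'" by (rule acdI_real[OF dy cy'])
  from u2_parts[OF this]
  have *: "integral {-l..l} (%x. (Y1*x - T*Yf x)*y' x) = - integral {-l..l} (%x. (Y1 - T*y x)*y x)" .
  have "((%x. Y1*y x - T*(y x)^2) has_integral Y1*Y1 - T*Y2) {-l..l}"
    by (intro has_integral_diff has_integral_mult_right hY hY2)
  moreover have "(%x. (Y1 - T*y x)*y x) = (%x. Y1*y x - T*(y x)^2)" by (auto simp: algebra_simps power2_eq_square)
  ultimately have **: "integral {-l..l} (%x. (Y1*x - T*Yf x)*y' x) = - (Y1*Y1 - T*Y2)"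
    using * by (simp add: integral_unique)
  have h: "((%x. (Y1*x - T*Yf x)*y' x) has_integral - (Y1*Y1 - T*Y2)) {-l..l}" unfolding **[symmetric]
    by (intro integrable_integral integrable_continuous_real continuous_intros cYf cy')
  have "((%x. (2*Y1 - 4*T)*y x + 2*T*(y x)^2 + (Y1*x - T*Yf x)*y' x)
     has_integral (2*Y1 - 4*T)*Y1 + 2*T*Y2 + - (Y1*Y1 - T*Y2)) {-l..l}"
    by (intro has_integral_add has_integral_mult_right hY hY2 h)
  moreover have "(%x. y x*fst u2 x) = (%x. (2*Y1 - 4*T)*y x + 2*T*(y x)^2 + (Y1*x - T*Yf x)*y' x)"
    by (auto simp: u2_def algebra_simps power2_eq_square ypsi[symmetric])
  ultimately have "B u2 = (2*Y1 - 4*T)*Y1 + 2*T*Y2 + - (Y1*Y1 - T*Y2)" unfolding B_def by (simp add: integral_unique)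
  also have "... = Y1^2 - 4*T*Y1 + T*(3*Y2)" by (simp add: algebra_simps power2_eq_square)
  also have "... = Y1^2 + 4*E*T^2" unfolding Y2_eq by (simp add: algebra_simps power2_eq_square)
  finally show ?thesis .
qed

lemma A_u2: "A u2 = T^2 + Yn*(3*Y1 - 4*T)"
proof -
  have "acd (-l) l (%x. - fst e1 x) (%x. - snd e1 x)" using adm_e1 unfolding adm_def by (intro acd_uminus) auto
  from u2_parts[OF this]
  have *: "integral {-l..l} (%x. (Y1*x - T*Yf x)*- snd e1 x) = - integral {-l..l} (%x. (Y1 - T*y x)*- fst e1 x)" .
  have "((%x. T - Y1*(1/y x)) has_integral T*T - Y1*Yn) {-l..l}"
    by (intro has_integral_diff has_integral_mult_right hYn hc)
  moreover have "(%x. (Y1 - T*y x)*- fst e1 x) = (%x. T - Y1*(1/y x))" using ynz by (auto simp: field_simps e1_def)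
  ultimately have **: "integral {-l..l} (%x. (Y1*x - T*Yf x)*- snd e1 x) = - (T*T - Y1*Yn)"
    using * by (simp add: integral_unique)
  have h: "((%x. (Y1*x - T*Yf x)*- snd e1 x) has_integral - (T*T - Y1*Yn)) {-l..l}"
    unfolding **[symmetric] e1_def snd_conv
    by (intro integrable_integral integrable_continuous_real continuous_intros cYf cy cpsi) (simp add: ynz)
  have "((%x. (2*Y1 - 4*T)*(1/y x) + 2*T + (Y1*x - T*Yf x)*- snd e1 x)
     has_integral (2*Y1 - 4*T)*Yn + T*(2*T) + - (T*T - Y1*Yn)) {-l..l}"
    by (intro has_integral_add has_integral_mult_right hYn hc h)
  moreover have "(%x. fst u2 x/y x) = (%x. (2*Y1 - 4*T)*(1/y x) + 2*T + (Y1*x - T*Yf x)*- snd e1 x)"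
    using ynz by (auto simp: u2_def e1_def field_simps power2_eq_square)
  ultimately have "A u2 = (2*Y1 - 4*T)*Yn + T*(2*T) + - (T*T - Y1*Yn)" unfolding A_def by (simp add: integral_unique)
  then show ?thesis by (simp add: algebra_simps power2_eq_square)
qed

lemma odd: "y' (- x) = - y' x"
proof -
  have "((%x. y (- x)) has_real_derivative y' (- x)*(- 1)) (at x)"
    by (rule DERIV_chain2[OF dy]) (auto intro!: derivative_eq_intros)
  then have "(y has_real_derivative - y' (- x)) (at x)" by (simp add: even)
  from DERIV_unique[OF this dy] show ?thesis by simp
qed

text \<open>\<open>psi\<close> vanishes at 0 and at the ends and has no zero in between, so it is
  the Jacobi field of \<open>jacobi_le\<close> on each half period, with no surplus. Equality forces
  a multiple of \<open>psi\<close>, possibly a different one on each half.\<close>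

lemma halves:
  assumes p: "adm p" "fst p 0 = 0" "fst p l = 0"
  defines "q \<equiv> %x. y x*(snd p x)^2 - V x*(fst p x)^2"
  shows "0 <= integral {0..l} q" "0 <= integral {-l..0} q"
    "integral {0..l} q <= 0 ==> EX c. ALL x:{0..l}. fst p x = c*psi x"
    "integral {-l..0} q <= 0 ==> EX c. ALL x:{-l..0}. fst p x = c*psi x"
proof -
  have pml: "fst p (-l) = 0" using p by (simp add: adm_def)
  have c1: "continuous_on S (%x. ett x/y x)" for S by (intro continuous_intros cett cy) (simp add: ynz)
  have d2: "((%x. y x*(ett x/y x)) has_real_derivative - (V x + 0)*psi x) (at x)" for x
    using dett[of x] by (simp add: ynz)
  have b1: "c0/y2*((x - 0)*(l - x)) <= \<bar>psi x\<bar>" if "x \<in> {0..l}" for x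
  proof -
    have nn: "0 <= c0*(x*(l - x))" using that low(1) by simp
    have "c0*(x*(l - x))/y2 <= y' x/y x" using that low(2)[of x] yb[of x] ypos[of x] nn by (intro frac_le) auto
    also have "... <= \<bar>psi x\<bar>" unfolding psi_def by (rule abs_ge_self)
    finally show ?thesis by simp
  qed
  have b2: "c0/y2*((x - (-l))*(0 - x)) <= \<bar>psi x\<bar>" if "x \<in> {-l..0}" for x
    using b1[of "-x"] that by (simp add: psi_def odd even algebra_simps)
  have cy2: "c0/y2 > 0" using low ord by simp
  have a1: "acd 0 l (fst p) (snd p)" and a2: "acd (-l) 0 (fst p) (snd p)"
    using l by (auto intro!: acd_subset[OF adm_acd[OF p(1)]])
  note J1 = jacobi_le[OF l a1 p(2,3) cy cV continuous_on_const c1 less_imp_le[OF ypos] order_refl cy2 b1 dpsi d2, unfolded q_def[symmetric]]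
  have l': "-l < 0" using l by simp
  note J2 = jacobi_le[OF l' a2 pml p(2) cy cV continuous_on_const c1 less_imp_le[OF ypos] order_refl cy2 b2 dpsi d2, unfolded q_def[symmetric]]
  show I1: "0 <= integral {0..l} q" using J1[of "l/2" "l/2"] l by (simp add: q_def)
  show I2: "0 <= integral {-l..0} q" using J2[of "-l/2" "-l/2"] l by (simp add: q_def)
  have nz: "psi x ~= 0" if "0 < x" "x < l" for x
  proof -
    have "0 < c0/y2*((x - 0)*(l - x))" using that by (intro mult_pos_pos cy2) auto
    then show ?thesis using b1[of x] that by auto
  qed
  have nz2: "psi x ~= 0" if "-l < x" "x < 0" for x using nz[of "-x"] that by (simp add: psi_def odd even)
  have psi0: "psi 0 = 0" "psi l = 0" "psi (-l) = 0" by (auto simp: psi_def y'0)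
  show "EX c. ALL x:{0..l}. fst p x = c*psi x" if z: "integral {0..l} q <= 0"
  proof -
    have le: "fst p t/psi t = fst p s/psi s" if st: "0 < s" "s <= t" "t < l" for s t
    proof (rule jacobi_eq[OF acd_subset[OF a1] st(2) c1 cy continuous_on_const ypos order_refl nz dpsi])
      show "integral {s..t} (%x. y x*(snd p x - ett x/y x/psi x*fst p x)^2 + 0*(fst p x)^2) <= 0"
        using J1[OF _ st] z by (simp add: q_def)
    qed (use st in auto)
    have "fst p x = fst p (l/2)/psi (l/2)*psi x" if x: "x \<in> {0..l}" for x
    proof -
      consider "x = 0" | "x = l" | "0 < x" "x <= l/2" | "l/2 <= x" "x < l" using x by fastforce
      then show ?thesis
      proof cases
        case 3
        then have "fst p x/psi x = fst p (l/2)/psi (l/2)" using le[of x "l/2"] l by simp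
        then show ?thesis using nz[of x] 3 l by (simp add: divide_eq_eq)
      next
        case 4
        then have "fst p x/psi x = fst p (l/2)/psi (l/2)" using le[of "l/2" x] l by simp
        then show ?thesis using nz[of x] 4 l by (simp add: divide_eq_eq)
      qed (use p psi0 in auto)
    qed
    then show ?thesis by blast
  qed
  show "EX c. ALL x:{-l..0}. fst p x = c*psi x" if z: "integral {-l..0} q <= 0"
  proof -
    have le: "fst p t/psi t = fst p s/psi s" if st: "-l < s" "s <= t" "t < 0" for s t
    proof (rule jacobi_eq[OF acd_subset[OF a2] st(2) c1 cy continuous_on_const ypos order_refl nz2 dpsi])
      show "integral {s..t} (%x. y x*(snd p x - ett x/y x/psi x*fst p x)^2 + 0*(fst p x)^2) <= 0"
        using J2[OF _ st] z by (simp add: q_def)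
    qed (use st in auto)
    have "fst p x = fst p (-l/2)/psi (-l/2)*psi x" if x: "x \<in> {-l..0}" for x
    proof -
      consider "x = 0" | "x = -l" | "-l < x" "x <= -l/2" | "-l/2 <= x" "x < 0" using x by fastforce
      then show ?thesis
      proof cases
        case 3
        then have "fst p x/psi x = fst p (-l/2)/psi (-l/2)" using le[of x "-l/2"] l by simp
        then show ?thesis using nz2[of x] 3 l by (simp add: divide_eq_eq)
      next
        case 4
        then have "fst p x/psi x = fst p (-l/2)/psi (-l/2)" using le[of "-l/2" x] l by simp
        then show ?thesis using nz2[of x] 4 l by (simp add: divide_eq_eq)
      qed (use p pml psi0 in auto)
    qed
    then show ?thesis by blast
  qed
qed

lemma Sb_self: "Sb p p = integral {-l..l} (%x. y x*(snd p x)^2 - V x*(fst p x)^2)"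
  by (simp add: Sb_def power2_eq_square)

lemma split_int:
  fixes f :: "real => real"
  assumes "f integrable_on {-l..l}"
  shows "integral {-l..l} f = integral {-l..0} f + integral {0..l} f"
  using Henstock_Kurzweil_Integration.integral_combine[of "-l" 0 l f] assms l by simp

lemma HD:
  assumes p: "adm p" "fst p 0 = 0" "fst p l = 0"
  shows "0 <= Sb p p"
    "Sb p p <= 0 ==> EX c1 c2. (ALL x:{0..l}. fst p x = c1*psi x) & (ALL x:{-l..0}. fst p x = c2*psi x)"
proof -
  have i: "(%x. y x*(snd p x)^2 - V x*(fst p x)^2) integrable_on {-l..l}"
    using Sb_integrable[OF p(1) p(1)] by (simp add: power2_eq_square)
  note e = split_int[OF i, folded Sb_self]
  show "0 <= Sb p p" using e halves(1,2)[OF p] by simp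
  show "EX c1 c2. (ALL x:{0..l}. fst p x = c1*psi x) & (ALL x:{-l..0}. fst p x = c2*psi x)" if "Sb p p <= 0"
  proof -
    have "integral {0..l} (%x. y x*(snd p x)^2 - V x*(fst p x)^2) <= 0"
      "integral {-l..0} (%x. y x*(snd p x)^2 - V x*(fst p x)^2) <= 0" using e halves(1,2)[OF p] that by linarith+
    from halves(3)[OF p this(1)] halves(4)[OF p this(2)] show ?thesis by blast
  qed
qed

text \<open>\<open>y*psi\<close> is the derivative of \<open>y\<close> and \<open>psi/y\<close> that
  of \<open>- 1/y\<close>; by symmetry of the two halves only the difference of the two factors
  survives.\<close>

lemma pieces_AB:
  assumes p: "adm p" and c: "!!x. x \<in> {0..l} ==> fst p x = c1*psi x" "!!x. x \<in> {-l..0} ==> fst p x = c2*psi x"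
  shows "B p = (c1 - c2)*(y2 - y1)" "A p = (c1 - c2)*(1/y1 - 1/y2)"
proof -
  have "integral {-l..0} (%x. y x*fst p x) = integral {-l..0} (%x. c2*y' x)"
    by (intro Henstock_Kurzweil_Integration.integral_cong) (auto simp: c(2) ypsi[symmetric])
  also have "... = c2*y 0 - c2*y (-l)" using l by (intro integral_FTC DERIV_cmult dy) auto
  finally have b1: "integral {-l..0} (%x. y x*fst p x) = c2*y1 - c2*y2" by (simp add: y0 yml)
  have "integral {0..l} (%x. y x*fst p x) = integral {0..l} (%x. c1*y' x)"
    by (intro Henstock_Kurzweil_Integration.integral_cong) (auto simp: c(1) ypsi[symmetric])
  also have "... = c1*y l - c1*y 0" using l by (intro integral_FTC DERIV_cmult dy) auto
  finally have b2: "integral {0..l} (%x. y x*fst p x) = c1*y2 - c1*y1" by (simp add: y0)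
  show "B p = (c1 - c2)*(y2 - y1)" unfolding B_def split_int[OF B_integrable[OF p]] b1 b2 by (simp add: algebra_simps)
  have d: "((%x. - (1/y x)) has_real_derivative psi x/y x) (at x)" for x
    by (auto intro!: derivative_eq_intros dy simp: ynz psi_def power2_eq_square)
  have "integral {-l..0} (%x. fst p x/y x) = integral {-l..0} (%x. c2*(psi x/y x))"
    by (intro Henstock_Kurzweil_Integration.integral_cong) (auto simp: c(2))
  also have "... = c2*(- (1/y 0)) - c2*(- (1/y (-l)))" using l by (intro integral_FTC DERIV_cmult d) auto
  finally have a1: "integral {-l..0} (%x. fst p x/y x) = c2*(- (1/y1)) - c2*(- (1/y2))" by (simp add: y0 yml)
  have "integral {0..l} (%x. fst p x/y x) = integral {0..l} (%x. c1*(psi x/y x))"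
    by (intro Henstock_Kurzweil_Integration.integral_cong) (auto simp: c(1))
  also have "... = c1*(- (1/y l)) - c1*(- (1/y 0))" using l by (intro integral_FTC DERIV_cmult d) auto
  finally have a2: "integral {0..l} (%x. fst p x/y x) = c1*(- (1/y2)) - c1*(- (1/y1))" by (simp add: y0)
  have "A p = (c2*(- (1/y1)) - c2*(- (1/y2))) + (c1*(- (1/y2)) - c1*(- (1/y1)))"
    unfolding A_def split_int[OF A_integrable[OF p]] a1 a2 ..
  also have "... = (c1 - c2)*(1/y1 - 1/y2)" by argo
  finally show "A p = (c1 - c2)*(1/y1 - 1/y2)" .
qed

end

text \<open>A positive determinant makes the form definite, and one negative value decides its
  sign.\<close>

lemma binary_form_neg:
  fixes P Q R :: real
  assumes "P * R - Q^2 > 0" "P*al0^2 + 2*Q*al0*be0 + R*be0^2 < 0" "al ~= 0 | be ~= 0"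
  shows "P*al^2 + 2*Q*al*be + R*be^2 < 0"
proof -
  have id: "P*(P*a^2 + 2*Q*a*b + R*b^2) = (P*a + Q*b)^2 + (P * R - Q^2)*b^2" for a b
    by (simp add: power2_eq_square algebra_simps)
  have P0: "P ~= 0" using assms(1) by auto
  have "P*(P*al0^2 + 2*Q*al0*be0 + R*be0^2) >= 0" unfolding id using assms(1) by simp
  then have P: "P < 0" using assms(2) P0 by (auto simp: zero_le_mult_iff)
  have "(P*al + Q*be)^2 + (P * R - Q^2)*be^2 > 0"
  proof (cases "be = 0")
    case True
    then show ?thesis using assms(3) P0 by simp
  next
    case False
    then show ?thesis using assms(1) by (intro add_nonneg_pos) auto
  qed
  then have "P*(P*al^2 + 2*Q*al*be + R*be^2) > 0" unfolding id .
  then show ?thesis using P by (auto simp: zero_less_mult_iff)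
qed

lemma cmb_cancel: "cmb (cmb p (- t) r) t r = p" by (simp add: cmb_def)

context orbit
begin

text \<open>A functional that vanishes on \<open>uu\<close> and on all functions that are 0 at 0 and
  at \<open>l\<close>; together these span its kernel.\<close>

definition "lam p = m0*fst p 0 + ml*fst p l"
definition "lc al be = (%x. al*fst e1 x + be*fst u2 x, %x. al * snd e1 x + be * snd u2 x)"

lemma m0_pos: "m0 > 0" and ml_pos: "ml > 0" using ord by (auto simp: m0_def ml_def)

lemma lc_cmb: "lc al be = cmb (cmb (%x. 0, %x. 0) al e1) be u2" by (simp add: lc_def cmb_def)

lemma adm_0: "adm (%x. 0, %x. 0)" by (simp add: adm_def acd_const)

lemma adm_lc: "adm (lc al be)" unfolding lc_cmb by (intro adm_cmb adm_0 adm_e1 adm_u2)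

lemma Sb_lc:
  assumes "adm p"
  shows "Sb (lc al be) p = - (3*al + 4*(Y1 + 4*E*T)*be)*B p - (4*E*al + 4*J^2*(3*Y1 - 4*T)*be)*A p"
proof -
  have "Sb (%x. 0, %x. 0) p = 0" by (simp add: Sb_def)
  then have "Sb (lc al be) p = al*Sb e1 p + be*Sb u2 p"
    unfolding lc_cmb by (simp add: Sb_cmb_left adm_cmb adm_0 adm_e1 adm_u2 assms)
  then show ?thesis unfolding Sb_e1[OF assms] Sb_u2[OF assms] by (simp add: algebra_simps)
qed

lemma A_lc: "A (lc al be) = al*A e1 + be*A u2" and B_lc: "B (lc al be) = al*T + be*B u2"
proof -
  have "A (%x. 0, %x. 0) = 0" "B (%x. 0, %x. 0) = 0" by (auto simp: A_def B_def)
  then show "A (lc al be) = al*A e1 + be*A u2" "B (lc al be) = al*T + be*B u2"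
    unfolding lc_cmb by (auto simp: A_cmb B_cmb adm_cmb adm_0 adm_e1 adm_u2 B_e1)
qed

lemma Sb_square:
  assumes "adm p" "adm r"
  shows "Sb (cmb p t r) (cmb p t r) = Sb p p + 2*t*Sb r p + t^2*Sb r r" using assms
  by (simp add: Sb_cmb_left Sb_cmb_right adm_cmb Sb_sym[of p r] power2_eq_square algebra_simps)

lemma lam_cmb: "lam (cmb p t r) = lam p + t*lam r" by (simp add: lam_def cmb_def algebra_simps)

lemma Sb_uu_uu: "Sb uu uu = ml*D0*((y2 - y1)*(y2 - y3)*(y1 - y3)^2)" by (simp add: Sb_uu[OF adm_uu] uu_vals)

lemma uu0_pos: "fst uu 0 > 0" using ord by (simp add: uu_vals)

lemma lam_uu: "lam uu = 0" by (simp add: lam_def uu_vals m0_def ml_def power2_eq_square)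

text \<open>A multiple of \<open>uu\<close> removes the value at 0, and \<open>lam p = 0\<close>
  then removes the value at \<open>l\<close>. The two parts are orthogonal for \<open>Sb\<close>
  because pairing with \<open>uu\<close> only evaluates at \<open>l\<close>.\<close>

lemma H1:
  assumes p: "adm p" "lam p = 0"
  obtains tu d where "adm d" "fst d 0 = 0" "fst d l = 0" "p = cmb d tu uu" "Sb p p = Sb d d + tu^2*Sb uu uu"
proof
  define tu where "tu = fst p 0/fst uu 0"
  define d where "d = cmb p (- tu) uu"
  show ad: "adm d" unfolding d_def by (intro adm_cmb p adm_uu)
  show "fst d 0 = 0" using uu0_pos by (simp add: d_def cmb_def tu_def)
  have "lam d = 0" unfolding d_def lam_cmb using p lam_uu by simp
  with \<open>fst d 0 = 0\<close> show dl: "fst d l = 0" using ml_pos by (simp add: lam_def)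
  show pe: "p = cmb d tu uu" unfolding d_def cmb_cancel ..
  show "Sb p p = Sb d d + tu^2*Sb uu uu" unfolding pe Sb_square[OF ad adm_uu] Sb_uu[OF ad] dl by simp
qed

lemma Sb_uu_nonneg: "D0 >= 0 ==> Sb uu uu >= 0" and Sb_uu_pos: "D0 > 0 ==> Sb uu uu > 0"
  unfolding Sb_uu_uu using ml_pos ord by (auto intro!: mult_nonneg_nonneg mult_pos_pos)

lemma lam_nonneg:
  assumes "adm p" "lam p = 0" "D0 >= 0"
  shows "Sb p p >= 0"
proof -
  obtain tu d where d: "adm d" "fst d 0 = 0" "fst d l = 0" "Sb p p = Sb d d + tu^2*Sb uu uu"
    using H1[OF assms(1,2)] by metis
  then show ?thesis using HD(1)[OF d(1-3)] Sb_uu_nonneg[OF assms(3)] by simp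
qed

text \<open>For \<open>D0 >= 0\<close> the form is nonnegative on the hyperplane
  \<open>lam = 0\<close>. Some \<open>p + t*r\<close> lies in it, and the value there is
  \<open>Sb p p + t^2*Sb r r\<close> with a negative second term; equality forces
  \<open>t = 0\<close>.\<close>

lemma codim1:
  assumes D: "D0 >= 0" and r: "adm r" "Sb r r < 0" and p: "adm p" "Sb r p = 0"
  shows "0 <= Sb p p" "Sb p p <= 0 ==> lam p = 0"
proof -
  have lr: "lam r ~= 0" using lam_nonneg[OF r(1) _ D] r(2) by force
  define t where "t = - lam p/lam r"
  have "lam (cmb p t r) = 0" unfolding lam_cmb t_def using lr by simp
  then have "0 <= Sb (cmb p t r) (cmb p t r)" by (intro lam_nonneg adm_cmb p r D)
  then have *: "0 <= Sb p p + t^2*Sb r r" unfolding Sb_square[OF p(1) r(1)] p(2) by simp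
  have "t^2*Sb r r <= 0" using r(2) by (simp add: mult_le_0_iff)
  with * show "0 <= Sb p p" by linarith
  show "lam p = 0" if "Sb p p <= 0"
  proof -
    have "0 <= t^2*Sb r r" using that * by linarith
    then have "t = 0" using r(2) by (auto simp: zero_le_mult_iff)
    then show ?thesis using lr by (simp add: t_def)
  qed
qed

lemma HD_final:
  assumes "adm p" "fst p 0 = 0" "fst p l = 0" "B p = 0" "Sb p p <= 0"
  shows "EX c. ALL x:{-l..l}. fst p x = c*psi x"
proof -
  obtain c1 c2 where c: "!!x. x \<in> {0..l} ==> fst p x = c1*psi x" "!!x. x \<in> {-l..0} ==> fst p x = c2*psi x"
    using HD(2)[OF assms(1-3,5)] by blast
  have "c1 = c2" using pieces_AB(1)[OF assms(1) c] assms(4) ord by simp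
  then have "ALL x:{-l..l}. fst p x = c1*psi x" using c by (metis atLeastAtMost_iff linear)
  then show ?thesis by blast
qed

abbreviation "cz \<equiv> - 3*Y1^2 + 4*T*Y1 + 4*E*T^2"
text \<open>The combination of \<open>e1\<close> and \<open>u2\<close> with \<open>B zz = 0\<close>,
  as \<open>B e1 = T\<close>. Pairing with it gives \<open>cz*B - 4*G*A\<close>, so on the mass
  constraint it detects exactly the moment \<open>A\<close>.\<close>

definition "zz = lc (B u2) (- T)"

lemma adm_zz: "adm zz" unfolding zz_def by (rule adm_lc)

lemma cz_pos: "cz > 0"
proof -
  have "cz = T^2*(- 3 * m^2 + 4 * m + 4*E)" by (simp add: Y1m algebra_simps power2_eq_square)
  then show ?thesis using fpm T0 by simp
qed

lemma Sb_zz: assumes "adm p" shows "Sb zz p = cz*B p - 4*G*A p"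
proof -
  have "- (3*B u2 + 4*(Y1 + 4*E*T)*(- T)) = cz" unfolding B_u2 by (simp add: algebra_simps power2_eq_square)
  moreover have "4*E*B u2 + 4*J^2*(3*Y1 - 4*T)*(- T) = 4*G"
    unfolding B_u2 G_def by (simp add: algebra_simps power2_eq_square)
  ultimately show ?thesis unfolding zz_def Sb_lc[OF assms] by simp
qed

lemma B_zz: "B zz = 0" by (simp add: zz_def B_lc)

lemma A_zz: "4*J^2*A zz = Y1^3 + 4*E*T^2*Y1 - 4*J^2*T^3 + 4*Yn*G"
proof -
  have "4*J^2*A zz = B u2*(4*J^2*A e1) - T*(4*J^2*A u2)" by (simp add: zz_def A_lc algebra_simps)
  also have "... = Y1^3 + 4*E*T^2*Y1 - 4*J^2*T^3 + 4*Yn*G"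
    unfolding A_e1 B_u2 A_u2 G_def by (simp add: algebra_simps power2_eq_square power3_eq_cube)
  finally show ?thesis .
qed

lemma Gg: "G = T^2*(E * m^2 + 4*E^2 - 3*J^2 * m + 4*J^2)"
  and Dd: "D0 = T*((9*J^2 - 4*E) * m - (12*J^2 + 16*E^2))"
  by (simp_all add: G_def D0_def Y1m algebra_simps power2_eq_square)

lemma G_neg: "G < 0 ==> D0 > 0" and D_npos: "D0 <= 0 ==> G > 0"
proof -
  show "D0 > 0" if "G < 0"
    using sign_G_D(1)[OF fm fpm m0' JE] that T0 unfolding Gg Dd by (simp add: mult_less_0_iff zero_less_mult_iff)
  show "G > 0" if "D0 <= 0"
    using sign_G_D(2)[OF fm fpm m0' JE] that T0 unfolding Gg Dd by (simp add: mult_le_0_iff zero_less_mult_iff)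
qed

text \<open>For \<open>J = 0\<close> the identity \<open>A_e1\<close> reads
  \<open>m = - 4*E*n\<close>; with \<open>m*n > 1\<close> and \<open>E < 0\<close> it makes
  \<open>m^2 + 4*E\<close> positive and hence \<open>G\<close> negative.\<close>

lemma G_nonneg_J: "G >= 0 ==> J ~= 0"
proof
  assume G: "G >= 0" and J: "J = 0"
  then have E: "E < 0" using JE by simp
  have "Y1 = - 4*E*Yn" using A_e1 J by simp
  then have "m*T = - 4*E*n*T" by (simp add: Y1m Ynn)
  then have "(m + 4*E*n)*T = 0" by (simp add: algebra_simps)
  then have mm: "m = - 4*E*n" using T0 by simp
  have "m * m = - 4*E*(m*n)" using mm by (simp add: algebra_simps)
  also have "... > - 4*E*1" using mn E by (intro mult_strict_left_mono) auto
  finally have "m^2 + 4*E > 0" by (simp add: power2_eq_square)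
  moreover have "G = T^2*(E*(m^2 + 4*E))" unfolding Gg using J by (simp add: algebra_simps power2_eq_square)
  ultimately have "G < 0" using E T0 by (simp add: mult_less_0_iff)
  with G show False by simp
qed

lemma Pi_pos: "J ~= 0 ==> (m^2 + 4*E)^2 - 16*J^2*(m - 1) > 0" by (rule sign_Pi[OF fm fpm])

text \<open>After multiplication by \<open>m\<close>, the mean \<open>n\<close> enters only as
  \<open>m*n\<close> with the nonnegative factor \<open>4*g\<close>. Lowering \<open>m*n\<close> to
  1 leaves \<open>T^3\<close> times the polynomial of \<open>Pi_pos\<close>.\<close>

lemma A_zz_pos: assumes "G >= 0" shows "A zz > 0"
proof -
  have J: "J ~= 0" using G_nonneg_J[OF assms] .
  define g where "g = E * m^2 + 4*E^2 - 3*J^2 * m + 4*J^2"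
  have g0: "g >= 0" using assms T0 unfolding Gg g_def by (simp add: zero_le_mult_iff)
  have e: "m*(4*J^2*A zz) = T^3*(m^4 + 4*E * m^2 - 4*J^2 * m + 4*(m*n)*g)"
    unfolding A_zz Gg g_def by (simp add: Y1m Ynn algebra_simps power2_eq_square power3_eq_cube power4_eq_xxxx)
  have "0 < T^3*((m^2 + 4*E)^2 - 16*J^2*(m - 1))" using Pi_pos[OF J] T0 by simp
  also have "... = T^3*(m^4 + 4*E * m^2 - 4*J^2 * m + 4*1*g)"
    unfolding g_def by (simp add: algebra_simps power2_eq_square power4_eq_xxxx)
  also have "... <= T^3*(m^4 + 4*E * m^2 - 4*J^2 * m + 4*(m*n)*g)"
    using mn g0 T0 by (intro mult_left_mono add_left_mono mult_right_mono) auto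
  finally have "m*(4*J^2*A zz) > 0" unfolding e .
  then show ?thesis using m0' J by (simp add: zero_less_mult_iff)
qed

text \<open>Among functions \<open>h\<close> with integral 0 for which \<open>h/y\<close> has
  integral \<open>2*J*A\<close>, the least value of the integral of \<open>h^2/y\<close> is
  \<open>kap*A^2\<close>. This is the rank one gain from the momentum constraint.\<close>

definition "kap = 4*J^2*Y1/(Y1*Yn - T^2)"

lemma den_pos: "Y1*Yn - T^2 > 0"
proof -
  have "Y1*Yn - T^2 = T^2*(m*n - 1)" by (simp add: Y1m Ynn algebra_simps power2_eq_square)
  then show ?thesis using mn T0 by simp
qed

lemma Y1_pos: "Y1 > 0" using m0' T0 by (simp add: Y1m)

lemma kap_nonneg: "kap >= 0" unfolding kap_def using den_pos Y1_pos by simp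

text \<open>Multiplying by \<open>Y1*Yn - T^2\<close> cancels the terms with \<open>Yn*G\<close> and
  leaves \<open>T^4\<close> times the polynomial of \<open>Pi_pos\<close>. The rank one gain thus
  outweighs the negative value \<open>Sb zz zz = - 4*G*A zz\<close>.\<close>

lemma kap_zz: assumes "J ~= 0" shows "kap*A zz - 4*G > 0"
proof -
  have "(Y1*Yn - T^2)*(kap*A zz - 4*G) = Y1*(4*J^2*A zz) - 4*G*(Y1*Yn - T^2)"
    unfolding kap_def using den_pos by (simp add: field_simps)
  also have "... = T^4*((m^2 + 4*E)^2 - 16*J^2*(m - 1))"
    unfolding A_zz Gg by (simp add: Y1m Ynn algebra_simps power2_eq_square power3_eq_cube power4_eq_xxxx)
  also have "... > 0" using Pi_pos[OF assms] T0 by simp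
  finally show ?thesis using den_pos by (simp add: zero_less_mult_iff)
qed

text \<open>For \<open>D0 = 0\<close> the sources of \<open>e1\<close> and \<open>u2\<close> are
  proportional, and \<open>3*T*uu\<close> becomes \<open>pp3\<close> times the combination of them
  without source; its \<open>B\<close> is known.\<close>

lemma uu_lc:
  assumes "D0 = 0"
  shows "3*T*B uu = pp3*cz"
proof -
  have e: "T*pp2 = - 2*pp3*Y1" using assms unfolding D0_def pp2_def pp3_def by (simp add: algebra_simps)
  have p1: "3*T*pp1 = 4*pp3*(Y1 + 4*E*T)"
  proof -
    have "4*pp3*(Y1 + 4*E*T) - 3*T*pp1 = 4*D0"
      unfolding D0_def pp1_def pp3_def by (simp add: algebra_simps power2_eq_square)
    then show ?thesis using assms by simp
  qed
  have pt: "3*T*fst uu x = pp3*fst (lc (4*(Y1 + 4*E*T)) (-3)) x" for x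
  proof -
    have "3*T*fst uu x = (3*T*pp1)/y x + 3*(T*pp2)*(1 + x*psi x/2) + 3*T*pp3*(psi x*Yf x - 2*y x + 4)"
      by (simp add: uu_def algebra_simps)
    also have "... = pp3*fst (lc (4*(Y1 + 4*E*T)) (-3)) x"
      unfolding e p1 by (simp add: lc_def e1_def u2_def field_simps ynz)
    finally show ?thesis .
  qed
  have "3*T*B uu = integral {-l..l} (%x. y x*(3*T*fst uu x))"
    unfolding B_def by (simp flip: integral_mult_right add: algebra_simps)
  also have "... = pp3*B (lc (4*(Y1 + 4*E*T)) (-3))"
    unfolding B_def pt by (simp flip: integral_mult_right add: algebra_simps)
  also have "B (lc (4*(Y1 + 4*E*T)) (-3)) = cz" unfolding B_lc B_u2 by (simp add: algebra_simps power2_eq_square)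
  finally show ?thesis .
qed

text \<open>Both sides express the pairing of \<open>zz\<close> with the function equal to
  \<open>psi\<close> on \<open>[0, l]\<close> and to 0 on \<open>[-l, 0]\<close>: the right side
  through the moments of that function, the left side through the jumps of its derivative at 0 and
  \<open>l\<close>.\<close>

lemma lam_zz: "lam zz = - (cz*(y2 - y1) - 4*G*(1/y1 - 1/y2))"
proof -
  have z0: "fst zz 0 = B u2/y1 - T*(2*Y1 - 4*T + 2*T*y1)"
    and zl: "fst zz l = B u2/y2 - T*(2*Y1 - 4*T + 2*T*y2)" by (auto simp: zz_def lc_def e1_def u2_def y0 psi_def y'0)
  have "y1*y2*lam zz = m0*(y2*(B u2 - T*(2*Y1 - 4*T + 2*T*y1)*y1))
      + ml*(y1*(B u2 - T*(2*Y1 - 4*T + 2*T*y2)*y2))" unfolding lam_def z0 zl using ord by (simp add: field_simps)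
  also have "... = y1*y2*(- (cz*(y2 - y1) - 4*G*(1/y1 - 1/y2)))"
  proof -
    have r: "y1*y2*(- (cz*(y2 - y1) - 4*G*(1/y1 - 1/y2))) = - (cz*(y2 - y1)*(y1*y2) - 4*G*(y2 - y1))"
      using ord by (simp add: field_simps)
    show ?thesis unfolding r B_u2 G_def m0_def ml_def unfolding Esub Jsub
      using ord by (simp add: y3sub field_simps power2_eq_square)
  qed
  finally show ?thesis by (subst (asm) mult_left_cancel) (use ord in auto)
qed

text \<open>Pairing with \<open>e1\<close> or \<open>u2\<close> gives 0 on the space
  \<open>A = B = 0\<close>, so negative directions in their span are orthogonal to it and can be
  split off. For \<open>D0 < 0\<close> the whole span is negative definite and fills the codimension
  two of \<open>HD\<close>; for \<open>D0 >= 0\<close> one negative direction suffices by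
  \<open>codim1\<close>.\<close>

lemma AB0:
  assumes G: "G >= 0" and d: "adm d" "A d = 0" "B d = 0"
  shows "0 <= Sb d d" "Sb d d <= 0 ==> EX c. ALL x:{-l..l}. fst d x = c*psi x"
proof -
  have J: "J ~= 0" using G_nonneg_J[OF G] .
  have Az: "A zz > 0" using A_zz_pos[OF G] .
  have lc0: "Sb (lc al be) d = 0" for al be unfolding Sb_lc[OF d(1)] using d by simp
  have "0 <= Sb d d & (Sb d d <= 0 --> (EX c. ALL x:{-l..l}. fst d x = c*psi x))"
  proof (cases "D0 < 0")
    case True
    then have Gp: "G > 0" using D_npos by simp
    define P Q R where "P = Sb e1 e1" and "Q = Sb e1 u2" and "R = Sb u2 u2"
    have Q1: "Q = - 3*B u2 - 4*E*A u2" unfolding Q_def by (rule Sb_e1[OF adm_u2])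
    have Q2: "Q = - 4*(Y1 + 4*E*T)*T - 4*J^2*(3*Y1 - 4*T)*A e1"
      unfolding Q_def Sb_sym[of e1 u2] using Sb_u2[OF adm_e1] B_e1 by simp
    \<comment> \<open>The Gram matrix is the matrix of sources times the matrix of moments, with
      determinants \<open>4*D0\<close> and \<open>- A zz\<close>.\<close>
    have "P * R - Q*Q = - 4*D0*A zz"
    proof -
      have "P * R - Q*Q = (- 3*T - 4*E*A e1)*(- 4*(Y1 + 4*E*T)*B u2 - 4*J^2*(3*Y1 - 4*T)*A u2)
         - (- 3*B u2 - 4*E*A u2)*(- 4*(Y1 + 4*E*T)*T - 4*J^2*(3*Y1 - 4*T)*A e1)"
        using Q1 Q2 Sb_e1[OF adm_e1] Sb_u2[OF adm_u2] B_e1 unfolding P_def R_def by metis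
      also have "... = - 4*D0*A zz" unfolding zz_def A_lc D0_def by (simp add: algebra_simps power2_eq_square)
      finally show ?thesis .
    qed
    moreover have "- 4*D0*A zz > 0" using True Az by (simp add: mult_less_0_iff)
    ultimately have det: "P * R - Q^2 > 0" by (simp add: power2_eq_square)
    have form: "Sb (lc al be) (lc al be) = P*al^2 + 2*Q*al*be + R*be^2" for al be
    proof -
      have z: "Sb (%x. 0, %x. 0) p = 0" "Sb p (%x. 0, %x. 0) = 0" for p by (auto simp: Sb_def)
      show ?thesis unfolding lc_cmb P_def Q_def R_def
        by (simp add: Sb_cmb_left Sb_cmb_right adm_cmb adm_0 adm_e1 adm_u2 z Sb_sym[of u2 e1] power2_eq_square algebra_simps)
    qed
    have "Sb zz zz < 0" unfolding Sb_zz[OF adm_zz] B_zz using Gp Az by simp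
    then have neg: "Sb (lc al be) (lc al be) < 0" if "al ~= 0 | be ~= 0" for al be
      unfolding zz_def form by (rule binary_form_neg[OF det _ that])
    define Del where "Del = fst e1 0*fst u2 l - fst e1 l*fst u2 0"
    have e10: "fst e1 0 ~= 0" using ord by (simp add: e1_def y0)
    have "Del ~= 0"
    proof
      assume "Del = 0"
      then have "fst (lc (fst u2 0) (- fst e1 0)) 0 = 0" "fst (lc (fst u2 0) (- fst e1 0)) l = 0"
        by (auto simp: lc_def Del_def algebra_simps)
      from HD(1)[OF adm_lc this] neg[of "fst u2 0" "- fst e1 0"] e10 show False by simp
    qed
    \<comment> \<open>Cramer's rule for the combination of \<open>e1\<close> and \<open>u2\<close>
      that has the values of \<open>d\<close> at 0 and \<open>l\<close>; \<open>Del\<close> is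
      nonzero because a combination vanishing at both points would have a nonnegative form.\<close>
    define al where "al = (fst d 0*fst u2 l - fst d l*fst u2 0)/Del"
    define be where "be = (fst e1 0*fst d l - fst e1 l*fst d 0)/Del"
    define r where "r = cmb d (-1) (lc al be)"
    have ar: "adm r" unfolding r_def by (intro adm_cmb d adm_lc)
    have "Del*fst r 0 = Del*fst d 0 - (Del*al)*fst e1 0 - (Del*be)*fst u2 0"
      by (simp add: r_def cmb_def lc_def algebra_simps)
    also have "... = 0" using \<open>Del \<noteq> 0\<close> by (simp add: al_def be_def) (simp add: Del_def algebra_simps)
    finally have r0: "fst r 0 = 0" using \<open>Del \<noteq> 0\<close> by simp
    have "Del*fst r l = Del*fst d l - (Del*al)*fst e1 l - (Del*be)*fst u2 l"
      by (simp add: r_def cmb_def lc_def algebra_simps)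
    also have "... = 0" using \<open>Del \<noteq> 0\<close> by (simp add: al_def be_def) (simp add: Del_def algebra_simps)
    finally have rl: "fst r l = 0" using \<open>Del \<noteq> 0\<close> by simp
    have Sr: "Sb r r = Sb d d + Sb (lc al be) (lc al be)" unfolding r_def Sb_square[OF d(1) adm_lc] lc0 by simp
    have ge: "0 <= Sb r r" by (rule HD(1)[OF ar r0 rl])
    have nonneg: "0 <= Sb d d" using Sr ge neg[of al be] by (cases "al = 0 & be = 0") (auto simp: form)
    have "EX c. ALL x:{-l..l}. fst d x = c*psi x" if le: "Sb d d <= 0"
    proof -
      have "al = 0 & be = 0" using Sr ge neg[of al be] le by force
      then have "r = d" by (simp add: r_def cmb_def lc_def)
      then show ?thesis using HD_final[OF d(1) _ _ d(3) le] r0 rl by simp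
    qed
    with nonneg show ?thesis by simp
  next
    case False
    then have D: "D0 >= 0" by simp
    obtain al be where neg: "Sb (lc al be) (lc al be) < 0"
    proof (cases "G > 0")
      case True
      have "Sb zz zz < 0" unfolding Sb_zz[OF adm_zz] B_zz using True Az by simp
      then show ?thesis using that unfolding zz_def by blast
    next
      case False
      then have G0: "G = 0" using G by simp
      \<comment> \<open>For \<open>G = 0\<close> the vector \<open>zz\<close> is isotropic but pairs
        with \<open>e1\<close> to \<open>cz*T > 0\<close>, so the form is affine along
        \<open>e1 + s*zz\<close>; this \<open>s\<close> gives the value -1.\<close>
      define s where "s = - (Sb e1 e1 + 1)/(2*(cz*T))"
      have "Sb (cmb e1 s zz) (cmb e1 s zz) = Sb e1 e1 + 2 * s*(cz*T)"
        unfolding Sb_square[OF adm_e1 adm_zz] Sb_zz[OF adm_e1] Sb_zz[OF adm_zz] B_zz G0 B_e1 by simp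
      also have "... = -1"
      proof -
        have "a + 2*(- (a + 1)/(2*w))*w = -1" if "w ~= 0" for a w :: real using that by (simp add: field_simps)
        from this[of "cz*T" "Sb e1 e1"] show ?thesis using cz_pos T0 unfolding s_def by simp
      qed
      finally have "Sb (cmb e1 s zz) (cmb e1 s zz) < 0" by simp
      moreover have "cmb e1 s zz = lc (1 + s*B u2) (- s*T)"
        by (simp add: cmb_def zz_def lc_def fun_eq_iff algebra_simps)
      ultimately show ?thesis using that by metis
    qed
    note C = codim1[OF D adm_lc neg d(1) lc0]
    have "EX c. ALL x:{-l..l}. fst d x = c*psi x" if le: "Sb d d <= 0"
    proof -
      obtain tu e where e: "adm e" "fst e 0 = 0" "fst e l = 0" "d = cmb e tu uu" "Sb d d = Sb e e + tu^2*Sb uu uu"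
        using H1[OF d(1) C(2)[OF le]] by metis
      have ee: "0 <= Sb e e" by (rule HD(1)[OF e(1-3)])
      have "tu = 0"
      proof (cases "D0 = 0")
        case False
        then have "Sb uu uu > 0" using D Sb_uu_pos by simp
        moreover have "tu^2*Sb uu uu <= 0" using e(5) le ee by linarith
        ultimately show ?thesis by (auto simp: mult_le_0_iff)
      next
        case True
        then have Gp: "G > 0" using D_npos by simp
        \<comment> \<open>With \<open>D0 = 0\<close> the function \<open>uu\<close> lies in the
          kernel of \<open>Sb\<close>, so the form gives no information on \<open>tu\<close>.
          Pairing with \<open>zz\<close> shows that \<open>e\<close> is one multiple of
          \<open>psi\<close> on both halves; then \<open>B e = 0\<close>, and \<open>B uu\<close>
          being nonzero forces \<open>tu = 0\<close>.\<close>
        have "Sb e e <= 0" using e(5) le Sb_uu_uu True by simp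
        then obtain c1 c2 where c: "!!x. x \<in> {0..l} ==> fst e x = c1*psi x" "!!x. x \<in> {-l..0} ==> fst e x = c2*psi x"
          using HD(2)[OF e(1-3)] by blast
        have AB: "B e = (c1 - c2)*(y2 - y1)" "A e = (c1 - c2)*(1/y1 - 1/y2)" using pieces_AB[OF e(1) c] by blast+
        have AB': "A e + tu*A uu = 0" "B e + tu*B uu = 0"
          using d(2,3) unfolding e(4) A_cmb[OF e(1) adm_uu] B_cmb[OF e(1) adm_uu] by auto
        have "cz*B uu - 4*G*A uu = 0" using Sb_zz[OF adm_uu] Sb_uu[OF adm_zz] True unfolding Sb_sym[of zz uu] by simp
        then have "cz*B e - 4*G*A e = 0" using AB' by algebra
        moreover have "s*(u * v - w*Z) = u*(s * v) - w*(s*Z)" for s u v w Z :: real by (simp add: algebra_simps)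
        ultimately have "(c1 - c2)*(cz*(y2 - y1) - 4*G*(1/y1 - 1/y2)) = 0" unfolding AB by metis
        then have "(c1 - c2)*lam zz = 0" unfolding lam_zz by (simp only: mult_minus_right neg_equal_0_iff_equal)
        moreover have "lam zz ~= 0"
        proof
          assume "lam zz = 0"
          then have "Sb zz zz >= 0" by (intro lam_nonneg adm_zz D)
          moreover have "Sb zz zz < 0" unfolding Sb_zz[OF adm_zz] B_zz using Gp Az by simp
          ultimately show False by simp
        qed
        ultimately have "c1 = c2" by simp
        then have tB: "tu*B uu = 0" using AB' AB by simp
        have "pp3 ~= 0"
        proof
          assume "pp3 = 0"
          then have "(12*J^2 + 16*E^2)*T = 0" using True unfolding D0_def pp3_def by simp
          moreover have "12*J^2 + 16*E^2 > 0" using J by (intro add_pos_nonneg) auto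
          ultimately show False using T0 by simp
        qed
        then have "B uu ~= 0" using uu_lc[OF True] cz_pos by auto
        with tB show ?thesis by simp
      qed
      then have "d = e" using e(4) by (simp add: cmb_def)
      then show ?thesis using HD_final[OF d(1) _ _ d(3) le] e by simp
    qed
    with C(1) show ?thesis by simp
  qed
  then show "0 <= Sb d d" "Sb d d <= 0 ==> EX c. ALL x:{-l..l}. fst d x = c*psi x" by auto
qed

text \<open>For \<open>G < 0\<close> the mass constraint is itself orthogonality to a negative
  vector, so \<open>codim1\<close> applies. For \<open>G >= 0\<close> the multiple of
  \<open>zz\<close> with the same \<open>A\<close> is split off: what remains satisfies
  \<open>A = B = 0\<close>, and the removed part has a positive value by
  \<open>kap_zz\<close>.\<close>

theorem scalar_pos:
  assumes p: "adm p" "B p = 0"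
  shows "0 <= Sb p p + kap*(A p)^2"
    "Sb p p + kap*(A p)^2 <= 0 ==> EX c. ALL x:{-l..l}. fst p x = c*psi x"
proof -
  have "0 <= Sb p p + kap*(A p)^2 & (Sb p p + kap*(A p)^2 <= 0 --> (EX c. ALL x:{-l..l}. fst p x = c*psi x))"
  proof (cases "G < 0")
    case True
    then have D: "D0 > 0" by (rule G_neg)
    \<comment> \<open>The coefficients cancel the \<open>1/y\<close> part of the source, so that
      pairing with \<open>w\<close> is a multiple of \<open>B\<close> alone.\<close>
    define w where "w = lc (J^2*(3*Y1 - 4*T)) (- E)"
    have w: "Sb w r = - D0*B r" if "adm r" for r
      unfolding w_def Sb_lc[OF that] D0_def by (simp add: algebra_simps power2_eq_square)
    have aw: "adm w" unfolding w_def by (rule adm_lc)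
    have "B w = - G" unfolding w_def B_lc B_u2 G_def by (simp add: algebra_simps power2_eq_square)
    then have "Sb w w < 0" using w[OF aw] True D by (simp add: mult_less_0_iff)
    note C = codim1[OF less_imp_le[OF D] aw this p(1)]
    have wp: "Sb w p = 0" using w[OF p(1)] p(2) by simp
    have k: "0 <= kap*(A p)^2" using kap_nonneg by simp
    have "EX c. ALL x:{-l..l}. fst p x = c*psi x" if "Sb p p + kap*(A p)^2 <= 0"
    proof -
      have le: "Sb p p <= 0" using that k by linarith
      obtain tu e where e: "adm e" "fst e 0 = 0" "fst e l = 0" "p = cmb e tu uu" "Sb p p = Sb e e + tu^2*Sb uu uu"
        using H1[OF p(1) C(2)[OF wp le]] by metis
      have ee: "0 <= Sb e e" by (rule HD(1)[OF e(1-3)])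
      have "tu^2*Sb uu uu <= 0" using e(5) le ee by linarith
      then have "tu = 0" using Sb_uu_pos[OF D] by (auto simp: mult_le_0_iff)
      then have "p = e" using e(4) by (simp add: cmb_def)
      then show ?thesis using HD_final[OF p(1) _ _ p(2) le] e by simp
    qed
    with C(1)[OF wp] k show ?thesis by simp
  next
    case False
    then have G: "G >= 0" by simp
    have J: "J ~= 0" using G_nonneg_J[OF G] .
    have Az: "A zz > 0" using A_zz_pos[OF G] .
    define s where "s = A p/A zz"
    define d where "d = cmb p (- s) zz"
    have ad: "adm d" unfolding d_def by (intro adm_cmb p adm_zz)
    have Ad: "A d = 0" and Bd: "B d = 0"
      unfolding d_def using A_cmb[OF p(1) adm_zz, of "-s"] B_cmb[OF p(1) adm_zz, of "-s"] p(2) Az B_zz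
      by (auto simp: s_def)
    have pe: "p = cmb d s zz" unfolding d_def cmb_cancel ..
    have Ap: "A p = s*A zz" using Az by (simp add: s_def)
    have "Sb p p = Sb d d + s^2*(- 4*G*A zz)"
      unfolding pe Sb_square[OF ad adm_zz] Sb_zz[OF ad] Sb_zz[OF adm_zz] Ad Bd B_zz by simp
    then have tot: "Sb p p + kap*(A p)^2 = Sb d d + s^2*(A zz*(kap*A zz - 4*G))"
      unfolding Ap by (simp add: power2_eq_square algebra_simps)
    have pos: "A zz*(kap*A zz - 4*G) > 0" using Az kap_zz[OF J] by simp
    have nn: "0 <= s^2*(A zz*(kap*A zz - 4*G))" by (rule mult_nonneg_nonneg[OF zero_le_power2 less_imp_le[OF pos]])
    note D = AB0[OF G ad Ad Bd]
    have "EX c. ALL x:{-l..l}. fst p x = c*psi x" if "Sb p p + kap*(A p)^2 <= 0"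
    proof -
      have "s^2*(A zz*(kap*A zz - 4*G)) <= 0" and le: "Sb d d <= 0" using that tot D(1) nn by linarith+
      then have "s = 0" using pos by (simp add: mult_le_0_iff[of "s^2"] del: mult_le_0_iff zero_less_mult_iff) 
      then have "p = d" using pe by (simp add: cmb_def)
      then show ?thesis using D(2)[OF le] by simp
    qed
    with tot nn D(1) show ?thesis by simp
  qed
  then show "0 <= Sb p p + kap*(A p)^2"
    "Sb p p + kap*(A p)^2 <= 0 ==> EX c. ALL x:{-l..l}. fst p x = c*psi x" by auto
qed

end

context orbit
begin

text \<open>Completing the square in \<open>gg = 2*J*a + y*gb\<close> separates the scalar form from
  the integral of \<open>gg^2/y\<close>. The constraint gives \<open>gg\<close> the integral 0, and
  periodicity of \<open>b\<close> gives \<open>gg/y\<close> the integral \<open>2*J*A\<close>, which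
  bounds that integral below by \<open>kap*A^2\<close>.\<close>

theorem pair_pos:
  assumes a: "adm (a, ga)" and b: "acd (-l) l b gb" "b (-l) = b l"
    and c1: "integral {-l..l} (%x. y x*a x) = 0"
    and c2: "integral {-l..l} (%x. 2*J*a x + y x*gb x) = 0"
  defines "F \<equiv> integral {-l..l} (%x. y x*(ga x)^2 + y x*(gb x)^2 + 4*J*a x*gb x - 2*(y x)^2*(a x)^2)"
  shows "0 <= F" "F <= 0 ==> EX c d. ALL x:{-l..l}. a x = c*psi x & b x = 2*J*c/y x + d"
proof -
  define p where "p = (a, ga)"
  have ap: "adm p" and Bp: "B p = 0" using a c1 by (auto simp: p_def B_def)
  have ca: "continuous_on {-l..l} a" using adm_cont[OF ap] by (simp add: p_def)
  have sgb: "sqint (-l) l gb" by (rule acd_sqint[OF b(1)])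
  define gg where "gg x = 2*J*a x + y x*gb x" for x
  have sgg: "sqint (-l) l gg"
    unfolding gg_def by (intro sqint_add sqint_continuous sqint_mult_bounded sgb continuous_intros ca cy)
  have ciy: "continuous_on {-l..l} (%x. 1/y x)" by (intro continuous_intros cy) (simp add: ynz)
  have i1: "(%x. gg x*gg x/y x) integrable_on {-l..l}"
    using sqint_times_integrable[OF sqint_mult_bounded[OF ciy sgg] sgg] by simp
  have i2: "(%x. gg x/y x) integrable_on {-l..l}" using sqint_int[OF sqint_mult_bounded[OF ciy sgg]] by simp
  have h1: "(gg has_integral 0) {-l..l}"
  proof -
    have "gg = (%x. 2*J*a x + y x*gb x)" by (auto simp: gg_def)
    then have "integral {-l..l} gg = 0" using c2 by simp
    then show ?thesis using integrable_integral[OF sqint_int[OF sgg]] by simp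
  qed
  have igb: "integral {-l..l} gb = 0" using acd_eq[OF b(1), of "-l" l] b(2) l by simp
  have h2: "((%x. gg x/y x) has_integral 2*J*A p) {-l..l}"
  proof -
    have "((%x. 2*J*(a x/y x) + gb x) has_integral 2*J*A p + 0) {-l..l}"
      using integrable_integral[OF A_integrable[OF ap]] integrable_integral[OF sqint_int[OF sgb]] igb
      by (intro has_integral_add has_integral_mult_right) (auto simp: A_def p_def)
    moreover have "(%x. 2*J*(a x/y x) + gb x) = (%x. gg x/y x)" using ynz by (auto simp: gg_def field_simps)
    ultimately show ?thesis by simp
  qed
  define I where "I = integral {-l..l} (%x. gg x*gg x/y x)"
  have hI: "((%x. gg x*gg x/y x) has_integral I) {-l..l}" unfolding I_def by (rule integrable_integral[OF i1])
  have FI: "F = Sb p p + I"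
  proof -
    have "F = integral {-l..l} (%x. (y x*(snd p x * snd p x) - V x*(fst p x*fst p x)) + gg x*gg x/y x)"
      unfolding F_def
      by (rule arg_cong[of _ _ "integral _"]) (auto simp: p_def V_def gg_def field_simps power2_eq_square ynz fun_eq_iff)
    also have "... = Sb p p + I" unfolding Sb_def I_def by (rule integral_add[OF Sb_integrable[OF ap ap] i1])
    finally show ?thesis .
  qed
  have Ige: "kap*(A p)^2 <= I"
  proof -
    \<comment> \<open>The integral of \<open>(gg - al*y - be)^2/y\<close>; the minimisers of the
      quadratic problem are of the form \<open>al*y + be\<close>, so optimising the multipliers
      gives the sharp constant.\<close>
    have low: "0 <= I - 2*be*(2*J*A p) + (al^2*Y1 + 2*al*be*T + be^2*Yn)" for al be
    proof -
      have "((%x. gg x*gg x/y x - 2*al*gg x - 2*be*(gg x/y x) + (al^2*y x + 2*al*be + be^2*(1/y x)))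
        has_integral I - 2*al*0 - 2*be*(2*J*A p) + (al^2*Y1 + T*(2*al*be) + be^2*Yn)) {-l..l}"
        by (intro has_integral_add has_integral_diff has_integral_mult_right hI h1 h2 hY hYn hc)
      moreover have "gg x*gg x/y x - 2*al*gg x - 2*be*(gg x/y x) + (al^2*y x + 2*al*be + be^2*(1/y x)) >= 0" for x
      proof -
        have "gg x*gg x/y x - 2*al*gg x - 2*be*(gg x/y x) + (al^2*y x + 2*al*be + be^2*(1/y x))
           = (gg x - al*y x - be)^2/y x" using ynz[of x] by (simp add: field_simps power2_eq_square)
        then show ?thesis using ypos[of x] by simp
      qed
      ultimately have "0 <= I - 2*al*0 - 2*be*(2*J*A p) + (al^2*Y1 + T*(2*al*be) + be^2*Yn)"
        using has_integral_nonneg by blast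
      then show ?thesis by (simp add: algebra_simps)
    qed
    define D where "D = Y1*Yn - T^2"
    have D: "D > 0" using den_pos by (simp add: D_def)
    define be where "be = 2*J*A p*Y1/D"
    have "0 <= I - 2*be*(2*J*A p) + ((- be*T/Y1)^2*Y1 + 2*(- be*T/Y1)*be*T + be^2*Yn)" by (rule low)
    also have "(- be*T/Y1)^2*Y1 + 2*(- be*T/Y1)*be*T + be^2*Yn = be^2*D/Y1"
      using Y1_pos by (simp add: D_def field_simps power2_eq_square)
    also have "I - 2*be*(2*J*A p) + be^2*D/Y1 = I - kap*(A p)^2"
    proof -
      have "kap = 4*J^2*Y1/D" by (simp add: kap_def D_def)
      then show ?thesis using Y1_pos D by (simp add: be_def field_simps power2_eq_square)
    qed
    finally show ?thesis by simp
  qed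
  show "0 <= F" using FI Ige scalar_pos(1)[OF ap Bp] by linarith
  show "EX c d. ALL x:{-l..l}. a x = c*psi x & b x = 2*J*c/y x + d" if F: "F <= 0"
  proof -
    have le: "Sb p p + kap*(A p)^2 <= 0" using FI Ige F by linarith
    obtain c where c: "!!x. x \<in> {-l..l} ==> fst p x = c*psi x" using scalar_pos(2)[OF ap Bp le] by blast
    have "A p = (c - c)*(1/y1 - 1/y2)" using l by (intro pieces_AB(2)[OF ap]) (auto intro!: c)
    then have "A p = 0" by simp
    then have I0: "I <= 0" using FI F scalar_pos(1)[OF ap Bp] by simp
    have gg0: "integral {-l..l} (%x. (gg x)^2) <= 0"
    proof -
      have "integral {-l..l} (%x. (gg x)^2) <= integral {-l..l} (%x. y2*(gg x*gg x/y x))"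
      proof (rule integral_le)
        show "(%x. (gg x)^2) integrable_on {-l..l}" using sqint_sq[OF sgg] by simp
        show "(%x. y2*(gg x*gg x/y x)) integrable_on {-l..l}" by (rule integrable_on_mult_right[OF i1])
        fix x
        have "y x*(gg x)^2 <= y2*(gg x)^2" by (intro mult_right_mono yb) auto
        then show "(gg x)^2 <= y2*(gg x*gg x/y x)" using ypos[of x] by (simp add: field_simps power2_eq_square)
      qed
      also have "... = y2*I" by (simp add: I_def integral_mult_right del: times_divide_eq_right)
      also have "... <= 0" using I0 ord by (simp add: mult_le_0_iff)
      finally show ?thesis .
    qed
    \<comment> \<open>Equality makes the square integral of \<open>gg\<close> vanish, so in
      integrals \<open>gb\<close> may be replaced by \<open>- 2*J*c*psi/y\<close>, the derivative of
      \<open>2*J*c/y\<close>.\<close>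
    have "b x = 2*J*c/y x + (b (-l) - 2*J*c/y2)" if x: "x \<in> {-l..l}" for x
    proof -
      have sub: "{-l..x} <= {-l..l}" using x by auto
      have sx: "sqint (-l) x gg" by (rule sqint_subset[OF sgg sub])
      have "integral {-l..x} (%x. (gg x)^2) <= integral {-l..l} (%x. (gg x)^2)"
        using sqint_sq[OF sgg] sqint_sq[OF sx] sub by (intro integral_subset_le) auto
      then have z: "integral {-l..x} (%x. (gg x)^2) <= 0" using gg0 by simp
      have z0: "0 <= integral {-l..x} (%x. (1/y x)^2)"
        by (intro integral_nonneg integrable_continuous_real continuous_intros cy) (auto simp: ynz)
      have "(integral {-l..x} (%x. (1/y x)*gg x))^2 <= integral {-l..x} (%x. (1/y x)^2)*integral {-l..x} (%x. (gg x)^2)"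
        by (rule Cauchy_Schwarz_integral[OF sqint_continuous[OF continuous_on_subset[OF ciy sub]] sx])
      also have "... <= 0" using z z0 by (simp add: mult_le_0_iff)
      finally have g0: "integral {-l..x} (%x. gg x/y x) = 0" by simp
      have d: "((%x. - (1/y x)) has_real_derivative psi x/y x) (at x)" for x
        by (auto intro!: derivative_eq_intros dy simp: ynz psi_def power2_eq_square)
      have ps: "integral {-l..x} (%x. 2*J*c*(psi x/y x)) = 2*J*c*(- (1/y x)) - 2*J*c*(- (1/y (-l)))"
        using x by (intro integral_FTC DERIV_cmult d) auto
      have "b x - b (-l) = integral {-l..x} gb" using acd_eq[OF b(1), of "-l" x] x by simp
      also have "... = integral {-l..x} (%x. gg x/y x - 2*J*c*(psi x/y x))"
      proof (intro Henstock_Kurzweil_Integration.integral_cong)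
        fix t assume t: "t \<in> {-l..x}"
        then have "a t = c*psi t" using c[of t] sub by (auto simp: p_def)
        then show "gb t = gg t/y t - 2*J*c*(psi t/y t)" using ynz[of t] by (simp add: gg_def field_simps)
      qed
      also have "... = integral {-l..x} (%x. gg x/y x) - integral {-l..x} (%x. 2*J*c*(psi x/y x))"
        by (intro integral_diff integrable_on_subinterval[OF i2 sub] integrable_continuous_real continuous_intros cy cpsi) (simp add: ynz)
      finally show ?thesis using g0 ps by (simp add: yml)
    qed
    then show ?thesis using c unfolding p_def fst_conv by blast
  qed
qed

end

section \<open>The real wave whose modulus has zeros\<close>

locale cnwave =
  fixes W W' :: "real => real" and E l c0 :: real
  assumes l: "l > 0" and E: "E > 0"
    and dW: "!!x. (W has_real_derivative W' x) (at x)"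
    and dW': "!!x. (W' has_real_derivative W x - (W x)^3) (at x)"
    and energy: "!!x. (W' x)^2 = 2*E + (W x)^2 - (W x)^4/2"
    and odd: "!!x. W (- x) = - W x"
    and W'l: "W' l = 0"
    and low: "c0 > 0" "!!x. -l <= x ==> x <= l ==> c0*((x + l)*(l - x)) <= W' x"
begin

lemma cW: "continuous_on S W" and cW': "continuous_on S W'"
  using dW dW' by (auto intro!: continuous_at_imp_continuous_on DERIV_isCont)

lemma W'_even: "W' (- x) = W' x"
proof -
  have "((%x. - W (- x)) has_real_derivative - (W' (- x)*(- 1))) (at x)"
    by (intro DERIV_minus DERIV_chain2[OF dW]) (auto intro!: derivative_eq_intros)
  then have "(W has_real_derivative W' (- x)) (at x)" by (simp add: odd)
  from DERIV_unique[OF this dW] show ?thesis .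
qed

lemma W'ml: "W' (-l) = 0" using W'_even[of l] W'l by simp

lemma W0: "W 0 = 0" using odd[of 0] by simp

lemma W'_pos: "-l < x ==> x < l ==> W' x > 0"
proof -
  assume "-l < x" "x < l"
  then have "0 < c0*((x + l)*(l - x))" using low(1) by simp
  also have "... <= W' x" using \<open>-l < x\<close> \<open>x < l\<close> by (intro low(2)) auto
  finally show ?thesis .
qed

lemma W_pos: "0 < x ==> x <= l ==> W x > 0" using DERIV_pos_imp_increasing_open[of 0 x W] W'_pos dW W0 l cW by force

definition "T = 2*l"
text \<open>\<open>W\<close> changes sign over a period of its modulus, whence antiperiodic
  perturbations. In \<open>Sf\<close> the value \<open>ka = 3\<close> belongs to the real part of a
  perturbation and \<open>ka = 1\<close> to the imaginary part.\<close>

definition "adm p \<longleftrightarrow> acd (-l) l (fst p) (snd p) & fst p (-l) = - fst p l"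
definition "Sf ka p r = integral {-l..l} (%x. snd p x * snd r x + (1 - ka*(W x)^2)*(fst p x*fst r x))"
definition "B p = integral {-l..l} (%x. W x*fst p x)"

lemma T0: "T > 0" using l by (simp add: T_def)

lemma adm_acd: "adm p ==> acd (-l) l (fst p) (snd p)" by (simp add: adm_def)

lemma adm_cont: "adm p ==> continuous_on {-l..l} (fst p)" using acd_continuous adm_acd by blast

lemma adm_cmb: "adm p ==> adm r ==> adm (cmb p t r)" unfolding adm_def cmb_def by (auto intro!: acd_add acd_cmult)

lemma Sf_integrable:
  assumes "adm p" "adm r"
  shows "(%x. snd p x * snd r x + (1 - ka*(W x)^2)*(fst p x*fst r x)) integrable_on {-l..l}"
  by (intro integrable_add[OF sqint_times_integrable[OF acd_sqint[OF adm_acd[OF assms(1)]] acd_sqint[OF adm_acd[OF assms(2)]]]]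
      integrable_continuous_real continuous_intros cW adm_cont assms)

lemma Sf_sym: "Sf ka p r = Sf ka r p" by (simp add: Sf_def mult.commute)

lemma Sf_cmb_left:
  assumes "adm p" "adm q" "adm r"
  shows "Sf ka (cmb p t q) r = Sf ka p r + t*Sf ka q r"
proof -
  have "Sf ka (cmb p t q) r = integral {-l..l} (%x. (snd p x * snd r x + (1 - ka*(W x)^2)*(fst p x*fst r x))
     + t*(snd q x * snd r x + (1 - ka*(W x)^2)*(fst q x*fst r x)))"
    unfolding Sf_def by (rule arg_cong[of _ _ "integral _"]) (auto simp: cmb_def fun_eq_iff algebra_simps)
  also have "... = Sf ka p r + t*Sf ka q r"
    unfolding Sf_def using Sf_integrable[OF assms(1,3)] Sf_integrable[OF assms(2,3)]
    by (subst integral_add) (auto intro!: integrable_on_mult_right)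
  finally show ?thesis .
qed

lemma Sf_square:
  assumes "adm p" "adm r"
  shows "Sf ka (cmb p t r) (cmb p t r) = Sf ka p p + 2*t*Sf ka r p + t^2*Sf ka r r"
proof -
  have "Sf ka (cmb p t r) (cmb p t r) = Sf ka p (cmb p t r) + t*Sf ka r (cmb p t r)"
    by (intro Sf_cmb_left adm_cmb assms)
  also have "Sf ka p (cmb p t r) = Sf ka p p + t*Sf ka r p"
    unfolding Sf_sym[of ka p "cmb p t r"] by (intro Sf_cmb_left assms)
  also have "Sf ka r (cmb p t r) = Sf ka r p + t*Sf ka r r"
    unfolding Sf_sym[of ka r "cmb p t r"] Sf_sym[of ka r p] by (intro Sf_cmb_left assms)
  finally show ?thesis by (simp add: algebra_simps power2_eq_square)
qed

lemma Sf_C1: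
  assumes "!!x. x \<in> {-l..l} ==> (e' has_real_derivative (1 - ka*(W x)^2)*e x - R x) (at x)"
    "continuous_on {-l..l} R" "continuous_on {-l..l} e" "adm p"
  shows "Sf ka (e, e') p = integral {-l..l} (%x. R x*fst p x) + (e' l*fst p l - e' (-l)*fst p (-l))"
proof -
  define r where "r x = R x - (1 - ka*(W x)^2)*e x" for x
  have c: "continuous_on {-l..l} r" unfolding r_def by (intro continuous_intros cW assms)
  have d: "(e' has_real_derivative - r x) (at x)" if "x \<in> {-l..l}" for x
    using assms(1)[OF that] by (simp add: r_def)
  have "acd (-l) l e' (%x. - r x)" using d c by (intro acdI_real continuous_on_minus)
  from sqint_int[OF acd_sqint[OF acd_mult[OF this adm_acd[OF assms(4)]]]]
  have i0: "(%x. e' x * snd p x - r x*fst p x) integrable_on {-l..l}" by (simp add: algebra_simps)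
  have i2: "(%x. R x*fst p x) integrable_on {-l..l}"
    by (intro integrable_continuous_real continuous_intros assms adm_cont)
  have "Sf ka (e, e') p = integral {-l..l} (%x. (e' x * snd p x - r x*fst p x) + R x*fst p x)"
    unfolding Sf_def by (rule arg_cong[of _ _ "integral _"]) (auto simp: r_def algebra_simps)
  also have "... = integral {-l..l} (%x. e' x * snd p x - r x*fst p x) + integral {-l..l} (%x. R x*fst p x)"
    by (rule integral_add[OF i0 i2])
  also have "integral {-l..l} (%x. e' x * snd p x - r x*fst p x) = e' l*fst p l - e' (-l)*fst p (-l)"
    using l by (intro acd_parts_C1[OF d c adm_acd[OF assms(4)]]) auto
  finally show ?thesis by simp
qed

text \<open>\<open>W'\<close> is positive inside the period and vanishes at its ends, so it serves
  as Jacobi field on the whole period, with the surplus \<open>(3 - ka)*(W x)^2\<close>. For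
  \<open>ka < 3\<close> this surplus excludes nonzero multiples of \<open>W'\<close> from the
  equality case.\<close>

lemma jac:
  assumes p: "adm p" "fst p l = 0" and k: "ka <= 3"
  shows "0 <= Sf ka p p"
    "Sf ka p p <= 0 ==> EX c. ALL x:{-l..l}. fst p x = c*W' x"
    "Sf ka p p <= 0 ==> ka < 3 ==> ALL x:{-l..l}. fst p x = 0"
proof -
  have pml: "fst p (-l) = 0" using p by (simp add: adm_def)
  define V where "V x = ka*(W x)^2 - 1" for x
  define U where "U x = (3 - ka)*(W x)^2" for x
  have cV: "continuous_on S V" and cU: "continuous_on S U" for S
    unfolding V_def U_def by (auto intro!: continuous_intros cW)
  have c1: "continuous_on S (%x. W x - (W x)^3)" for S by (intro continuous_intros cW)
  have U0: "0 <= U x" for x using k by (simp add: U_def)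
  have d2: "((%x. 1*(W x - (W x)^3)) has_real_derivative - (V x + U x)*W' x) (at x)" for x
    by (auto intro!: derivative_eq_intros dW simp: V_def U_def algebra_simps)
  have b: "c0*((x - (-l))*(l - x)) <= \<bar>W' x\<bar>" if "x \<in> {-l..l}" for x using low(2)[of x] that by auto
  have l': "-l < l" using l by simp
  have S: "Sf ka p p = integral {-l..l} (%x. 1*(snd p x)^2 - V x*(fst p x)^2)"
    unfolding Sf_def by (rule arg_cong[of _ _ "integral _"]) (auto simp: V_def algebra_simps power2_eq_square)
  note J = jacobi_le[OF l' adm_acd[OF p(1)] pml p(2) continuous_on_const cV cU c1 zero_le_one U0 low(1) b dW' d2, folded S]
  show I: "0 <= Sf ka p p" using J[of 0 0] l by simp
  show ex: "EX c. ALL x:{-l..l}. fst p x = c*W' x" if z: "Sf ka p p <= 0"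
  proof -
    have le: "fst p t/W' t = fst p s/W' s" if st: "-l < s" "s <= t" "t < l" for s t
    proof (rule jacobi_eq[OF acd_subset[OF adm_acd[OF p(1)]] st(2) c1 continuous_on_const cU zero_less_one U0 _ dW'])
      show "integral {s..t} (%x. 1*(snd p x - (W x - (W x)^3)/W' x*fst p x)^2 + U x*(fst p x)^2) <= 0"
        using J[OF _ st] z by simp
    qed (use st W'_pos in \<open>auto simp: less_le\<close>)
    have "fst p x = fst p 0/W' 0*W' x" if x: "x \<in> {-l..l}" for x
    proof -
      consider "x = -l" | "x = l" | "-l < x" "x <= 0" | "0 <= x" "x < l" using x by fastforce
      then show ?thesis
      proof cases
        case 3
        then have "fst p x/W' x = fst p 0/W' 0" using le[of x 0] l by simp
        then show ?thesis using W'_pos[of x] 3 l by (simp add: divide_eq_eq)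
      next
        case 4
        then have "fst p x/W' x = fst p 0/W' 0" using le[of 0 x] l by simp
        then show ?thesis using W'_pos[of x] 4 l by (simp add: divide_eq_eq)
      qed (use p pml W'l W'ml in auto)
    qed
    then show ?thesis by blast
  qed
  show "ALL x:{-l..l}. fst p x = 0" if z: "Sf ka p p <= 0" and k3: "ka < 3"
  proof -
    obtain c where c: "!!x. x \<in> {-l..l} ==> fst p x = c*W' x" using ex[OF z] by blast
    have "c = 0"
    proof (rule ccontr)
      assume "c ~= 0"
      define h where "h = l/2"
      have h: "0 < h" "h < l" using l by (auto simp: h_def)
      have i2: "(%x. U x*(fst p x)^2) integrable_on {-h..h}"
        by (intro integrable_continuous_real continuous_intros cU continuous_on_subset[OF adm_cont[OF p(1)]]) (use h in auto)
      have "integral {-h..h} (%x. U x*(fst p x)^2) > 0"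
      proof (rule integral_continuous_pos[where c=h])
        have "fst p h = c*W' h" using h by (intro c) auto
        then have "fst p h ~= 0" using \<open>c \<noteq> 0\<close> W'_pos[of h] h by simp
        moreover have "W h > 0" using W_pos h by simp
        ultimately show "U h*(fst p h)^2 > 0" using k3 by (simp add: U_def)
      qed (use h U0 in \<open>auto intro!: continuous_intros cU continuous_on_subset[OF adm_cont[OF p(1)]]\<close>)
      also have "integral {-h..h} (%x. U x*(fst p x)^2) <=
         integral {-h..h} (%x. 1*(snd p x - (W x - (W x)^3)/W' x*fst p x)^2 + U x*(fst p x)^2)"
      proof (rule integral_le[OF i2])
        show "(%x. 1*(snd p x - (W x - (W x)^3)/W' x*fst p x)^2 + U x*(fst p x)^2) integrable_on {-h..h}"
          by (rule jacobi_identity(1)[OF _ acd_subset[OF adm_acd[OF p(1)]] continuous_on_const cV cU c1 _ dW' d2])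
            (use h W'_pos in \<open>auto simp: less_le\<close>)
      qed auto
      also have "... <= Sf ka p p" using h by (intro J) auto
      finally show False using z by simp
    qed
    then show ?thesis using c by auto
  qed
qed

lemma adm_W: "adm (W, W')" unfolding adm_def using odd by (auto intro!: acdI_real dW cW')

lemma Sf1_W: assumes "adm p" shows "Sf 1 (W, W') p = 0"
proof -
  have "Sf 1 (W, W') p = integral {-l..l} (%x. 0*fst p x) + (W' l*fst p l - W' (-l)*fst p (-l))"
  proof (rule Sf_C1)
    show "(W' has_real_derivative (1 - 1*(W x)^2)*W x - 0) (at x)" for x
      using dW'[of x] by (simp add: algebra_simps power2_eq_square power3_eq_cube)
  qed (auto intro: cW assms)
  then show ?thesis by (simp add: W'l W'ml)
qed

lemma Wl: "W l > 0" using W_pos l by simp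

text \<open>\<open>W\<close> lies in the kernel for \<open>ka = 1\<close> and is nonzero at
  \<open>l\<close>, so subtracting a multiple of it reaches the boundary condition of
  \<open>jac\<close> without changing the form.\<close>

lemma minus_pos:
  assumes p: "adm p"
  shows "0 <= Sf 1 p p" "Sf 1 p p <= 0 ==> EX c. ALL x:{-l..l}. fst p x = c*W x"
proof -
  define t where "t = fst p l/W l"
  define d where "d = cmb p (- t) (W, W')"
  have ad: "adm d" unfolding d_def by (intro adm_cmb p adm_W)
  have dl: "fst d l = 0" using Wl by (simp add: d_def cmb_def t_def)
  have "Sf 1 d d = Sf 1 p p" unfolding d_def Sf_square[OF p adm_W] Sf1_W[OF p] Sf1_W[OF adm_W] by simp
  then show "0 <= Sf 1 p p" "Sf 1 p p <= 0 ==> EX c. ALL x:{-l..l}. fst p x = c*W x"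
    using jac(1)[OF ad dl, of 1] jac(3)[OF ad dl, of 1] by (auto simp: d_def cmb_def intro!: exI[of _ t])
qed

definition "Y1 = integral {-l..l} (%x. (W x)^2)"
definition "Y4 = integral {-l..l} (%x. (W x)^4)"
definition "Yf x = integral {-l-1..x} (%x. (W x)^2) - integral {-l-1..0} (%x. (W x)^2)"
text \<open>\<open>W\<close> times the function \<open>u2\<close> of the case without zeros, with
  \<open>y = W^2\<close>; the product is regular at the zeros of \<open>W\<close>.\<close>

definition "zz = (%x. (2*Y1 - 4*T)*W x + 2*T*(W x)^3 + 2*W' x*(Y1*x - T*Yf x),
   %x. (2*Y1 - 4*T)*W' x + 6*T*(W x)^2*W' x + 2*(W x - (W x)^3)*(Y1*x - T*Yf x)
     + 2*W' x*(Y1 - T*(W x)^2))"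

lemma cW2: "continuous_on S (%x. (W x)^2)" by (intro continuous_intros cW)

lemma W2int: "(%x. (W x)^2) integrable_on {a..b}" by (intro integrable_continuous_real cW2)

lemma dYf:
  assumes "x > -l-1" shows "(Yf has_real_derivative (W x)^2) (at x)"
proof -
  have "((%t. integral {-l-1..t} (%x. (W x)^2)) has_real_derivative (W x)^2) (at x within {-l-1..x+1})"
    using assms by (intro integral_has_real_derivative cW2) auto
  moreover have "(at x within {-l-1..x+1}) = at x" using assms by (intro at_within_interior) auto
  ultimately have "((%t. integral {-l-1..t} (%x. (W x)^2)) has_real_derivative (W x)^2) (at x)" by simp
  from DERIV_diff[OF this DERIV_const] show ?thesis unfolding Yf_def by simp
qed

lemma cYf: "continuous_on {-l..l} Yf"
  using dYf by (intro continuous_at_imp_continuous_on ballI) (force intro: DERIV_isCont)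

lemma half: "integral {-l..0} (%x. (W x)^2) = integral {0..l} (%x. (W x)^2)"
proof -
  have "integral {-l..-0} (%x. (W (- x))^2) = integral {0..l} (%x. (W x)^2)"
    by (rule Henstock_Kurzweil_Integration.integral_reflect_real)
  then show ?thesis by (simp add: odd)
qed

lemma Y1_half: "integral {0..l} (%x. (W x)^2) = Y1/2"
proof -
  have "integral {-l..0} (%x. (W x)^2) + integral {0..l} (%x. (W x)^2) = Y1"
    unfolding Y1_def using l by (intro Henstock_Kurzweil_Integration.integral_combine W2int) auto
  then show ?thesis using half by simp
qed

lemma Yfl: "Yf l = Y1/2" and Yfml: "Yf (-l) = - Y1/2"
proof -
  have "integral {-l-1..0} (%x. (W x)^2) + integral {0..l} (%x. (W x)^2) = integral {-l-1..l} (%x. (W x)^2)"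
    using l by (intro Henstock_Kurzweil_Integration.integral_combine W2int) auto
  then show "Yf l = Y1/2" using Y1_half by (simp add: Yf_def)
  have "integral {-l-1..-l} (%x. (W x)^2) + integral {-l..0} (%x. (W x)^2) = integral {-l-1..0} (%x. (W x)^2)"
    using l by (intro Henstock_Kurzweil_Integration.integral_combine W2int) auto
  then show "Yf (-l) = - Y1/2" using Y1_half half by (simp add: Yf_def)
qed

lemma adm_zz: "adm zz"
proof -
  have "acd (-l) l (fst zz) (snd zz)"
  proof (rule acdI_real)
    show "(fst zz has_real_derivative snd zz x) (at x)" if "x \<in> {-l..l}" for x
      unfolding zz_def fst_conv snd_conv using that
      by (auto intro!: derivative_eq_intros dW dW' dYf simp: algebra_simps)
    show "continuous_on {-l..l} (snd zz)" unfolding zz_def snd_conv by (intro continuous_intros cW cW' cYf)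
  qed
  then show ?thesis using odd[of l] by (simp add: adm_def zz_def W'l W'ml)
qed

lemma Sf3_zz: assumes "adm p" shows "Sf 3 zz p = - 4*(Y1 + 4*E*T)*B p"
proof -
  define R where "R x = - 4*(Y1 + 4*E*T)*W x" for x
  have "Sf 3 (fst zz, snd zz) p = integral {-l..l} (%x. R x*fst p x) + (snd zz l*fst p l - snd zz (-l)*fst p (-l))"
  proof (rule Sf_C1)
    fix x assume x: "x \<in> {-l..l}"
    let ?D = "(2*Y1 - 4*T)*(W x - (W x)^3) + 12*T*W x*(W' x)^2 + 6*T*(W x)^2*(W x - (W x)^3)
       + 2*(W' x - 3*(W x)^2*W' x)*(Y1*x - T*Yf x) + 2*(W x - (W x)^3)*(Y1 - T*(W x)^2)
       + 2*(W x - (W x)^3)*(Y1 - T*(W x)^2) - 4*T*W x*(W' x)^2"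
    have "(snd zz has_real_derivative ?D) (at x)" unfolding zz_def snd_conv using x
      by (auto intro!: derivative_eq_intros dW dW' dYf simp: algebra_simps power2_eq_square)
    moreover have "?D = (1 - 3*(W x)^2)*fst zz x - R x"
      unfolding energy by (simp add: zz_def R_def field_simps power2_eq_square power3_eq_cube power4_eq_xxxx)
    ultimately show "(snd zz has_real_derivative (1 - 3*(W x)^2)*fst zz x - R x) (at x)" by simp
  qed (auto simp: R_def intro!: continuous_intros cW adm_cont[OF adm_zz] assms)
  moreover have "snd zz l = 0" "snd zz (-l) = 0" by (simp_all add: zz_def W'l W'ml Yfl Yfml T_def)
  moreover have "integral {-l..l} (%x. R x*fst p x) = - 4*(Y1 + 4*E*T)*B p" unfolding R_def B_def mult.assoc by simp
  ultimately show ?thesis by simp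
qed

lemma Y4_eq: "3*Y4 = 4*Y1 + 4*E*T"
proof -
  have "integral {-l..l} (%x. - 3*(W x)^4 + 4*(W x)^2 + 4*E) = 2*W l*W' l - 2*W (-l)*W' (-l)"
  proof (rule integral_FTC)
    fix x
    have "((%x. 2*W x*W' x) has_real_derivative 2*(W' x)^2 + 2*W x*(W x - (W x)^3)) (at x)"
      by (auto intro!: derivative_eq_intros dW dW' simp: power2_eq_square)
    moreover have "2*(W' x)^2 + 2*W x*(W x - (W x)^3) = - 3*(W x)^4 + 4*(W x)^2 + 4*E"
      unfolding energy by (simp add: algebra_simps power2_eq_square power3_eq_cube power4_eq_xxxx)
    ultimately show "((%x. 2*W x*W' x) has_real_derivative - 3*(W x)^4 + 4*(W x)^2 + 4*E) (at x)" by simp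
  qed (use l in auto)
  moreover have "((%x. - 3*(W x)^4 + 4*(W x)^2 + 4*E) has_integral - 3*Y4 + 4*Y1 + (l - (-l)) *\<^sub>R (4*E)) {-l..l}"
    unfolding Y1_def Y4_def using l has_integral_const_real[of "4*E" "-l" l]
    by (intro has_integral_add has_integral_mult_right integrable_integral W2int integrable_continuous_real continuous_intros cW) auto
  ultimately show ?thesis by (simp add: integral_unique W'l W'ml T_def algebra_simps)
qed

lemma B_zz: "B zz = Y1^2 + 4*E*T^2"
proof -
  have "acd (-l) l (%x. (W x)^2) (%x. 2*W x*W' x)"
    by (intro acdI_real) (auto intro!: derivative_eq_intros dW continuous_intros cW cW')
  note A = this
  have "integral {-l..l} (%x. (Y1*x - T*Yf x)*(2*W x*W' x) - (- (Y1 - T*(W x)^2))*(W x)^2)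
     = (Y1*l - T*Yf l)*(W l)^2 - (Y1*(-l) - T*Yf (-l))*(W (-l))^2"
  proof (rule acd_parts_C1[OF _ _ A])
    show "((%x. Y1*x - T*Yf x) has_real_derivative - (- (Y1 - T*(W x)^2))) (at x)" if "x \<in> {-l..l}" for x
      using that by (auto intro!: derivative_eq_intros dYf)
  qed (use l in \<open>auto intro!: continuous_intros cW\<close>)
  also have "... = 0" by (simp add: Yfl Yfml T_def)
  finally have z: "integral {-l..l} (%x. (Y1*x - T*Yf x)*(2*W x*W' x) - (- (Y1 - T*(W x)^2))*(W x)^2) = 0" .
  have h0: "((%x. (Y1*x - T*Yf x)*(2*W x*W' x) - (- (Y1 - T*(W x)^2))*(W x)^2) has_integral 0) {-l..l}"
    unfolding z[symmetric] by (intro integrable_integral integrable_continuous_real continuous_intros cYf cW cW')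
  have h4: "((%x. (W x)^4) has_integral Y4) {-l..l}"
    unfolding Y4_def by (intro integrable_integral integrable_continuous_real continuous_intros cW)
  have h2: "((%x. (W x)^2) has_integral Y1) {-l..l}" unfolding Y1_def by (intro integrable_integral W2int)
  have "((%x. ((Y1*x - T*Yf x)*(2*W x*W' x) - (- (Y1 - T*(W x)^2))*(W x)^2)
       + (Y1 - 4*T)*(W x)^2 + 3*T*(W x)^4) has_integral 0 + (Y1 - 4*T)*Y1 + 3*T*Y4) {-l..l}"
    by (intro has_integral_add has_integral_mult_right h0 h2 h4)
  moreover have "(%x. ((Y1*x - T*Yf x)*(2*W x*W' x) - (- (Y1 - T*(W x)^2))*(W x)^2)
       + (Y1 - 4*T)*(W x)^2 + 3*T*(W x)^4) = (%x. W x*fst zz x)"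
    by (auto simp: zz_def algebra_simps power2_eq_square power3_eq_cube power4_eq_xxxx)
  ultimately have "B zz = (Y1 - 4*T)*Y1 + T*(3*Y4)" unfolding B_def by (simp add: integral_unique)
  then show ?thesis unfolding Y4_eq by (simp add: algebra_simps power2_eq_square)
qed

lemma Sf3_zz_neg: "Sf 3 zz zz < 0"
proof -
  have "0 <= Y1" unfolding Y1_def by (intro integral_nonneg W2int) auto
  then have "Y1 + 4*E*T > 0" "Y1^2 + 4*E*T^2 > 0" using E T0 by (auto intro!: add_nonneg_pos)
  then show ?thesis unfolding Sf3_zz[OF adm_zz] B_zz by (simp add: mult_less_0_iff)
qed

text \<open>The form is nonnegative on the hyperplane of functions vanishing at \<open>l\<close>,
  and \<open>zz\<close> is a negative vector. The mass constraint is orthogonality to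
  \<open>zz\<close>, so it removes the only negative direction.\<close>

lemma plus_pos:
  assumes p: "adm p" "B p = 0"
  shows "0 <= Sf 3 p p" "Sf 3 p p <= 0 ==> EX c. ALL x:{-l..l}. fst p x = c*W' x"
proof -
  have zl: "fst zz l ~= 0" using jac(1)[OF adm_zz, of 3] Sf3_zz_neg by force
  define t where "t = - fst p l/fst zz l"
  define r where "r = cmb p t zz"
  have ar: "adm r" unfolding r_def by (intro adm_cmb p adm_zz)
  have rl: "fst r l = 0" using zl by (simp add: r_def cmb_def t_def)
  have Sr: "Sf 3 r r = Sf 3 p p + t^2*Sf 3 zz zz"
    unfolding r_def Sf_square[OF p(1) adm_zz] Sf3_zz[OF p(1)] p(2) by simp
  have ge: "0 <= Sf 3 r r" using jac(1)[OF ar rl] by simp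
  have "t^2*Sf 3 zz zz <= 0" using Sf3_zz_neg by (simp add: mult_le_0_iff)
  with Sr ge show "0 <= Sf 3 p p" by linarith
  show "EX c. ALL x:{-l..l}. fst p x = c*W' x" if le: "Sf 3 p p <= 0"
  proof -
    have "0 <= t^2*Sf 3 zz zz" using Sr ge le by linarith
    then have "t = 0" using Sf3_zz_neg by (auto simp: zero_le_mult_iff)
    then have "r = p" by (simp add: r_def cmb_def)
    then show ?thesis using jac(2)[OF p(1) _ _ le] rl by simp
  qed
qed

end

section \<open>Explicit waves\<close>

lemma antiderivative_exists:
  fixes f :: "real => real"
  assumes "!!x. isCont f x"
  obtains F where "F 0 = 0" "!!x. (F has_real_derivative f x) (at x)" "!!x. 0 <= x ==> F x = integral {0..x} f"
proof -
  obtain G where G: "!!x. (G has_vector_derivative f x) (at x)"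
    using einterval_antiderivative[of "- \<infinity>" "\<infinity>" f] assms by auto
  have "((%x. G x - G 0) has_real_derivative f x) (at x)" for x
    using has_vector_derivative_diff[OF G has_vector_derivative_const] by (simp add: has_real_derivative_iff_has_vector_derivative)
  moreover have "G x - G 0 = integral {0..x} f" if "0 <= x" for x
    using that fundamental_theorem_of_calculus[of 0 x G f] has_vector_derivative_at_within[OF G] by (simp add: integral_unique)
  ultimately show ?thesis using that[of "%x. G x - G 0"] by simp
qed

text \<open>The cubic Taylor bound suffices, as \<open>x <= 1.6\<close> gives
  \<open>x^2 <= 3\<close> and hence \<open>x^3/6 <= x/2\<close>. The estimate quantifies the simple
  zeros of \<open>y'\<close>.\<close>

lemma sin_ge_half:
  fixes x :: real assumes "0 <= x" "x <= pi/2" shows "x/2 <= sin x"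
proof -
  have "\<bar>sin x - (\<Sum>m<3. sin_coeff m*x ^ m)\<bar> <= inverse (fact 3) * \<bar>x\<bar> ^ 3"
    by (rule Maclaurin_sin_bound)
  then have "\<bar>sin x - x\<bar> <= x^3/6" using assms by (simp add: numeral_eq_Suc sin_coeff_def)
  then have "x - x^3/6 <= sin x" by linarith
  moreover have "x^3/6 <= x/2"
  proof -
    have "x <= 1.6" using assms pi_less_4 pi_approx by simp
    then have "x^2 <= 1.6^2" using assms by (intro power_mono) auto
    then have "x*x^2 <= x*3" using assms by (intro mult_left_mono) (auto simp: power2_eq_square)
    then show ?thesis by (simp add: power3_eq_cube power2_eq_square)
  qed
  ultimately show ?thesis by linarith
qed

text \<open>The modulus is built from the amplitude function \<open>f\<close> of the elliptic integral, the solution of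
  \<open>f' = sqrt ((s f - y3) / 2)\<close> with \<open>f 0 = 0\<close>: then \<open>y1 * (cos f)^2 + y2 * (sin f)^2\<close> is the squared modulus.\<close>

locale amplitude =
  fixes y1 y2 y3 :: real
  assumes ord: "y3 < y1" "y1 < y2"
begin

definition "s ph = y1*(cos ph)^2 + y2*(sin ph)^2"
definition "f ph = sqrt 2/sqrt (s ph - y3)"
definition "T = 2 * sqrt 2*integral {0..pi/2} (%ph. 1/sqrt (s ph - y3))"

lemma s_alt: "s ph = y1 + (y2 - y1)*(sin ph)^2"
proof -
  have c: "(cos ph)^2 = 1 - (sin ph)^2" by (simp add: cos_squared_eq)
  show ?thesis unfolding s_def c by (simp only: algebra_simps)
qed

lemma s_ge: "y1 <= s ph" and s_le: "s ph <= y2"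
proof -
  have "(sin ph)^2 <= 1" by (simp add: abs_square_le_1)
  then have "(y2 - y1)*(sin ph)^2 <= (y2 - y1)*1" using ord by (intro mult_left_mono) auto
  then show "s ph <= y2" by (simp only: s_alt le_diff_eq add.commute mult_1_right)
  have "0 <= (y2 - y1)*(sin ph)^2" using ord by (intro mult_nonneg_nonneg) auto
  then show "y1 <= s ph" by (simp only: s_alt le_add_same_cancel1)
qed

lemma sy3: "s ph - y3 > 0" using s_ge[of ph] ord by simp

lemma f_ge: "sqrt 2/sqrt (y2 - y3) <= f ph"
  unfolding f_def using s_le[of ph] sy3[of ph] ord by (intro divide_left_mono) auto

lemma f_pos: "f ph > 0" using sy3[of ph] by (simp add: f_def)

lemma f_cont: "isCont f ph" unfolding f_def s_def using sy3[of ph] by (intro continuous_intros) (auto simp: s_def)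

lemma s_shift: "s (ph + pi) = s ph" and s_minus: "s (- ph) = s ph" by (simp_all add: s_def)

lemma f_shift: "f (ph + pi) = f ph" and f_minus: "f (- ph) = f ph" by (simp_all add: f_def s_shift s_minus)

definition "F = (SOME F. F 0 = 0 & (ALL x. (F has_real_derivative f x) (at x)) & (ALL x>=0. F x = integral {0..x} f))"

lemma F: "F 0 = 0" "(F has_real_derivative f x) (at x)" "x >= 0 ==> F x = integral {0..x} f"
proof -
  have "EX F. F 0 = 0 & (ALL x. (F has_real_derivative f x) (at x)) & (ALL x>=0. F x = integral {0..x} f)"
    using antiderivative_exists[OF f_cont] by metis
  from someI_ex[OF this, folded F_def] show "F 0 = 0" "(F has_real_derivative f x) (at x)" "x >= 0 ==> F x = integral {0..x} f"
    by auto
qed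

lemma F_half: "F (pi/2) = T/2"
proof -
  have "F (pi/2) = integral {0..pi/2} (%ph. sqrt 2*(1/sqrt (s ph - y3)))" by (subst F(3)) (auto simp: f_def[abs_def])
  also have "... = sqrt 2*integral {0..pi/2} (%ph. 1/sqrt (s ph - y3))" by (rule integral_mult_right)
  finally show ?thesis by (simp add: T_def)
qed

lemma F_strict: "x < z ==> F x < F z" using DERIV_pos_imp_increasing[of x z F] F(2) f_pos by blast

lemma F_minus: "F (- x) = - F x"
proof -
  have "((%x. F (- x) + F x) has_real_derivative f (- x)*(- 1) + f x) (at x)" for x
    by (intro DERIV_add F DERIV_chain2[OF F(2)]) (auto intro!: derivative_eq_intros)
  then have "ALL x. ((%x. F (- x) + F x) has_real_derivative 0) (at x)" by (simp add: f_minus)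
  from DERIV_isconst_all[OF this, of x 0] show ?thesis by (simp add: F)
qed

lemma F_shift: "F (x + pi) = F x + T"
proof -
  have "((%x. F (x + pi) - F x) has_real_derivative f (x + pi)*1 - f x) (at x)" for x
    by (intro DERIV_diff F DERIV_chain2[OF F(2)]) (auto intro!: derivative_eq_intros)
  then have d: "ALL x. ((%x. F (x + pi) - F x) has_real_derivative 0) (at x)" by (simp add: f_shift)
  have "F (x + pi) - F x = F (- (pi/2) + pi) - F (- (pi/2))" by (rule DERIV_isconst_all[OF d, of x "- (pi/2)"])
  also have "... = T" unfolding F_minus using F_half by (simp add: field_simps)
  finally show ?thesis by simp
qed

lemma T_pos: "T > 0" using F_strict[of 0 "pi/2"] F_half F(1) by simp

lemma F_surj: "EX x. F x = z"
proof -
  define c where "c = sqrt 2/sqrt (y2 - y3)"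
  have c: "c > 0" using ord by (simp add: c_def)
  have ge: "c*x <= F x" if "x >= 0" for x
  proof -
    have "F 0 - c*0 <= F x - c*x"
    proof (rule DERIV_nonneg_imp_nondecreasing[OF that])
      fix t
      have "((%x. F x - c*x) has_real_derivative f t - c) (at t)" by (auto intro!: derivative_eq_intros F)
      then show "EX z. ((%x. F x - c*x) has_real_derivative z) (at t) & 0 <= z"
        using f_ge[of t] by (auto simp: c_def intro!: exI[of _ "f t - c"])
    qed
    then show ?thesis using F(1) by simp
  qed
  define b where "b = \<bar>z\<bar>/c"
  have b: "b >= 0" "\<bar>z\<bar> <= F b" using ge[of b] c by (auto simp: b_def)
  have "F (- b) <= z" "z <= F b" using b F_minus[of b] by auto
  then have "EX x>=-b. x <= b & F x = z" using b F(2) by (intro IVT) (auto intro: DERIV_isCont)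
  then show ?thesis by blast
qed

definition "ph = inv F"

lemma Fph: "F (ph x) = x"
proof -
  have "surj F" unfolding surj_def using F_surj by metis
  then show ?thesis unfolding ph_def by (rule surj_f_inv_f)
qed

lemma F_inj: "F x = F z \<longleftrightarrow> x = z" using F_strict by (metis less_irrefl linorder_neq_iff)

lemma phF: "ph (F x) = x" using Fph[of "F x"] F_inj by simp

lemma ph_cont: "isCont ph x"
proof -
  have "isCont ph (F (ph x))"
    by (rule isCont_inverse_function[where d=1 and f=F and g=ph]) (auto simp: phF intro: DERIV_isCont[OF F(2)])
  then show ?thesis by (simp add: Fph)
qed

definition "omg x = sqrt ((s (ph x) - y3)/2)"

lemma omg_pos: "omg x > 0" using sy3 by (simp add: omg_def)

lemma omg_sq: "(omg x)^2 = (s (ph x) - y3)/2" using sy3[of "ph x"] by (simp add: omg_def)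

lemma dph: "(ph has_real_derivative omg x) (at x)"
proof -
  have "(ph has_real_derivative inverse (f (ph x))) (at x)"
    by (rule DERIV_inverse_function[where f=F and a="x-1" and b="x+1"])
      (use F(2) f_pos[of "ph x"] Fph ph_cont in auto)
  moreover have "inverse (f (ph x)) = omg x" by (simp add: f_def omg_def real_sqrt_divide)
  ultimately show ?thesis by simp
qed

lemma domg: "(omg has_real_derivative (y2 - y1) * sin (ph x)*cos (ph x)/2) (at x)"
proof -
  have pos: "(s (ph x) - y3)/2 > 0" using sy3 by simp
  have "((%x. (s (ph x) - y3)/2) has_real_derivative (y2 - y1) * sin (ph x)*cos (ph x) * omg x) (at x)"
    unfolding s_alt by (auto intro!: derivative_eq_intros dph)
  from DERIV_chain2[OF DERIV_real_sqrt[OF pos] this]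
  have 1: "(omg has_real_derivative inverse (omg x)/2*((y2 - y1) * sin (ph x)*cos (ph x) * omg x)) (at x)"
    unfolding omg_def[abs_def] .
  have 2: "inverse (omg x)/2*((y2 - y1) * sin (ph x)*cos (ph x) * omg x) = (y2 - y1) * sin (ph x)*cos (ph x)/2"
    using omg_pos[of x] by (simp add: field_simps)
  show ?thesis using 1 unfolding 2 .
qed

lemma ph_vals: "ph 0 = 0" "ph (T/2) = pi/2" "ph (- (T/2)) = - (pi/2)"
  using phF[of 0] phF[of "pi/2"] phF[of "-(pi/2)"] F(1) F_half F_minus by auto

lemma ph_minus: "ph (- x) = - ph x" using phF[of "- ph x"] by (simp add: F_minus Fph)

lemma ph_shift: "ph (x + T) = ph x + pi" using phF[of "ph x + pi"] by (simp add: F_shift Fph)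

lemma omg_ge: "sqrt ((y1 - y3)/2) <= omg x"
  unfolding omg_def using s_ge by (intro real_sqrt_le_mono) (auto intro: divide_right_mono)

definition "c1 = sqrt ((y1 - y3)/2)"

lemma c1_pos: "c1 > 0" using ord by (simp add: c1_def)

lemma ph_incr: assumes "x <= z" shows "c1*(z - x) <= ph z - ph x"
proof -
  have "ph x - c1*x <= ph z - c1*z"
  proof (rule DERIV_nonneg_imp_nondecreasing[OF assms])
    fix t
    have "((%x. ph x - c1*x) has_real_derivative omg t - c1) (at t)" by (auto intro!: derivative_eq_intros dph)
    then show "EX z. ((%x. ph x - c1*x) has_real_derivative z) (at t) & 0 <= z"
      using omg_ge[of t] by (auto simp: c1_def)
  qed
  then show ?thesis by (simp add: algebra_simps)
qed

lemma sinph_ge: assumes "0 <= x" "x <= T/2" shows "c1/2*x <= sin (ph x)"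
proof -
  have "0 <= c1*(T/2 - x)" using assms c1_pos by simp
  then have "c1*x <= ph x" "ph x <= pi/2"
    using ph_incr[OF assms(1)] ph_incr[OF assms(2)] unfolding ph_vals by (simp, linarith)
  moreover have "0 <= c1*x" using assms c1_pos by simp
  ultimately show ?thesis using sin_ge_half[of "ph x"] by simp
qed

lemma cosph_ge: assumes "0 <= x" "x <= T/2" shows "c1/2*(T/2 - x) <= cos (ph x)"
proof -
  have "0 <= c1*x" using assms c1_pos by simp
  then have "c1*(T/2 - x) <= pi/2 - ph x" "0 <= ph x"
    using ph_incr[OF assms(1)] ph_incr[OF assms(2)] unfolding ph_vals by (simp, simp)
  moreover have "0 <= c1*(T/2 - x)" using assms c1_pos by simp
  ultimately have "(pi/2 - ph x)/2 <= sin (pi/2 - ph x)" by (intro sin_ge_half) auto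
  then have "(pi/2 - ph x)/2 <= cos (ph x)" using cos_sin_eq[of "ph x"] by simp
  then have "c1*(T/2 - x)/2 <= cos (ph x)"
    using \<open>c1 * (T / 2 - x) \<le> pi / 2 - ph x\<close> divide_right_mono[of _ _ "2::real"] by (meson order_trans zero_le_numeral)
  then show ?thesis by simp
qed

definition "y x = s (ph x)"
definition "y' x = 2*(y2 - y1) * sin (ph x)*cos (ph x) * omg x"

lemma dy: "(y has_real_derivative y' x) (at x)"
  unfolding y_def[abs_def] y'_def s_alt by (auto intro!: derivative_eq_intros dph)

lemma dy': "(y' has_real_derivative
    2*(y2 - y1)*((cos (ph x))^2 - (sin (ph x))^2)*(y x - y3)/2 + ((y2 - y1) * sin (ph x)*cos (ph x))^2) (at x)"
proof -
  have "(y' has_real_derivative 2*(y2 - y1)*((cos (ph x))^2 - (sin (ph x))^2)*(omg x)^2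
       + ((y2 - y1) * sin (ph x)*cos (ph x))^2) (at x)" unfolding y'_def[abs_def]
    by (rule derivative_eq_intros dph domg refl)+ (simp add: power2_eq_square field_simps)
  then show ?thesis unfolding omg_sq y_def by simp
qed

lemma fi: "(y' x)^2 = 2*((y x - y1)*(y2 - y x)*(y x - y3))"
proof -
  define S where "S = (sin (ph x))^2"
  have c: "(cos (ph x))^2 = 1 - S" by (simp add: cos_squared_eq S_def)
  have a: "y x - y1 = (y2 - y1)*S" "y2 - y x = (y2 - y1)*(1 - S)"
    unfolding y_def s_alt S_def by (simp_all add: algebra_simps)
  have "(y' x)^2 = (2*(y2 - y1))^2*S*(cos (ph x))^2*(omg x)^2" by (simp only: y'_def power_mult_distrib S_def)
  also have "... = 2*((y x - y1)*(y2 - y x)*(y x - y3))"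
    unfolding omg_sq c a y_def[symmetric] by (simp add: power2_eq_square) (simp add: algebra_simps)
  finally show ?thesis .
qed

lemma dy'2: "(y' has_real_derivative - 3*(y x)^2 + 2*(y1 + y2 + y3)*y x - (y1*y2 + y1*y3 + y2*y3)) (at x)"
proof -
  have c: "(cos (ph x))^2 = 1 - (sin (ph x))^2" by (simp add: cos_squared_eq)
  have "2*(y2 - y1)*((cos (ph x))^2 - (sin (ph x))^2)*(y x - y3)/2 + ((y2 - y1) * sin (ph x)*cos (ph x))^2
    = - 3*(y x)^2 + 2*(y1 + y2 + y3)*y x - (y1*y2 + y1*y3 + y2*y3)"
    unfolding power_mult_distrib c y_def s_alt by (simp add: field_simps power2_eq_square)
  then show ?thesis using dy'[of x] by simp
qed

lemma y_bounds: "y1 <= y x" "y x <= y2" by (auto simp: y_def s_ge s_le)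
lemma y_vals: "y 0 = y1" "y (T/2) = y2" by (auto simp: y_def ph_vals s_def)
lemma y_even: "y (- x) = y x" by (simp add: y_def ph_minus s_minus)
lemma y_shift: "y (x + T) = y x" by (simp add: y_def ph_shift s_shift)

text \<open>The factor \<open>sin (ph x)\<close> is at least linear at 0, the factor
  \<open>cos (ph x)\<close> at least linear at \<open>T/2\<close>, and \<open>omg\<close> is at
  least \<open>c1\<close>. This provides the constant demanded by \<open>low\<close> in
  \<open>orbit\<close>.\<close>

lemma y'_low: assumes "0 <= x" "x <= T/2"
  shows "(y2 - y1)*c1^3/2*(x*(T/2 - x)) <= y' x"
proof -
  have "(y2 - y1)*c1^3/2*(x*(T/2 - x)) = 2*(y2 - y1)*((c1/2*x)*(c1/2*(T/2 - x))*c1)" by (simp add: power3_eq_cube)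
  also have "... <= 2*(y2 - y1)*(sin (ph x)*cos (ph x) * omg x)"
    using sinph_ge[OF assms] cosph_ge[OF assms] omg_ge[of x] c1_pos assms ord
    by (intro mult_left_mono mult_mono mult_nonneg_nonneg order_trans[OF _ sinph_ge[OF assms]] order_trans[OF _ cosph_ge[OF assms]])
      (auto simp: c1_def)
  finally show ?thesis by (simp add: y'_def algebra_simps)
qed

end

section \<open>Roots of the cubic and construction of the modulus\<close>

lemma q_of_eq: "J = q_of J*(1 + (q_of J)^2)"
proof -
  have "EX! q. J = q*(1 + q^2)"
  proof (rule ex_ex1I)
    have "\<bar>J\<bar>*1 <= \<bar>J\<bar>*(1 + J^2)" by (intro mult_left_mono) auto
    then have "- \<bar>J\<bar>*(1 + (- \<bar>J\<bar>)^2) <= J" "J <= \<bar>J\<bar>*(1 + \<bar>J\<bar>^2)" by auto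
    from IVT'[of "%q. q*(1 + q^2)", OF this] show "EX q. J = q*(1 + q^2)" by (force intro!: continuous_intros)
    fix a b :: real assume "J = a*(1 + a^2)" "J = b*(1 + b^2)"
    then have "(a - b)*(1 + a^2 + a*b + b^2) = 0" by (simp add: algebra_simps power2_eq_square)
    moreover have "0 < 1 + a^2 + a*b + b^2"
    proof -
      have "1 + a^2 + a*b + b^2 = 1 + (a + b/2)^2 + 3/4*b^2" by (simp add: power2_eq_square field_simps)
      then show ?thesis using zero_le_power2[of "a + b/2"] zero_le_power2[of b] by linarith
    qed
    ultimately show "a = b" by simp
  qed
  then show ?thesis unfolding q_of_def by (rule theI')
qed

lemma cubic_factor:
  fixes a b J E :: real
  assumes "- (a^3) + 2*a^2 + 4*E*a - 2*J^2 = 0" "- (b^3) + 2*b^2 + 4*E*b - 2*J^2 = 0" "a ~= b"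
  shows "- (y^3) + 2*y^2 + 4*E*y - 2*J^2 = - ((y - a)*(y - b)*(y - (2 - a - b)))"
proof -
  have "(a - b)*(4*E - (a^2 + a*b + b^2 - 2*(a + b))) = 0"
    using assms(1,2) by (simp add: algebra_simps power2_eq_square power3_eq_cube)
  then have E: "4*E = a^2 + a*b + b^2 - 2*(a + b)" using assms(3) by simp
  have J: "2*J^2 = - (a^3) + 2*a^2 + 4*E*a" using assms(1) by simp
  show ?thesis unfolding J E by (simp add: algebra_simps power2_eq_square power3_eq_cube)
qed

text \<open>\<open>1 + q^2\<close> is the squared modulus of the plane wave with flux
  \<open>J\<close>. The cubic equals \<open>4*(1 + q^2)*(E - E_minus J)\<close> there, which is
  positive, and it is negative at 0 and far out, so it has two positive roots; the product of all
  roots makes the third negative. For \<open>J = 0\<close> the roots are explicit.\<close>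

lemma roots_exist:
  assumes "(J, E) \<in> D_set"
  obtains y1 y2 y3 where "y3 <= 0" "0 <= y1" "y1 < y2" "y3 < y1"
    "!!y. - (y^3) + 2*y^2 + 4*E*y - 2*J^2 = - ((y - y1)*(y - y2)*(y - y3))"
proof (cases "J = 0")
  case False
  define p where "p y = - (y^3) + 2*y^2 + 4*E*y - 2*J^2" for y
  define q where "q = q_of J"
  define ys where "ys = 1 + q^2"
  have ys: "ys > 0" by (simp add: ys_def add_pos_nonneg)
  have J: "J = q*ys" using q_of_eq[of J] by (simp add: q_def ys_def)
  have "p ys = 4*ys*(E - (q^2 + 1)*(3*q^2 - 1)/4)"
    unfolding p_def J unfolding ys_def by (simp add: field_simps power2_eq_square power3_eq_cube)
  moreover have "E > (q^2 + 1)*(3*q^2 - 1)/4" using assms by (simp add: D_set_def E_minus_def q_def)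
  ultimately have p1: "p ys > 0" using ys by simp
  have p0: "p 0 < 0" using False by (simp add: p_def)
  \<comment> \<open>Beyond \<open>ys\<close> and large enough for
    \<open>L*(L - 2) >= 4*E\<close>.\<close>
  define L where "L = 2 + 4 * \<bar>E\<bar> + ys"
  have p2: "p L < 0"
  proof -
    have "L*1 <= L*(L - 2 - ys + 1)" using ys by (intro mult_left_mono) (auto simp: L_def)
    have "4*E <= 1*(L - 2)" using ys by (simp add: L_def)
    also have "... <= L*(L - 2)" using ys by (intro mult_right_mono) (auto simp: L_def)
    finally have "0 <= L*(L*(L - 2) - 4*E)" using ys by (intro mult_nonneg_nonneg) (auto simp: L_def)
    moreover have "p L = - (L*(L*(L - 2) - 4*E)) - 2*J^2"
      by (simp add: p_def algebra_simps power2_eq_square power3_eq_cube)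
    moreover have "J^2 > 0" using False by simp
    ultimately show ?thesis by linarith
  qed
  have cp: "continuous_on S p" for S unfolding p_def by (intro continuous_intros)
  obtain a where a: "0 <= a" "a <= ys" "p a = 0" using IVT'[of p 0 0 ys] p0 p1 ys cp by force
  obtain b where b: "ys <= b" "b <= L" "p b = 0" using IVT2'[of p L 0 ys] p1 p2 cp by (force simp: L_def)
  have "a ~= 0" "a ~= ys" "b ~= ys" using a b p0 p1 by auto
  then have ab: "0 < a" "a < b" using a b by auto
  have fac: "p y = - ((y - a)*(y - b)*(y - (2 - a - b)))" for y
    unfolding p_def using a b ab by (intro cubic_factor) (auto simp: p_def)
  have "p 0 = a*b*(2 - a - b)" unfolding fac by (simp add: algebra_simps)
  then have "a*b*(2 - a - b) < 0" using p0 by simp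
  moreover have "a*b > 0" using ab by simp
  ultimately have "2 - a - b < 0" by (meson mult_nonneg_nonneg not_less less_imp_le)
  then show ?thesis using that[of "2 - a - b" a b] fac ab unfolding p_def by simp
next
  case True
  have "q_of 0 = 0" using q_of_eq[of 0] by (auto simp: add_nonneg_eq_0_iff)
  then have E: "E > -1/4" "E ~= 0" using assms True by (auto simp: D_set_def E_minus_def)
  define r where "r = sqrt (1 + 4*E)"
  have r: "r > 0" "r^2 = 1 + 4*E" using E by (auto simp: r_def)
  have fac: "- (y^3) + 2*y^2 + 4*E*y - 2*J^2 = - (y*(y - (1 - r))*(y - (1 + r)))" for y
  proof -
    have "- (y*(y - (1 - r))*(y - (1 + r))) = - (y^3) + 2*y^2 + (r^2 - 1)*y"
      by (simp add: algebra_simps power2_eq_square power3_eq_cube)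
    then show ?thesis using r True by simp
  qed
  show ?thesis
  proof (cases "E > 0")
    case True
    then have "r > 1" unfolding r_def by simp
    then show ?thesis using that[of "1 - r" 0 "1 + r"] fac by (simp add: algebra_simps)
  next
    case False
    then have "r < 1" using E unfolding r_def by simp
    then show ?thesis using that[of 0 "1 - r" "1 + r"] fac r(1) by (simp add: algebra_simps)
  qed
qed

definition is_roots :: "real => real => real => real => real => bool" where
  "is_roots J E y1 y2 y3 \<longleftrightarrow> y3 <= 0 & 0 <= y1 & y1 < y2 &
     (ALL y. - (y^3) + 2*y^2 + 4*E*y - 2*J^2 = - ((y - y1)*(y - y2)*(y - y3)))"

text \<open>Vieta's formulas, read off from the values at 0, 1 and -1.\<close>

lemma is_roots_sums:
  assumes "is_roots J E y1 y2 y3"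
  shows "y1 + y2 + y3 = 2" "y1*y2 + y1*y3 + y2*y3 = - 4*E" "y1*y2*y3 = - 2*J^2"
proof -
  have id: "- (y^3) + 2*y^2 + 4*E*y - 2*J^2 = - ((y - y1)*(y - y2)*(y - y3))" for y
    using assms by (simp add: is_roots_def)
  show 3: "y1*y2*y3 = - 2*J^2" using id[of 0] by simp
  have a: "1 + 4*E - 2*J^2 = - ((1 - y1)*(1 - y2)*(1 - y3))" using id[of 1] by simp
  have b: "3 - 4*E - 2*J^2 = (1 + y1)*(1 + y2)*(1 + y3)" using id[of "-1"] by (simp add: algebra_simps)
  show "y1 + y2 + y3 = 2" "y1*y2 + y1*y3 + y2*y3 = - 4*E" using a b 3 by (simp_all add: algebra_simps)
qed

text \<open>The largest and the smallest root are determined by the polynomial, and the middle one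
  follows from the sum.\<close>

lemma is_roots_unique:
  assumes "is_roots J E a1 a2 a3" "is_roots J E b1 b2 b3"
  shows "a1 = b1 & a2 = b2 & a3 = b3"
proof -
  have le: "c2 <= d2 & d3 <= c3" if c: "is_roots J E c1 c2 c3" and d: "is_roots J E d1 d2 d3" for c1 c2 c3 d1 d2 d3
  proof -
    have id: "(y - c1)*(y - c2)*(y - c3) = (y - d1)*(y - d2)*(y - d3)" for y
      using c d unfolding is_roots_def by (metis neg_equal_iff_equal)
    have "c2 \<in> {d1, d2, d3}" using id[of c2] by auto
    moreover have "c3 \<in> {d1, d2, d3}" using id[of c3] by auto
    ultimately show ?thesis using c d unfolding is_roots_def by auto
  qed
  from le[OF assms] le[OF assms(2,1)] have "a2 = b2" "a3 = b3" by auto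
  moreover have "a1 + a2 + a3 = b1 + b2 + b3" using is_roots_sums(1)[OF assms(1)] is_roots_sums(1)[OF assms(2)] by simp
  ultimately show ?thesis by simp
qed

locale dpoint =
  fixes J E :: real
  assumes D: "(J, E) \<in> D_set"
begin

definition "y1 = y1_of (J, E)"
definition "y2 = y2_of (J, E)"
definition "y3 = y3_of (J, E)"

lemma roots: "is_roots J E y1 y2 y3" "y3 < y1"
proof -
  obtain a1 a2 a3 where a: "a3 < a1" "is_roots J E a1 a2 a3" using roots_exist[OF D] unfolding is_roots_def by metis
  have "roots3 (J, E) = (THE (z1, z2, z3). is_roots J E z1 z2 z3)" unfolding roots3_def is_roots_def by simp
  also have "... = (a1, a2, a3)"
  proof (rule the_equality)
    show "case (a1, a2, a3) of (z1, z2, z3) => is_roots J E z1 z2 z3" using a by simp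
    show "p = (a1, a2, a3)" if "case p of (z1, z2, z3) => is_roots J E z1 z2 z3" for p
      using is_roots_unique[OF a(2)] that by (cases p) auto
  qed
  finally have "y1 = a1" "y2 = a2" "y3 = a3" by (simp_all add: y1_def y2_def y3_def y1_of_def y2_of_def y3_of_def)
  then show "is_roots J E y1 y2 y3" "y3 < y1" using a by auto
qed

lemmas sums = is_roots_sums[OF roots(1)]

lemma signs: "y3 <= 0" "0 <= y1" "y1 < y2" using roots(1) by (auto simp: is_roots_def)

sublocale amplitude y1 y2 y3 by unfold_locales (use roots signs in auto)

lemma T_of_eq: "T_of (J, E) = T" unfolding T_of_def T_def s_of_def s_def unfolding y1_def y2_def y3_def ..

lemma fi': "(y' x)^2 = 2*(- ((y x)^3) + 2*(y x)^2 + 4*E*y x - 2*J^2)"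
proof -
  have "(y x - y1)*(y2 - y x)*(y x - y3)
    = - ((y x)^3) + (y1 + y2 + y3)*(y x)^2 - (y1*y2 + y1*y3 + y2*y3)*y x + y1*y2*y3"
    by (simp add: algebra_simps power2_eq_square power3_eq_cube)
  then show ?thesis unfolding fi sums by simp
qed

lemma dy'': "(y' has_real_derivative - 3*(y x)^2 + 4*y x + 4*E) (at x)"
  using dy'2[of x] unfolding sums by (simp add: algebra_simps)

text \<open>The level curve of the first integral is a single closed orbit: \<open>t\<close> is
  reached on a half period by continuity, and the reflection \<open>x\<close> to \<open>- x\<close>
  supplies the opposite slope. This is what makes the wave unique up to symmetries.\<close>

lemma attained:
  assumes "0 < t" "z^2 = 2*(- (t^3) + 2*t^2 + 4*E*t - 2*J^2)"
  obtains x where "y x = t" "y' x = z"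
proof -
  have e: "- (t^3) + 2*t^2 + 4*E*t - 2*J^2 = - ((t - y1)*(t - y2)*(t - y3))"
    using roots(1) by (simp add: is_roots_def)
  have "(t - y1)*(t - y2)*(t - y3) <= 0" using zero_le_power2[of z] unfolding assms(2) e by simp
  moreover have "t - y3 > 0" using assms(1) signs by simp
  ultimately have le: "(t - y1)*(t - y2) <= 0" by (meson mult_pos_pos not_less)
  have "y1 <= t"
  proof (rule ccontr)
    assume "~ y1 <= t"
    then have "0 < (t - y1)*(t - y2)" using signs by (intro mult_neg_neg) auto
    with le show False by simp
  qed
  moreover have "t <= y2"
  proof (rule ccontr)
    assume "~ t <= y2"
    then have "0 < (t - y1)*(t - y2)" using signs by (intro mult_pos_pos) auto
    with le show False by simp
  qed
  ultimately have "y 0 <= t" "t <= y (T/2)" unfolding y_vals by auto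
  moreover have "continuous_on {0..T/2} y"
    using dy by (intro continuous_at_imp_continuous_on) (auto intro: DERIV_isCont)
  ultimately obtain x where x: "y x = t" using IVT'[of y 0 t "T/2"] T_pos by auto
  have "(y' x)^2 = z^2" using fi'[of x] assms(2) x by simp
  then have "y' x = z | y' x = - z" by (simp add: power2_eq_iff)
  moreover have "y' (- x) = - y' x" by (simp add: y'_def ph_minus omg_def s_minus)
  ultimately show ?thesis using that[of x] that[of "- x"] x y_even by auto
qed

end

section \<open>Common description of both kinds of wave\<close>

definition quad :: "(real => complex) => (real => complex) => (real => complex) => real => real" where
  "quad W w g x = (cmod (g x))^2 + (cmod (w x))^2 - (cmod (W x))^2*(cmod (w x))^2 - 2*(Re (cnj (W x)*w x))^2"

text \<open>\<open>quad\<close> is the density of the second variation in the original variable.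
  \<open>pos\<close> states positivity for perturbations with the quasi-period of \<open>W\<close>
  that satisfy the mass and momentum constraints to first order, with only phase rotation and
  translation as null directions; \<open>attained\<close> serves the uniqueness of the wave.\<close>

locale good_wave =
  fixes J E T p :: real and W W1 :: "real => complex"
  assumes T_pos: "T > 0"
    and dW: "!!x. (W has_vector_derivative W1 x) (at x)"
    and dW1: "!!x. (W1 has_vector_derivative W x - of_real ((cmod (W x))^2)*W x) (at x)"
    and WJ: "!!x. Im (cnj (W x)*W1 x) = J"
    and WE: "!!x. (cmod (W1 x))^2/2 - (cmod (W x))^2/2 + (cmod (W x))^4/4 = E"
    and quasi: "!!x. W (x + T) = cis (p*T)*W x"
    and nonconst: "EX x z. cmod (W x) ~= cmod (W z)"
    and attained: "!!t z. 0 < t ==> z^2 = 2*(- (t^3) + 2*t^2 + 4*E*t - 2*J^2) ==>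
        EX x. (cmod (W x))^2 = t & 2 * Re (cnj (W x)*W1 x) = z"
    and pos: "!!w g. acd (- (T/2)) (T/2) w g ==> w (T/2) = cis (p*T)*w (- (T/2)) ==>
        integral {- (T/2)..T/2} (%x. Re (cnj (W x)*w x)) = 0 ==>
        integral {- (T/2)..T/2} (%x. Im (cnj (w x)*W1 x)) = 0 ==>
        0 <= integral {- (T/2)..T/2} (quad W w g) &
        (integral {- (T/2)..T/2} (quad W w g) <= 0 -->
          (EX al be. ALL x:{- (T/2)..T/2}. w x = of_real al*(\<i>*W x) + of_real be*W1 x))"

lemma has_vector_derivative_cis:
  assumes "(tht has_real_derivative tht') (at x)"
  shows "((%x. cis (tht x)) has_vector_derivative \<i> * of_real tht'*cis (tht x)) (at x)"
proof -
  have "((%x. cos (tht x)) has_real_derivative - sin (tht x)*tht') (at x)"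
    "((%x. sin (tht x)) has_real_derivative cos (tht x)*tht') (at x)" by (auto intro!: derivative_eq_intros assms)
  then have "((%x. of_real (cos (tht x)) + \<i> * of_real (sin (tht x))) has_vector_derivative
      of_real (- sin (tht x)*tht') + \<i> * of_real (cos (tht x)*tht')) (at x)"
    by (intro has_vector_derivative_add has_vector_derivative_of_real has_vector_derivative_mult_right)
  moreover have "(%x. of_real (cos (tht x)) + \<i> * of_real (sin (tht x))) = (%x. cis (tht x))"
    by (auto simp: complex_eq_iff)
  moreover have "of_real (- sin (tht x)*tht') + \<i> * of_real (cos (tht x)*tht') = \<i> * of_real tht'*cis (tht x)"
    by (auto simp: complex_eq_iff)
  ultimately show ?thesis by simp
qed

lemma vector_derivative_zero_const:
  fixes f :: "real => 'a::real_normed_vector"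
  assumes "!!x. (f has_vector_derivative 0) (at x)"
  shows "f x = f y" using has_derivative_zero_constant[of UNIV f] assms by (auto simp: has_vector_derivative_def)

context amplitude
begin

lemma s_pos: "y1 > 0 ==> s x > 0" using s_ge[of x] by simp

text \<open>Stands in for the evaluation of the integral of \<open>1 / s\<close>: only its value modulo the period of \<open>cis\<close> matters.\<close>

lemma cis_quarter:
  assumes "y1 > 0"
  shows "cis (2*(sqrt y1 * sqrt y2)*integral {0..pi/2} (%u. 1/s u)) = -1"
proof -
  have y2: "y2 > 0" using assms ord by simp
  have "isCont (%u. 1/s u) x" for x using s_pos[OF assms, of x] unfolding s_def by (intro continuous_intros) auto
  from antiderivative_exists[OF this] obtain Th where Th: "Th 0 = 0" "!!x. (Th has_real_derivative 1/s x) (at x)"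
    "!!x. 0 <= x ==> Th x = integral {0..x} (%u. 1/s u)" by metis
  define k where "k = sqrt y1 * sqrt y2"
  define c where "c x = of_real (sqrt y1*cos x) + \<i> * of_real (sqrt y2 * sin x)" for x
  define c' where "c' x = of_real (- sqrt y1 * sin x) + \<i> * of_real (sqrt y2*cos x)" for x
  \<comment> \<open>The ellipse \<open>c\<close> satisfies \<open>(cmod (c x))^2 = s x\<close>, and
    its argument grows at the rate \<open>k/s x\<close>. Hence the unimodular function
    \<open>c^2/s\<close> with this phase unwound is constant, and its values at 0 and
    \<open>pi/2\<close> are compared.\<close>
  define h where "h x = c x*c x * of_real (1/s x)*cis (- 2*k*Th x)" for x
  have dc: "(c has_vector_derivative c' x) (at x)" for x unfolding c_def[abs_def] c'_def
    by (intro has_vector_derivative_add has_vector_derivative_of_real has_vector_derivative_mult_right)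
      (auto simp: has_real_derivative_iff_has_vector_derivative[symmetric] intro!: derivative_eq_intros)
  have ds: "((%x. 1/s x) has_real_derivative - (2*(y2 - y1) * sin x*cos x)/(s x)^2) (at x)" for x
  proof -
    have "(s has_real_derivative 2*(y2 - y1) * sin x*cos x) (at x)"
      unfolding s_alt by (auto intro!: derivative_eq_intros)
    from DERIV_inverse'[OF this] s_pos[OF assms, of x] show ?thesis by (simp add: divide_simps power2_eq_square)
  qed
  have dh: "(h has_vector_derivative 0) (at x)" for x
  proof -
    have "((%x. - 2*k*Th x) has_real_derivative - 2*k*(1/s x)) (at x)" by (intro DERIV_cmult Th)
    note d = has_vector_derivative_mult[OF has_vector_derivative_mult[OF has_vector_derivative_mult[OF dc dc]
       has_vector_derivative_of_real[OF ds]] has_vector_derivative_cis[OF this]]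
    have sp: "s x ~= 0" using s_pos[OF assms, of x] by simp
    have key: "2*c' x * of_real (s x) - c x * of_real (2*(y2 - y1) * sin x*cos x) = 2 * \<i> * of_real k*c x"
    proof -
      have C: "(cos x)^2 = 1 - (sin x)^2" by (simp add: cos_squared_eq)
      have r1: "sqrt y1*(2*(sin x * s x)) + sqrt y1*(2*(y2 - y1) * sin x*(cos x)^2) = sqrt y1*(2*y2 * sin x)"
        unfolding s_def C by (simp add: algebra_simps)
      have r2: "sqrt y2*(2*(cos x * s x)) - sqrt y2*(2*(y2 - y1)*(sin x)^2*cos x) = sqrt y2*(2*y1*cos x)"
      proof -
        have S: "(sin x)^2 = 1 - (cos x)^2" by (simp add: sin_squared_eq)
        show ?thesis unfolding s_def S by (simp add: algebra_simps)
      qed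
      have k1: "k * sqrt y2 = sqrt y1*y2" "k * sqrt y1 = sqrt y2*y1" using assms y2 by (simp_all add: k_def)
      show ?thesis unfolding complex_eq_iff
        using r1 r2 k1 by (simp add: c_def c'_def power2_eq_square) (simp add: algebra_simps)
    qed
    have "c x*c x * of_real (1/s x)*(\<i> * of_real (- 2*k*(1/s x))*cis (- 2*k*Th x)) +
      (c x*c x * of_real (- (2*(y2 - y1) * sin x*cos x)/(s x)^2) + (c x*c' x + c' x*c x) * of_real (1/s x))*cis (- 2*k*Th x)
      = c x*cis (- 2*k*Th x) * of_real (1/(s x)^2) *
        ((2*c' x * of_real (s x) - c x * of_real (2*(y2 - y1) * sin x*cos x)) - 2 * \<i> * of_real k*c x)"
      using sp by (simp add: field_simps power2_eq_square)
    also have "... = 0" unfolding key by simp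
    finally show ?thesis using d unfolding h_def[abs_def] by (simp only:)
  qed
  have "h (pi/2) = h 0" by (rule vector_derivative_zero_const[OF dh])
  moreover have "h 0 = 1" using assms by (simp add: h_def c_def s_def Th flip: of_real_mult)
  moreover have "h (pi/2) = - cis (- 2*k*Th (pi/2))"
  proof -
    have r: "complex_of_real (sqrt y2) * of_real (sqrt y2) = of_real y2"
      using y2 by (metis of_real_mult real_sqrt_mult_self abs_of_pos)
    have "(\<i>*complex_of_real (sqrt y2))*(\<i> * of_real (sqrt y2)) * of_real (1/y2)
      = - (complex_of_real (sqrt y2) * of_real (sqrt y2)) * of_real (1/y2)" by (simp add: algebra_simps)
    also have "... = -1" unfolding r using y2 by simp
    finally have "(\<i>*complex_of_real (sqrt y2))*(\<i> * of_real (sqrt y2)) * of_real (1/y2) = -1" .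
    then show ?thesis by (simp add: h_def c_def s_def)
  qed
  ultimately have "cis (- 2*k*Th (pi/2)) = -1" by (metis minus_minus)
  then have "cnj (cis (- 2*k*Th (pi/2))) = -1" by simp
  then have "cis (2*k*Th (pi/2)) = -1" by (simp add: cis_cnj)
  then show ?thesis by (simp add: k_def Th(3))
qed

end

section \<open>Waves without zeros\<close>

context dpoint
begin

abbreviation "p \<equiv> p_of (J, E) (J, E)"

lemma low_c: "(y2 - y1)*c1^3/2 > 0" using signs c1_pos by simp

context
  assumes y1: "y1 > 0"
begin

interpretation O: orbit y y' J E "T/2" y1 y2 y3 "(y2 - y1)*c1^3/2"
  by unfold_locales (use T_pos dy dy'' fi sums y1 signs y_bounds y_vals y_even low_c y'_low in auto)

definition "tht = (SOME tht. tht 0 = 0 & (ALL x. (tht has_real_derivative J/y x) (at x)))"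

lemma tht: "tht 0 = 0" "(tht has_real_derivative J/y x) (at x)"
proof -
  have "isCont (%x. J/y x) x" for x using dy DERIV_isCont O.ynz by (intro continuous_intros) auto
  from antiderivative_exists[OF this]
  have "EX tht. tht 0 = 0 & (ALL x. (tht has_real_derivative J/y x) (at x))" by metis
  from someI_ex[OF this, folded tht_def] show "tht 0 = 0" "(tht has_real_derivative J/y x) (at x)" by auto
qed

lemma tht_minus: "tht (- x) = - tht x"
proof -
  have "((%x. tht (- x) + tht x) has_real_derivative J/y (- x)*(- 1) + J/y x) (at x)" for x
    by (intro DERIV_add tht DERIV_chain2[OF tht(2)]) (auto intro!: derivative_eq_intros)
  then have "ALL x. ((%x. tht (- x) + tht x) has_real_derivative 0) (at x)" by (simp add: y_even)
  from DERIV_isconst_all[OF this, of x 0] show ?thesis by (simp add: tht)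
qed

lemma tht_shift: "tht (x + T) = tht x + 2*tht (T/2)"
proof -
  have "((%x. tht (x + T) - tht x) has_real_derivative J/y (x + T)*1 - J/y x) (at x)" for x
    by (intro DERIV_diff tht DERIV_chain2[OF tht(2)]) (auto intro!: derivative_eq_intros)
  then have "ALL x. ((%x. tht (x + T) - tht x) has_real_derivative 0) (at x)" by (simp add: y_shift)
  from DERIV_isconst_all[OF this, of x "- (T/2)"] show ?thesis by (simp add: tht_minus)
qed

text \<open>The substitution \<open>x = F u\<close> turns the phase gained over half a period into
  the integral in \<open>Phi_of\<close>.\<close>

lemma tht_half: "2*tht (T/2) = Phi_of (J, E)"
proof -
  have c: "continuous_on {0..pi/2} (%u. J/s u*f u)"
  proof (intro continuous_intros)
    show "continuous_on {0..pi/2} s" unfolding s_def by (intro continuous_intros)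
    show "continuous_on {0..pi/2} f" using f_cont by (intro continuous_at_imp_continuous_on) auto
    show "ALL x:{0..pi/2}. s x ~= 0" using s_pos[OF y1] by (auto simp: less_le)
  qed
  have "((%u. tht (F u)) has_real_derivative J/y (F x)*f x) (at x)" for x by (rule DERIV_chain2[OF tht(2) F(2)])
  then have "((%u. tht (F u)) has_real_derivative J/s x*f x) (at x)" for x by (simp add: y_def phF)
  then have "integral {0..pi/2} (%u. J/s u*f u) = tht (F (pi/2)) - tht (F 0)" by (intro integral_FTC) auto
  then have "tht (T/2) = integral {0..pi/2} (%u. J/s u*f u)" by (simp add: F F_half tht)
  also have "... = integral {0..pi/2} (%u. sqrt 2*(J/s u*(1/sqrt (s u - y3))))" by (simp add: f_def algebra_simps)
  also have "... = sqrt 2*integral {0..pi/2} (%u. J/s u*(1/sqrt (s u - y3)))" by (rule integral_mult_right)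
  finally have "2*tht (T/2) = 2 * sqrt 2*integral {0..pi/2} (%u. J/s u*(1/sqrt (s u - y3)))" by simp
  also have "... = Phi_of (J, E)" unfolding Phi_of_def s_of_def s_def unfolding y1_def y2_def y3_def by simp
  finally show ?thesis .
qed

text \<open>Quasi-periodicity depends on \<open>p*T\<close> only modulo \<open>2*pi\<close>, so the
  two branches of \<open>p\<close> may be compared through \<open>cis\<close>. The difference of
  \<open>Phi_of\<close> and \<open>Psi_of\<close> is, up to sign, the angle of
  \<open>cis_quarter\<close>.\<close>

lemma cis_p: "cis (p*T) = cis (2*tht (T/2))"
proof (cases "(J, E) \<in> Gamma_minus")
  case True
  then show ?thesis using T_pos unfolding tht_half p_of_def T_of_eq by simp
next
  case False
  have J: "J ~= 0"
  proof
    assume J: "J = 0"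
    then have "y3 = 0" using sums(3) y1 signs by auto
    then have "y1*y2 = - 4*E" using sums(2) by simp
    moreover have "y1*y2 > 0" using y1 signs by simp
    moreover have "E > -1/4"
    proof -
      have "q_of 0 = 0" using q_of_eq[of 0] by (auto simp: add_nonneg_eq_0_iff)
      then show ?thesis using D J by (simp add: D_set_def E_minus_def)
    qed
    ultimately show False using False J by (simp add: Gamma_minus_def)
  qed
  have y3: "y3 < 0" using sums(3) J signs by (metis less_eq_real_def mult_zero_right neg_equal_0_iff_equal power_eq_0_iff mult_eq_0_iff zero_neq_numeral mult_minus_left)
  define a where "a = sqrt (- y3)"
  have a: "a > 0" "a^2 = - y3" using y3 by (auto simp: a_def)
  define I where "I = integral {0..pi/2} (%u. 1/s u)"
  have cs: "continuous_on {0..pi/2} s" unfolding s_def by (intro continuous_intros)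
  have snz: "s x ~= 0" "sqrt (s x - y3) ~= 0" "sqrt (s x - y3) > 0" for x using s_pos[OF y1, of x] sy3[of x] by auto
  \<comment> \<open>Partial fractions with \<open>s = b^2 - a^2\<close>, where
    \<open>a = sqrt (- y3)\<close> and \<open>b = sqrt (s - y3)\<close>.\<close>
  have pt: "J/s x*(1/sqrt (s x - y3)) = J/a*(1/s x) - J*(1/(a * sqrt (s x - y3)*(a + sqrt (s x - y3))))" for x
  proof -
    define b where "b = sqrt (s x - y3)"
    have b: "b > 0" "s x = (b - a)*(b + a)" using sy3[of x] a(2) by (auto simp: b_def algebra_simps power2_eq_square)
    have ba: "b - a ~= 0" using snz(1)[of x] b(2) by auto
    have "J/((b - a)*(b + a))*(1/b) = J/a*(1/((b - a)*(b + a))) - J*(1/(a*b*(a + b)))"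
      using a(1) b(1) ba by (simp add: divide_simps) (simp add: algebra_simps)
    then show ?thesis unfolding b(2)[symmetric] b_def[symmetric] .
  qed
  define IP IQ where "IP = integral {0..pi/2} (%u. J/s u*(1/sqrt (s u - y3)))"
    and "IQ = integral {0..pi/2} (%u. 1/(a * sqrt (s u - y3)*(a + sqrt (s u - y3))))"
  have "IP
     = integral {0..pi/2} (%u. J/a*(1/s u)) - integral {0..pi/2} (%u. J*(1/(a * sqrt (s u - y3)*(a + sqrt (s u - y3)))))"
    unfolding IP_def pt
  proof (rule integral_diff)
    show "(%u. J/a*(1/s u)) integrable_on {0..pi/2}"
      using snz by (intro integrable_continuous_real continuous_intros cs) (use a in auto)
    have "a + sqrt (s x - y3) ~= 0" for x using a(1) snz(3)[of x] by linarith
    then show "(%u. J*(1/(a * sqrt (s u - y3)*(a + sqrt (s u - y3))))) integrable_on {0..pi/2}"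
      using snz by (intro integrable_continuous_real continuous_intros cs) (use a in auto)
  qed
  then have IPe: "IP = J/a*I - J*IQ" unfolding I_def IQ_def integral_mult_right .
  have Pe: "Phi_of (J, E) = 2 * sqrt 2*IP"
    unfolding Phi_of_def s_of_def s_def IP_def fst_conv unfolding y1_def y2_def y3_def ..
  have Qe: "Psi_of (J, E) = - 2 * sqrt 2*J*IQ"
    unfolding Psi_of_def s_of_def s_def IQ_def a_def fst_conv unfolding y1_def y2_def y3_def ..
  have Ph: "Phi_of (J, E) = 2*(sqrt 2*(J/a))*I + Psi_of (J, E)" unfolding Pe Qe IPe by (simp add: algebra_simps)
  have X: "sqrt 2*(J/a) = sqrt y1 * sqrt y2 | sqrt 2*(J/a) = - (sqrt y1 * sqrt y2)"
  proof -
    have "(sqrt 2*(J/a))^2 = 2*J^2/(- y3)" by (simp add: power_mult_distrib power_divide a)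
    also have "... = y1*y2" using sums(3) y3 by (simp add: field_simps)
    also have "... = (sqrt y1 * sqrt y2)^2" using y1 signs by (simp add: power_mult_distrib)
    finally show ?thesis by (simp add: power2_eq_iff)
  qed
  have q: "cis (2*(sqrt y1 * sqrt y2)*I) = -1" unfolding I_def by (rule cis_quarter[OF y1])
  have q': "cis (2*- (sqrt y1 * sqrt y2)*I) = -1" using arg_cong[OF q, of cnj] by (simp add: cis_cnj)
  have "cis (2*(sqrt 2*(J/a))*I) = -1" using X q q' by metis
  then have "cis (Phi_of (J, E)) = - cis (Psi_of (J, E))" unfolding Ph cis_mult[symmetric] by simp
  moreover have "cis (p*T) = - cis (Psi_of (J, E))"
    using T_pos False by (simp add: p_of_def T_of_eq cis_mult[symmetric])
  ultimately show ?thesis unfolding tht_half by simp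
qed

definition "W x = of_real (sqrt (y x))*cis (tht x)"
text \<open>The logarithmic derivative of \<open>W\<close>; its derivative below is the Riccati form
  of the wave equation.\<close>

definition "rh x = (of_real (y' x/2) + \<i> * of_real J)/of_real (y x)"

lemma norm_W: "(cmod (W x))^2 = y x" using O.ypos[of x] by (simp add: W_def norm_mult)

lemma W_nz: "W x ~= 0" using norm_W[of x] O.ypos[of x] by auto

lemma dW: "(W has_vector_derivative W x*rh x) (at x)"
proof -
  have "((%x. sqrt (y x)) has_real_derivative inverse (sqrt (y x))/2*y' x) (at x)"
    by (rule DERIV_chain2[OF DERIV_real_sqrt[OF O.ypos] dy])
  from has_vector_derivative_mult[OF has_vector_derivative_of_real[OF this] has_vector_derivative_cis[OF tht(2)]]
  have "(W has_vector_derivative of_real (sqrt (y x))*(\<i> * of_real (J/y x)*cis (tht x)) +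
      of_real (inverse (sqrt (y x))/2*y' x)*cis (tht x)) (at x)" unfolding W_def[abs_def] .
  moreover have "of_real (sqrt (y x))*(\<i> * of_real (J/y x)*cis (tht x)) +
      of_real (inverse (sqrt (y x))/2*y' x)*cis (tht x) = W x*rh x"
  proof -
    have "of_real (inverse (sqrt (y x))/2*y' x) = complex_of_real (sqrt (y x)*(y' x/2/y x))"
      using O.ypos[of x] by (simp add: field_simps flip: of_real_mult)
    then show ?thesis by (simp add: W_def rh_def field_simps O.ynz)
  qed
  ultimately show ?thesis by simp
qed

lemma drh: "(rh has_vector_derivative of_real (1 - y x) - rh x*rh x) (at x)"
proof -
  have 1: "((%x. y' x/2) has_real_derivative (- 3*(y x)^2 + 4*y x + 4*E)/2) (at x)" by (intro DERIV_cdivide dy'')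
  have 2: "((%x. inverse (y x)) has_real_derivative - (inverse (y x)*y' x*inverse (y x))) (at x)"
    by (intro DERIV_inverse' dy O.ynz)
  have 3: "((%x. of_real (y' x/2) + \<i> * of_real J) has_vector_derivative
      of_real ((- 3*(y x)^2 + 4*y x + 4*E)/2) + 0) (at x)"
    by (intro has_vector_derivative_add has_vector_derivative_of_real 1 has_vector_derivative_const)
  have rhe: "rh = (%x. (of_real (y' x/2) + \<i> * of_real J) * of_real (inverse (y x)))"
    by (rule ext) (simp only: rh_def divide_inverse of_real_inverse)
  have "(rh has_vector_derivative (of_real (y' x/2) + \<i> * of_real J) * of_real (- (inverse (y x)*y' x*inverse (y x)))
     + (of_real ((- 3*(y x)^2 + 4*y x + 4*E)/2) + 0) * of_real (inverse (y x))) (at x)"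
    unfolding rhe by (rule has_vector_derivative_mult[OF 3 has_vector_derivative_of_real[OF 2]])
  moreover have "(of_real (y' x/2) + \<i> * of_real J) * of_real (- (inverse (y x)*y' x*inverse (y x)))
     + (of_real ((- 3*(y x)^2 + 4*y x + 4*E)/2) + 0) * of_real (inverse (y x)) = of_real (1 - y x) - rh x*rh x"
  proof (rule complex_eqI)
    have f: "y' x*y' x = 2*(- ((y x)^3) + 2*(y x)^2 + 4*E*y x - 2*J^2)" using fi'[of x] by (simp add: power2_eq_square)
    define q where "q = inverse (y x)"
    have q: "q*y x = 1" using O.ynz[of x] by (simp add: q_def)
    have R: "Re (rh x) = y' x/2*q" "Im (rh x) = J*q" unfolding rhe q_def[symmetric] by simp_all
    have "y' x/2*- (q*y' x*q) + (- 3*(y x)^2 + 4*y x + 4*E)/2*q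
      = 1 - y x - ((y' x/2*q)*(y' x/2*q) - J*q*(J*q))"
    proof -
      have q1: "(y x)^2*q = y x" using q by algebra
      have A: "y' x*y' x*q^2 = 2*(- y x + 2 + 4*E*q - 2*J^2*q^2)" using f q by algebra
      have "y' x/2*- (q*y' x*q) + (- 3*(y x)^2 + 4*y x + 4*E)/2*q
         = - (y' x*y' x*q^2)/2 + (- 3*((y x)^2*q) + 4*(q*y x) + 4*E*q)/2" by (simp add: field_simps power2_eq_square)
      also have "... = 1 - y x - (y' x*y' x*q^2/4 - J^2*q^2)" unfolding A q1 q by (simp add: field_simps)
      finally show ?thesis by (simp add: power2_eq_square mult_ac)
    qed
    then show "Re ((of_real (y' x/2) + \<i> * of_real J) * of_real (- (inverse (y x)*y' x*inverse (y x)))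
       + (of_real ((- 3*(y x)^2 + 4*y x + 4*E)/2) + 0) * of_real (inverse (y x))) = Re (of_real (1 - y x) - rh x*rh x)"
      unfolding q_def[symmetric] by (simp add: R)
    show "Im ((of_real (y' x/2) + \<i> * of_real J) * of_real (- (inverse (y x)*y' x*inverse (y x)))
       + (of_real ((- 3*(y x)^2 + 4*y x + 4*E)/2) + 0) * of_real (inverse (y x))) = Im (of_real (1 - y x) - rh x*rh x)"
      unfolding q_def[symmetric] by (simp add: R)
  qed
  ultimately show ?thesis by simp
qed

lemma rhR: "Re (rh x) = y' x/(2*y x)" and rhI: "Im (rh x) = J/y x"
proof -
  have "rh x = of_real (y' x/(2*y x)) + \<i> * of_real (J/y x)" using O.ynz[of x] by (simp add: rh_def field_simps)
  then show "Re (rh x) = y' x/(2*y x)" "Im (rh x) = J/y x" by simp_all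
qed

lemma cnj_W: "cnj (W x)*W x = of_real (y x)" by (metis complex_norm_square mult.commute norm_W of_real_power)

lemma W_W1: "cnj (W x)*(W x*rh x) = of_real (y' x/2) + \<i> * of_real J"
  unfolding mult.assoc[symmetric] cnj_W by (simp add: rh_def O.ynz)

lemma W_quasi: "W (x + T) = cis (p*T)*W x" unfolding W_def cis_p y_shift tht_shift cis_mult[symmetric] by simp

text \<open>With \<open>w = W*c\<close> and \<open>c = a + i*b\<close> periodic, \<open>quad\<close>
  becomes the density of \<open>pair_pos\<close> plus the derivative of a periodic function. The
  constraints become those of \<open>pair_pos\<close>, the second one after integrating
  \<open>y'*b\<close> by parts.\<close>

lemma good_wave_A: "good_wave J E T p W (%x. W x*rh x)"
proof
  show "T > 0" by (rule T_pos)
  show "(W has_vector_derivative W x*rh x) (at x)" for x by (rule dW)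
  show "((%x. W x*rh x) has_vector_derivative W x - of_real ((cmod (W x))^2)*W x) (at x)" for x
    using has_vector_derivative_mult[OF dW drh, of x] by (simp add: norm_W algebra_simps)
  show "Im (cnj (W x)*(W x*rh x)) = J" for x unfolding W_W1 by simp
  show "(cmod (W x*rh x))^2/2 - (cmod (W x))^2/2 + (cmod (W x))^4/4 = E" for x
  proof -
    have n4: "(cmod (W x))^4 = (y x)^2" unfolding norm_W[symmetric] by simp
    have "(cmod (W x*rh x))^2 = y x*((y' x/(2*y x))^2 + (J/y x)^2)"
      unfolding norm_mult power_mult_distrib norm_W cmod_power2[of "rh x"] rhR rhI ..
    also have "... = ((y' x)^2/4 + J^2)/y x" using O.ynz[of x] by (simp add: field_simps power2_eq_square)
    also have "... = - ((y x)^2)/2 + y x + 2*E"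
      unfolding fi' using O.ynz[of x] by (simp add: field_simps power2_eq_square power3_eq_cube)
    finally show ?thesis unfolding norm_W n4 by (simp add: field_simps)
  qed
  show "W (x + T) = cis (p*T)*W x" for x by (rule W_quasi)
  show "EX x z. cmod (W x) ~= cmod (W z)"
  proof -
    have "(cmod (W 0))^2 ~= (cmod (W (T/2)))^2" unfolding norm_W y_vals using signs by simp
    then show ?thesis by metis
  qed
  show "EX x. (cmod (W x))^2 = t & 2 * Re (cnj (W x)*(W x*rh x)) = z"
    if tz: "0 < t" "z^2 = 2*(- (t^3) + 2*t^2 + 4*E*t - 2*J^2)" for t z
  proof -
    obtain x where "y x = t" "y' x = z" using attained[OF tz] by blast
    then show ?thesis unfolding norm_W W_W1 by (intro exI[of _ x]) simp
  qed
  fix w g :: "real => complex"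
  assume wg: "acd (- (T/2)) (T/2) w g" and wT: "w (T/2) = cis (p*T)*w (- (T/2))"
    and n1: "integral {- (T/2)..T/2} (%x. Re (cnj (W x)*w x)) = 0"
    and n2: "integral {- (T/2)..T/2} (%x. Im (cnj (w x)*(W x*rh x))) = 0"
  let ?I = "{- (T/2)..T/2}"
  have cW: "continuous_on S W" for S
    by (intro continuous_at_imp_continuous_on ballI) (use dW has_vector_derivative_continuous in blast)
  have crh: "continuous_on S rh" for S
    by (intro continuous_at_imp_continuous_on ballI) (use drh has_vector_derivative_continuous in blast)
  have iW: "acd (- (T/2)) (T/2) (%x. inverse (W x)) (%x. - rh x*inverse (W x))"
  proof (rule acdI)
    fix x
    have "((%x. inverse (W x)) has_vector_derivative (W x*rh x)*- (inverse (W x)*inverse (W x))) (at x)"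
      using field_vector_diff_chain_at[OF dW DERIV_inverse[OF W_nz]] by (simp add: o_def power2_eq_square)
    moreover have "(W x*rh x)*- (inverse (W x)*inverse (W x)) = - rh x*inverse (W x)"
      using W_nz[of x] by (simp add: field_simps)
    ultimately have "((%x. inverse (W x)) has_vector_derivative - rh x*inverse (W x)) (at x)" by (simp only:)
    then show "((%x. inverse (W x)) has_vector_derivative - rh x*inverse (W x)) (at x within ?I)"
      by (rule has_vector_derivative_at_within)
  qed (use W_nz in \<open>auto intro!: continuous_intros cW crh\<close>)
  define c where "c x = w x*inverse (W x)" for x
  define gc where "gc x = g x*inverse (W x) + w x*(- rh x*inverse (W x))" for x
  have cgc: "acd (- (T/2)) (T/2) c gc" unfolding c_def gc_def by (rule acd_mult[OF wg iW])
  have wc: "w x = W x*c x" for x using W_nz[of x] by (simp add: c_def)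
  have ggc: "g x = W x*(gc x + rh x*c x)" for x using W_nz[of x] by (simp add: c_def gc_def field_simps)
  define a ga b gb where "a x = Re (c x)" and "ga x = Re (gc x)" and "b x = Im (c x)" and "gb x = Im (gc x)" for x
  have aga: "acd (- (T/2)) (T/2) a ga" and bgb: "acd (- (T/2)) (T/2) b gb" unfolding a_def ga_def b_def gb_def
    using acd_linear[OF cgc bounded_linear_Re] acd_linear[OF cgc bounded_linear_Im] by auto
  have cper: "c (T/2) = c (- (T/2))"
  proof -
    have "W (T/2) = cis (p*T)*W (- (T/2))" using W_quasi[of "- (T/2)"] by simp
    moreover have "(K * v)*inverse (K*u) = v * inverse u" if "K ~= 0" "u ~= 0" for K v u :: complex
      using that by (simp add: field_simps)
    ultimately show ?thesis unfolding c_def wT using cis_neq_zero W_nz by metis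
  qed
  then have per: "a (- (T/2)) = a (T/2)" "b (- (T/2)) = b (T/2)" by (auto simp: a_def b_def)
  have ca: "continuous_on ?I a" and cb: "continuous_on ?I b" using aga bgb acd_continuous by auto
  have R: "Re (cnj (W x)*w x) = y x*a x" for x
  proof -
    have "cnj (W x)*w x = of_real (y x)*c x" unfolding wc mult.assoc[symmetric] cnj_W ..
    then show ?thesis by (simp add: a_def)
  qed
  have c1: "integral ?I (%x. y x*a x) = 0" using n1 unfolding R .
  have I2: "Im (cnj (w x)*(W x*rh x)) = J*a x - b x*y' x/2" for x
  proof -
    have "cnj (w x)*(W x*rh x) = (cnj (W x)*W x)*(cnj (c x)*rh x)"
      unfolding wc complex_cnj_mult by (simp only: mult.assoc mult.left_commute[of "cnj (c x)"])
    then have e: "cnj (w x)*(W x*rh x) = of_real (y x)*(cnj (c x)*rh x)" unfolding cnj_W .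
    have "Im (cnj (w x)*(W x*rh x)) = y x*(a x*(J/y x) - b x*(y' x/(2*y x)))"
      unfolding e by (simp add: a_def b_def rhR rhI)
    also have "... = J*a x - b x*y' x/2" using O.ynz[of x] by (simp add: field_simps)
    finally show ?thesis .
  qed
  have c2: "integral ?I (%x. 2*J*a x + y x*gb x) = 0"
  proof -
    have "acd (- (T/2)) (T/2) y y'" by (rule acdI_real[OF dy O.cy'])
    from acd_parts[OF this bgb] T_pos
    have z: "integral ?I (%x. y' x*b x + y x*gb x) = 0" by (simp add: per(2) y_even)
    have i1: "(%x. y' x*b x + y x*gb x) integrable_on ?I"
      by (intro integrable_add integrable_continuous_real continuous_intros O.cy' cb sqint_int[OF sqint_mult_bounded[OF O.cy acd_sqint[OF bgb]]])
    have i2: "(%x. J*a x - b x*y' x/2) integrable_on ?I"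
      by (intro integrable_continuous_real continuous_intros O.cy' cb ca) auto
    have "integral ?I (%x. 2*J*a x + y x*gb x) = integral ?I (%x. (y' x*b x + y x*gb x) + 2*(J*a x - b x*y' x/2))"
      by (rule arg_cong[of _ _ "integral _"]) (auto simp: field_simps)
    also have "... = integral ?I (%x. y' x*b x + y x*gb x) + 2*integral ?I (%x. J*a x - b x*y' x/2)"
      by (subst integral_add[OF i1 integrable_on_mult_right[OF i2]]) (simp only: integral_mult_right)
    also have "... = 0" using z n2 unfolding I2 by simp
    finally show ?thesis .
  qed
  have adm: "O.adm (a, ga)" using aga per by (simp add: O.adm_def)
  \<comment> \<open>The derivative of \<open>y'/2*(a^2 + b^2) - 2*J*a*b\<close>. The first term
    absorbs the products \<open>a*a'\<close> and \<open>b*b'\<close>; the second turns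
    \<open>2*J*(a*b' - b*a')\<close> into \<open>4*J*a*b'\<close>.\<close>
  define DK where "DK x = ((- 3*(y x)^2 + 4*y x + 4*E)/2*(a x*a x + b x*b x)
     + y' x/2*((ga x*a x + a x*ga x) + (gb x*b x + b x*gb x))) - 2*J*(ga x*b x + a x*gb x)" for x
  have aK: "acd (- (T/2)) (T/2) (%x. y' x/2*(a x*a x + b x*b x) - 2*J*(a x*b x)) DK" unfolding DK_def
  proof (intro acd_diff acd_mult acd_add acd_cmult aga bgb acdI_real)
    show "((%x. y' x/2) has_real_derivative (- 3*(y x)^2 + 4*y x + 4*E)/2) (at x)" for x by (intro DERIV_cdivide dy'')
  qed (auto intro!: continuous_intros O.cy)
  have K0: "integral ?I DK = 0" using acd_eq[OF aK, of "- (T/2)" "T/2"] T_pos by (simp add: per O.y'0 O.odd)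
  have "quad W w g x = (y x*(ga x)^2 + y x*(gb x)^2 + 4*J*a x*gb x - 2*(y x)^2*(a x)^2) + DK x" for x
  proof -
    have g2: "(cmod (g x))^2 = y x*((ga x + (y' x/(2*y x)*a x - J/y x*b x))^2 + (gb x + (y' x/(2*y x)*b x + J/y x*a x))^2)"
      unfolding ggc norm_mult power_mult_distrib norm_W by (simp add: cmod_power2 rhR rhI a_def b_def ga_def gb_def)
    have w2: "(cmod (w x))^2 = y x*((a x)^2 + (b x)^2)"
      unfolding wc norm_mult power_mult_distrib norm_W by (simp add: cmod_power2 a_def b_def)
    have e: "y x*((ga x + (y' x/(2*y x)*a x - J/y x*b x))^2 + (gb x + (y' x/(2*y x)*b x + J/y x*a x))^2)
      = y x*((ga x)^2 + (gb x)^2) + y' x*(a x*ga x + b x*gb x) + 2*J*(a x*gb x - b x*ga x)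
        + ((y' x)^2/4 + J^2)/y x*((a x)^2 + (b x)^2)" using O.ynz[of x] by (simp add: field_simps power2_eq_square)
    have f: "((y' x)^2/4 + J^2)/y x = - ((y x)^2)/2 + y x + 2*E"
      unfolding fi' using O.ynz[of x] by (simp add: field_simps power2_eq_square power3_eq_cube)
    show ?thesis unfolding quad_def g2 w2 R norm_W e f DK_def by (simp add: field_simps power2_eq_square)
  qed
  then have qe: "quad W w g = (%x. (y x*(ga x)^2 + y x*(gb x)^2 + 4*J*a x*gb x - 2*(y x)^2*(a x)^2) + DK x)" by auto
  have i1: "(%x. y x*(ga x)^2 + y x*(gb x)^2 + 4*J*a x*gb x - 2*(y x)^2*(a x)^2) integrable_on ?I"
  proof -
    note sa = acd_sqint[OF aga] and sb = acd_sqint[OF bgb]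
    have ca4: "continuous_on ?I (%x. 4*J*a x)" by (intro continuous_intros ca)
    have "(%x. y x*ga x*ga x) integrable_on ?I" "(%x. y x*gb x*gb x) integrable_on ?I"
      by (intro sqint_times_integrable sqint_mult_bounded O.cy sa sb)+
    moreover have "(%x. 4*J*a x*gb x) integrable_on ?I" by (intro sqint_int sqint_mult_bounded ca4 sb)
    moreover have "(%x. 2*(y x)^2*(a x)^2) integrable_on ?I" by (intro integrable_continuous_real continuous_intros O.cy ca)
    ultimately show ?thesis
      by (simp only: power2_eq_square[of "ga _"] power2_eq_square[of "gb _"] mult.assoc[symmetric] integrable_add integrable_diff)
  qed
  have qi: "integral ?I (quad W w g) = integral ?I (%x. y x*(ga x)^2 + y x*(gb x)^2 + 4*J*a x*gb x - 2*(y x)^2*(a x)^2)"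
    unfolding qe using integral_add[OF i1 sqint_int[OF acd_sqint[OF aK]]] K0 by simp
  have ml: "- (T/2) = - (T/2)" ..
  note PP = O.pair_pos[OF adm bgb per(2) c1 c2, folded qi]
  show "0 <= integral ?I (quad W w g) &
        (integral ?I (quad W w g) <= 0 -->
          (EX al be. ALL x:?I. w x = of_real al*(\<i>*W x) + of_real be*(W x*rh x)))"
  proof (intro conjI impI)
    show "0 <= integral ?I (quad W w g)" by (rule PP(1))
    assume "integral ?I (quad W w g) <= 0"
    then obtain k d where kd: "!!x. x \<in> ?I ==> a x = k*O.psi x & b x = 2*J*k/y x + d" using PP(2) by blast
    \<comment> \<open>The factor 2 appears because the real part of \<open>rh\<close> is half of
      \<open>psi\<close>.\<close>
    have "w x = of_real d*(\<i>*W x) + of_real (2*k)*(W x*rh x)" if "x \<in> ?I" for x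
    proof -
      have "c x = \<i> * of_real d + of_real (2*k)*rh x"
        using kd[OF that] by (simp add: complex_eq_iff a_def[symmetric] b_def[symmetric] rhR rhI O.psi_def)
      then show ?thesis unfolding wc by (simp add: algebra_simps)
    qed
    then show "EX al be. ALL x:?I. w x = of_real al*(\<i>*W x) + of_real be*(W x*rh x)" by blast
  qed
qed

end

end

section \<open>Waves with zeros\<close>

context dpoint
begin

context
  assumes y10: "~ y1 > 0"
begin

lemma y1_0: "y1 = 0" using y10 signs by simp
lemma J0: "J = 0" using sums(3) y1_0 by simp
lemma y3_neg: "y3 < 0" using roots(2) y1_0 by simp
lemma y2_pos: "y2 > 0" using signs y1_0 by simp
lemma E_eq: "4*E = - y2*y3" using sums(2) y1_0 by simp
lemma E_pos: "E > 0" using E_eq mult_pos_neg[OF y2_pos y3_neg] by simp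
lemma y23: "y3 = 2 - y2" using sums(1) y1_0 by simp

text \<open>The smooth square root of \<open>y\<close>, changing sign at each zero.\<close>

definition "u x = sqrt y2 * sin (ph x)"
definition "u' x = sqrt y2*cos (ph x) * omg x"

lemma om_sq: "(omg x)^2 = (y2*(sin (ph x))^2 - y3)/2" unfolding omg_sq s_def using y1_0 by simp

lemma y_sin: "y x = y2*(sin (ph x))^2" unfolding y_def s_def using y1_0 by simp

lemma u_sq: "(u x)^2 = y x" unfolding u_def y_sin using y2_pos by (simp add: power_mult_distrib)

lemma du: "(u has_real_derivative u' x) (at x)"
  unfolding u_def[abs_def] u'_def by (auto intro!: derivative_eq_intros dph)

lemma du': "(u' has_real_derivative u x - (u x)^3) (at x)"
proof -
  have "(u' has_real_derivative sqrt y2*(- sin (ph x)*(omg x)^2 + cos (ph x)*((y2 - y1) * sin (ph x)*cos (ph x)/2))) (at x)"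
    unfolding u'_def[abs_def] by (auto intro!: derivative_eq_intros dph domg simp: power2_eq_square algebra_simps)
  moreover have "sqrt y2*(- sin (ph x)*(omg x)^2 + cos (ph x)*((y2 - y1) * sin (ph x)*cos (ph x)/2)) = u x - (u x)^3"
  proof -
    have S: "(cos (ph x))^2 = 1 - (sin (ph x))^2" by (simp add: cos_squared_eq)
    have "sqrt y2*(- sin (ph x)*(omg x)^2 + cos (ph x)*((y2 - y1) * sin (ph x)*cos (ph x)/2))
      = u x*(- (omg x)\<^sup>2 + y2*(cos (ph x))^2/2)" by (simp add: u_def y1_0 algebra_simps power2_eq_square)
    also have "- (omg x)\<^sup>2 + y2*(cos (ph x))^2/2 = 1 - y2*(sin (ph x))^2"
      unfolding om_sq S using y23 by (simp add: field_simps)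
    also have "y2*(sin (ph x))^2 = (u x)^2" using y2_pos by (simp add: u_def power_mult_distrib)
    finally show ?thesis by (simp add: algebra_simps power2_eq_square power3_eq_cube)
  qed
  ultimately show ?thesis by simp
qed

lemma u'_sq: "(u' x)^2 = 2*E + (u x)^2 - (u x)^4/2"
proof -
  have S: "(cos (ph x))^2 = 1 - (sin (ph x))^2" by (simp add: cos_squared_eq)
  have u4: "(u x)^4 = (y x)^2" unfolding u_sq[symmetric] by simp
  define S where "S = (sin (ph x))^2"
  have "(u' x)^2 = y2*(1 - S)*((y2*S - y3)/2)" unfolding u'_def power_mult_distrib om_sq S S_def using y2_pos by simp
  moreover have "y2*(1 - S)*((y2*S - y3)/2) = 2*E + y2*S - (y2*S)^2/2"
  proof -
    have e: "2*E = - y2*y3/2" using E_eq by simp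
    have s: "(y2 + y3)/2 = 1" using y23 by simp
    have "y2*(1 - S)*((y2*S - y3)/2) = - y2*y3/2 + y2*S*((y2 + y3)/2) - (y2*S)^2/2"
      by (simp add: field_simps power2_eq_square)
    then show ?thesis unfolding e s by simp
  qed
  ultimately show ?thesis unfolding u4 u_sq y_sin S_def by simp
qed

lemma u_odd: "u (- x) = - u x" by (simp add: u_def ph_minus)

lemma u'_even: "u' (- x) = u' x" by (simp add: u'_def ph_minus omg_def s_minus)

definition "cl = sqrt y2*c1^2/(2*T)"

lemma cl_pos: "cl > 0" using y2_pos c1_pos T_pos by (simp add: cl_def)

lemma u'_low0: assumes "0 <= x" "x <= T/2" shows "cl*((x + T/2)*(T/2 - x)) <= u' x"
proof -
  have nn: "0 <= c1/2*(T/2 - x)" using c1_pos assms by simp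
  have "cl*((x + T/2)*(T/2 - x)) <= cl*(T*(T/2 - x))"
    using cl_pos assms by (intro mult_left_mono mult_right_mono) auto
  also have "... = sqrt y2*((c1/2*(T/2 - x))*c1)" using T_pos by (simp add: cl_def power2_eq_square)
  also have "... <= sqrt y2*(cos (ph x) * omg x)"
  proof (intro mult_left_mono mult_mono)
    show "c1 <= omg x" using omg_ge[of x] by (simp only: c1_def)
    show "0 <= cos (ph x)" using order_trans[OF nn cosph_ge[OF assms]] .
  qed (use cosph_ge[OF assms] omg_ge[of x] nn c1_pos y2_pos in auto)
  finally show ?thesis by (simp add: u'_def mult.assoc)
qed

lemma u'_low: assumes "- (T/2) <= x" "x <= T/2" shows "cl*((x + T/2)*(T/2 - x)) <= u' x"
proof (cases "0 <= x")
  case True then show ?thesis using u'_low0 assms by simp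
next
  case False
  then have "cl*((- x + T/2)*(T/2 - - x)) <= u' (- x)" using assms by (intro u'_low0) auto
  then show ?thesis unfolding u'_even by (simp add: algebra_simps)
qed

interpretation C: cnwave u u' E "T/2" cl
proof
  show "u' (T/2) = 0" by (simp add: u'_def ph_vals)
qed (use T_pos E_pos du du' u'_sq u_odd cl_pos u'_low in auto)

lemma good_wave_B: "good_wave J E T p (%x. of_real (u x)) (%x. of_real (u' x))"
proof
  have G: "(J, E) \<notin> Gamma_minus" using E_pos by (simp add: Gamma_minus_def)
  \<comment> \<open>\<open>Psi_of\<close> carries the factor \<open>J = 0\<close>, so
    \<open>p*T = pi\<close>, which matches the sign change of \<open>u\<close> over a period of the
    modulus.\<close>
  then have cp: "cis (p*T) = -1"
  proof -
    have "Psi_of (J, E) = - 2 * sqrt 2*J*(integral {0..pi/2}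
     (%ph. 1/(sqrt (- y3_of (J, E)) * sqrt (s_of (J, E) ph - y3_of (J, E)) *
                (sqrt (- y3_of (J, E)) + sqrt (s_of (J, E) ph - y3_of (J, E))))))" unfolding Psi_of_def fst_conv ..
    also have "... = 0" using J0 by (simp only: mult_zero_right mult_zero_left)
    finally have Psi: "Psi_of (J, E) = 0" .
    have "p*T = pi" using G T_pos unfolding p_of_def T_of_eq Psi by simp
    then show ?thesis by simp
  qed
  show "T > 0" by (rule T_pos)
  show "((%x. complex_of_real (u x)) has_vector_derivative of_real (u' x)) (at x)" for x
    by (intro has_vector_derivative_of_real du)
  show "((%x. complex_of_real (u' x)) has_vector_derivative
      of_real (u x) - of_real ((cmod (of_real (u x)))^2) * of_real (u x)) (at x)" for x
    using has_vector_derivative_of_real[OF du', of x] by (simp add: power3_eq_cube power2_eq_square)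
  show "Im (cnj (of_real (u x)) * of_real (u' x)) = J" for x using J0 by simp
  show "(cmod (of_real (u' x)))^2/2 - (cmod (of_real (u x)))^2/2 + (cmod (of_real (u x)))^4/4 = E" for x
    using u'_sq[of x] by (simp add: field_simps)
  show "complex_of_real (u (x + T)) = cis (p*T) * of_real (u x)" for x unfolding cp by (simp add: u_def ph_shift)
  show "EX x z. cmod (of_real (u x)) ~= cmod (of_real (u z))"
    using y2_pos by (intro exI[of _ 0] exI[of _ "T/2"]) (simp add: u_def ph_vals)
  show "EX x. (cmod (of_real (u x)))^2 = t & 2 * Re (cnj (of_real (u x)) * of_real (u' x)) = z"
    if tz: "0 < t" "z^2 = 2*(- (t^3) + 2*t^2 + 4*E*t - 2*J^2)" for t z
  proof -
    obtain x where x: "y x = t" "y' x = z" using attained[OF tz] by blast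
    have "2*(u x*u' x) = y' x"
    proof -
      have r: "sqrt y2 * sqrt y2 = y2" using y2_pos by simp
      have "2*(u x*u' x) = 2*(sqrt y2 * sqrt y2)*(sin (ph x)*cos (ph x) * omg x)"
        by (simp only: u_def u'_def ac_simps)
      then show ?thesis unfolding r y'_def using y1_0 by simp
    qed
    then show ?thesis using x u_sq[of x] by (intro exI[of _ x]) simp
  qed
  fix w g :: "real => complex"
  let ?I = "{- (T/2)..T/2}" and ?W = "%x. complex_of_real (u x)"
  assume wg: "acd (- (T/2)) (T/2) w g" and wT: "w (T/2) = cis (p*T)*w (- (T/2))"
    and n1: "integral ?I (%x. Re (cnj (of_real (u x))*w x)) = 0"
  define p1 where "p1 = (%x. Re (w x), %x. Re (g x))"
  define p2 where "p2 = (%x. Im (w x), %x. Im (g x))"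
  have a1: "C.adm p1" and a2: "C.adm p2" unfolding C.adm_def p1_def p2_def
    using acd_linear[OF wg bounded_linear_Re] acd_linear[OF wg bounded_linear_Im] wT cp by auto
  have B: "C.B p1 = 0" using n1 by (simp add: C.B_def p1_def)
  have "quad ?W w g = (%x. (snd p1 x * snd p1 x + (1 - 3*(u x)^2)*(fst p1 x*fst p1 x)) +
     (snd p2 x * snd p2 x + (1 - 1*(u x)^2)*(fst p2 x*fst p2 x)))" unfolding quad_def[abs_def] cmod_power2
    by (auto simp: fun_eq_iff p1_def p2_def algebra_simps power2_eq_square)
  then have q: "integral ?I (quad ?W w g) = C.Sf 3 p1 p1 + C.Sf 1 p2 p2" unfolding C.Sf_def
    using integral_add[OF C.Sf_integrable[OF a1 a1, of 3] C.Sf_integrable[OF a2 a2, of 1]] by simp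
  note P = C.plus_pos[OF a1 B] C.minus_pos[OF a2]
  show "0 <= integral ?I (quad ?W w g) & (integral ?I (quad ?W w g) <= 0 -->
          (EX al be. ALL x:?I. w x = of_real al*(\<i>*?W x) + of_real be * of_real (u' x)))"
  proof (intro conjI impI)
    show "0 <= integral ?I (quad ?W w g)" using q P by simp
    assume le: "integral ?I (quad ?W w g) <= 0"
    then have "C.Sf 3 p1 p1 <= 0" "C.Sf 1 p2 p2 <= 0" using q P(1,3) by linarith+
    then obtain c d where cd: "!!x. x \<in> ?I ==> fst p1 x = c*u' x" "!!x. x \<in> ?I ==> fst p2 x = d*u x"
      using P(2,4) by blast
    have "w x = of_real d*(\<i>*?W x) + of_real c * of_real (u' x)" if "x \<in> ?I" for x
      using cd[OF that] by (simp add: complex_eq_iff p1_def p2_def)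
    then show "EX al be. ALL x:?I. w x = of_real al*(\<i>*?W x) + of_real be * of_real (u' x)" by blast
  qed
qed

end

lemma good_wave_ex: "EX W W1. good_wave J E T p W W1" using good_wave_A good_wave_B by blast

end

section \<open>Uniqueness of the wave up to phase and translation\<close>

lemma gronwall_zero:
  fixes G G' :: "real => real"
  assumes d: "!!x. x \<in> {a..b} ==> (G has_real_derivative G' x) (at x)"
    and bd: "!!x. x \<in> {a..b} ==> \<bar>G' x\<bar> <= C*G x" and nn: "!!x. G x >= 0"
    and c: "c \<in> {a..b}" "G c = 0" and x: "x \<in> {a..b}"
  shows "G x = 0"
proof (cases "c <= x")
  case True
  have "G x*exp (- C*x) <= G c*exp (- C*c)"
  proof (rule DERIV_nonpos_imp_nonincreasing[OF True])
    fix t assume t: "c <= t" "t <= x"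
    then have ti: "t \<in> {a..b}" using c x by auto
    have "((%x. G x*exp (- C*x)) has_real_derivative (G' t - C*G t)*exp (- C*t)) (at t)"
      by (auto intro!: derivative_eq_intros d[OF ti] simp: algebra_simps)
    moreover have "(G' t - C*G t)*exp (- C*t) <= 0" using bd[OF ti] by (simp add: mult_le_0_iff)
    ultimately show "EX y. ((%x. G x*exp (- C*x)) has_real_derivative y) (at t) & y <= 0" by blast
  qed
  then have "G x <= 0" using c by (simp add: mult_le_0_iff)
  then show ?thesis using nn[of x] by simp
next
  case False
  then have "x <= c" by simp
  then have "G x*exp (C*x) <= G c*exp (C*c)"
  proof (rule DERIV_nonneg_imp_nondecreasing)
    fix t assume t: "x <= t" "t <= c"
    then have ti: "t \<in> {a..b}" using c x by auto
    have "((%x. G x*exp (C*x)) has_real_derivative (G' t + C*G t)*exp (C*t)) (at t)"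
      by (auto intro!: derivative_eq_intros d[OF ti] simp: algebra_simps)
    moreover have "(G' t + C*G t)*exp (C*t) >= 0" using bd[OF ti] by (simp add: zero_le_mult_iff abs_le_iff)
    ultimately show "EX y. ((%x. G x*exp (C*x)) has_real_derivative y) (at t) & 0 <= y" by blast
  qed
  then have "G x <= 0" using c by (simp add: mult_le_0_iff)
  then show ?thesis using nn[of x] by simp
qed

lemma cubic_lipschitz:
  fixes u v :: complex
  assumes "cmod u <= M" "cmod v <= M"
  shows "cmod (of_real ((cmod v)^2) * v - of_real ((cmod u)^2)*u) <= 3*M^2*cmod (v - u)"
proof -
  have M: "0 <= M" using assms(1) norm_ge_zero order_trans by blast
  have "of_real ((cmod v)^2) * v - of_real ((cmod u)^2)*u
    = of_real ((cmod v)^2)*(v - u) + of_real ((cmod v - cmod u)*(cmod v + cmod u))*u"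
    by (simp add: algebra_simps power2_eq_square)
  then have "cmod (of_real ((cmod v)^2) * v - of_real ((cmod u)^2)*u)
    <= (cmod v)^2*cmod (v - u) + \<bar>cmod v - cmod u\<bar> * \<bar>cmod v + cmod u\<bar>*cmod u"
    by (metis (no_types, lifting) norm_triangle_ineq norm_mult norm_of_real abs_mult abs_power2)
  also have "... <= M^2*cmod (v - u) + cmod (v - u)*(2*M)*M" using assms M norm_triangle_ineq3[of v u]
    by (intro add_mono mult_mono mult_right_mono power_mono mult_nonneg_nonneg) auto
  finally show ?thesis by (simp add: power2_eq_square algebra_simps)
qed

lemma norm_sq_has_derivative:
  fixes f :: "real => complex"
  assumes "(f has_vector_derivative f') (at x)"
  shows "((%x. (cmod (f x))^2) has_real_derivative 2 * Re (cnj (f x)*f')) (at x)"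
proof -
  have r: "((%x. Re (f x)) has_real_derivative Re f') (at x)" "((%x. Im (f x)) has_real_derivative Im f') (at x)"
    using bounded_linear.has_vector_derivative[OF bounded_linear_Re assms]
      bounded_linear.has_vector_derivative[OF bounded_linear_Im assms]
    by (simp_all add: has_real_derivative_iff_has_vector_derivative)
  show ?thesis unfolding cmod_power2
    using DERIV_add[OF DERIV_power[OF r(1), of 2] DERIV_power[OF r(2), of 2]] by (simp add: mult_ac)
qed

text \<open>Gronwall's argument for \<open>(cmod (D x))^2 + (cmod (D1 x))^2\<close> on a compact
  interval joining \<open>c\<close> and \<open>x\<close>, on which both solutions are bounded and
  the cubic term is Lipschitz.\<close>

lemma wave_ode_unique:
  fixes V V1 U U1 :: "real => complex"
  assumes V: "!!x. (V has_vector_derivative V1 x) (at x)"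
      "!!x. (V1 has_vector_derivative V x - of_real ((cmod (V x))^2)*V x) (at x)"
    and U: "!!x. (U has_vector_derivative U1 x) (at x)"
      "!!x. (U1 has_vector_derivative U x - of_real ((cmod (U x))^2)*U x) (at x)"
    and eq: "V c = U c" "V1 c = U1 c"
  shows "V x = U x"
proof -
  define a b where "a = min c x" and "b = max c x"
  define D D1 where "D x = V x - U x" and "D1 x = V1 x - U1 x" for x
  define N where "N x = (V x - of_real ((cmod (V x))^2)*V x) - (U x - of_real ((cmod (U x))^2)*U x)" for x
  have cV: "continuous_on {a..b} V" and cU: "continuous_on {a..b} U"
    using has_vector_derivative_continuous[OF V(1)] has_vector_derivative_continuous[OF U(1)]
    by (auto intro!: continuous_at_imp_continuous_on)
  have "bounded (V ` {a..b})" "bounded (U ` {a..b})"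
    using cV cU compact_continuous_image compact_imp_bounded compact_Icc by blast+
  then obtain M1 M2 where M12: "!!x. x \<in> {a..b} ==> cmod (V x) <= M1" "!!x. x \<in> {a..b} ==> cmod (U x) <= M2"
    unfolding bounded_iff by blast
  define M where "M = max M1 M2"
  have M: "cmod (V x) <= M" "cmod (U x) <= M" if "x \<in> {a..b}" for x using M12[OF that] by (auto simp: M_def)
  have dD: "(D has_vector_derivative D1 x) (at x)" and dD1: "(D1 has_vector_derivative N x) (at x)" for x
    unfolding D_def[abs_def] D1_def[abs_def] N_def by (intro has_vector_derivative_diff V U)+
  define C where "C = 2 + 3*M^2"
  have Nb: "cmod (N x) <= (1 + 3*M^2)*cmod (D x)" if "x \<in> {a..b}" for x
  proof -
    have "N x = D x - (of_real ((cmod (V x))^2)*V x - of_real ((cmod (U x))^2)*U x)" by (simp add: N_def D_def)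
    then have "cmod (N x) <= cmod (D x) + cmod (of_real ((cmod (V x))^2)*V x - of_real ((cmod (U x))^2)*U x)"
      by (metis norm_triangle_ineq4)
    also have "... <= cmod (D x) + 3*M^2*cmod (D x)" unfolding D_def using cubic_lipschitz[OF M(2,1)[OF that]] by simp
    finally show ?thesis by (simp add: algebra_simps)
  qed
  define G where "G x = (cmod (D x))^2 + (cmod (D1 x))^2" for x
  have "G x = 0"
  proof (rule gronwall_zero[where G=G and x=x and a=a and b=b and c=c and C=C
      and G'="%t. 2 * Re (cnj (D t)*D1 t) + 2 * Re (cnj (D1 t)*N t)"])
    fix t assume t: "t \<in> {a..b}"
    show "(G has_real_derivative 2 * Re (cnj (D t)*D1 t) + 2 * Re (cnj (D1 t)*N t)) (at t)"
      unfolding G_def[abs_def] by (intro DERIV_add norm_sq_has_derivative dD dD1)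
    have "\<bar>2 * Re (cnj (D t)*D1 t) + 2 * Re (cnj (D1 t)*N t)\<bar> <= 2*(cmod (D t)*cmod (D1 t)) + 2*(cmod (D1 t)*cmod (N t))"
      using abs_Re_le_cmod[of "cnj (D t)*D1 t"] abs_Re_le_cmod[of "cnj (D1 t)*N t"] by (simp add: norm_mult)
    also have "... <= 2*(cmod (D t)*cmod (D1 t)) + 2*(cmod (D1 t)*((1 + 3*M^2)*cmod (D t)))"
      using Nb[OF t] by (intro add_left_mono mult_left_mono) auto
    also have "... = C*(2*cmod (D t)*cmod (D1 t))" by (simp add: C_def algebra_simps)
    also have "... <= C*G t" unfolding G_def
      using sum_squares_bound[of "cmod (D t)" "cmod (D1 t)"] by (intro mult_left_mono) (auto simp: C_def)
    finally show "\<bar>2 * Re (cnj (D t)*D1 t) + 2 * Re (cnj (D1 t)*N t)\<bar> <= C*G t" .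
  qed (auto simp: G_def D_def D1_def eq a_def b_def)
  then show ?thesis by (simp add: G_def D_def add_nonneg_eq_0_iff)
qed

context good_wave
begin

lemma is_wave_W: "is_wave (J, E) W" unfolding is_wave_def prod.case
  by (rule exI[of _ W1], rule exI[of _ "%x. W x - of_real ((cmod (W x))^2)*W x"]) (use dW dW1 WJ WE nonconst in simp)

text \<open>Where \<open>V\<close> is nonzero, its squared modulus and the derivative of that
  satisfy the first integral, so \<open>W\<close> attains the same pair at some point. As the fluxes
  agree as well, the Cauchy data of \<open>V\<close> are a unimodular multiple of those of
  \<open>W\<close> at that point.\<close>

lemma wave_unique:
  assumes "is_wave (J, E) V"
  shows "EX al x0. ALL x. V x = cis al*W (x + x0)"
proof -
  obtain V1 V2 where V: "!!x. (V has_vector_derivative V1 x) (at x)"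
      "!!x. (V1 has_vector_derivative V2 x) (at x)"
      "!!x. V2 x - V x + of_real ((cmod (V x))^2)*V x = 0"
      "!!x. Im (cnj (V x)*V1 x) = J"
      "!!x. (cmod (V1 x))^2/2 - (cmod (V x))^2/2 + (cmod (V x))^4/4 = E"
      "EX x y. cmod (V x) ~= cmod (V y)" using assms unfolding is_wave_def by auto
  obtain x1 where x1: "V x1 ~= 0" using V(6) by force
  define t z where "t = (cmod (V x1))^2" and "z = 2 * Re (cnj (V x1)*V1 x1)"
  have t: "t > 0" using x1 by (simp add: t_def)
  have cV: "cnj (V x1)*V1 x1 = of_real (z/2) + \<i> * of_real J" using V(4)[of x1] by (simp add: complex_eq_iff z_def)
  have "t*(cmod (V1 x1))^2 = (z/2)^2 + J^2"
  proof -
    have "t*(cmod (V1 x1))^2 = (cmod (cnj (V x1)*V1 x1))^2" by (simp add: t_def norm_mult power_mult_distrib)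
    then show ?thesis unfolding cV by (simp add: cmod_power2)
  qed
  moreover have "(cmod (V1 x1))^2 = 2*E + t - t^2/2"
  proof -
    have "(cmod (V x1))^4 = t^2" unfolding t_def by simp
    then show ?thesis using V(5)[of x1] by (simp add: t_def[symmetric] field_simps)
  qed
  ultimately have "t*(2*E + t - t^2/2) = (z/2)^2 + J^2" by simp
  then have "z^2 = 2*(- (t^3) + 2*t^2 + 4*E*t - 2*J^2)" by (simp add: field_simps power2_eq_square power3_eq_cube)
  from attained[OF t this] obtain x2 where x2: "(cmod (W x2))^2 = t" "2 * Re (cnj (W x2)*W1 x2) = z" by blast
  have W0: "W x2 ~= 0" using x2 t by auto
  have cW: "cnj (W x2)*W1 x2 = of_real (z/2) + \<i> * of_real J" using WJ[of x2] x2(2) by (simp add: complex_eq_iff)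
  define ka where "ka = V x1/W x2"
  have "cmod ka = 1"
  proof -
    have "cmod (V x1) = cmod (W x2)" using x2(1) by (simp add: t_def)
    then show ?thesis using W0 by (simp add: ka_def norm_divide)
  qed
  then have ka: "ka = cis (Arg ka)" using cis_Arg[of ka] by (metis norm_zero sgn_eq scaleR_one div_by_1 of_real_1 zero_neq_one)
  define x0 where "x0 = x2 - x1"
  have dsh: "((%x. W (x + x0)) has_vector_derivative W1 (x + x0)) (at x)"
    "((%x. W1 (x + x0)) has_vector_derivative W (x + x0) - of_real ((cmod (W (x + x0)))^2)*W (x + x0)) (at x)" for x
  proof -
    have h: "((%x. x + x0) has_vector_derivative 1) (at x)"
      by (auto simp: has_real_derivative_iff_has_vector_derivative[symmetric] intro!: derivative_eq_intros)
    show "((%x. W (x + x0)) has_vector_derivative W1 (x + x0)) (at x)"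
      "((%x. W1 (x + x0)) has_vector_derivative W (x + x0) - of_real ((cmod (W (x + x0)))^2)*W (x + x0)) (at x)"
      using vector_diff_chain_at[OF h dW] vector_diff_chain_at[OF h dW1] by (simp_all add: o_def)
  qed
  have "V x = ka*W (x + x0)" for x
  proof (rule wave_ode_unique[where c=x1 and V=V and ?V1.0=V1 and U="%x. ka*W (x + x0)" and ?U1.0="%x. ka*W1 (x + x0)"])
    show "(V1 has_vector_derivative V x - of_real ((cmod (V x))^2)*V x) (at x)" for x
    proof -
      have "V2 x = V x - of_real ((cmod (V x))^2)*V x" using V(3)[of x] by (simp add: algebra_simps add_eq_0_iff)
      then show ?thesis using V(2)[of x] by simp
    qed
    show "((%x. ka*W (x + x0)) has_vector_derivative ka*W1 (x + x0)) (at x)" for x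
      by (intro has_vector_derivative_mult_right dsh)
    have "ka*W (x + x0) - of_real ((cmod (ka*W (x + x0)))^2)*(ka*W (x + x0))
       = ka*(W (x + x0) - of_real ((cmod (W (x + x0)))^2)*W (x + x0))" for x
      using \<open>cmod ka = 1\<close> by (simp add: norm_mult algebra_simps)
    then show "((%x. ka*W1 (x + x0)) has_vector_derivative
       ka*W (x + x0) - of_real ((cmod (ka*W (x + x0)))^2)*(ka*W (x + x0))) (at x)" for x
      using has_vector_derivative_mult_right[OF dsh(2)] by simp
    show "V x1 = ka*W (x1 + x0)" using W0 by (simp add: ka_def x0_def)
    have "cnj (V x1)*V1 x1 = cnj (V x1)*(ka*W1 x2)"
    proof -
      have "V x1 = ka*W x2" using W0 by (simp add: ka_def)
      then have "cnj (V x1)*(ka*W1 x2) = (cnj ka*ka)*(cnj (W x2)*W1 x2)" by (simp add: algebra_simps)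
      also have "cnj ka*ka = 1" using \<open>cmod ka = 1\<close> complex_norm_square[of ka] by (simp add: mult.commute)
      finally show ?thesis using cV cW by simp
    qed
    then show "V1 x1 = ka*W1 (x1 + x0)" using x1 by (simp add: x0_def)
  qed (use V in auto)
  then show ?thesis using ka by metis
qed

end

section \<open>Periodic functions\<close>

text \<open>By Henstock's lemma, Riemann sums of a function all of whose integrals over subintervals vanish
  are small term by term.\<close>

lemma norm_integral_zero:
  fixes g :: "real => 'a::euclidean_space"
  assumes i: "g integrable_on {a..b}" and z: "!!x. x \<in> {a..b} ==> integral {a..x} g = 0"
  shows "((%x. norm (g x)) has_integral 0) {a..b}"
proof -
  have z': "integral {c..d} g = 0" if cd: "a <= c" "d <= b" for c d
  proof (cases "c <= d")
    case True
    have "integral {a..c} g + integral {c..d} g = integral {a..d} g"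
      using cd True integrable_on_subinterval[OF i, of a d]
      by (intro Henstock_Kurzweil_Integration.integral_combine) auto
    then show ?thesis using z[of c] z[of d] cd True by auto
  qed simp
  show ?thesis unfolding cbox_interval[symmetric] has_integral
  proof (intro allI impI)
    fix e :: real assume "e > 0"
    from Henstock_lemma[OF i[folded cbox_interval] this] obtain gm where gm: "gauge gm"
      "!!p. p tagged_partial_division_of cbox a b ==> gm fine p ==>
        (\<Sum>(x, k)\<in>p. norm (measure lborel k *\<^sub>R g x - integral k g)) < e" by blast
    have "norm ((\<Sum>(x, k)\<in>D. measure lborel k *\<^sub>R norm (g x)) - 0) < e"
      if D: "D tagged_division_of cbox a b" "gm fine D" for D
    proof -
      have "(\<Sum>(x, k)\<in>D. norm (measure lborel k *\<^sub>R g x - integral k g)) = (\<Sum>(x, k)\<in>D. measure lborel k *\<^sub>R norm (g x))"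
      proof (rule sum.cong[OF refl], clarify)
        fix x k assume xk: "(x, k) \<in> D"
        obtain c d where k: "k = {c..d}" using tagged_division_ofD(4)[OF D(1) xk] by (auto simp: cbox_interval)
        have "{c..d} <= {a..b}" using tagged_division_ofD(3)[OF D(1) xk] by (simp add: k cbox_interval)
        then have "integral k g = 0" unfolding k by (cases "c <= d") (auto intro!: z')
        then show "norm (measure lborel k *\<^sub>R g x - integral k g) = measure lborel k *\<^sub>R norm (g x)" by simp
      qed
      moreover have "0 <= (\<Sum>(x, k)\<in>D. measure lborel k *\<^sub>R norm (g x))" by (rule sum_nonneg) auto
      ultimately show ?thesis using gm(2)[OF _ D(2)] D(1) tagged_division_of_def by fastforce
    qed
    then show "EX gm. gauge gm & (ALL \<D>. \<D> tagged_division_of cbox a b & gm fine \<D> -->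
        norm ((\<Sum>(x, k)\<in>\<D>. measure lborel k *\<^sub>R norm (g x)) - 0) < e)" using gm(1) by blast
  qed
qed

lemma AE_zero_of_integral:
  fixes f :: "real => real"
  assumes i: "(f has_integral 0) {a..b}" and nn: "!!x. x \<in> {a..b} ==> 0 <= f x"
  shows "AE x in lebesgue. x \<in> {a..b} --> f x = 0"
proof -
  have s: "f absolutely_integrable_on {a..b}"
    using i nn by (intro nonnegative_absolutely_integrable_1) (auto simp: integrable_on_def)
  then have "integral\<^sup>L lebesgue (%x. indicator {a..b} x *\<^sub>R f x) = 0"
    using set_lebesgue_integral_eq_integral(2)[OF s] integral_unique[OF i] by (simp add: set_lebesgue_integral_def)
  moreover have "integrable lebesgue (%x. indicator {a..b} x *\<^sub>R f x)" using s by (simp add: set_integrable_def)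
  moreover have "AE x in lebesgue. 0 <= indicator {a..b} x *\<^sub>R f x" using nn by (auto simp: indicator_def)
  ultimately have "AE x in lebesgue. indicator {a..b} x *\<^sub>R f x = 0" using integral_nonneg_eq_0_iff_AE by blast
  then show ?thesis by eventually_elim (auto simp: indicator_def)
qed

lemma AE_UNIV:
  assumes "!!n::nat. AE x in lebesgue. x \<in> {- real n..real n} --> P x"
  shows "AE x in lebesgue. P x"
proof -
  have "AE x in lebesgue. ALL n::nat. x \<in> {- real n..real n} --> P x" using assms unfolding AE_all_countable by blast
  then show ?thesis
  proof eventually_elim
    case (elim x)
    obtain n where "\<bar>x\<bar> <= real n" using real_arch_simple by blast
    then show ?case using elim[rule_format, of n] by (auto simp: abs_le_iff)
  qed
qed

lemma integral_AE_cong: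
  fixes f g :: "real => 'a::euclidean_space"
  assumes "AE x in lebesgue. f x = g x" shows "integral S f = integral S g"
proof -
  from assms obtain N where N: "{x. f x ~= g x} <= N" "N \<in> null_sets lebesgue"
    by (auto elim!: AE_E simp: null_sets_def)
  show ?thesis by (rule integral_spike[of N]) (use N in \<open>auto simp: negligible_iff_null_sets dest: sym\<close>)
qed

lemma integrable_AE_cong:
  fixes f g :: "real => 'a::euclidean_space"
  assumes "f integrable_on S" "AE x in lebesgue. f x = g x" shows "g integrable_on S"
proof -
  from assms(2) obtain N where N: "{x. f x ~= g x} <= N" "N \<in> null_sets lebesgue"
    by (auto elim!: AE_E simp: null_sets_def)
  show ?thesis by (rule integrable_spike[OF assms(1), of N]) (use N in \<open>auto simp: negligible_iff_null_sets dest: sym\<close>)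
qed

lemma sqint_AE_cong:
  fixes f g :: "real => 'a::euclidean_space"
  assumes s: "sqint a b f" and ae: "AE x in lebesgue. f x = g x"
  shows "sqint a b g"
proof -
  have "AE x in lebesgue. norm (f x) = norm (g x)" "AE x in lebesgue. (norm (f x))^2 = (norm (g x))^2"
    using ae by auto
  then show ?thesis using s ae unfolding sqint_def absolutely_integrable_on_def by (auto intro: integrable_AE_cong)
qed

lemma acd_AE_cong:
  assumes "acd a b u g" "AE x in lebesgue. g x = h x" shows "acd a b u h" using assms unfolding acd_def
  by (metis integral_AE_cong sqint_AE_cong)

text \<open>Both candidates have the same integrals over all intervals, so the difference is one of
  the functions treated in \<open>norm_integral_zero\<close>.\<close>

lemma acd_deriv_unique:
  assumes "!!a b. acd a b u g" "!!a b. acd a b u h"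
  shows "AE x in lebesgue. g x = h x"
proof (rule AE_UNIV)
  fix n :: nat
  let ?a = "- real n" and ?b = "real n"
  have i: "g integrable_on {?a..?b}" "h integrable_on {?a..?b}" using assms acd_sqint sqint_int by blast+
  have "integral {?a..x} (%x. g x - h x) = 0" if "x \<in> {?a..?b}" for x
  proof -
    have "integral {?a..x} g = integral {?a..x} h"
      using acd_eq[OF assms(1), of ?a ?a x x] acd_eq[OF assms(2), of ?a ?a x x] that by auto
    then show ?thesis using that i by (subst integral_diff) (auto intro: integrable_on_subinterval)
  qed
  from norm_integral_zero[OF integrable_diff[OF i] this]
  have "AE x in lebesgue. x \<in> {?a..?b} --> norm (g x - h x) = 0" by (rule AE_zero_of_integral) auto
  then show "AE x in lebesgue. x \<in> {?a..?b} --> g x = h x" by simp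
qed

lemma has_integral_affine:
  fixes f :: "real => 'a::euclidean_space"
  assumes "(f has_integral i) {m*a + c..m*b + c}" "m > 0"
  shows "((%x. f (m*x + c)) has_integral i /\<^sub>R m) {a..b}"
proof -
  have "{(m*a + c - c) /\<^sub>R m..(m*b + c - c) /\<^sub>R m} = {a..b}" using assms(2) by simp
  then show ?thesis using has_integral_affinity'[of f i "m*a + c" "m*b + c" m c] assms
    by (simp only: cbox_interval DIM_real power_one_right real_scaleR_def simp_thms)
qed

lemma integral_affine:
  fixes f :: "real => 'a::euclidean_space"
  assumes "f integrable_on {m*a + c..m*b + c}" "m > 0"
  shows "(%x. f (m*x + c)) integrable_on {a..b}"
    "integral {a..b} (%x. f (m*x + c)) = integral {m*a + c..m*b + c} f /\<^sub>R m"
  using has_integral_affine[OF integrable_integral[OF assms(1)] assms(2)]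
  by (auto simp: integral_unique has_integral_integrable)

lemma sqint_affine:
  fixes f :: "real => 'a::euclidean_space"
  assumes "sqint (m*a + c) (m*b + c) f" "m > 0"
  shows "sqint a b (%x. f (m*x + c))" using assms unfolding sqint_def absolutely_integrable_on_def
  by (auto intro: integral_affine(1)[where f=f] integral_affine(1)[where f="%x. norm (f x)"]
      integral_affine(1)[where f="%x. (norm (f x))^2"])

lemma acd_affine:
  fixes u g :: "real => 'a::euclidean_space"
  assumes "acd (m*a + c) (m*b + c) u g" "m > 0"
  shows "acd a b (%x. u (m*x + c)) (%x. m *\<^sub>R g (m*x + c))" unfolding acd_def
proof (intro conjI ballI)
  show "sqint a b (%x. m *\<^sub>R g (m*x + c))" by (intro sqint_scaleR sqint_affine acd_sqint[OF assms(1)] assms(2))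
  fix x assume x: "x \<in> {a..b}"
  then have mx: "m*a <= m*x" "m*x <= m*b" using assms(2) by auto
  have "g integrable_on {m*a + c..m*x + c}"
    using sqint_int[OF acd_sqint[OF assms(1)]] by (rule integrable_on_subinterval) (use mx in auto)
  from integral_affine(2)[OF this assms(2)]
  have "integral {a..x} (%x. m *\<^sub>R g (m*x + c)) = integral {m*a + c..m*x + c} g"
    using assms(2) by (simp add: integral_cmul)
  then show "u (m*x + c) = u (m*a + c) + integral {a..x} (%x. m *\<^sub>R g (m*x + c))"
    using acd_eq[OF assms(1), of "m*a + c" "m*x + c"] mx by (simp add: algebra_simps)
qed

lemma acd_combine:
  assumes "acd a b u g" "acd b c u g" "a <= b" "b <= c"
  shows "acd a c u g" unfolding acd_def
proof (intro conjI ballI)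
  show s: "sqint a c g" using assms acd_sqint sqint_combine by blast
  fix x assume x: "x \<in> {a..c}"
  show "u x = u a + integral {a..x} g"
  proof (cases "x <= b")
    case True then show ?thesis using acd_val[OF assms(1), of x] x by simp
  next
    case False
    have "integral {a..b} g + integral {b..x} g = integral {a..x} g"
      using False x assms sqint_int[OF sqint_subset[OF s, of a x]]
      by (intro Henstock_Kurzweil_Integration.integral_combine) auto
    moreover have "u b = u a + integral {a..b} g" "u x = u b + integral {b..x} g"
      using acd_val[OF assms(1), of b] acd_val[OF assms(2), of x] False x assms(3,4) by auto
    ultimately show ?thesis by (metis add.assoc)
  qed
qed

definition per :: "(real => 'a) => bool" where "per f \<longleftrightarrow> (ALL z. f (z + 2*pi) = f z)"

lemma perD: "per f ==> f (z + 2*pi) = f z" by (simp add: per_def)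

lemma per_nat: "per f ==> f (z + 2*pi*real n) = f z"
proof (induction n)
  case (Suc n)
  have "f (z + 2*pi*real n + 2*pi) = f (z + 2*pi*real n)" by (rule perD[OF Suc.prems])
  then show ?case using Suc by (simp add: algebra_simps)
qed simp

lemma per_int: assumes "per f" shows "f (z + 2*pi * of_int n) = f z"
proof (cases "n >= 0")
  case True
  then show ?thesis using per_nat[OF assms, of z "nat n"] by simp
next
  case False
  then show ?thesis using per_nat[OF assms, of "z + 2*pi * of_int n" "nat (- n)"] by simp
qed

lemma period_representative:
  obtains n :: int where "z + 2*pi * of_int n \<in> {0..2*pi}"
proof
  have *: "of_int \<lfloor>z/(2*pi)\<rfloor> <= z/(2*pi)" "z/(2*pi) < of_int \<lfloor>z/(2*pi)\<rfloor> + 1" by linarith+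
  show "z + 2*pi * of_int (- \<lfloor>z/(2*pi)\<rfloor>) \<in> {0..2*pi}"
    using mult_left_mono[OF *(1), of "2*pi"] mult_strict_left_mono[OF *(2), of "2*pi"] by (simp add: algebra_simps)
qed

lemma integral_shift:
  fixes f :: "real => 'a::euclidean_space"
  shows "integral {a..b} (%x. f (x + c)) = integral {a + c..b + c} f"
  using integral_shift_Icc_real[of a b f c] by (simp add: o_def add.commute)

lemma integral_period:
  fixes f :: "real => 'a::euclidean_space"
  assumes p: "per f" and i: "!!a b. f integrable_on {a..b}"
  shows "integral {a..a + 2*pi} f = integral {0..2*pi} f"
proof -
  have *: "integral {x..x + 2*pi} f = integral {y..y + 2*pi} f" if "x <= y" for x y
  proof -
    have "integral {x..y} f + integral {y..y + 2*pi} f = integral {x..y + 2*pi} f"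
      "integral {x..x + 2*pi} f + integral {x + 2*pi..y + 2*pi} f = integral {x..y + 2*pi} f"
      using that by (intro Henstock_Kurzweil_Integration.integral_combine i; simp)+
    moreover have "integral {x + 2*pi..y + 2*pi} f = integral {x..y} f"
      using integral_shift[of x y f "2*pi"] perD[OF p] by simp
    ultimately show ?thesis by (metis add.commute add_left_cancel)
  qed
  show ?thesis using *[of 0 a] *[of a 0] by (cases "a <= 0") auto
qed

lemma integral_per_shift:
  fixes f :: "real => 'a::euclidean_space"
  assumes p: "per f" and i: "!!a b. f integrable_on {a..b}"
  shows "integral {0..2*pi} (%x. f (x + c)) = integral {0..2*pi} f"
  using integral_shift[of 0 "2*pi" f c] integral_period[OF p i, of c] by (simp add: add.commute)

definition hp :: "(real => complex) => (real => complex) => bool" where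
  "hp u g \<longleftrightarrow> per u & per g & (ALL a b. acd a b u g)"

lemma hpD: "hp u g ==> per u" "hp u g ==> per g" "hp u g ==> acd a b u g" by (auto simp: hp_def)

lemma acd_cont: assumes "!!a b. acd a b u g" shows "continuous_on S u"
proof -
  have "isCont u x" for x
    using acd_continuous[OF assms, of "x - 1" "x + 1"] by (intro continuous_on_interior[of "{x - 1..x + 1}"]) auto
  then show ?thesis by (intro continuous_at_imp_continuous_on) auto
qed

lemma hp_cont: "hp u g ==> continuous_on S u" using acd_cont[OF hpD(3)] .

lemma hp_add: "hp u g ==> hp v h ==> hp (%z. u z + v z) (%z. g z + h z)" by (auto simp: hp_def per_def intro: acd_add)

lemma hp_linear: "hp u g ==> bounded_linear L ==> hp (%z. L (u z)) (%z. L (g z))"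
  by (auto simp: hp_def per_def intro: acd_linear)

lemma hp_shift: assumes "hp u g" shows "hp (%z. u (z + c)) (%z. g (z + c))"
proof -
  have "per (%z. u (z + c))" "per (%z. g (z + c))"
    using hpD(1,2)[OF assms] unfolding per_def by (metis add.assoc add.commute)+
  moreover have "acd a b (%z. u (z + c)) (%z. g (z + c))" for a b
    using acd_affine[of 1 a c b u g] hpD(3)[OF assms] by simp
  ultimately show ?thesis by (simp add: hp_def)
qed

lemma hpI_C1:
  assumes "per u" "!!z. (u has_vector_derivative u' z) (at z)" "!!z. isCont u' z"
  shows "hp u u'"
proof -
  have "per u'" unfolding per_def
  proof
    fix z
    have h: "((%x. x + 2*pi) has_vector_derivative 1) (at z)"
      by (auto simp: has_real_derivative_iff_has_vector_derivative[symmetric] intro!: derivative_eq_intros)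
    have "((%x. u (x + 2*pi)) has_vector_derivative u' (z + 2*pi)) (at z)"
      using vector_diff_chain_at[OF h assms(2)] by (simp add: o_def)
    moreover have "(%x. u (x + 2*pi)) = u" using perD[OF assms(1)] by auto
    ultimately show "u' (z + 2*pi) = u' z" using assms(2) vector_derivative_unique_at by metis
  qed
  moreover have "acd a b u u'" for a b
  proof (rule acdI)
    show "continuous_on {a..b} u'" using assms(3) by (simp add: continuous_at_imp_continuous_on)
  qed (rule has_vector_derivative_at_within[OF assms(2)])
  ultimately show ?thesis using assms(1) by (simp add: hp_def)
qed

lemma hp_zero: "hp (%z. 0) (%z. 0)" by (rule hpI_C1) (auto simp: per_def)

section \<open>The periodic Sobolev space as an inner product space\<close>

definition ip :: "(real => complex) => (real => complex) => real" where
  "ip f g = integral {0..2*pi} (%z. Re (f z*cnj (g z)))"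

abbreviation L2 :: "(real => complex) => bool" where "L2 \<equiv> sqint 0 (2*pi)"

lemma sqint_cnj: "sqint a b f ==> sqint a b (%z. cnj (f z))" by (rule sqint_linear[OF _ bounded_linear_cnj])

lemma mult_cnj_integrable: "L2 f ==> L2 g ==> (%z. f z*cnj (g z)) integrable_on {0..2*pi}"
  by (intro sqint_times_integrable sqint_cnj)

lemma integrable_Re: "f integrable_on S ==> (%z. Re (f z)) integrable_on S"
  and integrable_Im: "f integrable_on S ==> (%z. Im (f z)) integrable_on S"
  using integrable_linear[OF _ bounded_linear_Re, of f S] integrable_linear[OF _ bounded_linear_Im, of f S]
  by (simp_all add: o_def)

lemma integral_Re: "f integrable_on S ==> integral S (%z. Re (f z)) = Re (integral S f)"
  and integral_Im: "f integrable_on S ==> integral S (%z. Im (f z)) = Im (integral S f)"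
  using integral_linear[OF _ bounded_linear_Re, of f S] integral_linear[OF _ bounded_linear_Im, of f S]
  by (simp_all add: o_def)

lemma ip_integrable: "L2 f ==> L2 g ==> (%z. Re (f z*cnj (g z))) integrable_on {0..2*pi}"
  by (intro integrable_Re mult_cnj_integrable)

lemma ip_Re: "L2 f ==> L2 g ==> ip f g = Re (integral {0..2*pi} (%z. f z*cnj (g z)))"
  unfolding ip_def by (intro integral_Re mult_cnj_integrable)

lemma ip_commute: "ip f g = ip g f"
  unfolding ip_def by (rule arg_cong[of _ _ "integral _"]) (auto simp: algebra_simps)

lemma ip_add: "L2 f ==> L2 g ==> L2 h ==> ip (%z. f z + g z) h = ip f h + ip g h"
  unfolding ip_def distrib_right plus_complex.sel(1) by (intro integral_add ip_integrable)

lemma ip_scaleR: "ip (%z. c *\<^sub>R f z) h = c*ip f h"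
  unfolding ip_def by (simp flip: integral_mult_right add: algebra_simps)

lemma ip_AE_cong:
  assumes "AE z in lebesgue. f z = f' z" "AE z in lebesgue. g z = g' z"
  shows "ip f g = ip f' g'" unfolding ip_def by (rule integral_AE_cong) (use assms in eventually_elim, simp)

lemma ip_self: "ip f f = integral {0..2*pi} (%z. (cmod (f z))^2)"
  unfolding ip_def cmod_power2 by (simp add: power2_eq_square)

lemma ip_nonneg: "0 <= ip f f"
proof (cases "(%z. (cmod (f z))^2) integrable_on {0..2*pi}")
  case True
  then show ?thesis unfolding ip_self by (rule integral_nonneg) auto
qed (simp add: ip_self not_integrable_integral)

lemma ip_Cauchy: assumes "L2 f" "L2 g" shows "\<bar>ip f g\<bar> <= sqrt (ip f f) * sqrt (ip g g)"
proof -
  have "\<bar>ip f g\<bar> <= cmod (integral {0..2*pi} (%z. f z*cnj (g z)))"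
    unfolding ip_Re[OF assms] by (rule abs_Re_le_cmod)
  also have "... <= sqrt (ip f f) * sqrt (ip g g)"
    using Cauchy_Schwarz_norm[OF assms(1) sqint_cnj[OF assms(2)]] by (simp add: ip_self)
  finally show ?thesis .
qed

text \<open>Elements are the continuous representatives themselves rather than classes modulo null
  sets, so equality is pointwise. The derivative picked by \<open>dv\<close> is determined up to
  null sets.\<close>

typedef h1 = "{u. EX g. hp u g}" morphisms fn h1_of using hp_zero by blast

definition dv :: "h1 => real => complex" where "dv u = (SOME g. hp (fn u) g)"

lemma hp_fn: "hp (fn u) (dv u)" unfolding dv_def by (rule someI_ex[of "hp (fn u)"]) (use fn[of u] in simp)

lemma fn_h1_of: "hp u g ==> fn (h1_of u) = u" by (rule h1_of_inverse) auto

lemma h1_eqI: "(!!z. fn u z = fn v z) ==> u = v" using fn_inject by blast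

lemma dv_AE: assumes "hp (fn u) g" shows "AE z in lebesgue. dv u z = g z"
  using acd_deriv_unique hpD(3)[OF hp_fn] hpD(3)[OF assms] by blast

lemma fn_cont: "continuous_on S (fn u)" by (rule hp_cont[OF hp_fn])

lemma fn_per: "per (fn u)" and dv_per: "per (dv u)" and fn_acd: "acd a b (fn u) (dv u)" using hpD[OF hp_fn] by auto

lemma fn_sqint: "sqint a b (fn u)" by (rule acd_sqint_fun[OF fn_acd])
lemma dv_sqint: "sqint a b (dv u)" by (rule acd_sqint[OF fn_acd])

instantiation h1 :: real_inner
begin

definition "0 = h1_of (%z. 0)"
definition "u + v = h1_of (%z. fn u z + fn v z)"
definition "c *\<^sub>R u = h1_of (%z. c *\<^sub>R fn u z)"
definition "- u = (-1) *\<^sub>R (u::h1)"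
definition "u - v = u + - (v::h1)"
definition "inner u v = ip (fn u) (fn v) + ip (dv u) (dv v)"
definition "norm u = sqrt (inner u (u::h1))"
definition "dist u v = norm (u - (v::h1))"
definition "sgn u = inverse (norm u) *\<^sub>R (u::h1)"
definition "(uniformity :: (h1 \<times> h1) filter) = (INF e\<in>{0<..}. principal {(x, y). dist x y < e})"
definition "open (U :: h1 set) \<longleftrightarrow> (ALL x:U. eventually (%(x', y). x' = x --> y \<in> U) uniformity)"

lemma fn_zero: "fn 0 z = 0" by (simp add: zero_h1_def fn_h1_of[OF hp_zero])

lemma hp_plus: "hp (fn (u + v)) (%z. dv u z + dv v z)" and fn_plus: "fn (u + v) z = fn u z + fn v z"
  using hp_add[OF hp_fn hp_fn, of u v] by (simp_all add: plus_h1_def fn_h1_of)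

lemma hp_scaleR: "hp (fn (c *\<^sub>R u)) (%z. c *\<^sub>R dv u z)" and fn_scaleR: "fn (c *\<^sub>R u) z = c *\<^sub>R fn u z"
  using hp_linear[OF hp_fn bounded_linear_scaleR_right, of c u] by (simp_all add: scaleR_h1_def fn_h1_of)

lemma fn_uminus: "fn (- u) z = - fn u z" by (simp add: uminus_h1_def fn_scaleR)

lemma fn_minus: "fn (u - v) z = fn u z - fn v z" by (simp add: minus_h1_def fn_plus fn_uminus)

lemma inner_zero_imp: assumes "inner u u = (0::real)" shows "u = (0::h1)"
proof (rule h1_eqI)
  fix z
  have "ip (fn u) (fn u) = 0" using assms ip_nonneg[of "fn u"] ip_nonneg[of "dv u"] by (simp add: inner_h1_def)
  then have "ALL z:{0..2*pi}. (cmod (fn u z))^2 = 0"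
    unfolding ip_self by (subst (asm) integral_eq_0_iff) (auto intro!: continuous_intros fn_cont)
  moreover obtain n where "z + 2*pi * of_int n \<in> {0..2*pi}" by (rule period_representative)
  ultimately have "fn u (z + 2*pi * of_int n) = 0" by auto
  then show "fn u z = fn 0 z" by (simp add: per_int[OF fn_per] fn_zero)
qed

instance
proof
  fix u v w :: h1 and a b :: real
  note E = fn_zero fn_plus fn_scaleR fn_uminus fn_minus
  show "u + v + w = u + (v + w)" "u + v = v + u" "0 + u = u" "- u + u = 0" "u - v = u + - v"
    "a *\<^sub>R (u + v) = a *\<^sub>R u + a *\<^sub>R v" "(a + b) *\<^sub>R u = a *\<^sub>R u + b *\<^sub>R u" "a *\<^sub>R b *\<^sub>R u = (a*b) *\<^sub>R u"
    "1 *\<^sub>R u = u" by (auto intro!: h1_eqI simp: E algebra_simps)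
  show "dist u v = norm (u - v)" "sgn u = inverse (norm u) *\<^sub>R u" by (fact dist_h1_def sgn_h1_def)+
  show "uniformity = (INF e\<in>{0<..}. principal {(x, y). dist (x::h1) y < e})" by (fact uniformity_h1_def)
  show "open U \<longleftrightarrow> (ALL x:U. eventually (%(x', y). x' = x --> y \<in> U) uniformity)" for U :: "h1 set"
    by (fact open_h1_def)
  show "inner u v = inner v u" unfolding inner_h1_def by (simp add: ip_commute)
  have "ip (dv (u + v)) (dv w) = ip (%z. dv u z + dv v z) (dv w)" by (rule ip_AE_cong) (use dv_AE[OF hp_plus] in auto)
  then show "inner (u + v) w = inner u w + inner v w"
    unfolding inner_h1_def using ip_add[OF fn_sqint fn_sqint fn_sqint, of u v w] ip_add[OF dv_sqint dv_sqint dv_sqint, of u v w]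
    by (simp add: fn_plus[abs_def])
  have "ip (dv (a *\<^sub>R u)) (dv v) = ip (%z. a *\<^sub>R dv u z) (dv v)"
    by (rule ip_AE_cong) (use dv_AE[OF hp_scaleR] in auto)
  then show "inner (a *\<^sub>R u) v = a*inner u v"
    unfolding inner_h1_def fn_scaleR[abs_def] ip_scaleR by (simp add: algebra_simps)
  show "0 <= inner u u" unfolding inner_h1_def using ip_nonneg[of "fn u"] ip_nonneg[of "dv u"] by simp
  have "inner (0::h1) 0 = 0"
  proof -
    have "ip (dv 0) (dv 0) = ip (%z. 0) (%z. 0)"
      by (rule ip_AE_cong) (use dv_AE[of 0 "%z. 0"] hp_zero in \<open>auto simp: fn_zero[abs_def]\<close>)
    then show ?thesis by (simp add: inner_h1_def fn_zero[abs_def] ip_def)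
  qed
  then show "inner u u = 0 \<longleftrightarrow> u = 0" using inner_zero_imp by blast
  show "norm u = sqrt (inner u u)" by (fact norm_h1_def)
qed

end

lemma dv_plus: "AE z in lebesgue. dv (u + v) z = dv u z + dv v z" by (rule dv_AE[OF hp_plus])
lemma dv_scaleR: "AE z in lebesgue. dv (c *\<^sub>R u) z = c *\<^sub>R dv u z" by (rule dv_AE[OF hp_scaleR])
lemma dv_uminus: "AE z in lebesgue. dv (- u) z = - dv u z" using dv_scaleR[of "-1" u] by simp
lemma dv_minus: "AE z in lebesgue. dv (u - v) z = dv u z - dv v z"
  using dv_plus[of u "- v"] dv_uminus[of v] by eventually_elim simp

definition cm :: "complex => h1 => h1" where "cm c u = h1_of (%z. c*fn u z)"

lemma hp_cm: "hp (fn (cm c u)) (%z. c*dv u z)" and fn_cm: "fn (cm c u) z = c*fn u z"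
  using hp_linear[OF hp_fn bounded_linear_mult_right, of c u] by (simp_all add: cm_def fn_h1_of)

lemma dv_cm: "AE z in lebesgue. dv (cm c u) z = c*dv u z" by (rule dv_AE[OF hp_cm])

definition sh :: "real => h1 => h1" where "sh r u = h1_of (%z. fn u (z + r))"

lemma hp_sh: "hp (fn (sh r u)) (%z. dv u (z + r))" and fn_sh: "fn (sh r u) z = fn u (z + r)"
  using hp_shift[OF hp_fn, of u r] by (simp_all add: sh_def fn_h1_of)

lemma dv_sh: "AE z in lebesgue. dv (sh r u) z = dv u (z + r)" by (rule dv_AE[OF hp_sh])

text \<open>Mass, kinetic energy and momentum are built from these three real forms; the complex
  structure enters only through \<open>cm \<i>\<close>.\<close>

definition sg :: "h1 => h1 => real" where "sg u v = ip (fn u) (fn v)"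
definition ta :: "h1 => h1 => real" where "ta u v = ip (dv u) (dv v)"
definition ch :: "h1 => h1 => real" where "ch u v = ip (dv u) (fn v)"

lemma inner_h1: "inner u v = sg u v + ta u v" by (simp add: inner_h1_def sg_def ta_def)

lemma sg_commute: "sg u v = sg v u" and ta_commute: "ta u v = ta v u" by (simp_all add: sg_def ta_def ip_commute)

lemma norm_h1_sq: "(norm u)^2 = sg u u + ta u u"
  by (simp add: norm_h1_def inner_h1 sg_def ta_def ip_nonneg add_nonneg_nonneg)

lemma sg_nonneg: "0 <= sg u u" and ta_nonneg: "0 <= ta u u" by (simp_all add: sg_def ta_def ip_nonneg)

lemma sg_le_norm: "sqrt (sg u u) <= norm u" and ta_le_norm: "sqrt (ta u u) <= norm u"
  by (simp_all add: norm_h1_def inner_h1 sg_nonneg ta_nonneg)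

lemma ip_bound:
  assumes "L2 f" "L2 g" "sqrt (ip f f) <= a" "sqrt (ip g g) <= b"
  shows "\<bar>ip f g\<bar> <= a*b"
proof -
  have "0 <= a" using order_trans[OF real_sqrt_ge_zero[OF ip_nonneg] assms(3)] .
  then have "sqrt (ip f f) * sqrt (ip g g) <= a*b" using assms(3,4) by (intro mult_mono) (auto simp: ip_nonneg)
  then show ?thesis using ip_Cauchy[OF assms(1,2)] by linarith
qed

lemma ip_add_right: "L2 f ==> L2 g ==> L2 h ==> ip h (%z. f z + g z) = ip h f + ip h g"
  using ip_add by (simp add: ip_commute[of h])

lemma ip_scaleR_right: "ip h (%z. c *\<^sub>R f z) = c*ip h f" using ip_scaleR by (simp add: ip_commute[of h])

lemma bounded_bilinear_symI:
  fixes B :: "'a::real_normed_vector => 'a => real"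
  assumes "!!u u' v. B (u + u') v = B u v + B u' v" "!!r u v. B (r *\<^sub>R u) v = r*B u v"
    and "!!u v. B u v = B v u" "!!u v. \<bar>B u v\<bar> <= K*(norm u*norm v)"
  shows "bounded_bilinear B"
proof
  show "B v (u + u') = B v u + B v u'" "B v (r *\<^sub>R u) = r *\<^sub>R B v u" for u u' v r
    using assms(1,2) by (simp_all add: assms(3)[of v])
  show "EX K. ALL u v. norm (B u v) <= norm u*norm v * K"
    using assms(4) by (intro exI[of _ K]) (simp add: mult.commute)
qed (simp_all add: assms(1,2))

lemma bounded_bilinear_sg: "bounded_bilinear sg"
proof (rule bounded_bilinear_symI[where K=1])
  show "sg (u + u') v = sg u v + sg u' v" for u u' v unfolding sg_def fn_plus[abs_def] by (intro ip_add fn_sqint)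
  show "sg (r *\<^sub>R u) v = r * sg u v" for r u v unfolding sg_def fn_scaleR[abs_def] by (rule ip_scaleR)
  show "\<bar>sg u v\<bar> <= 1*(norm u*norm v)" for u v
    using ip_bound[OF fn_sqint fn_sqint sg_le_norm[unfolded sg_def] sg_le_norm[unfolded sg_def], of u v] by (simp add: sg_def)
qed (rule sg_commute)

lemma bounded_bilinear_ta: "bounded_bilinear ta"
proof (rule bounded_bilinear_symI[where K=1])
  fix u u' v and r :: real
  have "ta (u + u') v = ip (%z. dv u z + dv u' z) (dv v)" unfolding ta_def by (rule ip_AE_cong) (use dv_plus in auto)
  then show "ta (u + u') v = ta u v + ta u' v" unfolding ta_def using ip_add[OF dv_sqint dv_sqint dv_sqint] by simp
  have "ta (r *\<^sub>R u) v = ip (%z. r *\<^sub>R dv u z) (dv v)" unfolding ta_def by (rule ip_AE_cong) (use dv_scaleR in auto)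
  then show "ta (r *\<^sub>R u) v = r*ta u v" unfolding ta_def ip_scaleR by simp
  show "\<bar>ta u v\<bar> <= 1*(norm u*norm v)"
    using ip_bound[OF dv_sqint dv_sqint ta_le_norm[unfolded ta_def] ta_le_norm[unfolded ta_def], of u v] by (simp add: ta_def)
qed (rule ta_commute)

lemma ch_bound: "\<bar>ch u v\<bar> <= sqrt (ta u u) * sqrt (sg v v)"
  using ip_Cauchy[OF dv_sqint fn_sqint, of u v] by (simp add: ch_def ta_def sg_def)

lemma bounded_bilinear_ch: "bounded_bilinear ch"
proof
  show "ch (u + u') v = ch u v + ch u' v" for u u' v
  proof -
    have "ch (u + u') v = ip (%z. dv u z + dv u' z) (fn v)"
      unfolding ch_def by (rule ip_AE_cong) (use dv_plus in auto)
    then show ?thesis unfolding ch_def using ip_add[OF dv_sqint dv_sqint fn_sqint] by simp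
  qed
  show "ch (r *\<^sub>R u) v = r *\<^sub>R ch u v" for r u v
  proof -
    have "ch (r *\<^sub>R u) v = ip (%z. r *\<^sub>R dv u z) (fn v)"
      unfolding ch_def by (rule ip_AE_cong) (use dv_scaleR in auto)
    then show ?thesis unfolding ch_def ip_scaleR by simp
  qed
  show "ch v (u + u') = ch v u + ch v u'" for u u' v
    unfolding ch_def fn_plus[abs_def] by (intro ip_add_right fn_sqint dv_sqint)
  show "ch v (r *\<^sub>R u) = r *\<^sub>R ch v u" for r u v
    unfolding ch_def fn_scaleR[abs_def] by (simp add: ip_scaleR_right del: scaleR_conv_of_real)
  have "norm (ch u v) <= norm u*norm v * 1" for u v
    using ch_bound[of u v] mult_mono[OF ta_le_norm[of u] sg_le_norm[of v]] by (simp add: sg_nonneg)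
  then show "EX K. ALL u v. norm (ch u v) <= norm u*norm v * K" by blast
qed

lemma linear_cm: "cm c (u + v) = cm c u + cm c v" "cm c (r *\<^sub>R u) = r *\<^sub>R cm c u"
  by (auto intro!: h1_eqI simp: fn_cm fn_plus fn_scaleR algebra_simps)

lemma cm_cm: "cm c (cm d u) = cm (c*d) u" and cm_1: "cm 1 u = u" and cm_of_real: "cm (of_real r) u = r *\<^sub>R u"
  by (auto intro!: h1_eqI simp: fn_cm fn_scaleR mult.assoc scaleR_conv_of_real)

lemma ip_cmult: "ip (%z. c*f z) (%z. c*g z) = (cmod c)^2*ip f g"
proof -
  have e: "c*f z*cnj (c*g z) = of_real ((cmod c)^2)*(f z*cnj (g z))" for z
    unfolding complex_norm_square by (simp add: ac_simps)
  then have "Re (c*f z*cnj (c*g z)) = (cmod c)^2 * Re (f z*cnj (g z))" for z unfolding e by simp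
  then show ?thesis unfolding ip_def by (simp only: integral_mult_right)
qed

lemma sg_cm: "sg (cm c u) (cm c v) = (cmod c)^2 * sg u v" unfolding sg_def fn_cm[abs_def] by (rule ip_cmult)

lemma ta_cm: "ta (cm c u) (cm c v) = (cmod c)^2*ta u v"
proof -
  have "ta (cm c u) (cm c v) = ip (%z. c*dv u z) (%z. c*dv v z)" unfolding ta_def by (rule ip_AE_cong) (rule dv_cm)+
  then show ?thesis unfolding ta_def ip_cmult .
qed

lemma ch_cm: "ch (cm c u) (cm c v) = (cmod c)^2*ch u v"
proof -
  have "ch (cm c u) (cm c v) = ip (%z. c*dv u z) (%z. c*fn v z)"
    unfolding ch_def fn_cm[abs_def] by (rule ip_AE_cong) (use dv_cm in auto)
  then show ?thesis unfolding ch_def ip_cmult .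
qed

lemma norm_cm: "norm (cm c u) = cmod c*norm u"
  by (rule power2_eq_imp_eq) (simp_all add: norm_h1_sq sg_cm ta_cm power_mult_distrib algebra_simps)

lemma bounded_linear_cm: "bounded_linear (cm c)"
  by (rule bounded_linear_intro[where K="cmod c"]) (auto simp: linear_cm norm_cm)

lemma ip_shift:
  assumes "per f" "per g" "!!a b. sqint a b f" "!!a b. sqint a b g"
  shows "ip (%z. f (z + r)) (%z. g (z + r)) = ip f g"
proof -
  have "per (%z. Re (f z*cnj (g z)))" using assms(1,2) by (simp add: per_def)
  moreover have "(%z. Re (f z*cnj (g z))) integrable_on {a..b}" for a b
    by (intro integrable_Re sqint_times_integrable sqint_cnj assms)
  ultimately show ?thesis unfolding ip_def by (rule integral_per_shift)
qed

lemma sg_sh: "sg (sh r u) (sh r v) = sg u v" unfolding sg_def fn_sh[abs_def] by (intro ip_shift fn_per fn_sqint)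

lemma ta_sh: "ta (sh r u) (sh r v) = ta u v"
proof -
  have "ta (sh r u) (sh r v) = ip (%z. dv u (z + r)) (%z. dv v (z + r))"
    unfolding ta_def by (rule ip_AE_cong) (rule dv_sh)+
  also have "... = ta u v" unfolding ta_def by (intro ip_shift dv_per dv_sqint)
  finally show ?thesis .
qed

lemma ch_sh: "ch (sh r u) (sh r v) = ch u v"
proof -
  have "ch (sh r u) (sh r v) = ip (%z. dv u (z + r)) (%z. fn v (z + r))"
    unfolding ch_def fn_sh[abs_def] by (rule ip_AE_cong) (use dv_sh in auto)
  also have "... = ch u v" unfolding ch_def by (intro ip_shift dv_per dv_sqint fn_per fn_sqint)
  finally show ?thesis .
qed

lemma norm_sh: "norm (sh r u) = norm u" by (rule power2_eq_imp_eq) (simp_all add: norm_h1_sq sg_sh ta_sh)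

lemma linear_sh: "sh r (u + v) = sh r u + sh r v" "sh r (c *\<^sub>R u) = c *\<^sub>R sh r u"
  by (auto intro!: h1_eqI simp: fn_sh fn_plus fn_scaleR)

lemma bounded_linear_sh: "bounded_linear (sh r)"
  by (rule bounded_linear_intro[where K=1]) (auto simp: linear_sh norm_sh)

lemma sh_sh: "sh r (sh s u) = sh (r + s) u" and sh_0: "sh 0 u = u" and cm_sh: "cm c (sh r u) = sh r (cm c u)"
  by (auto intro!: h1_eqI simp: fn_sh fn_cm add.assoc)

text \<open>Periodicity cancels the boundary term of the integration by parts.\<close>

lemma ch_skew: "ch u v = - ch v u"
proof -
  have c: "acd 0 (2*pi) (%z. cnj (fn v z)) (%z. cnj (dv v z))" by (rule acd_linear[OF fn_acd bounded_linear_cnj])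
  have "integral {0..2*pi} (%z. dv u z*cnj (fn v z) + fn u z*cnj (dv v z)) = 0"
    using acd_parts[OF fn_acd[of 0 "2*pi" u] c] perD[OF fn_per, of _ 0] by simp
  then have "integral {0..2*pi} (%z. dv u z*cnj (fn v z)) + integral {0..2*pi} (%z. fn u z*cnj (dv v z)) = 0"
    by (subst (asm) integral_add) (auto intro!: mult_cnj_integrable fn_sqint dv_sqint)
  then have "Re (integral {0..2*pi} (%z. dv u z*cnj (fn v z))) + Re (integral {0..2*pi} (%z. fn u z*cnj (dv v z))) = 0"
    by (metis plus_complex.sel(1) zero_complex.sel(1))
  then show ?thesis
    using ip_commute[of "dv v" "fn u"] by (simp add: ch_def ip_Re[OF dv_sqint fn_sqint] ip_Re[OF fn_sqint dv_sqint])
qed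

lemma fn_incr:
  assumes "0 <= x" "x <= y" "y <= 2*pi"
  shows "cmod (fn u y - fn u x) <= sqrt (y - x) * sqrt (ta u u)"
proof -
  have "cmod (fn u y - fn u x) <= sqrt (y - x) * sqrt (integral {x..y} (%z. (cmod (dv u z))^2))"
    using integral_norm_le_sqrt[OF dv_sqint, of x y u] acd_eq[OF fn_acd[of 0 "2*pi" u], of x y] assms by simp
  also have "integral {x..y} (%z. (cmod (dv u z))^2) <= ta u u" unfolding ta_def ip_self using assms
    by (intro integral_subset_le sqint_sq dv_sqint) auto
  finally show ?thesis using assms by (simp add: mult_left_mono order_trans[OF _ mult_left_mono])
qed

lemma sqrt_2pi: "1 <= sqrt (2*pi)" "sqrt (2*pi) <= 3" using pi_ge_two pi_less_4 by (auto intro: real_le_lsqrt)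

text \<open>The value at \<open>x\<close> exceeds that at \<open>y\<close> by at most
  \<open>3*norm u\<close>, as \<open>sqrt (2*pi) <= 3\<close>; averaging over \<open>y\<close>
  bounds the other term by \<open>norm u\<close>.\<close>

lemma fn_bound: "cmod (fn u z) <= 4*norm u"
proof -
  obtain n where n: "z + 2*pi * of_int n \<in> {0..2*pi}" by (rule period_representative)
  define x where "x = z + 2*pi * of_int n"
  have x: "x \<in> {0..2*pi}" "fn u x = fn u z" using n by (simp_all add: x_def per_int[OF fn_per])
  have le: "cmod (fn u x) <= cmod (fn u y) + 3*norm u" if y: "y \<in> {0..2*pi}" for y
  proof -
    have b: "sqrt \<bar>x - y\<bar> * sqrt (ta u u) <= 3*norm u" using x(1) y sqrt_2pi ta_le_norm[of u]
      by (intro mult_mono order_trans[OF _ sqrt_2pi(2)] real_sqrt_le_mono) (auto simp: ta_nonneg)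
    have "cmod (fn u x - fn u y) <= sqrt \<bar>x - y\<bar> * sqrt (ta u u)"
      using fn_incr[of x y u] fn_incr[of y x u] x(1) y by (cases "x <= y") (auto simp: norm_minus_commute abs_if)
    then show ?thesis using b norm_triangle_ineq2[of "fn u x" "fn u y"] by linarith
  qed
  have c: "(%y. cmod (fn u y)) integrable_on {0..2*pi}" by (intro integrable_continuous_real continuous_intros fn_cont)
  have "2*pi*cmod (fn u x) = integral {0..2*pi} (%y. cmod (fn u x))" by simp
  also have "... <= integral {0..2*pi} (%y. cmod (fn u y) + 3*norm u)"
    using le by (intro integral_le integrable_add c) auto
  also have "... = integral {0..2*pi} (%y. cmod (fn u y)) + 2*pi*(3*norm u)" by (subst integral_add[OF c]) auto
  also have "integral {0..2*pi} (%y. cmod (fn u y)) <= sqrt (2*pi) * sqrt (sg u u)"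
    using integral_norm_le_sqrt[OF sqint_norm[OF fn_sqint[of 0 "2*pi" u]]] by (simp add: sg_def ip_self)
  also have "... <= 2*pi*norm u"
  proof (rule mult_mono[OF _ sg_le_norm])
    have "sqrt (2*pi)*1 <= sqrt (2*pi) * sqrt (2*pi)" using sqrt_2pi by (intro mult_left_mono) auto
    then show "sqrt (2*pi) <= 2*pi" by simp
  qed (auto simp: sg_nonneg)
  finally have "2*pi*cmod (fn u x) <= 2*pi*(4*norm u)" by (simp add: algebra_simps)
  then show ?thesis using x(2) by simp
qed

section \<open>The wave profile\<close>

text \<open>Half of \<open>aa k p u u\<close> is the quadratic part of the functional
  \<open>E_JE\<close>; subtracting the second derivative of its quartic part at \<open>w\<close>
  gives \<open>LL\<close>, the second variation at \<open>w\<close>.\<close>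

definition aa :: "real => real => h1 => h1 => real" where
  "aa k p u v = 4*k^2*ta u v - 4*k*p*ch (cm \<i> u) v + (1 + p^2) * sg u v"

definition nu :: "h1 => h1 => h1 => real" where
  "nu w u v = integral {0..2*pi} (%z. (cmod (fn w z))^2 * Re (fn u z*cnj (fn v z)))"

definition cq :: "h1 => h1 => real" where
  "cq w v = integral {0..2*pi} (%z. (Re (cnj (fn w z)*fn v z))^2)"

definition LL :: "real => real => h1 => h1 => real" where
  "LL k p w v = aa k p v v - nu w v v - 2*cq w v"

text \<open>The constraints in \<open>pos\<close> are orthogonality to the gradients of mass and
  momentum, and its null directions generate phase rotations and translations. \<open>dshQ\<close>
  demands differentiability of the translation orbit in the energy norm, that is, more regularity
  than the energy space provides.\<close>

locale profile =
  fixes k p :: real and Q Q1 :: h1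
  assumes k: "k > 0"
    and dQ: "hp (fn Q) (fn Q1)"
    and dshQ: "((%xh. sh xh Q) has_vector_derivative Q1) (at 0)"
    and eqn: "!!v. aa k p Q v = nu Q Q v"
    and pos: "!!v. sg Q v = 0 ==> sg (cm \<i> Q1) v = 0 ==>
       0 <= LL k p Q v & (LL k p Q v <= 0 --> (EX al be. v = al *\<^sub>R cm \<i> Q + be *\<^sub>R Q1))"

lemma per_uniformly_continuous:
  fixes f :: "real => complex"
  assumes p: "per f" and c: "!!z. isCont f z" and e: "e > 0"
  shows "EX d>0. ALL z r. \<bar>r\<bar> <= d --> cmod (f (z + r) - f z) < e"
proof -
  have "uniformly_continuous_on {-1..2*pi + 1} f"
    by (intro compact_uniformly_continuous continuous_at_imp_continuous_on) (use c in auto)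
  then obtain d where d: "d > 0" "!!x y. x \<in> {-1..2*pi + 1} ==> y \<in> {-1..2*pi + 1} ==> dist y x < d ==> dist (f y) (f x) < e"
    using e unfolding uniformly_continuous_on_def by blast
  show ?thesis
  proof (intro exI[of _ "min (d/2) 1"] conjI allI impI)
    fix z r :: real assume r: "\<bar>r\<bar> <= min (d/2) 1"
    obtain n where n: "z + 2*pi * of_int n \<in> {0..2*pi}" by (rule period_representative)
    define x where "x = z + 2*pi * of_int n"
    have "dist (f (x + r)) (f x) < e" using d(1) r n by (intro d(2)) (auto simp: dist_real_def x_def)
    moreover have "f (x + r) = f (z + r)" "f x = f z"
      using per_int[OF p, of "z + r" n] per_int[OF p, of z n] by (simp_all add: x_def algebra_simps)
    ultimately show "cmod (f (z + r) - f z) < e" by (simp add: dist_norm)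
  qed (use d in auto)
qed

lemma per_linearization:
  fixes f :: "real => complex"
  assumes p: "per f'" and d: "!!z. (f has_vector_derivative f' z) (at z)" and c: "!!z. isCont f' z" and e: "e > 0"
  shows "EX de>0. ALL z h. \<bar>h\<bar> <= de --> cmod (f (z + h) - f z - of_real h*f' z) <= e * \<bar>h\<bar>"
proof -
  from per_uniformly_continuous[OF p c e] obtain de where de: "de > 0"
    "!!z r. \<bar>r\<bar> <= de ==> cmod (f' (z + r) - f' z) < e" by blast
  show ?thesis
  proof (intro exI[of _ de] conjI allI impI)
    fix z h :: real assume h: "\<bar>h\<bar> <= de"
    have "norm (f (z + h) - f z - ((z + h) - z) *\<^sub>R f' z) <= norm ((z + h) - z)*e"
    proof (rule vector_differentiable_bound_linearization[where S="{z - de..z + de}"])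
      show "(f has_vector_derivative f' x) (at x within {z - de..z + de})" for x
        by (rule has_vector_derivative_at_within[OF d])
      show "closed_segment z (z + h) <= {z - de..z + de}"
        using h by (auto simp: closed_segment_eq_real_ivl abs_le_iff split: if_splits)
      show "norm (f' x - f' z) <= e" if "x \<in> {z - de..z + de}" for x
        using de(2)[of "x - z" z] that by (simp add: abs_le_iff less_imp_le)
    qed (use de in auto)
    then show "cmod (f (z + h) - f z - of_real h*f' z) <= e * \<bar>h\<bar>"
      by (simp add: scaleR_conv_of_real mult.commute)
  qed (rule de(1))
qed

text \<open>The constant comes from \<open>4*pi <= 16\<close>.\<close>

lemma norm_h1_le:
  assumes "!!z. cmod (fn u z) <= e" "hp (fn u) g" "!!z. cmod (g z) <= e"
  shows "norm u <= 4*e"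
proof -
  have e: "0 <= e" using assms(1)[of 0] norm_ge_zero order_trans by blast
  have *: "ip f f <= 2*pi*e^2" if "L2 f" "!!z. cmod (f z) <= e" for f
  proof -
    have "ip f f <= integral {0..2*pi} (%z. e^2)" unfolding ip_self
      by (intro integral_le sqint_sq that power_mono) auto
    then show ?thesis by simp
  qed
  have "ta u u = ip g g" unfolding ta_def using dv_AE[OF assms(2)] by (intro ip_AE_cong)
  then have "(norm u)^2 <= 2*pi*e^2 + 2*pi*e^2" unfolding norm_h1_sq sg_def
    using *[OF fn_sqint assms(1)] *[OF acd_sqint[OF hpD(3)[OF assms(2)]] assms(3)] by simp
  also have "... = pi*(4*e^2)" by simp
  also have "... <= 4*(4*e^2)" using pi_less_4 by (intro mult_right_mono) auto
  also have "... = (4*e)^2" by (simp add: power_mult_distrib)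
  finally show ?thesis by (rule power2_le_imp_le) (use e in simp)
qed

text \<open>Two continuous periodic derivatives make the first order Taylor remainders of
  \<open>f\<close> and of \<open>f1\<close> uniformly small, which controls both parts of the energy
  norm.\<close>

lemma sh_has_derivative:
  assumes p: "per f" and d: "!!z. (f has_vector_derivative f1 z) (at z)" "!!z. (f1 has_vector_derivative f2 z) (at z)"
    and c: "!!z. isCont f2 z"
  shows "((%xh. sh xh (h1_of f)) has_vector_derivative h1_of f1) (at 0)"
proof -
  have h1: "hp f f1" by (rule hpI_C1[OF p d(1) has_vector_derivative_continuous[OF d(2)]])
  have h2: "hp f1 f2" using hpD(2)[OF h1] d(2) c by (rule hpI_C1)
  have F: "fn (h1_of f) = f" "fn (h1_of f1) = f1" using h1 h2 by (auto intro: fn_h1_of)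
  have "EX d>0. ALL y. norm (y - 0) < d --> norm (sh y (h1_of f) - sh 0 (h1_of f) - (y - 0) *\<^sub>R h1_of f1) <= e*norm (y - 0)"
    if e: "e > 0" for e
  proof -
    have e4: "e/4 > 0" using e by simp
    obtain de1 where de1: "de1 > 0" "!!z h. \<bar>h\<bar> <= de1 ==> cmod (f (z + h) - f z - of_real h*f1 z) <= e/4 * \<bar>h\<bar>"
      using per_linearization[OF hpD(2)[OF h1] d(1) has_vector_derivative_continuous[OF d(2)] e4] by blast
    obtain de2 where de2: "de2 > 0" "!!z h. \<bar>h\<bar> <= de2 ==> cmod (f1 (z + h) - f1 z - of_real h*f2 z) <= e/4 * \<bar>h\<bar>"
      using per_linearization[OF hpD(2)[OF h2] d(2) c e4] by blast
    show ?thesis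
    proof (intro exI[of _ "min de1 de2"] conjI allI impI)
      fix h :: real assume h: "norm (h - 0) < min de1 de2"
      define w where "w = sh h (h1_of f) - sh 0 (h1_of f) - (h - 0) *\<^sub>R h1_of f1"
      have wz: "fn w z = f (z + h) - f z - of_real h*f1 z" for z
        by (simp add: w_def fn_minus fn_sh fn_scaleR F scaleR_conv_of_real)
      have "hp (fn w) (%z. f1 (z + h) - f1 z - of_real h*f2 z)"
      proof -
        have "hp (%z. (f (z + h) + (- 1) *\<^sub>R f z) + (- h) *\<^sub>R f1 z) (%z. (f1 (z + h) + (- 1) *\<^sub>R f1 z) + (- h) *\<^sub>R f2 z)"
          by (intro hp_add hp_shift hp_linear[OF _ bounded_linear_scaleR_right] h1 h2)
        then show ?thesis unfolding wz[abs_def] by (simp add: scaleR_conv_of_real)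
      qed
      then have "norm w <= 4*(e/4 * \<bar>h\<bar>)" using h de1(2) de2(2) by (intro norm_h1_le) (auto simp: wz)
      then show "norm (sh h (h1_of f) - sh 0 (h1_of f) - (h - 0) *\<^sub>R h1_of f1) <= e*norm (h - 0)"
        by (simp add: w_def)
    qed (use de1 de2 in auto)
  qed
  then show ?thesis unfolding has_vector_derivative_def has_derivative_at_alt
    by (auto intro: bounded_linear_scaleR_left)
qed

context good_wave
begin

definition "kk = pi/T"
definition "e0 z = cis (- (p/(2*kk))*z)"
definition "Qf z = e0 z*W (z/(2*kk))"
definition "Q1f z = of_real (1/(2*kk))*(e0 z*(W1 (z/(2*kk)) - \<i> * of_real p*W (z/(2*kk))))"
definition "Q2f z = of_real (1/(4*kk^2))*(e0 z*((W (z/(2*kk)) - of_real ((cmod (W (z/(2*kk))))^2)*W (z/(2*kk)))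
    - 2 * \<i> * of_real p*W1 (z/(2*kk)) - of_real (p^2)*W (z/(2*kk))))"

lemma kk: "kk > 0" using T_pos by (simp add: kk_def)

lemma de0: "(e0 has_vector_derivative - \<i> * of_real (p/(2*kk))*e0 z) (at z)"
proof -
  have "((%z. - (p/(2*kk))*z) has_real_derivative - (p/(2*kk))) (at z)"
    using kk by (auto simp: has_real_derivative_iff_has_vector_derivative[symmetric] intro!: derivative_eq_intros)
  from has_vector_derivative_cis[OF this] show ?thesis unfolding e0_def[abs_def] by simp
qed

lemma d_scale:
  assumes "!!x. (f has_vector_derivative f' x) (at x)"
  shows "((%z. f (z/(2*kk))) has_vector_derivative of_real (1/(2*kk))*f' (z/(2*kk))) (at z)"
proof -
  have h: "((%z. z/(2*kk)) has_vector_derivative 1/(2*kk)) (at z)"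
    using kk by (auto simp: has_real_derivative_iff_has_vector_derivative[symmetric] intro!: derivative_eq_intros)
  from vector_diff_chain_at[OF h assms] show ?thesis by (simp add: o_def scaleR_conv_of_real)
qed

lemma dQf: "(Qf has_vector_derivative Q1f z) (at z)"
proof -
  have "(Qf has_vector_derivative e0 z*(of_real (1/(2*kk))*W1 (z/(2*kk))) + - \<i> * of_real (p/(2*kk))*e0 z*W (z/(2*kk))) (at z)"
    unfolding Qf_def[abs_def] by (intro has_vector_derivative_mult de0 d_scale dW)
  moreover have "e0 z*(of_real (1/(2*kk))*W1 (z/(2*kk))) + - \<i> * of_real (p/(2*kk))*e0 z*W (z/(2*kk)) = Q1f z"
    unfolding Q1f_def by (simp add: algebra_simps)
  ultimately show ?thesis by simp
qed

lemma dQ1f: "(Q1f has_vector_derivative Q2f z) (at z)"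
proof -
  define w w1 where "w = W (z/(2*kk))" and "w1 = W1 (z/(2*kk))"
  have "(Q1f has_vector_derivative of_real (1/(2*kk)) *
     (e0 z*(of_real (1/(2*kk))*(w - of_real ((cmod w)^2)*w) - \<i> * of_real p*(of_real (1/(2*kk))*w1))
        + - \<i> * of_real (p/(2*kk))*e0 z*(w1 - \<i> * of_real p*w))) (at z)" unfolding Q1f_def[abs_def] w_def w1_def
    by (intro has_vector_derivative_mult_right has_vector_derivative_mult has_vector_derivative_diff de0 d_scale dW dW1)
  moreover have "of_real (1/(2*kk)) *
     (e0 z*(of_real (1/(2*kk))*(w - of_real ((cmod w)^2)*w) - \<i> * of_real p*(of_real (1/(2*kk))*w1))
        + - \<i> * of_real (p/(2*kk))*e0 z*(w1 - \<i> * of_real p*w)) = Q2f z"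
    unfolding Q2f_def w_def[symmetric] w1_def[symmetric] using kk by (simp add: field_simps power2_eq_square)
  ultimately show ?thesis by simp
qed

lemma cont_W: "isCont W x" "isCont W1 x"
  using has_vector_derivative_continuous[OF dW] has_vector_derivative_continuous[OF dW1] by auto

lemma cont_Q2f: "isCont Q2f z"
proof -
  have "isCont (%z. z/(2*kk)) z" using kk by (intro continuous_intros) auto
  then have "isCont (%z. W (z/(2*kk))) z" "isCont (%z. W1 (z/(2*kk))) z" using isCont_o2 cont_W by blast+
  then show ?thesis using has_vector_derivative_continuous[OF de0]
    unfolding Q2f_def[abs_def] by (intro continuous_intros) auto
qed

lemma norm_e0: "cmod (e0 z) = 1" by (simp add: e0_def)

lemma per_Qf: "per Qf" unfolding per_def
proof
  fix z
  have "(z + 2*pi)/(2*kk) = z/(2*kk) + T" using T_pos by (simp add: kk_def field_simps)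
  moreover have "e0 (z + 2*pi)*cis (p*T) = e0 z"
  proof -
    have "- (p/(2*kk))*(z + 2*pi) + p*T = - (p/(2*kk))*z" using T_pos by (simp add: kk_def field_simps)
    then show ?thesis by (simp add: e0_def cis_mult)
  qed
  ultimately show "Qf (z + 2*pi) = Qf z" unfolding Qf_def by (simp add: quasi mult.assoc[symmetric])
qed

lemma hpQ: "hp Qf Q1f" by (rule hpI_C1[OF per_Qf dQf]) (rule has_vector_derivative_continuous[OF dQ1f])

lemma hpQ1: "hp Q1f Q2f" by (rule hpI_C1[OF hpD(2)[OF hpQ] dQ1f cont_Q2f])

lemma ode_Q: "of_real (4*kk^2)*Q2f z + \<i> * of_real (4*p*kk)*Q1f z - of_real (1 + p^2)*Qf z
    + of_real ((cmod (Qf z))^2)*Qf z = 0"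
proof -
  define w w1 where "w = W (z/(2*kk))" and "w1 = W1 (z/(2*kk))"
  have "cmod (Qf z) = cmod w" by (simp add: Qf_def w_def norm_mult norm_e0)
  moreover have "of_real (4*kk^2)*Q2f z = e0 z*((w - of_real ((cmod w)^2)*w) - 2 * \<i> * of_real p*w1 - of_real (p^2)*w)"
    unfolding Q2f_def w_def w1_def using kk by simp
  moreover have "\<i> * of_real (4*p*kk)*Q1f z = e0 z*(2 * \<i> * of_real p*(w1 - \<i> * of_real p*w))"
    unfolding Q1f_def w_def w1_def using kk by (simp add: field_simps)
  moreover have "Qf z = e0 z*w" by (simp add: Qf_def w_def)
  ultimately show ?thesis by (simp add: algebra_simps power2_eq_square)
qed

definition "QH = h1_of Qf"
definition "QH1 = h1_of Q1f"

lemma fn_QH: "fn QH = Qf" "fn QH1 = Q1f" unfolding QH_def QH1_def by (rule fn_h1_of[OF hpQ] fn_h1_of[OF hpQ1])+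

lemma scaled_integral:
  fixes f :: "real => real"
  assumes "per f" "!!a b. f integrable_on {a..b}"
  shows "integral {- (T/2)..T/2} (%x. f (2*kk*x)) = integral {0..2*pi} f/(2*kk)"
proof -
  have e: "2*kk*- (T/2) + 0 = - pi" "2*kk*(T/2) + 0 = pi" using T_pos by (auto simp: kk_def)
  have "integral {- (T/2)..T/2} (%x. f (2*kk*x)) = integral {- pi..pi} f/(2*kk)"
    using integral_affine(2)[of f, where m="2*kk" and c=0 and a="- (T/2)" and b="T/2"] assms(2) kk unfolding e by (simp add: field_simps)
  also have "integral {- pi..pi} f = integral {0..2*pi} f" using integral_period[OF assms, of "- pi"] by simp
  finally show ?thesis .
qed

text \<open>The profile equation \<open>ode_Q\<close> tested with \<open>v\<close>, the derivative
  on \<open>v\<close> being moved back by \<open>ch_skew\<close>.\<close>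

lemma eqn_QH: "aa kk p QH v = nu QH QH v"
proof -
  have d: "dv QH1 = dv QH1" ..
  have t: "ta QH v = - ip Q2f (fn v)"
  proof -
    have "ta QH v = ip Q1f (dv v)" unfolding ta_def by (rule ip_AE_cong) (use dv_AE[of QH Q1f] hpQ fn_QH in auto)
    also have "... = - ip Q2f (fn v)"
    proof -
      have "ip Q1f (dv v) = ch v QH1" by (simp add: ch_def fn_QH ip_commute)
      also have "... = - ch QH1 v" by (rule ch_skew)
      also have "ch QH1 v = ip Q2f (fn v)" unfolding ch_def
        by (rule ip_AE_cong) (use dv_AE[of QH1 Q2f] hpQ1 fn_QH in auto)
      finally show ?thesis .
    qed
    finally show ?thesis .
  qed
  have c: "ch (cm \<i> QH) v = ip (%z. \<i>*Q1f z) (fn v)" unfolding ch_def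
    by (rule ip_AE_cong) (use dv_AE[of "cm \<i> QH"] hp_linear[OF hpQ bounded_linear_mult_right] in \<open>auto simp: fn_cm[abs_def] fn_QH\<close>)
  have s: "sg QH v = ip Qf (fn v)" by (simp add: sg_def fn_QH)
  have L: "L2 Qf" "L2 Q1f" "L2 Q2f"
    using acd_sqint_fun[OF hpD(3)[OF hpQ]] acd_sqint[OF hpD(3)[OF hpQ]] acd_sqint[OF hpD(3)[OF hpQ1]] .
  have Li: "L2 (%z. \<i>*Q1f z)" by (intro sqint_mult_bounded L continuous_intros)
  note I = ip_integrable[OF L(1) fn_sqint, of v] ip_integrable[OF L(3) fn_sqint, of v] ip_integrable[OF Li fn_sqint, of v]
  have "aa kk p QH v - nu QH QH v = integral {0..2*pi} (%z. - (4*kk^2) * Re (Q2f z*cnj (fn v z))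
     - 4*kk*p * Re (\<i>*Q1f z*cnj (fn v z)) + (1 + p^2) * Re (Qf z*cnj (fn v z))
     - (cmod (Qf z))^2 * Re (Qf z*cnj (fn v z)))"
  proof -
    have i4: "(%z. (cmod (Qf z))^2 * Re (Qf z*cnj (fn v z))) integrable_on {0..2*pi}"
      by (intro integrable_continuous_real continuous_intros fn_cont hp_cont[OF hpQ])
    show ?thesis unfolding aa_def nu_def t c s fn_QH ip_def
      using I i4 by (simp only: integral_diff integral_add integrable_diff integrable_add integral_mult_right integrable_on_mult_right)
  qed
  also have "... = integral {0..2*pi} (%z. 0)"
  proof (rule arg_cong[of _ _ "integral _"], rule ext)
    fix z
    have "Re ((of_real (4*kk^2)*Q2f z + \<i> * of_real (4*p*kk)*Q1f z - of_real (1 + p^2)*Qf z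
      + of_real ((cmod (Qf z))^2)*Qf z)*cnj (fn v z)) = 0" unfolding ode_Q by simp
    then show "- (4*kk^2) * Re (Q2f z*cnj (fn v z)) - 4*kk*p * Re (\<i>*Q1f z*cnj (fn v z))
      + (1 + p^2) * Re (Qf z*cnj (fn v z)) - (cmod (Qf z))^2 * Re (Qf z*cnj (fn v z)) = 0"
      by (simp add: algebra_simps)
  qed
  finally show ?thesis by simp
qed

text \<open>Undoing the scaling and restoring the phase turns \<open>v\<close> into a quasi-periodic
  \<open>w\<close> whose \<open>quad\<close> integrates to \<open>LL kk p QH v/(2*kk)\<close>. The
  momentum constraint for \<open>w\<close> is a combination of both constraints on
  \<open>v\<close>.\<close>

lemma pos_QH:
  assumes n1: "sg QH v = 0" and n2: "sg (cm \<i> QH1) v = 0"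
  shows "0 <= LL kk p QH v & (LL kk p QH v <= 0 --> (EX al be. v = al *\<^sub>R cm \<i> QH + be *\<^sub>R QH1))"
proof -
  let ?I = "{- (T/2)..T/2}"
  define V G where "V = fn v" and "G = dv v"
  have hv: "hp V G" unfolding V_def G_def by (rule hp_fn)
  have sV: "sqint a b V" and sG: "sqint a b G" for a b unfolding V_def G_def by (rule fn_sqint dv_sqint)+
  define w g where "w x = cis (p*x)*V (2*kk*x)"
    and "g x = \<i> * of_real p*cis (p*x)*V (2*kk*x) + cis (p*x)*(of_real (2*kk)*G (2*kk*x))" for x
  have "acd (- (T/2)) (T/2) (%x. cis (p*x)) (%x. \<i> * of_real p*cis (p*x))"
  proof (rule acdI)
    show "((%x. cis (p*x)) has_vector_derivative \<i> * of_real p*cis (p*x)) (at x within ?I)" for x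
      by (rule has_vector_derivative_at_within[OF has_vector_derivative_cis[OF DERIV_cmult_Id]])
    show "continuous_on ?I (%x. \<i> * of_real p*cis (p*x))" by (intro continuous_intros)
  qed
  moreover have "acd (- (T/2)) (T/2) (%x. V (2*kk*x)) (%x. of_real (2*kk)*G (2*kk*x))"
    using acd_affine[OF hpD(3)[OF hv], where m="2*kk" and c=0 and a="- (T/2)" and b="T/2"] kk by (simp add: scaleR_conv_of_real)
  ultimately have wg: "acd (- (T/2)) (T/2) w g" unfolding w_def g_def by (rule acd_mult)
  have wT: "w (T/2) = cis (p*T)*w (- (T/2))"
  proof -
    have "2*kk*(T/2) = 2*kk*- (T/2) + 2*pi" using T_pos by (simp add: kk_def)
    then have "V (2*kk*(T/2)) = V (2*kk*- (T/2))" using perD[OF hpD(1)[OF hv]] by metis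
    moreover have "cis (p*(T/2)) = cis (p*T)*cis (p*- (T/2))" by (simp add: cis_mult algebra_simps)
    ultimately show ?thesis unfolding w_def by (simp only: mult.assoc)
  qed
  have e0: "cis (p*x)*e0 (2*kk*x) = 1" for x using kk by (simp add: e0_def cis_mult)
  have Wx: "W x = cis (p*x)*Qf (2*kk*x)" for x unfolding Qf_def mult.assoc[symmetric] e0 using kk by simp
  have W1x: "W1 x = cis (p*x)*(of_real (2*kk)*Q1f (2*kk*x) + \<i> * of_real p*Qf (2*kk*x))" for x
  proof -
    have "of_real (2*kk)*Q1f (2*kk*x) + \<i> * of_real p*Qf (2*kk*x) = e0 (2*kk*x)*W1 x"
      unfolding Q1f_def Qf_def using kk by (simp add: algebra_simps)
    then show ?thesis unfolding mult.assoc[symmetric] by (simp add: e0 mult.assoc[symmetric])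
  qed
  have cc: "cnj (cis t*a)*(cis t*b) = cnj a*b" for t a b
  proof -
    have "cnj (cis t*a)*(cis t*b) = (cnj (cis t)*cis t)*(cnj a*b)" by (simp add: algebra_simps)
    also have "cnj (cis t)*cis t = 1" by (simp add: cis_cnj cis_mult)
    finally show ?thesis by simp
  qed
  have ints: "per V" "per G" "per Qf" "per Q1f" using hpD(1,2)[OF hv] hpD(1,2)[OF hpQ] by auto
  have cV: "continuous_on S V" and cQ: "continuous_on S Qf" and cQ1: "continuous_on S Q1f" for S
    using hp_cont[OF hv] hp_cont[OF hpQ] hp_cont[OF hpQ1] by auto
  have c1: "integral ?I (%x. Re (cnj (W x)*w x)) = 0"
  proof -
    have "integral ?I (%x. Re (cnj (W x)*w x)) = integral ?I (%x. (%z. Re (Qf z*cnj (V z))) (2*kk*x))"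
      by (rule arg_cong[of _ _ "integral _"]) (simp add: Wx w_def cc fun_eq_iff del: complex_cnj_mult)
    also have "... = integral {0..2*pi} (%z. Re (Qf z*cnj (V z)))/(2*kk)"
      by (rule scaled_integral) (use ints in \<open>auto simp: per_def intro!: integrable_continuous_real continuous_intros cV cQ\<close>)
    also have "... = 0" using n1 by (simp add: sg_def ip_def fn_QH V_def)
    finally show ?thesis .
  qed
  have im: "Im (cnj v * (of_real a*q1 + \<i> * of_real b*q)) = - a * Re (\<i>*q1*cnj v) + b * Re (q*cnj v)" for a b v q q1
    by (simp add: algebra_simps)
  have c2: "integral ?I (%x. Im (cnj (w x)*W1 x)) = 0"
  proof -
    have "integral ?I (%x. Im (cnj (w x)*W1 x)) = integral ?I (%x. (%z. - (2*kk) * Re (\<i>*Q1f z*cnj (V z)) + p * Re (Qf z*cnj (V z))) (2*kk*x))"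
      by (simp only: w_def W1x cc im)
    also have "... = integral {0..2*pi} (%z. - (2*kk) * Re (\<i>*Q1f z*cnj (V z)) + p * Re (Qf z*cnj (V z)))/(2*kk)"
      by (rule scaled_integral) (use ints in \<open>auto simp: per_def intro!: integrable_continuous_real continuous_intros cV cQ cQ1\<close>)
    also have "integral {0..2*pi} (%z. - (2*kk) * Re (\<i>*Q1f z*cnj (V z)) + p * Re (Qf z*cnj (V z)))
      = - (2*kk) * sg (cm \<i> QH1) v + p * sg QH v"
      unfolding sg_def ip_def fn_QH fn_cm[abs_def] V_def[symmetric] integral_mult_right[symmetric]
      by (intro integral_add integrable_continuous_real continuous_intros cV cQ cQ1)
    finally show ?thesis using n1 n2 by simp
  qed
  have Lz: "integral ?I (quad W w g) = LL kk p QH v/(2*kk)"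
  proof -
    define q where "q z = 4*kk^2 * Re (G z*cnj (G z)) - 4*kk*p * Re (\<i>*G z*cnj (V z)) + (1 + p^2) * Re (V z*cnj (V z))
      - (cmod (Qf z))^2 * Re (V z*cnj (V z)) - 2*(Re (cnj (Qf z)*V z))^2" for z
    have "quad W w g x = q (2*kk*x)" for x
    proof -
      define V' G' Q' where "V' = V (2*kk*x)" and "G' = G (2*kk*x)" and "Q' = Qf (2*kk*x)"
      have gg: "g x = cis (p*x)*(\<i> * of_real p*V' + of_real (2*kk)*G')"
        unfolding g_def V'_def G'_def by (simp add: algebra_simps)
      have g2: "(cmod (g x))^2 = p^2*(cmod V')^2 + 4*kk^2*(cmod G')^2 - 4*kk*p * Re (\<i>*G'*cnj V')"
        unfolding gg norm_mult cmod_power2 power_mult_distrib by (simp add: cmod_power2 power2_eq_square algebra_simps)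
      have w2: "cmod (w x) = cmod V'" "cmod (W x) = cmod Q'" by (simp_all add: w_def Wx V'_def Q'_def norm_mult)
      have r2: "Re (cnj (W x)*w x) = Re (cnj Q'*V')" by (simp only: w_def Wx cc V'_def Q'_def)
      have n: "Re (z*cnj z) = (cmod z)^2" for z unfolding cmod_power2 by (simp add: power2_eq_square)
      show ?thesis unfolding quad_def g2 w2 r2 q_def V'_def[symmetric] G'_def[symmetric] Q'_def[symmetric] n
        by (simp add: algebra_simps)
    qed
    then have "integral ?I (quad W w g) = integral ?I (%x. q (2*kk*x))" by (simp add: fun_eq_iff cong: integral_cong)
    have i1: "(%z. Re (G z*cnj (G z))) integrable_on {a..b}" "(%z. Re (\<i>*G z*cnj (V z))) integrable_on {a..b}" for a b
      by (intro integrable_Re sqint_times_integrable sqint_cnj sG sV sqint_mult_bounded continuous_intros)+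
    have i2: "(%z. Re (V z*cnj (V z))) integrable_on {a..b}" "(%z. (cmod (Qf z))^2 * Re (V z*cnj (V z))) integrable_on {a..b}"
      "(%z. (Re (cnj (Qf z)*V z))^2) integrable_on {a..b}" for a b
      by (intro integrable_continuous_real continuous_intros cV cQ)+
    have qi: "q integrable_on {a..b}" for a b
      unfolding q_def[abs_def] by (intro integrable_diff integrable_add integrable_on_mult_right i1 i2)
    have "integral ?I (%x. q (2*kk*x)) = integral {0..2*pi} q/(2*kk)"
      by (rule scaled_integral[OF _ qi]) (use ints in \<open>simp add: per_def q_def\<close>)
    moreover have "integral {0..2*pi} q = LL kk p QH v"
    proof -
      have c: "ch (cm \<i> v) v = ip (%z. \<i>*G z) V" unfolding ch_def V_def G_def
        by (rule ip_AE_cong) (use dv_cm in auto)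
      show ?thesis
        unfolding LL_def aa_def nu_def cq_def c ta_def sg_def fn_QH V_def[symmetric] G_def[symmetric] ip_def q_def[abs_def]
        by (simp only: integral_diff integral_add integrable_diff integrable_add integral_mult_right integrable_on_mult_right i1 i2)
    qed
    ultimately show ?thesis using \<open>integral ?I (quad W w g) = integral ?I (\<lambda>x. q (2 * kk * x))\<close> by simp
  qed
  note P = pos[OF wg wT c1 c2, unfolded Lz]
  have "0 <= LL kk p QH v" using P kk by (simp add: zero_le_divide_iff)
  moreover have "EX al be. v = al *\<^sub>R cm \<i> QH + be *\<^sub>R QH1" if "LL kk p QH v <= 0"
  proof -
    have "LL kk p QH v/(2*kk) <= 0" using that kk by (simp add: divide_le_0_iff)
    then obtain al be where ab: "!!x. x \<in> ?I ==> w x = of_real al*(\<i>*W x) + of_real be*W1 x" using P by blast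
    \<comment> \<open>Differentiating \<open>W\<close> also hits the phase factor removed from the
      profile, which contributes \<open>p*be\<close> to the rotation coefficient.\<close>
    have "V z = of_real (al + p*be)*(\<i>*Qf z) + of_real (2*kk*be)*Q1f z" if z: "z \<in> {- pi..pi}" for z
    proof -
      define x where "x = z/(2*kk)"
      have zx: "2*kk*x = z" using kk by (simp add: x_def)
      have "T*- pi <= T*z" "T*z <= T*pi" using mult_left_mono[of "- pi" z T] mult_left_mono[of z pi T] z T_pos by auto
      then have "x \<in> ?I" using T_pos by (simp add: x_def kk_def field_simps)
      from ab[OF this] have "cis (p*x)*V z = cis (p*x)*(of_real (al + p*be)*(\<i>*Qf z) + of_real (2*kk*be)*Q1f z)"
        by (simp only: w_def Wx W1x zx) (simp add: algebra_simps)
      then show ?thesis by (simp del: of_real_mult of_real_add)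
    qed note V1 = this
    have "v = (al + p*be) *\<^sub>R cm \<i> QH + (2*kk*be) *\<^sub>R QH1"
    proof (rule h1_eqI)
      fix z
      obtain n where n: "z + pi + 2*pi * of_int n \<in> {0..2*pi}" by (rule period_representative)
      define x where "x = z + 2*pi * of_int n"
      have x: "x \<in> {- pi..pi}" using n by (simp add: x_def)
      have "V z = V x" "Qf z = Qf x" "Q1f z = Q1f x" using ints by (simp_all add: x_def per_int)
      then show "fn v z = fn ((al + p*be) *\<^sub>R cm \<i> QH + (2*kk*be) *\<^sub>R QH1) z"
        using V1[OF x] by (simp add: fn_plus fn_scaleR fn_cm fn_QH V_def scaleR_conv_of_real)
    qed
    then show ?thesis by blast
  qed
  ultimately show ?thesis by blast
qed

lemma profile: "profile kk p QH QH1"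
proof
  show "hp (fn QH) (fn QH1)" unfolding fn_QH by (rule hpQ)
  show "((%xh. sh xh QH) has_vector_derivative QH1) (at 0)"
    unfolding QH_def QH1_def by (rule sh_has_derivative[OF per_Qf dQf dQ1f cont_Q2f])
qed (use kk eqn_QH pos_QH in auto)

end

section \<open>Conservation laws\<close>

definition ff :: "h1 => h1 => real" where "ff u v = nu u u v"
definition FF :: "h1 => real" where "FF u = integral {0..2*pi} (%z. (cmod (fn u z))^4)/4"
definition l2 :: "h1 => real" where "l2 u = sqrt (sg u u)"

lemma l2_nonneg: "0 <= l2 u" and l2_le: "l2 u <= norm u" and l2_sq: "(l2 u)^2 = sg u u"
  using sg_le_norm[of u] sg_nonneg[of u] by (auto simp: l2_def)

lemma ff_ip: "ff u v = ip (%z. of_real ((cmod (fn u z))^2)*fn u z) (fn v)"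
  unfolding ff_def nu_def ip_def by (simp add: algebra_simps)

lemma ip_le_bound:
  assumes f: "continuous_on {0..2*pi} f" and "!!z. cmod (f z) <= c*cmod (fn w z)" "0 <= c"
  shows "\<bar>ip f (fn v)\<bar> <= c*l2 w*l2 v"
proof -
  have "ip f f <= integral {0..2*pi} (%z. c^2*(cmod (fn w z))^2)" unfolding ip_self
    using assms power_mono[OF assms(2), of _ 2]
    by (intro integral_le integrable_continuous_real continuous_intros fn_cont) (auto simp: power_mult_distrib)
  also have "... = (c*l2 w)^2" by (simp add: power_mult_distrib l2_sq sg_def ip_self)
  finally have "sqrt (ip f f) <= c*l2 w" using assms(3) l2_nonneg by (simp add: real_le_lsqrt)
  then show ?thesis using ip_bound[OF sqint_continuous[OF f] fn_sqint _ order_refl, of "c*l2 w" v]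
    by (simp add: l2_def sg_def)
qed

lemma ff_bound:
  assumes "!!z. cmod (fn u z) <= M"
  shows "\<bar>ff u v\<bar> <= M^2*l2 u*l2 v" unfolding ff_ip
proof (rule ip_le_bound)
  show "cmod (of_real ((cmod (fn u z))^2)*fn u z) <= M^2*cmod (fn u z)" for z
    unfolding norm_mult norm_of_real abs_power2
    using power_mono[OF assms[of z] norm_ge_zero, of 2] by (intro mult_right_mono) auto
qed (auto intro!: continuous_intros fn_cont)

text \<open>The second derivative of \<open>FF\<close> at \<open>w\<close>.\<close>

definition pot :: "h1 => h1 => h1 => real" where
  "pot w u v = integral {0..2*pi} (%z. (cmod (fn w z))^2 * Re (fn u z*cnj (fn v z))
     + 2*(Re (cnj (fn w z)*fn u z) * Re (cnj (fn w z)*fn v z)))"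

lemma pot_bound: "\<bar>pot w u v\<bar> <= 48*(norm w)^2*(l2 u*l2 v)"
proof -
  let ?I = "integral {0..2*pi}"
  define M where "M = 4*norm w"
  have C: "?I (%z. cmod (fn u z)*cmod (fn v z)) <= l2 u*l2 v"
    using Cauchy_Schwarz_norm[OF sqint_norm[OF fn_sqint] sqint_norm[OF fn_sqint], of 0 "2*pi" u v]
    by (simp add: l2_def sg_def ip_self)
  have e: "norm (pot w u v) <= ?I (%z. 3*M^2*(cmod (fn u z)*cmod (fn v z)))" unfolding pot_def
  proof (rule integral_norm_bound_integral)
    fix z
    have wM: "cmod (fn w z) <= M" using fn_bound by (simp add: M_def)
    have 1: "\<bar>Re (cnj (fn w z)*fn x z)\<bar> <= M*cmod (fn x z)" for x
      using abs_Re_le_cmod[of "cnj (fn w z)*fn x z"] mult_right_mono[OF wM, of "cmod (fn x z)"] by (simp add: norm_mult)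
    have 2: "\<bar>Re (fn u z*cnj (fn v z))\<bar> <= cmod (fn u z)*cmod (fn v z)"
      using abs_Re_le_cmod[of "fn u z*cnj (fn v z)"] by (simp add: norm_mult)
    have 3: "\<bar>(cmod (fn w z))^2 * Re (fn u z*cnj (fn v z))\<bar> <= M^2*(cmod (fn u z)*cmod (fn v z))"
      unfolding abs_mult abs_power2 using 2 power_mono[OF wM norm_ge_zero, of 2] by (intro mult_mono) auto
    have 4: "\<bar>Re (cnj (fn w z)*fn u z) * Re (cnj (fn w z)*fn v z)\<bar> <= (M*cmod (fn u z))*(M*cmod (fn v z))"
      unfolding abs_mult using 1[of u] 1[of v] order_trans[OF abs_ge_zero 1[of u]] by (intro mult_mono) auto
    have 5: "3*M^2*(cmod (fn u z)*cmod (fn v z)) = M^2*(cmod (fn u z)*cmod (fn v z)) + 2*((M*cmod (fn u z))*(M*cmod (fn v z)))"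
      by (simp add: power2_eq_square)
    show "norm ((cmod (fn w z))^2 * Re (fn u z*cnj (fn v z)) + 2*(Re (cnj (fn w z)*fn u z) * Re (cnj (fn w z)*fn v z)))
      <= 3*M^2*(cmod (fn u z)*cmod (fn v z))" unfolding 5 real_norm_def using 3 4 by linarith
  qed (intro integrable_continuous_real continuous_intros fn_cont)+
  have "?I (%z. 3*M^2*(cmod (fn u z)*cmod (fn v z))) = 3*M^2*?I (%z. cmod (fn u z)*cmod (fn v z))"
    by (rule integral_mult_right)
  also have "... <= 3*M^2*(l2 u*l2 v)" using C by (intro mult_left_mono) auto
  finally show ?thesis using e by (simp add: M_def power_mult_distrib)
qed

text \<open>Pointwise the remainder is exactly
  \<open>Re (cnj q*v)*(cmod v)^2 + (cmod v)^4/4\<close>. The sup bound is spent on all factors but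
  two, so that the square of the weaker norm \<open>l2 v\<close> survives.\<close>

lemma FF_expand: "\<bar>FF (q + v) - FF q - ff q v - pot q v v/2\<bar> <= (16*norm q*norm v + 4*(norm v)^2)*(l2 v)^2"
proof -
  let ?I = "integral {0..2*pi}"
  let ?r = "%z. Re (cnj (fn q z)*fn v z)*(cmod (fn v z))^2 + (cmod (fn v z))^4/4"
  have pw: "(cmod (q + v))^4/4 - (cmod q)^4/4 - (cmod q)^2 * Re (q*cnj v)
     - ((cmod q)^2 * Re (v * cnj v) + 2*(Re (cnj q * v) * Re (cnj q * v)))/2
     = Re (cnj q * v)*(cmod v)^2 + (cmod v)^4/4" for q v :: complex
  proof -
    define R where "R = Re (cnj q * v)"
    have 1: "(cmod (q + v))^2 = (cmod q)^2 + 2 * R + (cmod v)^2"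
      unfolding cmod_power2 R_def by (simp add: power2_eq_square algebra_simps)
    have 2: "Re (q*cnj v) = R" "Re (v * cnj v) = (cmod v)^2"
      unfolding cmod_power2 R_def by (simp_all add: power2_eq_square algebra_simps)
    have 4: "(cmod x)^4 = ((cmod x)^2)^2" for x by simp
    show ?thesis unfolding 4 1 2 R_def[symmetric] by (simp add: power2_eq_square algebra_simps)
  qed
  have j: "(%z. (cmod (fn (q + v) z))^4/4) integrable_on {0..2*pi}" "(%z. (cmod (fn q z))^4/4) integrable_on {0..2*pi}"
    "(%z. (cmod (fn q z))^2 * Re (fn q z*cnj (fn v z))) integrable_on {0..2*pi}"
    "(%z. ((cmod (fn q z))^2 * Re (fn v z*cnj (fn v z)) + 2*(Re (cnj (fn q z)*fn v z) * Re (cnj (fn q z)*fn v z)))/2) integrable_on {0..2*pi}"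
    by (auto intro!: integrable_continuous_real continuous_intros fn_cont)
  have e1: "FF (q + v) - FF q - ff q v - pot q v v/2 = ?I ?r"
    unfolding FF_def ff_def nu_def pot_def integral_divide[symmetric] pw[symmetric] fn_plus[symmetric]
    by (simp only: integral_diff integrable_diff j)
  have "norm (?I ?r) <= ?I (%z. (16*norm q*norm v + 4*(norm v)^2)*(cmod (fn v z))^2)"
  proof (rule integral_norm_bound_integral)
    fix z
    have "\<bar>Re (cnj (fn q z)*fn v z)\<bar> <= cmod (fn q z)*cmod (fn v z)"
      using abs_Re_le_cmod[of "cnj (fn q z)*fn v z"] by (simp add: norm_mult)
    also have "... <= (4*norm q)*(4*norm v)" by (intro mult_mono fn_bound) auto
    finally have 1: "\<bar>Re (cnj (fn q z)*fn v z)\<bar>*(cmod (fn v z))^2 <= (4*norm q)*(4*norm v)*(cmod (fn v z))^2"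
      by (intro mult_right_mono) auto
    have "(cmod (fn v z))^2 <= (4*norm v)^2" by (intro power_mono fn_bound) auto
    then have "(cmod (fn v z))^2*(cmod (fn v z))^2 <= (4*norm v)^2*(cmod (fn v z))^2" by (intro mult_right_mono) auto
    then have 2: "(cmod (fn v z))^4/4 <= 4*(norm v)^2*(cmod (fn v z))^2"
      by (simp add: power4_eq_xxxx power2_eq_square)
    have "norm (?r z) <= \<bar>Re (cnj (fn q z)*fn v z)\<bar>*(cmod (fn v z))^2 + (cmod (fn v z))^4/4"
      using abs_triangle_ineq[of "Re (cnj (fn q z)*fn v z)*(cmod (fn v z))^2" "(cmod (fn v z))^4/4"]
      by (simp add: abs_mult)
    then show "norm (?r z) <= (16*norm q*norm v + 4*(norm v)^2)*(cmod (fn v z))^2"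
      using 1 2 by (simp add: algebra_simps)
  qed (auto intro!: integrable_continuous_real continuous_intros fn_cont)
  also have "... = (16*norm q*norm v + 4*(norm v)^2)*(l2 v)^2"
    unfolding l2_sq sg_def ip_self by (rule integral_mult_right)
  finally show ?thesis using e1 by simp
qed

text \<open>The error involves \<open>l2\<close> alone, in which increments of a solution are
  smaller than in the energy norm. The constant is \<open>24 + 32 + 16\<close>, from the Hessian and
  the two remainder terms with \<open>norm (a - c) <= 2*R\<close>.\<close>

lemma FF_increment:
  assumes "norm a <= R" "norm c <= R"
  shows "\<bar>FF a - FF c - ff c (a - c)\<bar> <= 72 * R^2*(l2 (a - c))^2"
proof -
  let ?v = "a - c"
  have v: "norm ?v <= 2 * R" using norm_triangle_ineq4[of a c] assms by simp
  have R: "0 <= R" using assms(1) norm_ge_zero order_trans by blast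
  have "(norm c)^2 <= R^2" "norm c*norm ?v <= R*(2 * R)" "(norm ?v)^2 <= (2 * R)^2"
    using power_mono[OF assms(2) norm_ge_zero, of 2] mult_mono[OF assms(2) v R norm_ge_zero]
      power_mono[OF v norm_ge_zero, of 2] by blast+
  then have "24*(norm c)^2 + (16*norm c*norm ?v + 4*(norm ?v)^2) <= 72 * R^2" by (simp add: power2_eq_square)
  then have "(24*(norm c)^2 + (16*norm c*norm ?v + 4*(norm ?v)^2))*(l2 ?v)^2 <= 72 * R^2*(l2 ?v)^2"
    by (rule mult_right_mono) simp
  then show ?thesis
    using FF_expand[of c ?v] pot_bound[of c ?v ?v] by (simp add: distrib_right power2_eq_square[of "l2 ?v"] abs_le_iff)
qed

lemma ch_cm_sym: "ch (cm \<i> u) v = ch (cm \<i> v) u"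
proof -
  have "ch (cm \<i> v) u = ch (cm \<i> (cm \<i> v)) (cm \<i> u)" by (simp add: ch_cm)
  also have "cm \<i> (cm \<i> v) = (- 1) *\<^sub>R v" unfolding cm_cm by (simp flip: cm_of_real)
  also have "ch ((- 1) *\<^sub>R v) (cm \<i> u) = - ch v (cm \<i> u)"
    using bounded_bilinear.scaleR_left[OF bounded_bilinear_ch, of "-1" v "cm \<i> u"] by simp
  also have "... = ch (cm \<i> u) v" using ch_skew[of v "cm \<i> u"] by simp
  finally show ?thesis by simp
qed

lemma aa_sym: "aa k p u v = aa k p v u"
  unfolding aa_def by (simp add: sg_commute[of u v] ta_commute[of u v] ch_cm_sym[of u v])

lemma cm_ii: "cm \<i> (cm \<i> u) = - u" unfolding cm_cm by (rule h1_eqI) (simp add: fn_cm fn_uminus)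

lemma sg_i: "sg (cm \<i> u) v = - sg u (cm \<i> v)"
proof -
  have "sg (cm \<i> u) v = sg (cm \<i> (cm \<i> u)) (cm \<i> v)" by (simp add: sg_cm)
  then show ?thesis using bounded_bilinear.minus_left[OF bounded_bilinear_sg, of u "cm \<i> v"] by (simp add: cm_ii)
qed

lemma ta_i: "ta (cm \<i> u) v = - ta u (cm \<i> v)"
proof -
  have "ta (cm \<i> u) v = ta (cm \<i> (cm \<i> u)) (cm \<i> v)" by (simp add: ta_cm)
  then show ?thesis using bounded_bilinear.minus_left[OF bounded_bilinear_ta, of u "cm \<i> v"] by (simp add: cm_ii)
qed

lemma sg_i_self: "sg (cm \<i> u) u = 0" using sg_i[of u u] sg_commute[of u "cm \<i> u"] by simp
lemma ta_i_self: "ta (cm \<i> u) u = 0" using ta_i[of u u] ta_commute[of u "cm \<i> u"] by simp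
lemma ch_self: "ch u u = 0" using ch_skew[of u u] by simp

lemma norm_ch: "\<bar>ch u v\<bar> <= norm u*norm v"
  using ch_bound[of u v] mult_mono[OF ta_le_norm[of u] sg_le_norm[of v]] by (simp add: sg_nonneg)

lemma norm_sg: "\<bar>sg u v\<bar> <= l2 u*l2 v"
  using ip_Cauchy[OF fn_sqint fn_sqint, of u v] by (simp add: l2_def sg_def)

lemma norm_ta: "\<bar>ta u v\<bar> <= norm u*norm v"
  using ip_bound[OF dv_sqint dv_sqint ta_le_norm[unfolded ta_def] ta_le_norm[unfolded ta_def], of u v] by (simp add: ta_def)

definition aK :: "real => real => real" where "aK k p = 4*k^2 + 4 * \<bar>k*p\<bar> + (1 + p^2)"

lemma aK_pos: "aK k p > 0" unfolding aK_def by (intro add_nonneg_pos add_pos_nonneg) auto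

lemma aa_bound: "\<bar>aa k p u v\<bar> <= aK k p*(norm u*norm v)"
proof -
  have 1: "\<bar>4*k^2*ta u v\<bar> <= 4*k^2*(norm u*norm v)" using norm_ta[of u v] by (simp add: abs_mult mult_left_mono)
  have 2: "\<bar>4*k*p*ch (cm \<i> u) v\<bar> <= 4 * \<bar>k*p\<bar>*(norm u*norm v)"
    using norm_ch[of "cm \<i> u" v] by (simp add: abs_mult norm_cm mult_left_mono mult.assoc)
  have 3: "\<bar>(1 + p^2) * sg u v\<bar> <= (1 + p^2)*(norm u*norm v)"
    using norm_sg[of u v] mult_mono[OF l2_le[of u] l2_le[of v]] l2_nonneg
    by (simp add: abs_mult abs_of_nonneg mult_left_mono)
  have "\<bar>aa k p u v\<bar> <= 4*k^2*(norm u*norm v) + 4 * \<bar>k*p\<bar>*(norm u*norm v) + (1 + p^2)*(norm u*norm v)"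
    unfolding aa_def using 1 2 3 by linarith
  then show ?thesis unfolding aK_def by (simp add: distrib_right)
qed

lemma bounded_bilinear_aa: "bounded_bilinear (aa k p)"
proof (rule bounded_bilinear_symI[OF _ _ aa_sym aa_bound])
  show "aa k p (u + u') v = aa k p u v + aa k p u' v" for u u' v
    unfolding aa_def linear_cm bounded_bilinear.add_left[OF bounded_bilinear_sg]
      bounded_bilinear.add_left[OF bounded_bilinear_ta] bounded_bilinear.add_left[OF bounded_bilinear_ch]
    by (simp add: algebra_simps)
  show "aa k p (r *\<^sub>R u) v = r*aa k p u v" for r u v
    unfolding aa_def linear_cm bounded_bilinear.scaleR_left[OF bounded_bilinear_sg]
      bounded_bilinear.scaleR_left[OF bounded_bilinear_ta] bounded_bilinear.scaleR_left[OF bounded_bilinear_ch]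
    by (simp add: algebra_simps)
qed

interpretation sg: bounded_bilinear sg by (rule bounded_bilinear_sg)
interpretation ta: bounded_bilinear ta by (rule bounded_bilinear_ta)
interpretation ch: bounded_bilinear ch by (rule bounded_bilinear_ch)
interpretation aa: bounded_bilinear "aa k p" for k p by (rule bounded_bilinear_aa)

lemma sg_le: "\<bar>sg u v\<bar> <= norm u*norm v"
  using norm_sg[of u v] mult_mono[OF l2_le[of u] l2_le[of v]] l2_nonneg by (simp add: order_trans)

lemma aa_i_self: "aa k p u (cm \<i> u) = 0"
proof -
  have "ta u (cm \<i> u) = 0" "sg u (cm \<i> u) = 0" "ch (cm \<i> u) (cm \<i> u) = 0"
    using ta_i_self[of u] sg_i_self[of u] ta_commute[of u] sg_commute[of u] ch_self by auto
  then show ?thesis by (simp add: aa_def)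
qed

lemma ff_i_self: "ff u (cm \<i> u) = 0" unfolding ff_def nu_def fn_cm by (simp add: algebra_simps)

lemma aa_sh: "aa k p (sh r u) (sh r v) = aa k p u v" by (simp add: aa_def ta_sh sg_sh ch_sh cm_sh)

lemma FF_sh: "FF (sh r u) = FF u" unfolding FF_def fn_sh
  using integral_per_shift[of "%z. (cmod (fn u z))^4" r] fn_per[of u]
  by (simp add: per_def integrable_continuous_real continuous_intros fn_cont)

lemma ff_add: "ff w (u + v) = ff w u + ff w v" and ff_scaleR: "ff w (r *\<^sub>R u) = r*ff w u"
proof -
  have i: "(%z. (cmod (fn w z))^2 * Re (fn w z*cnj (fn u z))) integrable_on {0..2*pi}" for u
    by (intro integrable_continuous_real continuous_intros fn_cont)
  have "(cmod (fn w z))^2 * Re (fn w z*cnj (fn (u + v) z)) = (cmod (fn w z))^2 * Re (fn w z*cnj (fn u z)) + (cmod (fn w z))^2 * Re (fn w z*cnj (fn v z))" for z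
    by (simp add: fn_plus algebra_simps)
  then show "ff w (u + v) = ff w u + ff w v" unfolding ff_def nu_def by (simp only: integral_add i)
  have "(cmod (fn w z))^2 * Re (fn w z*cnj (fn (r *\<^sub>R u) z)) = r*((cmod (fn w z))^2 * Re (fn w z*cnj (fn u z)))" for z
    by (simp add: fn_scaleR algebra_simps)
  then show "ff w (r *\<^sub>R u) = r*ff w u" unfolding ff_def nu_def by (simp only: integral_mult_right)
qed

lemma ff_diff: "ff w (u - v) = ff w u - ff w v" using ff_add[of w u "(-1) *\<^sub>R v"] ff_scaleR[of w "-1" v] by simp

lemma fn_bound_le: "norm u <= R ==> cmod (fn u z) <= 4 * R" using fn_bound[of u z] by simp

text \<open>A bounded, skew substitute for the derivative; it commutes with \<open>cm \<i>\<close>,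
  so that the regularised momentum is a quadratic form of a bounded symmetric operator.\<close>

definition Kh :: "real => h1 => h1" where "Kh h u = (1/(2*h)) *\<^sub>R (sh h u - sh (- h) u)"

lemma l2_sup:
  assumes "!!z. cmod (fn u z) <= e"
  shows "l2 u <= 3*e"
proof -
  have e: "0 <= e" using assms[of 0] norm_ge_zero order_trans by blast
  have "sg u u <= integral {0..2*pi} (%z. e^2)" unfolding sg_def ip_self
    by (intro integral_le sqint_sq fn_sqint power_mono assms) auto
  also have "... = (sqrt (2*pi)*e)^2" by (simp add: power_mult_distrib)
  finally have "l2 u <= sqrt (2*pi)*e" unfolding l2_def using e sqrt_2pi by (intro real_le_lsqrt) auto
  also have "... <= 3*e" using sqrt_2pi e by (intro mult_right_mono) auto
  finally show ?thesis .
qed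

lemma ch_le: "\<bar>ch u v\<bar> <= norm u*l2 v"
  using ch_bound[of u v] mult_right_mono[OF ta_le_norm[of u] l2_nonneg[of v]] unfolding l2_def by linarith

text \<open>For a primitive \<open>A\<close> of \<open>fn u\<close>, the difference
  \<open>w r\<close> of \<open>A\<close> and its translate is periodic with derivative
  \<open>sh r u - u\<close>. Moving that derivative to \<open>v\<close> leaves \<open>w r\<close>,
  and \<open>w r\<close> divided by \<open>r\<close> tends uniformly to \<open>u\<close>.\<close>

lemma shift_derivative:
  "((%r. sg v (sh r u)) has_real_derivative ch (sh t u) v) (at t)"
proof -
  have 0: "((%r. sg v (sh r u)) has_real_derivative ch u v) (at 0)" for u
  proof -
    have c: "isCont (fn u) z" for z using fn_cont[of UNIV u] by (simp add: continuous_on_eq_continuous_at)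
    obtain A where A: "!!z. (A has_vector_derivative fn u z) (at z)"
      using einterval_antiderivative[of "- \<infinity>" "\<infinity>" "fn u"] c by auto
    have As: "((%z. A (z + r)) has_vector_derivative fn u (z + r)) (at z)" for r z
    proof -
      have "((%z. z + r) has_vector_derivative 1) (at z)"
        by (auto simp: has_real_derivative_iff_has_vector_derivative[symmetric] intro!: derivative_eq_intros)
      from vector_diff_chain_at[OF this A] show ?thesis by (simp add: o_def)
    qed
    have "((%z. A (z + 2*pi) - A z) has_vector_derivative 0) (at z)" for z
      using has_vector_derivative_diff[OF As[of "2*pi"] A] perD[OF fn_per[of u]] by simp
    then have Ap: "A (x + 2*pi) - A x = A (y + 2*pi) - A y" for x y by (rule vector_derivative_zero_const)
    define w where "w r = h1_of (%z. A (z + r) - A z)" for r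
    have hw: "hp (%z. A (z + r) - A z) (fn (sh r u - u))" for r
    proof (rule hpI_C1)
      show "per (%z. A (z + r) - A z)" unfolding per_def using Ap[of "_ + r"] by (simp add: algebra_simps)
      show "((%z. A (z + r) - A z) has_vector_derivative fn (sh r u - u) z) (at z)" for z
        using has_vector_derivative_diff[OF As A] by (simp add: fn_minus fn_sh)
    qed (use fn_cont[of UNIV] in \<open>simp add: continuous_on_eq_continuous_at\<close>)
    note fw = fn_h1_of[OF hw, folded w_def]
    have "sg v (sh r u - u) = ch (w r) v" for r
      unfolding sg_def ch_def ip_commute[of "fn v"] by (rule ip_AE_cong) (use dv_AE[OF hw[of r, folded fw]] in auto)
    then have q: "sg v (sh r u) - sg v u = - ch v (w r)" for r using ch_skew[of "w r" v] by (simp add: sg.diff_right)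
    have "((%r. sg v (sh r u)) has_derivative (%r. r*ch u v)) (at 0)" unfolding has_derivative_at_alt
    proof (intro conjI allI impI)
      fix e :: real assume "e > 0"
      define K where "K = norm v + 1"
      have K: "0 < K" "norm v <= K" unfolding K_def using norm_ge_zero[of v] by linarith+
      have "e/(3*K) > 0" using \<open>e > 0\<close> K by simp
      from per_linearization[OF fn_per A c this] obtain d where d: "d > 0"
        "!!z h. \<bar>h\<bar> <= d ==> cmod (A (z + h) - A z - of_real h*fn u z) <= e/(3*K) * \<bar>h\<bar>" by blast
      show "EX d>0. ALL y. norm (y - 0) < d --> norm (sg v (sh y u) - sg v (sh 0 u) - (y - 0)*ch u v) <= e*norm (y - 0)"
      proof (intro exI[of _ d] conjI allI impI d)
        fix y :: real assume y: "norm (y - 0) < d"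
        have "l2 (w y - y *\<^sub>R u) <= 3*(e/(3*K) * \<bar>y\<bar>)"
          using d(2)[of y] y by (intro l2_sup) (simp add: fn_minus fn_scaleR fw scaleR_conv_of_real)
        then have "norm v * l2 (w y - y *\<^sub>R u) <= norm v * (3*(e/(3*K) * \<bar>y\<bar>))" by (rule mult_left_mono) simp
        also have "... <= K*(3*(e/(3*K) * \<bar>y\<bar>))" using \<open>e > 0\<close> K by (intro mult_right_mono) auto
        also have "... = e * \<bar>y\<bar>" using K by simp
        finally have "norm v * l2 (w y - y *\<^sub>R u) <= e * \<bar>y\<bar>" by simp
        moreover note ch_le[of v "w y - y *\<^sub>R u"]
        moreover have "sg v (sh y u) - sg v (sh 0 u) - (y - 0)*ch u v = - ch v (w y - y *\<^sub>R u)"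
          using q[of y] ch_skew[of u v] by (simp add: sh_0 ch.diff_right ch.scaleR_right)
        ultimately show "norm (sg v (sh y u) - sg v (sh 0 u) - (y - 0)*ch u v) <= e*norm (y - 0)" by simp
      qed
    qed (rule bounded_linear_mult_left)
    then show ?thesis by (rule has_derivative_imp_has_field_derivative) simp
  qed
  have "((%r. sg v (sh (r - t) (sh t u))) has_real_derivative ch (sh t u) v * 1) (at t)"
    by (rule DERIV_chain2[where g="%r. r - t"]) (use 0[of "sh t u"] in \<open>auto intro!: derivative_eq_intros\<close>)
  then show ?thesis by (simp add: sh_sh)
qed

text \<open>The mean value inequality is applied to the translates tested with the increment itself,
  after which one factor \<open>l2\<close> cancels.\<close>

lemma l2_sh_incr: "l2 (sh h u - u) <= \<bar>h\<bar>*norm u"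
proof -
  let ?d = "sh h u - u"
  have "norm (sg ?d (sh h u) - sg ?d (sh 0 u)) <= norm u*l2 ?d*norm (h - 0)"
  proof (rule field_differentiable_bound[where S=UNIV])
    show "norm (ch (sh r u) ?d) <= norm u*l2 ?d" for r using ch_le[of "sh r u" ?d] by (simp add: norm_sh)
  qed (auto intro: shift_derivative)
  then have "(l2 ?d)^2 <= norm u*l2 ?d * \<bar>h\<bar>" by (simp add: sh_0 sg.diff_right l2_sq)
  then have "l2 ?d*l2 ?d <= \<bar>h\<bar>*norm u*l2 ?d" by (simp add: power2_eq_square mult_ac)
  moreover have "0 <= \<bar>h\<bar>*norm u" by simp
  ultimately show ?thesis using l2_nonneg[of ?d] mult_right_le_imp_le[of "l2 ?d" "l2 ?d"] by (cases "l2 ?d = 0") auto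
qed

lemma sg_Kh: "((%h. sg v (Kh h u)) \<longlongrightarrow> ch u v) (at 0)"
proof -
  have "((%h. sg v (sh h u) - sg v (sh (- h) u)) has_real_derivative ch (sh 0 u) v - ch (sh (- 0) u) v * (- 1)) (at 0)"
    by (intro DERIV_diff shift_derivative DERIV_chain2[OF shift_derivative]) (auto intro!: derivative_eq_intros)
  then have "((%h. (sg v (sh h u) - sg v (sh (- h) u))/h/2) \<longlongrightarrow> (ch u v + ch u v)/2) (at 0)"
    unfolding DERIV_def by (intro tendsto_divide tendsto_const) (simp_all add: sh_0)
  then show ?thesis by (simp add: Kh_def sg.scaleR_right sg.diff_right mult.commute)
qed

section \<open>Completeness of the energy space\<close>

text \<open>The squared gaps remain summable after weighting with \<open>2^i\<close>; by
  \<open>d <= 1/2^i + 2^i*d^2\<close> this gives convergence almost everywhere. Fatou's lemma then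
  transfers the rate to the limit.\<close>

lemma L2_complete:
  fixes g :: "nat => real => complex"
  assumes s: "!!n. sqint a b (g n)"
    and fast: "!!m n. n <= m ==> integral {a..b} (%x. (cmod (g n x - g m x))^2) <= (1/8)^n"
  shows "EX h. sqint a b h & (ALL n. integral {a..b} (%x. (cmod (g n x - h x))^2) <= (1/8)^n)"
proof -
  let ?M = "lebesgue_on {a..b}"
  have [measurable]: "g n \<in> borel_measurable ?M" for n by (rule sqint_measurable[OF s])
  have nn: "(\<integral>\<^sup>+x. (cmod (u x))^2 \<partial>?M) = integral {a..b} (%x. (cmod (u x))^2)" if "sqint a b u" for u
  proof -
    have i: "integrable ?M (%x. (cmod (u x))^2)"
      by (rule absolutely_integrable_imp_integrable[OF sqint_sq_abs[OF that]]) simp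
    show ?thesis using nn_integral_eq_integral[OF i] lebesgue_integral_eq_integral[OF i] by simp
  qed
  have le: "(\<integral>\<^sup>+x. (cmod (g n x - g m x))^2 \<partial>?M) <= ennreal ((1/8)^n)" if "n <= m" for m n
    unfolding nn[OF sqint_diff[OF s s]] using fast[OF that] by (rule ennreal_leI)
  let ?c = "%i x. (cmod (g i x - g (Suc i) x))^2"
  have "AE x in ?M. (\<Sum>i. ennreal (2^i)*ennreal (?c i x)) ~= \<infinity>"
  proof (rule nn_integral_PInf_AE)
    have "(\<integral>\<^sup>+x. (\<Sum>i. ennreal (2^i)*ennreal (?c i x)) \<partial>?M) = (\<Sum>i. ennreal (2^i) * \<integral>\<^sup>+x. ?c i x \<partial>?M)"
      by (subst nn_integral_suminf) (auto simp: nn_integral_cmult)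
    also have "... <= (\<Sum>i. ennreal (2^i)*ennreal ((1/8)^i))"
      by (intro suminf_le mult_left_mono le summableI) auto
    also have "... = ennreal (\<Sum>i. (1/4)^i)"
      by (subst suminf_ennreal2[symmetric]) (auto simp flip: ennreal_mult' power_mult_distrib)
    finally show "(\<integral>\<^sup>+x. (\<Sum>i. ennreal (2^i)*ennreal (?c i x)) \<partial>?M) ~= \<infinity>" by (auto simp: top_unique)
  qed measurable
  then have conv: "AE x in ?M. (%n. g n x) \<longlonglongrightarrow> lim (%n. g n x)"
  proof eventually_elim
    case (elim x)
    have "summable (%i. 2^i*?c i x)"
      by (intro summable_suminf_not_top) (use elim in \<open>auto simp: ennreal_mult'\<close>)
    then have "summable (%i. (1/2)^i + 2^i*?c i x)" by (intro summable_add summable_geometric) auto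
    then have "summable (%i. g (Suc i) x - g i x)"
    proof (rule summable_comparison_test'[where N=0])
      fix i
      define t d where "t = (2::real)^i" and "d = cmod (g i x - g (Suc i) x)"
      have "t > 0" by (simp add: t_def)
      have "d*t <= 1 + (d*t)^2" using zero_le_power2[of "d*t - 1"] \<open>t > 0\<close>
        by (simp add: power2_diff d_def) (smt (verit) norm_ge_zero mult_nonneg_nonneg)
      then have "d <= 1/t + t*d^2" using \<open>t > 0\<close> by (simp add: field_simps power2_eq_square)
      then show "norm (g (Suc i) x - g i x) <= (1/2)^i + 2^i*?c i x"
        by (simp add: t_def d_def power_one_over norm_minus_commute)
    qed
    then have "convergent (%n. (\<Sum>i<n. g (Suc i) x - g i x) + g 0 x)"
      by (intro convergent_add convergent_const) (simp add: summable_iff_convergent)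
    then show ?case unfolding sum_lessThan_telescope[of "%i. g i x"] by (simp add: convergent_LIMSEQ_iff)
  qed
  define h where "h x = lim (%n. g n x)" for x
  have [measurable]: "h \<in> borel_measurable ?M" unfolding h_def by measurable
  have b: "(\<integral>\<^sup>+x. (cmod (g n x - h x))^2 \<partial>?M) <= ennreal ((1/8)^n)" for n
  proof -
    have "(\<integral>\<^sup>+x. (cmod (g n x - h x))^2 \<partial>?M) <= (\<integral>\<^sup>+x. liminf (%m. ennreal ((cmod (g n x - g m x))^2)) \<partial>?M)"
    proof (rule nn_integral_mono_AE, use conv in eventually_elim)
      case (elim x)
      have "(%m. ennreal ((cmod (g n x - g m x))^2)) \<longlonglongrightarrow> ennreal ((cmod (g n x - h x))^2)"
        unfolding h_def by (intro tendsto_intros elim)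
      then show ?case by (subst lim_imp_Liminf) auto
    qed
    also have "... <= liminf (%m. \<integral>\<^sup>+x. (cmod (g n x - g m x))^2 \<partial>?M)" by (intro nn_integral_liminf) measurable
    also have "... <= liminf (%m. ennreal ((1/8)^n))" using le by (intro Liminf_mono eventually_sequentiallyI[of n])
    finally show ?thesis by (simp add: Liminf_const)
  qed
  have d: "sqint a b (%x. g n x - h x)" for n
  proof (rule sqintI[OF _ _ order_refl])
    have "integrable ?M (%x. (cmod (g n x - h x))^2)"
      by (rule integrableI_bounded) (use b[of n] in \<open>auto simp: le_less_trans\<close>)
    then show "(%x. (cmod (g n x - h x))^2) integrable_on {a..b}" by (rule integrable_on_lebesgue_on) simp
  qed measurable
  have "sqint a b h" using sqint_diff[OF s d, of 0 0] by simp
  moreover have "integral {a..b} (%x. (cmod (g n x - h x))^2) <= (1/8)^n" for n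
    using b[of n] unfolding nn[OF d] by (simp add: ennreal_le_iff)
  ultimately show ?thesis by blast
qed

lemma sqint_cong: "(!!x. x \<in> {a..b} ==> g x = h x) ==> sqint a b g \<longleftrightarrow> sqint a b h"
  unfolding sqint_def absolutely_integrable_on_def
  using integrable_cong[of "{a..b}" g h] integrable_cong[of "{a..b}" "%x. norm (g x)" "%x. norm (h x)"]
    integrable_cong[of "{a..b}" "%x. (norm (g x))^2" "%x. (norm (h x))^2"] by simp

lemma acd_cong:
  assumes "acd a b u g" "!!x. x \<in> {a..b} ==> g x = h x" "!!x. x \<in> {a..b} ==> u x = v x"
  shows "acd a b v h" unfolding acd_def
proof (intro conjI ballI)
  show "sqint a b h" using acd_sqint[OF assms(1)] sqint_cong[of a b g h] assms(2) by blast
  fix x assume x: "x \<in> {a..b}"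
  have "integral {a..x} g = integral {a..x} h" using x assms(2) by (intro integral_cong) auto
  then show "v x = v a + integral {a..x} h" using acd_val[OF assms(1) x] assms(3)[OF x] assms(3)[of a] x by simp
qed

text \<open>The derivative is repeated periodically after its value at \<open>2*pi\<close> is
  matched to the one at 0, which changes it on a null set only.\<close>

lemma hp_extend:
  assumes pu: "per u" and ug: "acd 0 (2*pi) u g"
  shows "EX g'. hp u g' & (ALL z:{0..<2*pi}. g' z = g z)"
proof -
  define g0 where "g0 z = (if z = 2*pi then g 0 else g z)" for z
  have "AE z in lebesgue. z \<notin> {2*pi}" by (intro AE_not_in) auto
  then have "AE z in lebesgue. g z = g0 z" by eventually_elim (simp add: g0_def)
  then have ug0: "acd 0 (2*pi) u g0" by (rule acd_AE_cong[OF ug])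
  define g' where "g' z = g0 (z - 2*pi * of_int \<lfloor>z/(2*pi)\<rfloor>)" for z
  have fl: "\<lfloor>z/(2*pi)\<rfloor> = n" if "2*pi * of_int n <= z" "z < 2*pi * of_int n + 2*pi" for z n
    using that by (intro floor_unique) (auto simp: field_simps)
  have per: "per g'"
  proof -
    have "\<lfloor>(z + 2*pi)/(2*pi)\<rfloor> = \<lfloor>z/(2*pi)\<rfloor> + 1" for z by (simp add: add_divide_distrib)
    then show ?thesis by (simp add: per_def g'_def algebra_simps)
  qed
  have g'g0: "g' z = g0 (z - 2*pi * of_int n)" if z: "z \<in> {2*pi * of_int n..2*pi * of_int n + 2*pi}" for z n
  proof (cases "z = 2*pi * of_int n + 2*pi")
    case True
    have "\<lfloor>z/(2*pi)\<rfloor> = n + 1" using True by (intro fl) (auto simp: algebra_simps)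
    then show ?thesis using True by (simp add: g'_def g0_def algebra_simps)
  next
    case False
    then show ?thesis using z fl[of n z] by (simp add: g'_def)
  qed
  have one: "acd (2*pi * of_int n) (2*pi * of_int n + 2*pi) u g'" for n
  proof -
    have "acd (2*pi * of_int n) (2*pi * of_int n + 2*pi) (%z. u (z - 2*pi * of_int n)) (%z. g0 (z - 2*pi * of_int n))"
      using acd_affine[of 1 "2*pi * of_int n" "- (2*pi * of_int n)" "2*pi * of_int n + 2*pi" u g0] ug0 by simp
    then show ?thesis by (rule acd_cong) (use g'g0 per_int[OF pu, of _ "- n"] in auto)
  qed
  have many: "acd (2*pi * of_int n) (2*pi * of_int n + 2*pi*real m) u g'" for n m
  proof (induction m)
    case 0
    show ?case using acd_subset[OF one[of n], of "2*pi * of_int n" "2*pi * of_int n"] by simp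
  next
    case (Suc m)
    have "acd (2*pi * of_int n + 2*pi*real m) (2*pi * of_int n + 2*pi*real (Suc m)) u g'"
      using one[of "n + int m"] by (simp add: algebra_simps)
    with Suc show ?case by (rule acd_combine) auto
  qed
  have "acd a b u g'" for a b
  proof -
    obtain m where m: "\<bar>a\<bar> + \<bar>b\<bar> <= real m" using real_arch_simple by blast
    have "real m <= 2*pi*real m" using mult_right_mono[of 1 "2*pi" "real m"] pi_ge_two by simp
    then have "2*pi * of_int (- int m) <= a" "b <= 2*pi * of_int (- int m) + 2*pi*real (2 * m)" using m by auto
    then show ?thesis by (rule acd_subset[OF many])
  qed
  moreover have "g' z = g z" if "z \<in> {0..<2*pi}" for z using g'g0[of z 0] that by (auto simp: g0_def)
  ultimately show ?thesis using pu per by (auto simp: hp_def)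
qed

lemma ta_diff_self: "ta (u - v) (u - v) = integral {0..2*pi} (%z. (cmod (dv u z - dv v z))^2)"
  unfolding ta_def ip_self by (rule integral_AE_cong) (use dv_minus[of u v] in eventually_elim, simp)

text \<open>Along a fast subsequence the functions converge uniformly, by \<open>fn_bound\<close>,
  and the derivatives converge in mean square. The integral relation between them passes to the
  limit and identifies the limit derivative.\<close>

instance h1 :: banach
proof
  fix X :: "nat => h1" assume C: "Cauchy X"
  \<comment> \<open>The rate is such that its square \<open>(1/9)^n\<close> stays below the
    \<open>(1/8)^n\<close> of \<open>L2_complete\<close>.\<close>
  have "ALL n. EX N. ALL i>=N. ALL j>=N. norm (X i - X j) < (1/3)^n"
    using C unfolding Cauchy_def dist_norm by (intro allI) (auto intro: zero_less_power)
  then obtain N where N: "!!n i j. i >= N n ==> j >= N n ==> norm (X i - X j) < (1/3)^n" by metis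
  \<comment> \<open>The sum dominates every earlier \<open>N i\<close>, and the added
    \<open>n\<close> makes the sequence strictly increasing.\<close>
  define r where "r n = (\<Sum>i\<le>n. N i) + n" for n
  have rN: "r m >= N n" if "n <= m" for n m unfolding r_def using that member_le_sum[of n "{..m}" N] by simp
  define Y where "Y n = X (r n)" for n
  have YY: "norm (Y i - Y j) < (1/3)^n" if "n <= i" "n <= j" for n i j unfolding Y_def by (intro N rN that)
  have z: "(%n. (1/3::real)^n) \<longlonglongrightarrow> 0" "(%n. (1/8::real)^n) \<longlonglongrightarrow> 0" by (intro LIMSEQ_realpow_zero; simp)+
  then have z3: "(%n. sqrt ((1/8)^n)) \<longlonglongrightarrow> 0" using tendsto_real_sqrt by fastforce
  have "integral {0..2*pi} (%x. (cmod (dv (Y n) x - dv (Y m) x))^2) <= (1/8)^n" if "n <= m" for m n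
  proof -
    have "ta (Y n - Y m) (Y n - Y m) <= (norm (Y n - Y m))^2" unfolding norm_h1_sq using sg_nonneg by simp
    also have "... <= ((1/3)^n)^2" using YY[of n n m] that by (intro power_mono) auto
    also have "... <= (1/8)^n" by (simp add: power_mult_distrib[symmetric] power2_eq_square power_mono)
    finally show ?thesis unfolding ta_diff_self .
  qed
  from L2_complete[OF dv_sqint this] obtain g where g: "sqint 0 (2*pi) g"
    "!!n. integral {0..2*pi} (%x. (cmod (dv (Y n) x - g x))^2) <= (1/8)^n" by blast
  have fY: "cmod (fn (Y i) x - fn (Y j) x) <= 4*(1/3)^n" if "n <= i" "n <= j" for n i j x
    using fn_bound[of "Y i - Y j" x] YY[OF that] by (simp add: fn_minus)
  have "convergent (%n. fn (Y n) x)" for x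
  proof (rule Cauchy_convergent, rule metric_CauchyI)
    fix e :: real assume "e > 0"
    then have "\<forall>\<^sub>F n in sequentially. 4*(1/3::real)^n < e"
      using tendsto_mult_right_zero[OF z(1), of 4] by (intro order_tendstoD) auto
    then obtain n where "4*(1/3::real)^n < e" by (auto simp: eventually_sequentially)
    then show "EX M. ALL m>=M. ALL n>=M. dist (fn (Y m) x) (fn (Y n) x) < e"
      using fY[of n _ _ x] unfolding dist_norm by (meson le_less_trans)
  qed
  then obtain u where u: "!!x. (%n. fn (Y n) x) \<longlonglongrightarrow> u x" unfolding convergent_def by metis
  have uu: "cmod (fn (Y n) x - u x) <= 4*(1/3)^n" for n x
    by (rule Lim_bounded[of "%m. cmod (fn (Y n) x - fn (Y m) x)" _ n]) (auto intro!: tendsto_intros u fY)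
  have "per u" unfolding per_def using LIMSEQ_unique[OF u[of "_ + 2*pi"]] u by (simp add: perD[OF fn_per])
  moreover have "acd 0 (2*pi) u g" unfolding acd_def
  proof (intro conjI ballI g(1))
    fix x assume x: "x \<in> {0..2*pi}"
    have b: "norm (fn (Y n) x - fn (Y n) 0 - integral {0..x} g) <= 3 * sqrt ((1/8)^n)" for n
    proof -
      have sd: "sqint 0 (2*pi) (%z. dv (Y n) z - g z)" by (intro sqint_diff dv_sqint g)
      have sx: "sqint 0 x (%z. dv (Y n) z - g z)" by (rule sqint_subset[OF sd]) (use x in auto)
      have gx: "g integrable_on {0..x}" by (rule sqint_int[OF sqint_subset[OF g(1)]]) (use x in auto)
      have "integral {0..x} (%z. (cmod (dv (Y n) z - g z))^2) <= integral {0..2*pi} (%z. (cmod (dv (Y n) z - g z))^2)"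
        using x by (intro integral_subset_le sqint_sq sx sd) auto
      moreover have "sqrt x <= 3" by (rule order_trans[OF real_sqrt_le_mono sqrt_2pi(2)]) (use x in simp)
      ultimately have "sqrt x * sqrt (integral {0..x} (%z. (cmod (dv (Y n) z - g z))^2)) <= 3 * sqrt ((1/8)^n)"
        using g(2)[of n] x by (intro mult_mono real_sqrt_le_mono) (auto intro!: integral_nonneg sqint_sq sx)
      then show ?thesis using integral_norm_le_sqrt[OF sx] acd_eq[OF fn_acd[of 0 "2*pi" "Y n"], of 0 x] x
          integral_diff[OF sqint_int[OF dv_sqint] gx, of "Y n"] by simp
    qed
    have "(%n. fn (Y n) x - fn (Y n) 0 - integral {0..x} g) \<longlonglongrightarrow> 0"
      by (rule Lim_null_comparison[OF always_eventually[OF allI[OF b]] tendsto_mult_right_zero[OF z3]])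
    moreover have "(%n. fn (Y n) x - fn (Y n) 0 - integral {0..x} g) \<longlonglongrightarrow> u x - u 0 - integral {0..x} g"
      by (intro tendsto_intros u)
    ultimately have "u x - u 0 - integral {0..x} g = 0" using LIMSEQ_unique by blast
    then show "u x = u 0 + integral {0..x} g" by (simp add: algebra_simps)
  qed
  ultimately obtain g' where g': "hp u g'" "!!z. z \<in> {0..<2*pi} ==> g' z = g z" using hp_extend by blast
  define L where "L = h1_of u"
  have fL: "fn L = u" unfolding L_def by (rule fn_h1_of[OF g'(1)])
  have dL: "AE z in lebesgue. dv L z = g' z" using g'(1) by (intro dv_AE) (simp add: fL)
  have b: "norm (Y n - L) <= 12*(1/3)^n + sqrt ((1/8)^n)" for n
  proof -
    have "ta (Y n - L) (Y n - L) = integral {0..2*pi} (%z. (cmod (dv (Y n) z - g' z))^2)"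
      unfolding ta_diff_self by (rule integral_AE_cong) (use dL in eventually_elim, simp)
    also have "... = integral {0..2*pi} (%z. (cmod (dv (Y n) z - g z))^2)"
      by (rule integral_spike[of "{2*pi}"]) (use g'(2) in auto)
    finally have "sqrt (ta (Y n - L) (Y n - L)) <= sqrt ((1/8)^n)" using g(2) by simp
    moreover have "norm (Y n - L) <= l2 (Y n - L) + sqrt (ta (Y n - L) (Y n - L))"
      unfolding l2_def norm_h1_def inner_h1 using sqrt_add_le_add_sqrt[OF sg_nonneg ta_nonneg] by blast
    moreover have "l2 (Y n - L) <= 3*(4*(1/3)^n)" by (rule l2_sup) (simp add: fn_minus fL uu)
    ultimately show ?thesis by linarith
  qed
  have "(%n. Y n - L) \<longlonglongrightarrow> 0" by (rule Lim_null_comparison[OF always_eventually[OF allI[OF b]]])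
      (rule tendsto_add_zero[OF tendsto_mult_right_zero[OF z(1)] z3])
  then have "(X \<circ> r) \<longlonglongrightarrow> L" by (simp add: Y_def o_def LIM_zero_iff)
  moreover have "strict_mono r" unfolding strict_mono_Suc_iff by (simp add: r_def)
  ultimately show "convergent X" using Cauchy_converges_subseq[OF C] unfolding convergent_def by blast
qed

section \<open>Weak solutions and their invariants\<close>

definition BB :: "real => real => h1 => h1 => real" where
  "BB k p u v = aa k p u v - ff u v"

text \<open>Twice the momentum \<open>M_fun\<close>, just as \<open>sg u u\<close> is twice the
  mass. The functional \<open>EE\<close> below is \<open>E_JE\<close> for the given \<open>k\<close>
  and \<open>p\<close>, and \<open>BB\<close> is its differential.\<close>

definition Pm :: "h1 => real" where "Pm u = ch (cm \<i> u) u"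

definition EE :: "real => real => h1 => real" where "EE k p u = aa k p u u/2 - FF u"

lemma BB_scaleR: "BB k p u (r *\<^sub>R v) = r*BB k p u v"
  by (simp add: BB_def aa.scaleR_right ff_scaleR algebra_simps)

lemma BB_bound:
  assumes "norm u <= R"
  shows "\<bar>BB k p u v\<bar> <= (aK k p * R + 16 * R^3)*norm v"
proof -
  have R: "0 <= R" using assms norm_ge_zero order_trans by blast
  have "\<bar>aa k p u v\<bar> <= aK k p*(R*norm v)"
    using aa_bound[of k p u v] mult_left_mono[OF mult_right_mono[OF assms norm_ge_zero[of v]] less_imp_le[OF aK_pos[of k p]]]
    by linarith
  moreover have "\<bar>ff u v\<bar> <= (4 * R)^2 * R*norm v"
  proof -
    have "\<bar>ff u v\<bar> <= (4 * R)^2*l2 u*l2 v" by (rule ff_bound[OF fn_bound_le[OF assms]])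
    also have "... <= (4 * R)^2 * R*norm v"
      using assms l2_le[of u] l2_le[of v] l2_nonneg R by (intro mult_mono mult_left_mono) auto
    finally show ?thesis .
  qed
  ultimately have "\<bar>BB k p u v\<bar> <= aK k p*(R*norm v) + (4 * R)^2 * R*norm v" unfolding BB_def by linarith
  then show ?thesis by (simp add: algebra_simps power2_eq_square power3_eq_cube)
qed

lemma symmetric_Kh: "sg (cm \<i> (Kh h u)) v = sg u (cm \<i> (Kh h v))"
proof -
  have "sg (Kh h u) w = - sg u (Kh h w)" for u w
  proof -
    have "sg (sh r u) w = sg u (sh (- r) w)" for r using sg_sh[of r u "sh (- r) w"] by (simp add: sh_sh sh_0)
    from this[of h] this[of "- h"] show ?thesis
      by (simp add: Kh_def sg.diff_left sg.diff_right sg.scaleR_left sg.scaleR_right algebra_simps diff_divide_distrib)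
  qed
  moreover have "Kh h (cm \<i> v) = cm \<i> (Kh h v)"
    by (rule h1_eqI) (simp add: Kh_def fn_scaleR fn_minus fn_cm fn_sh algebra_simps)
  ultimately show ?thesis using sg_i[of "Kh h u" v] by simp
qed

lemma bounded_linear_Kh: "bounded_linear (Kh h)" unfolding Kh_def[abs_def]
  by (intro bounded_linear_scaleR_right[THEN bounded_linear_compose] bounded_linear_sub bounded_linear_sh)

lemma aa_Kh: "aa k p u (Kh h u) = 0"
proof -
  have "aa k p u (sh h u) = aa k p u (sh (- h) u)"
    using aa_sh[of k p "- h" u "sh h u"] aa_sym by (simp add: sh_sh sh_0)
  then show ?thesis by (simp add: Kh_def aa.scaleR_right aa.diff_right)
qed

text \<open>\<open>FF\<close> is translation invariant, so \<open>ff u (sh r u - u)\<close> is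
  purely the second order error in \<open>FF_increment\<close>, of order \<open>h^2\<close>; the
  difference quotient loses one power of \<open>h\<close>.\<close>

lemma ff_Kh:
  assumes "norm u <= R" "0 < h"
  shows "\<bar>ff u (Kh h u)\<bar> <= 72 * R^4*h"
proof -
  have R: "0 <= R" using assms norm_ge_zero order_trans by blast
  have *: "\<bar>ff u (sh r u - u)\<bar> <= 72 * R^2*(h * R)^2" if l: "l2 (sh r u - u) <= h * R" for r
  proof -
    have "norm (sh r u) <= R" using assms by (simp add: norm_sh)
    from FF_increment[OF this assms(1)] have "\<bar>ff u (sh r u - u)\<bar> <= 72 * R^2*(l2 (sh r u - u))^2"
      by (simp add: FF_sh)
    also have "... <= 72 * R^2*(h * R)^2" using l l2_nonneg by (intro mult_left_mono power_mono) auto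
    finally show ?thesis .
  qed
  have l: "l2 (sh h u - u) <= h * R" "l2 (sh (- h) u - u) <= h * R"
    using order_trans[OF l2_sh_incr mult_left_mono[OF assms(1)], of h]
      order_trans[OF l2_sh_incr mult_left_mono[OF assms(1)], of "- h"] assms(2) by auto
  have "Kh h u = (1/(2*h)) *\<^sub>R ((sh h u - u) - (sh (- h) u - u))" by (simp add: Kh_def)
  then have "ff u (Kh h u) = (1/(2*h))*(ff u (sh h u - u) - ff u (sh (- h) u - u))" by (simp only: ff_scaleR ff_diff)
  then have "\<bar>ff u (Kh h u)\<bar> = (1/(2*h)) * \<bar>ff u (sh h u - u) - ff u (sh (- h) u - u)\<bar>"
    using assms by (simp add: abs_mult)
  also have "... <= (1/(2*h))*(2*(72 * R^2*(h * R)^2))"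
    using *[OF l(1)] *[OF l(2)] assms by (intro mult_left_mono) auto
  also have "... = 72 * R^4*h" using assms by (simp add: power2_eq_square power4_eq_xxxx)
  finally show ?thesis .
qed

lemma FF_continuous: "isCont FF u"
proof -
  let ?K = "72*(norm u + 1)^2 + (4*norm u)^2*norm u"
  have "\<forall>\<^sub>F v in at u. norm (FF v - FF u) <= norm (v - u)*?K" unfolding eventually_at
  proof (intro exI[of _ 1] conjI ballI impI)
    fix v assume "v ~= u & dist v u < 1"
    then have v: "norm v <= norm u + 1" "norm (v - u) <= 1" using norm_triangle_sub[of v u] by (simp_all add: dist_norm)
    have "(l2 (v - u))^2 <= norm (v - u)*1"
      unfolding power2_eq_square using v(2) l2_le[of "v - u"] l2_nonneg[of "v - u"] by (intro mult_mono) auto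
    then have "72*(norm u + 1)^2*(l2 (v - u))^2 <= 72*(norm u + 1)^2*norm (v - u)" by (intro mult_left_mono) auto
    moreover have "\<bar>ff u (v - u)\<bar> <= (4*norm u)^2*norm u*norm (v - u)"
      by (rule order_trans[OF ff_bound[OF fn_bound]]) (intro mult_mono mult_left_mono l2_le l2_nonneg; simp)
    ultimately show "norm (FF v - FF u) <= norm (v - u)*?K"
      using FF_increment[OF v(1), of u] by (simp add: algebra_simps)
  qed simp
  moreover have "((%v. norm (v - u)*?K) \<longlongrightarrow> 0) (at u)"
    by (intro tendsto_mult_left_zero tendsto_norm_zero LIM_zero tendsto_ident_at)
  ultimately show ?thesis unfolding isCont_def by (rule LIM_zero_cancel[OF Lim_null_comparison])
qed

text \<open>The real part of the weak equation: the time derivative of \<open>cm \<i> U\<close> is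
  the differential of \<open>EE\<close>, tested with a fixed \<open>v\<close>.\<close>

locale sol =
  fixes k p :: real and U :: "real => h1"
  assumes cont: "!!t. isCont U t"
    and eq: "!!v t. ((%s. sg (cm \<i> (U s)) v) has_real_derivative BB k p (U t) v) (at t)"
begin

lemma cont_U: "continuous_on S U" using cont by (simp add: continuous_at_imp_continuous_on)

lemma eq': "((%s. sg (U s) v) has_real_derivative BB k p (U t) (cm \<i> v)) (at t)"
  using eq[of "cm \<i> v" t] by (simp add: sg_cm)

lemma bounded_on: obtains R where "R > 0" "!!t. t \<in> {a..b} ==> norm (U t) <= R"
proof -
  have "bounded (U ` {a..b})" by (intro compact_imp_bounded compact_continuous_image cont_U) auto
  then obtain R where "R > 0" "!!x. x \<in> U ` {a..b} ==> norm x <= R" unfolding bounded_pos by blast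
  then show thesis using that by blast
qed

text \<open>\<open>BB\<close> is bounded on bounded sets, so \<open>U\<close> is Lipschitz in time
  with values in the dual of the energy space.\<close>

lemma dual_lipschitz:
  assumes R: "!!t. t \<in> {a..b} ==> norm (U t) <= R" and st: "s \<in> {a..b}" "t \<in> {a..b}"
  shows "\<bar>sg (U s - U t) v\<bar> <= (aK k p * R + 16 * R^3)*norm v * \<bar>s - t\<bar>"
proof -
  have "norm (sg (U s) v - sg (U t) v) <= (aK k p * R + 16 * R^3)*norm v * norm (s - t)"
  proof (rule field_differentiable_bound[where S="{a..b}" and f'="%t. BB k p (U t) (cm \<i> v)"])
    show "((%s. sg (U s) v) has_field_derivative BB k p (U t) (cm \<i> v)) (at t within {a..b})" for t
      using eq' by (rule has_field_derivative_at_within)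
    show "norm (BB k p (U t) (cm \<i> v)) <= (aK k p * R + 16 * R^3)*norm v" if "t \<in> {a..b}" for t
      using BB_bound[OF R[OF that], of k p "cm \<i> v"] by (simp add: norm_cm)
  qed (use st in auto)
  then show ?thesis by (simp add: sg.diff_left)
qed

text \<open>\<open>U\<close> need not be differentiable in norm. The part quadratic in
  \<open>U s - U t\<close> pairs a quantity of order \<open>s - t\<close> in the dual with one that
  tends to 0 in norm, so it does not contribute to the derivative.\<close>

lemma quadratic_derivative:
  assumes S: "bounded_linear S" and sym: "!!u v. sg (S u) v = sg u (S v)"
  shows "((%t. sg (U t) (S (U t))) has_real_derivative 2*BB k p (U t) (cm \<i> (S (U t)))) (at t)"
proof -
  define v where "v = S (U t)"
  define r where "r s = sg (U s - U t) (S (U s - U t))" for s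
  obtain K where K: "K >= 0" "!!u. norm (S u) <= norm u*K" using bounded_linear.nonneg_bounded[OF S] by blast
  obtain R where R: "R > 0" "!!s. s \<in> {t - 1..t + 1} ==> norm (U s) <= R" using bounded_on by blast
  define C where "C = aK k p * R + 16 * R^3"
  have C: "C >= 0" using R aK_pos[of k p] by (simp add: C_def)
  have rb: "\<bar>r s\<bar> <= (C*K*norm (U s - U t)) * \<bar>s - t\<bar>" if "s \<in> {t - 1..t + 1}" for s
  proof -
    have "\<bar>r s\<bar> <= C*norm (S (U s - U t)) * \<bar>s - t\<bar>"
      unfolding r_def C_def by (rule dual_lipschitz[OF R(2) that]) auto
    also have "... <= C*(norm (U s - U t)*K) * \<bar>s - t\<bar>"
      using C K(2) by (intro mult_right_mono mult_left_mono) auto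
    finally show ?thesis by (simp add: mult_ac)
  qed
  have dr: "(r has_real_derivative 0) (at t)" unfolding has_field_derivative_iff
  proof (rule Lim_null_comparison)
    have "\<forall>\<^sub>F s in at t. s \<in> {t - 1<..<t + 1}" by (rule eventually_at_in_open') auto
    then show "\<forall>\<^sub>F s in at t. norm ((r s - r t)/(s - t)) <= C*K*norm (U s - U t)"
    proof eventually_elim
      case (elim s)
      have "\<bar>r s\<bar> <= (C*K*norm (U s - U t)) * \<bar>s - t\<bar>" using elim by (intro rb) auto
      then have "\<bar>r s\<bar>/\<bar>s - t\<bar> <= C*K*norm (U s - U t)"
        using C K(1) by (cases "s = t") (auto simp: divide_le_eq)
      moreover have "r t = 0" by (simp add: r_def sg.zero_left)
      ultimately show ?case by simp
    qed
    have "(U \<longlongrightarrow> U t) (at t)" using cont by (simp add: isCont_def)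
    then have "((%s. C*K*norm (U s - U t)) \<longlongrightarrow> C*K*norm (U t - U t)) (at t)" by (intro tendsto_intros)
    then show "((%s. C*K*norm (U s - U t)) \<longlongrightarrow> 0) (at t)" by simp
  qed
  have e: "(%s. sg (U s) (S (U s))) = (%s. 2 * sg (U s) v - sg (U t) v + r s)"
  proof
    fix s
    have "r s = sg (U s) (S (U s)) - sg (U s) v - (sg (U t) (S (U s)) - sg (U t) v)"
      by (simp add: r_def v_def linear_diff[OF bounded_linear.linear[OF S]] sg.diff_left sg.diff_right)
    moreover have "sg (U t) (S (U s)) = sg (U s) v" using sym[of "U t" "U s"] by (simp add: v_def sg_commute)
    ultimately show "sg (U s) (S (U s)) = 2 * sg (U s) v - sg (U t) v + r s" by simp
  qed
  have "((%s. 2 * sg (U s) v - sg (U t) v + r s) has_real_derivative 2*BB k p (U t) (cm \<i> v) - 0 + 0) (at t)"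
    by (intro DERIV_add DERIV_diff DERIV_cmult eq' dr DERIV_const)
  then show ?thesis unfolding e by (simp add: v_def)
qed

lemma mass_conserved: "sg (U t) (U t) = sg (U 0) (U 0)"
proof -
  have "((%t. sg (U t) (U t)) has_real_derivative 0) (at t)" for t
    using quadratic_derivative[of "%u. u" t] by (simp add: bounded_linear_ident BB_def aa_i_self ff_i_self)
  then show ?thesis by (intro DERIV_isconst_all) auto
qed

text \<open>The forms \<open>q h\<close> with the difference quotient \<open>Kh h\<close>
  approximate the momentum and fall under \<open>quadratic_derivative\<close>. The part of their
  drift from \<open>aa\<close> vanishes by \<open>aa_Kh\<close>, and the part from the nonlinearity
  is of order \<open>h\<close> by \<open>ff_Kh\<close>.\<close>

lemma momentum_conserved: "Pm (U t) = Pm (U 0)"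
proof -
  define a b where "a = min 0 t" and "b = max 0 t"
  obtain R where R: "R > 0" "!!s. s \<in> {a..b} ==> norm (U s) <= R" using bounded_on by blast
  define q where "q h s = sg (U s) (cm \<i> (Kh h (U s)))" for h s
  have b: "norm (q h t - q h 0) <= 144 * R^4*h*norm (t - 0)" if h: "0 < h" for h
  proof (rule field_differentiable_bound[where S="{a..b}" and f'="%s. 2*BB k p (U s) (cm \<i> (cm \<i> (Kh h (U s))))"])
    fix s assume s: "s \<in> {a..b}"
    show "(q h has_field_derivative 2*BB k p (U s) (cm \<i> (cm \<i> (Kh h (U s))))) (at s within {a..b})"
      unfolding q_def by (rule has_field_derivative_at_within, rule quadratic_derivative)
        (auto intro: bounded_linear_compose[OF bounded_linear_cm bounded_linear_Kh] symmetric_Kh)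
    have "BB k p (U s) (cm \<i> (cm \<i> (Kh h (U s)))) = ff (U s) (Kh h (U s))"
      unfolding cm_ii using BB_scaleR[of k p "U s" "-1" "Kh h (U s)"] by (simp add: BB_def aa_Kh)
    then show "norm (2*BB k p (U s) (cm \<i> (cm \<i> (Kh h (U s))))) <= 144 * R^4*h"
      using ff_Kh[OF R(2)[OF s] h] by simp
  qed (auto simp: a_def b_def)
  have z: "((%h. q h t - q h 0) \<longlongrightarrow> 0) (at_right 0)"
    by (rule Lim_null_comparison[OF eventually_mono[OF eventually_at_right_less]], erule b)
      (intro tendsto_mult_left_zero tendsto_mult_right_zero tendsto_ident_at)
  have lim: "((%h. q h s) \<longlongrightarrow> Pm (U s)) (at_right 0)" for s
  proof -
    have "((%h. - sg (cm \<i> (U s)) (Kh h (U s))) \<longlongrightarrow> - ch (U s) (cm \<i> (U s))) (at_right 0)"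
      by (intro tendsto_minus tendsto_mono[OF at_within_le_at sg_Kh])
    then show ?thesis using sg_i[of "U s"] ch_skew[of "U s"] by (simp add: q_def Pm_def)
  qed
  show ?thesis using tendsto_unique[OF trivial_limit_at_right_real tendsto_diff[OF lim lim] z] by simp
qed

text \<open>Averaging \<open>U\<close> over \<open>[t, t + h]\<close> gives a path that is differentiable in the energy space, with
  velocity \<open>d / h\<close>, where \<open>d = U (t + h) - U t\<close>. Testing the increment of the equation against \<open>d\<close>
  removes the time derivative, and \<open>d\<close> has mean square norm of order less than the square root of \<open>h\<close>.\<close>

lemma energy_conserved_interval:
  assumes ab: "al <= be"
  shows "EE k p (U be) = EE k p (U al)"
proof -
  let ?I = "{al - 1..be + 2}"
  have cF: "continuous_on S (%t. FF (U t))" for S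
    using FF_continuous cont by (intro continuous_at_imp_continuous_on ballI isCont_o2[OF cont]) auto
  have at: "(at t within ?I) = at t" if "t \<in> {al..be + 1}" for t
    using that by (intro at_within_interior) (auto simp: interior_atLeastAtMost_real)
  obtain V where V0: "!!t. t \<in> ?I ==> (V has_vector_derivative U t) (at t within ?I)"
    using antiderivative_continuous[OF cont_U] by blast
  have V: "(V has_vector_derivative U t) (at t)" if "t \<in> {al..be + 1}" for t
    using V0[of t] at[OF that] that by simp
  obtain H where H0: "!!t. t \<in> ?I ==> (H has_vector_derivative FF (U t)) (at t within ?I)"
    using antiderivative_continuous[OF cF] by blast
  have H: "(H has_real_derivative FF (U t)) (at t)" if "t \<in> {al..be + 1}" for t
    using H0[of t] at[OF that] that by (simp add: has_real_derivative_iff_has_vector_derivative)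
  define w where "w h t = (1/h) *\<^sub>R (V (t + h) - V t)" for h t
  \<comment> \<open>The quadratic part of the energy is taken at the averaged path, whereas the
    quartic part is itself averaged over time; both converge as \<open>h\<close> tends to 0.\<close>
  define ph where "ph h t = aa k p (w h t) (w h t)/2 - (H (t + h) - H t)/h" for h t
  have lim: "((%h. ph h t) \<longlongrightarrow> EE k p (U t)) (at_right 0)" if t: "t \<in> {al..be}" for t
  proof -
    have "w h t - U t = (1/h) *\<^sub>R (V (t + h) - V t - h *\<^sub>R U t)" if "h ~= 0" for h
      using that by (simp add: w_def scaleR_diff_right)
    then have ev: "\<forall>\<^sub>F h in at 0. norm (V (t + h) - V t - h *\<^sub>R U t)/norm h = norm (w h t - U t)"
      by (simp add: eventually_at_filter)
    have "((%h. norm (V (t + h) - V t - h *\<^sub>R U t)/norm h) \<longlongrightarrow> 0) (at 0)"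
      using V[of t] t by (simp add: has_vector_derivative_def has_derivative_at)
    from LIM_zero_cancel[OF tendsto_norm_zero_cancel[OF Lim_transform_eventually[OF this ev]]]
    have "((%h. w h t) \<longlongrightarrow> U t) (at 0)" .
    moreover have "((%h. (H (t + h) - H t)/h) \<longlongrightarrow> FF (U t)) (at 0)" using H[of t] t by (simp add: DERIV_def)
    ultimately have "((%h. ph h t) \<longlongrightarrow> aa k p (U t) (U t)/2 - FF (U t)) (at 0)"
      unfolding ph_def by (intro tendsto_intros aa.tendsto) auto
    then show ?thesis unfolding EE_def by (rule tendsto_mono[OF at_within_le_at])
  qed
  obtain R where R: "R > 0" "!!s. s \<in> {al..be + 1} ==> norm (U s) <= R" using bounded_on by blast
  define C where "C = aK k p * R + 16 * R^3"
  have C: "C > 0" unfolding C_def using R aK_pos[of k p] by (intro add_pos_pos mult_pos_pos) auto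
  have *: "\<bar>EE k p (U be) - EE k p (U al)\<bar> <= e*(be - al)" if e: "e > 0" for e
  proof -
    \<comment> \<open>Chosen so that \<open>72 * R^2*(C * omg*h) = e*h/2\<close> when
      \<open>FF_increment\<close> is applied.\<close>
    define omg where "omg = e/(144 * R^2*C)"
    have omg: "omg > 0" using e R C by (simp add: omg_def)
    have "uniformly_continuous_on {al..be + 1} U" by (intro compact_uniformly_continuous cont_U) auto
    then obtain d where d: "d > 0" "!!s t. s \<in> {al..be + 1} ==> t \<in> {al..be + 1} ==> \<bar>s - t\<bar> < d ==> norm (U s - U t) < omg"
      using omg unfolding uniformly_continuous_on_def dist_norm real_norm_def by metis
    have "norm (ph h be - ph h al) <= e*norm (be - al)" if h: "0 < h" "h < 1" "h < d" for h
    proof (rule field_differentiable_bound[where S="{al..be}"])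
      fix t assume t: "t \<in> {al..be}"
      define de where "de = U (t + h) - U t"
      define m where "m = FF (U (t + h)) - FF (U t)"
      have tI: "t \<in> {al..be + 1}" "t + h \<in> {al..be + 1}" using t h by auto
      have "((%t. V (t + h)) has_vector_derivative U (t + h)) (at t)"
        using vector_diff_chain_at[OF has_vector_derivative_add[OF has_vector_derivative_id has_vector_derivative_const], of V "U (t + h)" t h]
          V[OF tI(2)] by (simp add: o_def)
      from has_vector_derivative_diff[OF this V[OF tI(1)]]
      have w': "(w h has_vector_derivative (1/h) *\<^sub>R de) (at t)"
        unfolding w_def de_def by (rule bounded_linear.has_vector_derivative[OF bounded_linear_scaleR_right])
      have "((%t. aa k p (w h t) (w h t)) has_real_derivative 2*(aa k p (w h t) de/h)) (at t)"
        using aa.has_vector_derivative[OF w' w', of k p] aa_sym[of k p de]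
        by (simp add: has_real_derivative_iff_has_vector_derivative aa.scaleR_left aa.scaleR_right)
      from DERIV_cdivide[OF this, of 2]
      have "((%t. aa k p (w h t) (w h t)/2) has_real_derivative aa k p (w h t) de/h) (at t)" by simp
      moreover have "((%t. (H (t + h) - H t)/h) has_real_derivative m/h) (at t)"
        unfolding m_def using H[OF tI(1)] H[OF tI(2)] by (intro DERIV_cdivide DERIV_diff DERIV_shift[THEN iffD1])
      ultimately show "(ph h has_field_derivative aa k p (w h t) de/h - m/h) (at t within {al..be})"
        unfolding ph_def by (intro has_field_derivative_at_within[OF DERIV_diff])
      have small: "(l2 (U r - U s))^2 <= C * omg*h" if sr: "r \<in> {t..t + h}" "s \<in> {t..t + h}" for r s
      proof -
        have in': "r \<in> {al..be + 1}" "s \<in> {al..be + 1}" "\<bar>r - s\<bar> <= h" using sr t h by auto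
        have "\<bar>sg (U r - U s) (U r - U s)\<bar> <= C*norm (U r - U s) * \<bar>r - s\<bar>"
          unfolding C_def by (rule dual_lipschitz[OF R(2) in'(1,2)]) auto
        also have "... <= C * omg*h" using d(2)[OF in'(1,2)] in'(3) h C omg by (intro mult_mono mult_left_mono) auto
        finally show ?thesis by (simp add: l2_sq)
      qed
      \<comment> \<open>By the equation its derivative is \<open>ff (U s) de - m\<close>, which is
        small. Over \<open>[t, t + h]\<close> the middle term contributes
        \<open>sg (cm \<i> de) de = 0\<close>, and what remains is \<open>h\<close> times the
        numerator of the derivative of \<open>ph h\<close>.\<close>
      define G where "G s = aa k p (V s) de - sg (cm \<i> (U s)) de - s * m" for s
      have "norm (G (t + h) - G t) <= e*h*norm (t + h - t)"
      proof (rule field_differentiable_bound[where S="{t..t + h}"])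
        fix s assume s: "s \<in> {t..t + h}"
        have "((%s. aa k p (V s) de) has_real_derivative aa k p (U s) de) (at s)"
          using aa.bounded_linear_left[THEN bounded_linear.has_vector_derivative] V[of s] s t h
          by (simp add: has_real_derivative_iff_has_vector_derivative)
        from has_field_derivative_at_within[OF DERIV_diff[OF DERIV_diff[OF this eq[of de s]] DERIV_cmult_right[OF DERIV_ident, of m]]]
        show "(G has_field_derivative ff (U s) de - m) (at s within {t..t + h})" unfolding G_def by (simp add: BB_def)
        have nr: "norm (U r) <= R" if "r \<in> {t..t + h}" for r using that t h by (intro R(2)) auto
        have tt: "t \<in> {t..t + h}" "t + h \<in> {t..t + h}" using h by auto
        have q: "\<bar>FF (U r) - FF (U s) - ff (U s) (U r - U s)\<bar> <= e*h/2" if r: "r \<in> {t..t + h}" for r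
        proof -
          have "72 * R^2*(l2 (U r - U s))^2 <= 72 * R^2*(C * omg*h)" by (intro mult_left_mono small[OF r s]) simp
          also have "... = e*h/2" using C R(1) by (simp add: omg_def field_simps)
          finally show ?thesis using FF_increment[OF nr[OF r] nr[OF s]] by linarith
        qed
        have "ff (U s) de = ff (U s) (U (t + h) - U s) - ff (U s) (U t - U s)" unfolding de_def ff_diff by simp
        then show "norm (ff (U s) de - m) <= e*h" using q[OF tt(1)] q[OF tt(2)] unfolding m_def real_norm_def by linarith
      qed (use h in auto)
      moreover have "G (t + h) - G t = h*(aa k p (w h t) de - m)"
      proof -
        have "sg (cm \<i> (U (t + h))) de - sg (cm \<i> (U t)) de = sg (cm \<i> de) de"
          by (simp add: de_def linear_diff[OF bounded_linear.linear[OF bounded_linear_cm]] sg.diff_left)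
        then show ?thesis
          using sg_i_self[of de] h by (simp add: G_def w_def aa.scaleR_left aa.diff_left algebra_simps)
      qed
      ultimately have "h * \<bar>aa k p (w h t) de - m\<bar> <= h*(e*h)" using h(1) by (simp add: abs_mult mult_ac)
      then show "norm (aa k p (w h t) de/h - m/h) <= e"
        using h(1) by (simp add: pos_divide_le_eq flip: diff_divide_distrib)
    qed (use ab in auto)
    then have ev: "\<forall>\<^sub>F h in at_right 0. norm (ph h be - ph h al) <= e*(be - al)"
      unfolding eventually_at_right_field using d ab by (intro exI[of _ "min 1 d"]) auto
    have "((%h. norm (ph h be - ph h al)) \<longlongrightarrow> norm (EE k p (U be) - EE k p (U al))) (at_right 0)"
      using ab by (intro tendsto_intros lim) auto
    from tendsto_upperbound[OF this ev] show ?thesis by simp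
  qed
  have "\<bar>EE k p (U be) - EE k p (U al)\<bar> <= 0 + e" if "e > 0" for e
  proof -
    have "e/(be - al + 1)*(be - al) <= e" using ab that by (simp add: field_simps)
    then show ?thesis using *[of "e/(be - al + 1)"] ab that by simp
  qed
  from field_le_epsilon[OF this] show ?thesis by simp
qed

lemma energy_conserved: "EE k p (U t) = EE k p (U 0)"
  using energy_conserved_interval[of 0 t] energy_conserved_interval[of t 0] by (cases "0 <= t") auto

end

section \<open>Coercivity of the second variation\<close>

lemma pot_sym: "pot w u v = pot w v u"
  unfolding pot_def by (rule arg_cong[of _ _ "integral _"]) (simp add: fun_eq_iff algebra_simps)

lemma bounded_bilinear_pot: "bounded_bilinear (pot w)"
proof (rule bounded_bilinear_symI[OF _ _ pot_sym])
  have i: "(%z. (cmod (fn w z))^2 * Re (fn u z*cnj (fn v z)) + 2*(Re (cnj (fn w z)*fn u z) * Re (cnj (fn w z)*fn v z))) integrable_on {0..2*pi}" for u v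
    by (intro integrable_continuous_real continuous_intros fn_cont)
  show "pot w (u + u') v = pot w u v + pot w u' v" for u u' v unfolding pot_def integral_add[OF i i, symmetric]
    by (rule arg_cong[of _ _ "integral _"]) (simp add: fun_eq_iff fn_plus algebra_simps)
  show "pot w (r *\<^sub>R u) v = r*pot w u v" for r u v unfolding pot_def integral_mult_right[symmetric]
    by (rule arg_cong[of _ _ "integral _"]) (simp add: fun_eq_iff fn_scaleR algebra_simps)
  show "\<bar>pot w u v\<bar> <= 48*(norm w)^2*(norm u*norm v)" for u v
    using l2_le l2_nonneg by (intro order_trans[OF pot_bound] mult_left_mono mult_mono) auto
qed

definition Lb :: "real => real => h1 => h1 => h1 => real" where
  "Lb k p w u v = aa k p u v - pot w u v"

lemma LL_Lb: "LL k p w v = Lb k p w v v"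
proof -
  have "pot w v v = nu w v v + integral {0..2*pi} (%z. 2*(Re (cnj (fn w z)*fn v z) * Re (cnj (fn w z)*fn v z)))"
    unfolding pot_def nu_def by (intro integral_add integrable_continuous_real continuous_intros fn_cont)
  also have "integral {0..2*pi} (%z. 2*(Re (cnj (fn w z)*fn v z) * Re (cnj (fn w z)*fn v z))) = 2*cq w v"
    unfolding cq_def power2_eq_square by (rule integral_mult_right)
  finally show ?thesis by (simp add: LL_def Lb_def)
qed

lemma bounded_bilinear_Lb: "bounded_bilinear (Lb k p w)"
proof (rule bounded_bilinear_symI)
  interpret pot: bounded_bilinear "pot w" by (rule bounded_bilinear_pot)
  fix u u' v and r :: real
  show "Lb k p w (u + u') v = Lb k p w u v + Lb k p w u' v" by (simp add: Lb_def aa.add_left pot.add_left)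
  show "Lb k p w (r *\<^sub>R u) v = r*Lb k p w u v" by (simp add: Lb_def aa.scaleR_left pot.scaleR_left algebra_simps)
  show "Lb k p w u v = Lb k p w v u" by (simp add: Lb_def aa_sym[of k p u v] pot_sym[of w u v])
  have "48*(norm w)^2*(l2 u*l2 v) <= 48*(norm w)^2*(norm u*norm v)"
    using l2_le l2_nonneg by (intro mult_left_mono mult_mono) auto
  then show "\<bar>Lb k p w u v\<bar> <= (aK k p + 48*(norm w)^2)*(norm u*norm v)"
    using aa_bound[of k p u v] pot_bound[of w u v] unfolding Lb_def distrib_right by linarith
qed

text \<open>Half of the leading coefficient \<open>4*k^2\<close> is spent on absorbing the momentum
  term by \<open>2*a*b <= a^2 + b^2\<close>.\<close>

lemma garding: "2*k^2*ta v v <= Lb k p w v v + (2*p^2 + 48*(norm w)^2)*(l2 v)^2"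
proof -
  have "\<bar>ch (cm \<i> v) v\<bar> <= sqrt (ta v v)*l2 v"
    using ch_bound[of "cm \<i> v" v] by (simp add: ta_cm l2_def)
  then have "4*k*p*ch (cm \<i> v) v <= 4 * \<bar>k*p\<bar>*(sqrt (ta v v)*l2 v)"
    using mult_left_mono[of "\<bar>ch (cm \<i> v) v\<bar>" "sqrt (ta v v)*l2 v" "4 * \<bar>k*p\<bar>"]
      abs_ge_self[of "4*k*p*ch (cm \<i> v) v"] by (simp add: abs_mult)
  also have "... = 2*(2*(\<bar>k\<bar> * sqrt (ta v v))*(\<bar>p\<bar>*l2 v))" by (simp add: abs_mult)
  also have "... <= 2*((\<bar>k\<bar> * sqrt (ta v v))^2 + (\<bar>p\<bar>*l2 v)^2)"
    using sum_squares_bound[of "\<bar>k\<bar> * sqrt (ta v v)" "\<bar>p\<bar>*l2 v"] by simp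
  also have "... = 2*k^2*ta v v + 2*p^2*(l2 v)^2"
    using ta_nonneg[of v] by (simp add: power_mult_distrib algebra_simps)
  finally have "4*k*p*ch (cm \<i> v) v <= 2*k^2*ta v v + 2*p^2*(l2 v)^2" .
  moreover have "pot w v v <= 48*(norm w)^2*(l2 v)^2" using pot_bound[of w v v] by (simp add: power2_eq_square)
  moreover have "0 <= (1 + p^2) * sg v v" using sg_nonneg by simp
  ultimately show ?thesis unfolding Lb_def aa_def by (simp add: algebra_simps)
qed

text \<open>Induction on the list: a vector \<open>w\<close> in the kernel of the earlier
  functionals with \<open>f w = 1\<close> corrects the value of \<open>f\<close>; if
  \<open>f\<close> vanishes on that kernel, \<open>w = 0\<close> does.\<close>

lemma nearby_in_kernel:
  fixes fs :: "('a::real_normed_vector => real) list"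
  assumes "!!f. f \<in> set fs ==> bounded_linear f"
  shows "EX C>=0. ALL v. EX y. (ALL f:set fs. f y = 0) & norm (v - y) <= C*(\<Sum>f\<leftarrow>fs. \<bar>f v\<bar>)"
  using assms
proof (induction fs)
  case Nil
  then show ?case by (auto intro!: exI[of _ 0])
next
  case (Cons f fs)
  interpret f: bounded_linear f using Cons.prems by simp
  have lin: "linear g" if "g \<in> set (f # fs)" for g using Cons.prems[OF that] by (rule bounded_linear.linear)
  obtain K where K: "K >= 0" "!!x. \<bar>f x\<bar> <= norm x*K" using f.nonneg_bounded by auto
  from Cons obtain C where C: "C >= 0" "!!v. EX y. (ALL g:set fs. g y = 0) & norm (v - y) <= C*(\<Sum>g\<leftarrow>fs. \<bar>g v\<bar>)" by auto
  obtain w where w: "ALL g:set fs. g w = 0" "f w = 1 | (w = 0 & (ALL y. (ALL g:set fs. g y = 0) --> f y = 0))"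
  proof (cases "ALL y. (ALL g:set fs. g y = 0) --> f y = 0")
    case True
    then show thesis using that[of 0] Cons.prems by (auto intro: linear_0 bounded_linear.linear)
  next
    case False
    then obtain z where z: "ALL g:set fs. g z = 0" "f z ~= 0" by blast
    then show thesis using that[of "(1/f z) *\<^sub>R z"] Cons.prems
      by (auto simp: f.scaleR linear_scale[OF bounded_linear.linear])
  qed
  have "EX y. (ALL g:set (f # fs). g y = 0) & norm (v - y) <= (norm w + (1 + K*norm w)*C)*(\<Sum>g\<leftarrow>f # fs. \<bar>g v\<bar>)" for v
  proof -
    obtain y where y: "ALL g:set fs. g y = 0" "norm (v - y) <= C*(\<Sum>g\<leftarrow>fs. \<bar>g v\<bar>)" using C(2) by blast
    let ?S = "\<Sum>g\<leftarrow>fs. \<bar>g v\<bar>"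
    have S: "?S >= 0" by (intro sum_list_nonneg) auto
    have "g (y - f y *\<^sub>R w) = 0" if "g \<in> set (f # fs)" for g
      using that w y(1) linear_diff[OF lin[OF that]] linear_scale[OF lin[OF that]] by (cases "g = f") auto
    moreover have "norm (v - (y - f y *\<^sub>R w)) <= (norm w + (1 + K*norm w)*C)*(\<bar>f v\<bar> + ?S)"
    proof -
      have "\<bar>f y\<bar> <= \<bar>f v\<bar> + norm (v - y)*K" using K(2)[of "v - y"] by (simp add: f.diff)
      also have "... <= \<bar>f v\<bar> + C*?S*K" using y(2) K(1) by (intro add_left_mono mult_right_mono)
      finally have "\<bar>f y\<bar>*norm w <= (\<bar>f v\<bar> + C*?S*K)*norm w" by (rule mult_right_mono) simp
      moreover have "norm (v - (y - f y *\<^sub>R w)) <= norm (v - y) + \<bar>f y\<bar>*norm w"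
        using norm_triangle_ineq[of "v - y" "f y *\<^sub>R w"] by (simp only: diff_diff_eq2 diff_add_eq norm_scaleR)
      moreover have "0 <= norm w*?S" "0 <= (1 + K*norm w)*C * \<bar>f v\<bar>" using S C(1) K(1) by auto
      ultimately show ?thesis using y(2) by (simp add: algebra_simps)
    qed
    ultimately show ?thesis by (intro exI[of _ "y - f y *\<^sub>R w"]) simp
  qed
  moreover have "0 <= norm w + (1 + K*norm w)*C" using C(1) K(1) by simp
  ultimately show ?case by blast
qed

text \<open>Coercivity is used at a nearby kernel element \<open>y\<close>; the cross terms are
  absorbed by half of \<open>c\<close> through Young's inequality, and the distance
  \<open>norm (v - y)\<close> is paid for by the functionals.\<close>

lemma coercive_extend:
  fixes B :: "'a::real_normed_vector => 'a => real"
  assumes B: "bounded_bilinear B" and fs: "!!f. f \<in> set fs ==> bounded_linear f"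
    and c: "c > 0" "!!v. (ALL f:set fs. f v = 0) ==> c*(norm v)^2 <= B v v"
  shows "EX c' C. c' > 0 & C >= 0 & (ALL v. c'*(norm v)^2 <= B v v + C*(\<Sum>f\<leftarrow>fs. \<bar>f v\<bar>)^2)"
proof -
  interpret B: bounded_bilinear B by fact
  obtain K where K: "K > 0" "!!u v. norm (B u v) <= norm u*norm v * K" using B.pos_bounded by blast
  obtain D where D: "D >= 0" "!!v. EX y. (ALL f:set fs. f y = 0) & norm (v - y) <= D*(\<Sum>f\<leftarrow>fs. \<bar>f v\<bar>)"
    using nearby_in_kernel[of fs] fs by blast
  define C where "C = 2*K + 4*K^2/c + c"
  have C: "C >= 0" using K c by (simp add: C_def)
  have "c/4*(norm v)^2 <= B v v + C*D^2*(\<Sum>f\<leftarrow>fs. \<bar>f v\<bar>)^2" for v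
  proof -
    obtain y where y: "ALL f:set fs. f y = 0" "norm (v - y) <= D*(\<Sum>f\<leftarrow>fs. \<bar>f v\<bar>)" using D(2) by blast
    define r a where "r = norm (v - y)" and "a = norm y"
    have "B v v = B y y + (B y (v - y) + B (v - y) y + B (v - y) (v - y))" by (simp add: B.diff_left B.diff_right)
    moreover have "\<bar>B y (v - y)\<bar> <= K*(a*r)" "\<bar>B (v - y) y\<bar> <= K*(a*r)" "\<bar>B (v - y) (v - y)\<bar> <= K*r^2"
      using K(2)[of y "v - y"] K(2)[of "v - y" y] K(2)[of "v - y" "v - y"] by (simp_all add: r_def a_def power2_eq_square mult_ac)
    moreover have "c*a^2 <= B y y" unfolding a_def by (rule c(2)[OF y(1)])
    moreover have "2*K*(a*r) <= c/2*a^2 + 2*K^2/c*r^2"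
    proof -
      have "0 <= c/2*(a - 2/c*K*r)^2" using c(1) by simp
      also have "... = c/2*a^2 + 2*K^2/c*r^2 - 2*K*(a*r)" using c(1) by (simp add: field_simps power2_eq_square)
      finally show ?thesis by simp
    qed
    moreover have "c/4*(norm v)^2 <= c/2*a^2 + c/2*r^2"
    proof -
      have "(norm v)^2 <= (a + r)^2" using norm_triangle_sub[of v y] by (intro power_mono) (auto simp: a_def r_def)
      also have "... <= 2*a^2 + 2*r^2" using sum_squares_bound[of a r] by (simp add: power2_sum)
      finally show ?thesis using mult_left_mono[of "(norm v)^2" "2*a^2 + 2*r^2" "c/4"] c(1) by (simp add: algebra_simps)
    qed
    moreover have "C*r^2 = 2*(K*r^2) + 2*(2*K^2/c*r^2) + 2*(c/2*r^2)" by (simp add: C_def algebra_simps)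
    moreover have "0 <= K*r^2" "0 <= 2*K^2/c*r^2" "0 <= c/2*r^2" using K c by simp_all
    ultimately have "c/4*(norm v)^2 <= B v v + C*r^2" by linarith
    also have "C*r^2 <= C*(D*(\<Sum>f\<leftarrow>fs. \<bar>f v\<bar>))^2"
      using y(2) C by (intro mult_left_mono power_mono) (auto simp: r_def)
    finally show ?thesis by (simp add: power_mult_distrib)
  qed
  moreover have "c/4 > 0" "C*D^2 >= 0" using c(1) C by simp_all
  ultimately show ?thesis by blast
qed

interpretation Lb: bounded_bilinear "Lb k p w" for k p w by (rule bounded_bilinear_Lb)

lemma l2_sup_period:
  assumes "!!z. z \<in> {0..2*pi} ==> cmod (fn u z) <= e"
  shows "l2 u <= 3*e"
proof (rule l2_sup)
  fix z
  obtain n where n: "z + 2*pi * of_int n \<in> {0..2*pi}" by (rule period_representative)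
  have "fn u (z + 2*pi * of_int n) = fn u z" by (rule per_int[OF fn_per])
  then show "cmod (fn u z) <= e" using assms[OF n] by simp
qed

text \<open>The energy bound gives a common Hoelder bound with exponent 1/2, so Arzela-Ascoli
  applies on one period.\<close>

lemma uniformly_convergent_subsequence:
  fixes w :: "nat => h1"
  assumes "!!n. norm (w n) <= 1"
  obtains r :: "nat => nat" where "strict_mono r" "!!e. e > 0 ==> EX N. ALL n>=N. ALL m>=N. l2 (w (r n) - w (r m)) < e"
proof -
  let ?S = "{0..2*pi}"
  have inc: "cmod (fn (w n) x - fn (w n) y) <= sqrt \<bar>x - y\<bar>" if "x \<in> ?S" "y \<in> ?S" for n x y
  proof -
    have 1: "sqrt (ta (w n) (w n)) <= 1" using ta_le_norm[of "w n"] assms[of n] by linarith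
    have "cmod (fn (w n) x - fn (w n) y) <= sqrt \<bar>x - y\<bar> * sqrt (ta (w n) (w n))"
      using fn_incr[of x y "w n"] fn_incr[of y x "w n"] that by (cases "x <= y") (auto simp: norm_minus_commute abs_if)
    also have "... <= sqrt \<bar>x - y\<bar>*1" using 1 by (intro mult_left_mono) auto
    finally show ?thesis by simp
  qed
  obtain G r where r: "strict_mono (r :: nat => nat)"
    and G: "!!e. 0 < e ==> EX N. ALL n x. n >= N & x \<in> ?S --> norm (fn (w (r n)) x - G x) < e"
  proof (rule Arzela_Ascoli[of ?S "%n. fn (w n)" 4])
    show "norm (fn (w n) x) <= 4" for n x using fn_bound[of "w n" x] assms[of n] by linarith
    fix x e :: real assume x: "x \<in> ?S" and e: "0 < e"
    show "EX d>0. ALL n y. y \<in> ?S & norm (x - y) < d --> norm (fn (w n) x - fn (w n) y) < e"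
    proof (intro exI[of _ "e^2"] conjI allI impI)
      fix n y assume y: "y \<in> ?S & norm (x - y) < e^2"
      have "sqrt \<bar>x - y\<bar> < sqrt (e^2)" using y by (intro real_sqrt_less_mono) auto
      then show "norm (fn (w n) x - fn (w n) y) < e" using inc[OF x, of y n] y e by simp
    qed (use e in simp)
  qed auto
  show thesis
  proof (rule that[OF r])
    fix e :: real assume e: "e > 0"
    obtain N where N: "!!n x. n >= N ==> x \<in> ?S ==> norm (fn (w (r n)) x - G x) < e/8" using G[of "e/8"] e by auto
    have "l2 (w (r n) - w (r m)) < e" if nm: "n >= N" "m >= N" for n m
    proof -
      have "l2 (w (r n) - w (r m)) <= 3*(e/4)"
      proof (rule l2_sup_period)
        fix z assume z: "z \<in> ?S"
        have "cmod (fn (w (r n) - w (r m)) z) <= cmod (fn (w (r n)) z - G z) + cmod (fn (w (r m)) z - G z)"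
          unfolding fn_minus using norm_triangle_ineq4[of "fn (w (r n)) z - G z" "fn (w (r m)) z - G z"] by simp
        then show "cmod (fn (w (r n) - w (r m)) z) <= e/4" using N[OF nm(1) z] N[OF nm(2) z] by simp
      qed
      then show ?thesis using e by simp
    qed
    then show "EX N. ALL n>=N. ALL m>=N. l2 (w (r n) - w (r m)) < e" by blast
  qed
qed

context profile
begin

lemma blin_n1: "bounded_linear (%v. sg Q v)" and blin_n2: "bounded_linear (%v. sg (cm \<i> Q1) v)"
  and blin_k1: "bounded_linear (%v. inner v (cm \<i> Q))" and blin_k2: "bounded_linear (%v. inner v Q1)"
  by (rule sg.bounded_linear_right bounded_linear_inner_left)+

text \<open>If no constant works, unit vectors of \<open>Y\<close> on which the form tends to 0 have
  a subsequence converging in norm. The limit is a unit vector of \<open>Y\<close> with form at most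
  0, hence by \<open>pos\<close> a combination of the symmetry directions, to which it is also
  orthogonal.\<close>

lemma coercive_Y:
  "EX c>0. ALL v. sg Q v = 0 --> sg (cm \<i> Q1) v = 0 --> inner v (cm \<i> Q) = 0 --> inner v Q1 = 0 -->
     c*(norm v)^2 <= Lb k p Q v v"
proof (rule ccontr)
  assume neg: "~ ?thesis"
  define Y where "Y = {v. sg Q v = 0 & sg (cm \<i> Q1) v = 0 & inner v (cm \<i> Q) = 0 & inner v Q1 = 0}"
  interpret n1: bounded_linear "%v. sg Q v" by (rule blin_n1)
  interpret n2: bounded_linear "%v. sg (cm \<i> Q1) v" by (rule blin_n2)
  have lin: "r *\<^sub>R v \<in> Y" "u + v \<in> Y" if "u \<in> Y" "v \<in> Y" for r u v
    using that by (auto simp: Y_def n1.add n1.scaleR n2.add n2.scaleR inner_add_left)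
  have "EX v:Y. norm v = 1 & Lb k p Q v v < 1/(real n + 1)" for n
  proof -
    have "1/(real n + 1) > 0" by simp
    moreover have "ALL c>0. EX v:Y. Lb k p Q v v < c*(norm v)^2" using neg by (auto simp: Y_def not_le)
    ultimately obtain v where v: "v \<in> Y" "Lb k p Q v v < 1/(real n + 1)*(norm v)^2" by blast
    have v0: "norm v ~= 0" using v(2) by (auto simp: Lb.zero_left)
    define w where "w = (1/norm v) *\<^sub>R v"
    have "norm w = 1" using v0 by (simp add: w_def)
    moreover have "w \<in> Y" using lin(1)[OF v(1) v(1)] by (simp add: w_def)
    moreover have "Lb k p Q w w = Lb k p Q v v/(norm v)^2"
      by (simp add: w_def Lb.scaleR_left Lb.scaleR_right power2_eq_square)
    moreover have "Lb k p Q v v/(norm v)^2 < 1/(real n + 1)" using v(2) v0 by (simp add: divide_less_eq)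
    ultimately show ?thesis by auto
  qed
  then obtain w where w: "!!n. w n \<in> Y" "!!n. norm (w n) = 1" "!!n. Lb k p Q (w n) (w n) < 1/(real n + 1)" by metis
  obtain r :: "nat => nat" where r: "strict_mono r" "!!e. e > 0 ==> EX N. ALL n>=N. ALL m>=N. l2 (w (r n) - w (r m)) < e"
    using uniformly_convergent_subsequence[of w] w(2) by (metis order_refl)
  define V where "V n = w (r n)" for n
  have VY: "V n \<in> Y" "norm (V n) = 1" for n by (simp_all add: V_def w)
  have VL: "Lb k p Q (V n) (V n) < 1/(real N + 1)" if "n >= N" for n N :: nat
  proof -
    have "real N <= real (r n)" using that seq_suble[OF r(1), of n] by simp
    then have "1/(real (r n) + 1) <= 1/(real N + 1)" by (intro divide_left_mono) auto
    then show ?thesis using w(3)[of "r n"] by (simp add: V_def)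
  qed
  have posY: "0 <= Lb k p Q v v" if "v \<in> Y" for v using pos[of v] that by (simp add: Y_def LL_Lb)
  have k2: "2*k^2 > 0" using k by simp
  define C where "C = 2*p^2 + 48*(norm Q)^2"
  define K where "K = 1 + C/(2*k^2)"
  have C: "C >= 0" by (simp add: C_def)
  have K: "K >= 1" using C k by (simp add: K_def)
  \<comment> \<open>The parallelogram law and nonnegativity at \<open>V n + V m\<close> make the
    form small at the difference; \<open>garding\<close> then upgrades convergence in
    \<open>l2\<close> to convergence in norm.\<close>
  have dist_est: "(norm (V n - V m))^2 <= K*(l2 (V n - V m))^2 + 4/(real N + 1)/(2*k^2)" if nm: "n >= N" "m >= N" for n m N :: nat
  proof -
    let ?d = "V n - V m"
    have "Lb k p Q ?d ?d = 2*Lb k p Q (V n) (V n) + 2*Lb k p Q (V m) (V m) - Lb k p Q (V n + V m) (V n + V m)"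
      by (simp add: Lb.add_left Lb.add_right Lb.diff_left Lb.diff_right)
    also have "... <= 4/(real N + 1)"
      using VL[OF nm(1)] VL[OF nm(2)] posY[OF lin(2)[OF VY(1)[of n] VY(1)[of m]]] by simp
    finally have "2*k^2*ta ?d ?d <= 4/(real N + 1) + C*(l2 ?d)^2"
      using garding[of k ?d p Q] unfolding C_def by linarith
    then have "ta ?d ?d <= (4/(real N + 1) + C*(l2 ?d)^2)/(2*k^2)"
      using k2 by (simp add: pos_le_divide_eq mult.commute)
    moreover have "(norm ?d)^2 = (l2 ?d)^2 + ta ?d ?d" by (simp add: norm_h1_sq l2_sq)
    ultimately show ?thesis by (simp add: K_def add_divide_distrib algebra_simps)
  qed
  have "Cauchy V"
  proof (rule metric_CauchyI)
    fix e :: real assume e: "e > 0"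
    have "e/sqrt (2*K) > 0" using e K by simp
    then obtain N1 where N1: "!!n m. n >= N1 ==> m >= N1 ==> l2 (V n - V m) < e/sqrt (2*K)"
      using r(2)[of "e/sqrt (2*K)"] by (auto simp: V_def)
    obtain N2 :: nat where N2: "8/(e^2*(2*k^2)) < real N2" using reals_Archimedean2 by blast
    define N where "N = max N1 N2"
    have "dist (V n) (V m) < e" if nm: "n >= N" "m >= N" for n m
    proof -
      have "(l2 (V n - V m))^2 <= (e/sqrt (2*K))^2"
        using N1[of n m] nm l2_nonneg by (intro power_mono) (auto simp: N_def less_imp_le)
      then have 1: "K*(l2 (V n - V m))^2 <= e^2/2" using K by (simp add: power_divide field_simps)
      have "8/(e^2*(2*k^2)) < real N + 1" using N2 by (simp add: N_def)
      then have "8 < (real N + 1)*(e^2*(2*k^2))" using e k2 by (subst (asm) pos_divide_less_eq) auto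
      then have 2: "4/(real N + 1)/(2*k^2) < e^2/2"
        using k2 by (simp add: divide_divide_eq_left pos_divide_less_eq mult_ac)
      have "(norm (V n - V m))^2 < e^2" using dist_est[OF nm] 1 2 by linarith
      then show ?thesis unfolding dist_norm using e by (intro power2_less_imp_less[of _ e]) auto
    qed
    then show "EX M. ALL m>=M. ALL n>=M. dist (V m) (V n) < e" by blast
  qed
  then obtain L where L: "V \<longlonglongrightarrow> L" using Cauchy_convergent unfolding convergent_def by blast
  have lim0: "f L = 0" if "bounded_linear f" "!!n. f (V n) = (0::real)" for f
    using bounded_linear.tendsto[OF that(1) L] that(2) LIMSEQ_unique[OF tendsto_const] by fastforce
  have LY: "L \<in> Y" using VY(1) lim0[OF blin_n1] lim0[OF blin_n2] lim0[OF blin_k1] lim0[OF blin_k2] by (simp add: Y_def)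
  have "(%n. norm (V n)) \<longlonglongrightarrow> norm L" by (rule tendsto_norm[OF L])
  then have L1: "norm L = 1" by (simp add: VY LIMSEQ_const_iff)
  have "(%n. Lb k p Q (V n) (V n)) \<longlonglongrightarrow> Lb k p Q L L" by (rule Lb.tendsto[OF L L])
  moreover have "(%n. 1/(real n + 1)) \<longlonglongrightarrow> 0" using LIMSEQ_Suc[OF lim_inverse_n'] by (simp add: add.commute)
  ultimately have "Lb k p Q L L <= 0" using VL by (intro LIMSEQ_le[of _ _ "%n. 1/(real n + 1)"]) (auto intro: less_imp_le)
  then have "EX al be. L = al *\<^sub>R cm \<i> Q + be *\<^sub>R Q1" using pos[of L] LY by (simp add: Y_def LL_Lb)
  then obtain al be where ab: "L = al *\<^sub>R cm \<i> Q + be *\<^sub>R Q1" by blast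
  have "inner L L = inner L (al *\<^sub>R cm \<i> Q + be *\<^sub>R Q1)" using ab by simp
  also have "... = al*inner L (cm \<i> Q) + be*inner L Q1" by (simp add: inner_add_right)
  also have "... = 0" using LY by (simp add: Y_def)
  finally show False using L1 by (simp add: power2_norm_eq_inner[symmetric])
qed

text \<open>Modulation makes the two symmetry functionals vanish exactly, so they stay hypotheses.
  The gradients of mass and momentum are only approximately orthogonal to a perturbation and
  therefore become a penalty.\<close>

lemma coercive:
  "EX c C. c > 0 & C >= 0 & (ALL v. inner v (cm \<i> Q) = 0 --> inner v Q1 = 0 -->
     c*(norm v)^2 <= Lb k p Q v v + C*(\<bar>sg Q v\<bar> + \<bar>sg (cm \<i> Q1) v\<bar>)^2)"
proof -
  let ?fs = "[%v. sg Q v, %v. sg (cm \<i> Q1) v, %v. inner v (cm \<i> Q), %v. inner v Q1]"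
  obtain c where c: "c > 0" "!!v. (ALL f:set ?fs. f v = 0) ==> c*(norm v)^2 <= Lb k p Q v v" using coercive_Y by auto
  have "bounded_linear f" if "f \<in> set ?fs" for f using that blin_n1 blin_n2 blin_k1 blin_k2 by auto
  from coercive_extend[OF bounded_bilinear_Lb this c] obtain c' C where "c' > 0" "C >= 0"
    and r: "!!v. c'*(norm v)^2 <= Lb k p Q v v + C*(\<Sum>f\<leftarrow>?fs. \<bar>f v\<bar>)^2" by blast
  moreover have "c'*(norm v)^2 <= Lb k p Q v v + C*(\<bar>sg Q v\<bar> + \<bar>sg (cm \<i> Q1) v\<bar>)^2"
    if "inner v (cm \<i> Q) = 0" "inner v Q1 = 0" for v using r[of v] that by simp
  ultimately show ?thesis by blast
qed

end

section \<open>Nonlinear stability\<close>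

lemma minimal_orthogonal:
  fixes gm :: "real => 'a::real_inner"
  assumes d: "(gm has_vector_derivative gm') (at 0)" and "gm 0 = 0"
    and min: "!!t. norm v <= norm (v + gm t)"
  shows "inner v gm' = 0"
proof -
  have "((%t. v + gm t) has_vector_derivative gm') (at 0)" using has_vector_derivative_add[OF has_vector_derivative_const d, of v] by simp
  from bounded_bilinear.has_vector_derivative[OF bounded_bilinear_inner this this]
  have "((%t. inner (v + gm t) (v + gm t)) has_real_derivative 2*inner v gm') (at 0)"
    using assms(2) by (simp add: has_real_derivative_iff_has_vector_derivative inner_commute)
  moreover have "ALL y. \<bar>0 - y\<bar> < 1 --> inner (v + gm 0) (v + gm 0) <= inner (v + gm y) (v + gm y)"
    using min assms(2) by (simp add: power2_norm_eq_inner[symmetric] power_mono)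
  ultimately have "2*inner v gm' = 0" using DERIV_local_min[of "%t. inner (v + gm t) (v + gm t)" "2*inner v gm'" 0 1] by simp
  then show ?thesis by simp
qed

context profile
begin

definition orb :: "real => real => h1" where "orb ph xh = cm (cis (- ph)) (sh xh Q)"

definition od :: "h1 => real" where "od u = (INF (ph, xh)\<in>(UNIV :: (real \<times> real) set). norm (u - orb ph xh))"

lemma bdd: "bdd_below ((%(ph, xh). norm (u - orb ph xh)) ` S)" by (rule bdd_belowI[of _ 0]) auto

lemma od_le: "od u <= norm (u - orb ph xh)" unfolding od_def using cINF_lower[OF bdd, of "(ph, xh)" UNIV u] by simp

lemma od_lipschitz: "od u <= od v + norm (u - v)"
proof -
  have "od u - norm (u - v) <= od v" unfolding od_def[of v]
  proof (rule cINF_greatest)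
    fix x :: "real \<times> real"
    obtain ph xh where x: "x = (ph, xh)" by (cases x)
    have "od u <= norm (u - orb ph xh)" by (rule od_le)
    also have "... <= norm (u - v) + norm (v - orb ph xh)" using norm_triangle_ineq[of "u - v" "v - orb ph xh"] by simp
    finally show "od u - norm (u - v) <= (case x of (ph, xh) => norm (v - orb ph xh))" by (simp add: x)
  qed auto
  then show ?thesis by simp
qed

lemma od_nonneg: "0 <= od u" unfolding od_def by (rule cINF_greatest) auto

lemma cont_orb: "isCont (%(ph, xh). orb ph xh) (ph0, xh0)"
proof -
  have cs: "isCont (%xh. sh xh Q) xh1" for xh1
  proof -
    have "isCont (%xh. sh xh Q) 0" using has_vector_derivative_continuous[OF dshQ] by simp
    then have "((%h. sh h Q) \<longlongrightarrow> sh 0 Q) (at 0)" by (simp add: isCont_def)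
    from bounded_linear.tendsto[OF bounded_linear_sh this, of xh1]
    have "((%h. sh (xh1 + h) Q) \<longlongrightarrow> sh xh1 Q) (at 0)" by (simp add: sh_sh)
    then show ?thesis unfolding isCont_iff .
  qed
  have split: "cm (cis (- ph)) u = cos ph *\<^sub>R u - sin ph *\<^sub>R cm \<i> u" for ph u
    by (rule h1_eqI) (simp add: fn_cm fn_minus fn_scaleR complex_eq_iff algebra_simps)
  have c1: "isCont (%x. sh (snd x) Q) (ph0, xh0)"
    using isCont_o2[of "(ph0, xh0)" snd "%xh. sh xh Q"] cs by (simp add: continuous_snd)
  have c2: "isCont (%x. cm \<i> (sh (snd x) Q)) (ph0, xh0)" by (rule bounded_linear.isCont[OF bounded_linear_cm c1])
  show ?thesis unfolding case_prod_beta orb_def split by (intro continuous_intros c1 c2)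
qed

text \<open>Both parameters are periodic, so a minimum over a compact square is a minimum over the
  whole orbit.\<close>

lemma od_attained: "EX ph xh. norm (u - orb ph xh) = od u"
proof -
  let ?f = "%x. norm (u - (%(ph, xh). orb ph xh) x)"
  let ?K = "{0..2*pi} \<times> {0..2*pi}"
  have "continuous_on ?K ?f" by (intro continuous_at_imp_continuous_on ballI continuous_intros) (use cont_orb in auto)
  moreover have "compact ?K" "?K ~= {}" by (auto intro: compact_Times)
  ultimately obtain x where x: "x \<in> ?K" "!!y. y \<in> ?K ==> ?f x <= ?f y"
    using continuous_attains_inf[of ?K ?f] by blast
  obtain ph xh where x': "x = (ph, xh)" by (cases x)
  have "norm (u - orb ph xh) <= od u" unfolding od_def
  proof (rule cINF_greatest)
    fix y :: "real \<times> real"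
    obtain a b where y: "y = (a, b)" by (cases y)
    obtain n where n: "a + 2*pi * of_int n \<in> {0..2*pi}" by (rule period_representative)
    obtain m where m: "b + 2*pi * of_int m \<in> {0..2*pi}" by (rule period_representative)
    have "cis (- (a + 2*pi * of_int n)) = cis (- a)"
      using per_int[of cis "- a" "- n"] by (simp add: per_def complex_eq_iff)
    moreover have "sh (b + 2*pi * of_int m) Q = sh b Q"
    proof (rule h1_eqI)
      fix z
      have "fn Q (z + b + 2*pi * of_int m) = fn Q (z + b)" by (rule per_int[OF fn_per])
      then show "fn (sh (b + 2*pi * of_int m) Q) z = fn (sh b Q) z" by (simp add: fn_sh add.assoc)
    qed
    ultimately have "orb (a + 2*pi * of_int n) (b + 2*pi * of_int m) = orb a b" by (simp add: orb_def)
    then show "norm (u - orb ph xh) <= (case y of (ph, xh) => norm (u - orb ph xh))"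
      using x(2)[of "(a + 2*pi * of_int n, b + 2*pi * of_int m)"] n m by (simp add: x' y)
  qed auto
  then show ?thesis using od_le[of u ph xh] by (intro exI[of _ ph] exI[of _ xh]) simp
qed

lemma EE_invariant: "cmod c = 1 ==> EE k p (cm c (sh r u)) = EE k p u"
proof -
  assume c: "cmod c = 1"
  have "aa k p (cm c w) (cm c w) = aa k p w w" for w
  proof -
    have "cm \<i> (cm c w) = cm c (cm \<i> w)" by (simp add: cm_cm mult.commute)
    then show ?thesis by (simp add: aa_def ta_cm sg_cm ch_cm c)
  qed
  moreover have "FF (cm c w) = FF w" for w by (simp add: FF_def fn_cm norm_mult c)
  ultimately show ?thesis by (simp add: EE_def FF_sh aa_sh)
qed

lemma Pm_invariant: "cmod c = 1 ==> Pm (cm c (sh r u)) = Pm u"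
proof -
  assume c: "cmod c = 1"
  have "cm \<i> (cm c w) = cm c (cm \<i> w)" for w by (simp add: cm_cm mult.commute)
  then show ?thesis by (simp add: Pm_def ch_cm c cm_sh ch_sh)
qed

lemma sg_invariant: "cmod c = 1 ==> sg (cm c (sh r u)) (cm c (sh r u)) = sg u u" by (simp add: sg_cm sg_sh)

text \<open>The symmetry that moves a closest orbit point to \<open>Q\<close> is an isometry
  preserving the orbit and the invariants. Minimality along the phase and translation curves through
  \<open>Q\<close> gives the two orthogonality relations.\<close>

lemma modulation:
  "EX v. norm v = od u & inner v (cm \<i> Q) = 0 & inner v Q1 = 0 & EE k p u = EE k p (Q + v)
     & sg u u = sg (Q + v) (Q + v) & Pm u = Pm (Q + v)"
proof -
  obtain ph xh where m: "norm (u - orb ph xh) = od u" using od_attained by blast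
  define T where "T w = cm (cis ph) (sh (- xh) w)" for w
  have bT: "bounded_linear T" unfolding T_def[abs_def]
    by (rule bounded_linear_compose[OF bounded_linear_cm bounded_linear_sh])
  have nT: "norm (T w) = norm w" for w by (simp add: T_def norm_cm norm_sh)
  have Torb: "T (orb a b) = orb (a - ph) (b - xh)" for a b
    by (rule h1_eqI) (simp add: T_def orb_def fn_cm fn_sh mult.assoc[symmetric] cis_mult algebra_simps)
  have orb0: "orb 0 0 = Q" by (simp add: orb_def sh_0 cm_1)
  define v where "v = T u - Q"
  have Tu: "T u = Q + v" by (simp add: v_def)
  have dist: "norm (Q + v - orb a b) = norm (u - orb (a + ph) (b + xh))" for a b
  proof -
    have "Q + v - orb a b = T (u - orb (a + ph) (b + xh))"
      using Torb[of "a + ph" "b + xh"] by (simp add: linear_diff[OF bounded_linear.linear[OF bT]] Tu)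
    then show ?thesis by (simp add: nT)
  qed
  have nv: "norm v = od u" using dist[of 0 0] m by (simp add: orb0)
  have min: "norm v <= norm (v + (Q - orb a b))" for a b
    using od_le[of u "a + ph" "b + xh"] dist[of a b] nv by (simp add: algebra_simps)
  have "inner v (cm \<i> Q) = 0"
  proof (rule minimal_orthogonal[where gm="%t. Q - orb t 0"])
    have split: "orb t 0 = cos t *\<^sub>R Q - sin t *\<^sub>R cm \<i> Q" for t
      by (rule h1_eqI) (simp add: orb_def sh_0 fn_cm fn_minus fn_scaleR complex_eq_iff algebra_simps)
    have "((%t. Q - (cos t *\<^sub>R Q - sin t *\<^sub>R cm \<i> Q)) has_vector_derivative 0 - ((- sin 0) *\<^sub>R Q - cos 0 *\<^sub>R cm \<i> Q)) (at 0)"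
    proof (intro has_vector_derivative_diff has_vector_derivative_const)
      have "((%t. cos t *\<^sub>R w) has_vector_derivative (- sin 0) *\<^sub>R w) (at 0)" "((%t. sin t *\<^sub>R w) has_vector_derivative cos 0 *\<^sub>R w) (at 0)" for w :: h1
        using has_vector_derivative_scaleR[OF DERIV_cos[of 0] has_vector_derivative_const[of w]]
          has_vector_derivative_scaleR[OF DERIV_sin[of 0] has_vector_derivative_const[of w]] by auto
      then show "((%t. cos t *\<^sub>R Q) has_vector_derivative (- sin 0) *\<^sub>R Q) (at 0)" "((%t. sin t *\<^sub>R cm \<i> Q) has_vector_derivative cos 0 *\<^sub>R cm \<i> Q) (at 0)"
        by blast+
    qed
    then show "((%t. Q - orb t 0) has_vector_derivative cm \<i> Q) (at 0)" by (simp add: split)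
  qed (use min orb0 in auto)
  moreover have "inner v (- Q1) = 0"
  proof (rule minimal_orthogonal[where gm="%t. Q - orb 0 t"])
    have "orb 0 t = sh t Q" for t by (simp add: orb_def cm_1)
    then show "((%t. Q - orb 0 t) has_vector_derivative - Q1) (at 0)"
      using has_vector_derivative_diff[OF has_vector_derivative_const[of Q] dshQ] by simp
  qed (use min orb0 in auto)
  moreover have "EE k p u = EE k p (Q + v)" "sg u u = sg (Q + v) (Q + v)" "Pm u = Pm (Q + v)"
    unfolding Tu[symmetric] T_def by (simp_all add: EE_invariant sg_invariant Pm_invariant)
  ultimately show ?thesis using nv by auto
qed

lemma ch_Q: "ch (cm \<i> Q) v = sg (cm \<i> Q1) v" unfolding ch_def sg_def
proof (rule ip_AE_cong)
  have "AE z in lebesgue. dv Q z = fn Q1 z" by (rule dv_AE[OF dQ])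
  then show "AE z in lebesgue. dv (cm \<i> Q) z = fn (cm \<i> Q1) z"
    using dv_cm[of \<i> Q] by eventually_elim (simp add: fn_cm)
qed simp

text \<open>\<open>eqn\<close> says that \<open>Q\<close> is a critical point, which removes the
  linear term.\<close>

lemma EE_expand: "\<bar>EE k p (Q + v) - EE k p Q - Lb k p Q v v/2\<bar> <= 16*norm Q*(norm v)^3 + 4*(norm v)^4"
proof -
  have "aa k p (Q + v) (Q + v) = aa k p Q Q + 2*ff Q v + aa k p v v"
    using eqn[of v] aa_sym[of k p v Q] by (simp add: aa.add_left aa.add_right ff_def)
  then have "EE k p (Q + v) - EE k p Q - Lb k p Q v v/2 = - (FF (Q + v) - FF Q - ff Q v - pot Q v v/2)"
    by (simp add: EE_def Lb_def field_simps)
  moreover have "(16*norm Q*norm v + 4*(norm v)^2)*(l2 v)^2 <= (16*norm Q*norm v + 4*(norm v)^2)*(norm v)^2"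
    using l2_le[of v] l2_nonneg[of v] by (intro mult_left_mono power_mono) auto
  moreover have "... = 16*norm Q*(norm v)^3 + 4*(norm v)^4"
    by (simp add: algebra_simps power2_eq_square power3_eq_cube power4_eq_xxxx)
  ultimately show ?thesis using FF_expand[of Q v] by simp
qed

lemma sg_expand: "sg (Q + v) (Q + v) - sg Q Q = 2 * sg Q v + sg v v"
  using sg_commute[of v Q] by (simp add: sg.add_left sg.add_right)

lemma Pm_expand: "Pm (Q + v) - Pm Q = 2 * sg (cm \<i> Q1) v + Pm v"
  using ch_cm_sym[of v Q] by (simp add: Pm_def linear_cm ch.add_left ch.add_right ch_Q)

lemma Pm_bound: "\<bar>Pm v\<bar> <= (norm v)^2"
  using norm_ch[of "cm \<i> v" v] by (simp add: Pm_def norm_cm power2_eq_square)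

lemma sg_bound: "\<bar>sg v v\<bar> <= (norm v)^2" using sg_le[of v v] by (simp add: power2_eq_square)

text \<open>Let \<open>y\<close> and \<open>e\<close> be the distances of \<open>u\<close> and
  \<open>w\<close> from the orbit. Equal energies bound the form by multiples of \<open>e^2\<close>
  and \<open>y^3\<close>; equal mass and momentum bound the constraint functionals by
  \<open>H*e + y^2\<close>. Coercivity absorbs the cubic term for small \<open>y\<close>, leaving
  \<open>y\<close> at most a multiple of \<open>e\<close>.\<close>

lemma a_priori:
  "EX de A. 0 < de & de <= 1 & 0 < A & (ALL u w. od u <= de --> od w <= 1 -->
      EE k p u = EE k p w --> sg u u = sg w w --> Pm u = Pm w --> od u <= A * od w)"
proof -
  obtain c C where c: "c > 0" "C >= 0" "!!v. inner v (cm \<i> Q) = 0 ==> inner v Q1 = 0 ==>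
     c*(norm v)^2 <= Lb k p Q v v + C*(\<bar>sg Q v\<bar> + \<bar>sg (cm \<i> Q1) v\<bar>)^2" using coercive by blast
  obtain K0 where K0: "K0 > 0" "!!u v. norm (Lb k p Q u v) <= norm u*norm v * K0" using Lb.pos_bounded by blast
  define R where "R = 16*norm Q + 4"
  define H where "H = norm Q + norm (cm \<i> Q1) + 1"
  define K where "K = 4 * R + K0 + 2*C*(H^2 + 1)"
  have R: "R >= 4" and H: "H >= 1" by (auto simp: R_def H_def)
  have K: "K > 0" unfolding K_def using R K0 c(2) by (intro add_pos_nonneg) auto
  \<comment> \<open>\<open>de\<close> ensures \<open>K*y^3 <= c/4*y^2\<close>; then
    \<open>c/2*y^2 <= K*e^2\<close>, which gives \<open>A\<close>.\<close>
  define de A where "de = min 1 (c/(4*K))" and "A = sqrt (2*K/c)"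
  have de: "0 < de" "de <= 1" "de <= c/(4*K)" using c(1) K by (auto simp: de_def)
  have A: "A > 0" using c(1) K by (simp add: A_def)
  have rem: "16*norm Q*(norm x)^3 + 4*(norm x)^4 <= R*(norm x)^3" if "norm x <= 1" for x :: h1
  proof -
    have "(norm x)^4 <= (norm x)^3" using that by (intro power_decreasing) auto
    then show ?thesis by (simp add: R_def algebra_simps)
  qed
  have "od u <= A * od w" if u: "od u <= de" and w: "od w <= 1"
    and EEq: "EE k p u = EE k p w" and Neq: "sg u u = sg w w" and Peq: "Pm u = Pm w" for u w
  proof -
    obtain v where v: "norm v = od u" "inner v (cm \<i> Q) = 0" "inner v Q1 = 0" "EE k p u = EE k p (Q + v)"
      "sg u u = sg (Q + v) (Q + v)" "Pm u = Pm (Q + v)" using modulation by blast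
    obtain v0 where v0: "norm v0 = od w" "EE k p w = EE k p (Q + v0)"
      "sg w w = sg (Q + v0) (Q + v0)" "Pm w = Pm (Q + v0)" using modulation by blast
    define y e where "y = norm v" and "e = norm v0"
    have y: "0 <= y" "y <= de" "y <= 1" using u v(1) de by (simp_all add: y_def od_nonneg)
    have e: "0 <= e" "e <= 1" using w v0(1) by (simp_all add: e_def od_nonneg)
    have e3: "e^3 <= e^2" "e^2 <= e" using e power_decreasing[of 2 3 e] power_decreasing[of 1 2 e] by auto
    have y43: "y^4 <= y^3" using y by (intro power_decreasing) auto
    have Lb1: "Lb k p Q v v <= 2*(R*y^3) + K0*e^2 + 2*(R*e^2)"
    proof -
      have 1: "\<bar>EE k p (Q + v) - EE k p Q - Lb k p Q v v/2\<bar> <= R*y^3"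
        using EE_expand[of v] rem[of v] y by (simp add: y_def)
      have 2: "\<bar>EE k p (Q + v0) - EE k p Q - Lb k p Q v0 v0/2\<bar> <= R*e^3"
        using EE_expand[of v0] rem[of v0] e by (simp add: e_def)
      have 3: "\<bar>Lb k p Q v0 v0\<bar> <= K0*e^2" using K0(2)[of v0 v0] by (simp add: e_def power2_eq_square mult_ac)
      have 4: "R*e^3 <= R*e^2" using e3 R by (intro mult_left_mono) auto
      have "EE k p (Q + v) = EE k p (Q + v0)" using EEq v v0 by simp
      then show ?thesis using 1 2 3 4 by linarith
    qed
    have n: "\<bar>sg Q v\<bar> + \<bar>sg (cm \<i> Q1) v\<bar> <= H*e + y^2"
    proof -
      have "2 * sg Q v = 2 * sg Q v0 + sg v0 v0 - sg v v"
        "2 * sg (cm \<i> Q1) v = 2 * sg (cm \<i> Q1) v0 + Pm v0 - Pm v"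
        using sg_expand[of v] sg_expand[of v0] Pm_expand[of v] Pm_expand[of v0] Neq Peq v v0 by simp_all
      moreover have "\<bar>sg Q v0\<bar> <= norm Q*e" "\<bar>sg (cm \<i> Q1) v0\<bar> <= norm (cm \<i> Q1)*e" "\<bar>sg v v\<bar> <= y^2"
        "\<bar>sg v0 v0\<bar> <= e^2" "\<bar>Pm v\<bar> <= y^2" "\<bar>Pm v0\<bar> <= e^2"
        using sg_le sg_bound Pm_bound by (simp_all add: e_def y_def)
      moreover have "H*e = norm Q*e + norm (cm \<i> Q1)*e + e" by (simp add: H_def algebra_simps)
      ultimately show ?thesis using e3(2) by linarith
    qed
    have "c*y^2 <= Lb k p Q v v + C*(\<bar>sg Q v\<bar> + \<bar>sg (cm \<i> Q1) v\<bar>)^2"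
      using c(3)[OF v(2,3)] by (simp add: y_def)
    also have "... <= (2*(R*y^3) + K0*e^2 + 2*(R*e^2)) + C*(2*(H^2*e^2) + 2*y^3)"
    proof (rule add_mono[OF Lb1 mult_left_mono[OF _ c(2)]])
      have "(\<bar>sg Q v\<bar> + \<bar>sg (cm \<i> Q1) v\<bar>)^2 <= (H*e + y^2)^2" using n by (intro power_mono) auto
      also have "... <= 2*(H*e)^2 + 2*(y^2)^2" using sum_squares_bound[of "H*e" "y^2"] by (simp add: power2_sum)
      finally show "(\<bar>sg Q v\<bar> + \<bar>sg (cm \<i> Q1) v\<bar>)^2 <= 2*(H^2*e^2) + 2*y^3"
        using y43 by (simp add: power_mult_distrib)
    qed
    also have "... <= K*e^2 + K*y^3"
    proof -
      have "(2 * R + 2*C)*y^3 <= K*y^3" using R K0 c(2) y by (intro mult_right_mono) (auto simp: K_def algebra_simps)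
      moreover have "(K0 + 2 * R + 2*C*H^2)*e^2 <= K*e^2" using R c(2) by (intro mult_right_mono) (auto simp: K_def algebra_simps)
      ultimately show ?thesis by (simp add: algebra_simps)
    qed
    also have "K*y^3 <= c/4*y^2"
    proof -
      have "K*y <= K*(c/(4*K))" using y(2) de(3) K by (intro mult_left_mono) auto
      then have "K*y <= c/4" using K by simp
      then have "K*y*y^2 <= c/4*y^2" by (intro mult_right_mono) auto
      then show ?thesis by (simp add: power3_eq_cube power2_eq_square)
    qed
    finally have fin: "c*y^2 <= K*e^2 + c/4*y^2" by simp
    have "0 <= c*y^2" "c/4*y^2 = c*y^2/4" "c/2*y^2 = c*y^2/2" using c(1) by simp_all
    then have "c/2*y^2 <= K*e^2" using fin by linarith
    then have "y^2 <= 2*K/c*e^2" using c(1) by (simp add: field_simps)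
    also have "... = (A*e)^2" using c(1) K by (simp add: A_def power_mult_distrib)
    finally have "y <= A*e" by (rule power2_le_imp_le) (use A e in simp)
    then show ?thesis using v(1) v0(1) by (simp add: y_def e_def)
  qed
  then show ?thesis using de A by blast
qed

text \<open>A continuity argument: a distance above \<open>C0*ep\<close> would make the distance
  equal, at some time, to a value \<open>m\<close> with \<open>C0*ep < m <= de\<close>. There
  \<open>a_priori\<close> applies, with the initial datum as \<open>w\<close>, and yields at most
  \<open>A*ep\<close>.\<close>

theorem h1_stability:
  "EX C0>0. EX ep0>0. ALL ep<=ep0. ALL U. sol k p U --> od (U 0) <= ep --> (ALL t. od (U t) <= C0*ep)"
proof -
  obtain de A where dA: "0 < de" "de <= 1" "0 < A"
    "!!u w. od u <= de ==> od w <= 1 ==> EE k p u = EE k p w ==> sg u u = sg w w ==> Pm u = Pm w ==> od u <= A * od w"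
    using a_priori by blast
  define C0 ep0 where "C0 = A + 1" and "ep0 = de/(2*C0)"
  have C0: "C0 >= 1" "C0 >= A" using dA by (auto simp: C0_def)
  have e0: "ep0 > 0" "C0*ep0 < de" using dA C0 by (auto simp: ep0_def)
  have "od (U t) <= C0*ep" if eps: "ep <= ep0" and s: "sol k p U" and init: "od (U 0) <= ep" for ep U t
  proof (rule ccontr)
    assume "~ od (U t) <= C0*ep"
    then have gt: "C0*ep < od (U t)" by simp
    interpret S: sol k p U by fact
    have eps0: "0 <= ep" using init od_nonneg[of "U 0"] by linarith
    have "C0*ep <= C0*ep0" using eps C0 by (intro mult_left_mono) auto
    then have lt: "C0*ep < de" using e0 by simp
    define m where "m = min de (od (U t))"
    have m: "C0*ep < m" "m <= de" "m <= od (U t)" using gt lt by (auto simp: m_def)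
    have e1: "ep <= C0*ep" using C0 eps0 mult_right_mono[of 1 C0 ep] by simp
    have cod: "isCont (%s. od (U s)) s" for s
    proof -
      have "((%r. od (U r) - od (U s)) \<longlongrightarrow> 0) (at s)"
      proof (rule Lim_null_comparison)
        show "\<forall>\<^sub>F r in at s. norm (od (U r) - od (U s)) <= norm (U r - U s)"
          using od_lipschitz[of "U _" "U s"] od_lipschitz[of "U s" "U _"]
          by (intro always_eventually allI) (simp add: abs_le_iff norm_minus_commute algebra_simps)
        have "(U \<longlongrightarrow> U s) (at s)" using S.cont by (simp add: isCont_def)
        then show "((%r. norm (U r - U s)) \<longlongrightarrow> 0) (at s)" by (simp add: LIM_zero tendsto_norm_zero)
      qed
      then show ?thesis unfolding isCont_def by (rule Lim_null[THEN iffD2])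
    qed
    have "EX s. od (U s) = m"
    proof (cases "0 <= t")
      case True
      then show ?thesis using IVT[of "%s. od (U s)" 0 m t] init m e1 cod by auto
    next
      case False
      then show ?thesis using IVT2[of "%s. od (U s)" 0 m t] init m e1 cod by auto
    qed
    then obtain s where s: "od (U s) = m" by blast
    have "od (U 0) <= 1" using init e1 lt dA(2) by linarith
    then have "od (U s) <= A * od (U 0)"
      using s m S.energy_conserved[of s] S.mass_conserved[of s] S.momentum_conserved[of s] by (intro dA(4)) auto
    also have "... <= A*ep" using init dA(3) by (intro mult_left_mono) auto
    also have "... <= C0*ep" using C0 eps0 by (intro mult_right_mono) auto
    finally show False using s m by simp
  qed
  moreover have "C0 > 0" using C0 by simp
  ultimately show ?thesis using e0(1) by blast
qed

end

section \<open>Weak derivatives\<close>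

text \<open>The polynomial prefactor makes the family closed under differentiation, so that one
  derivative formula settles smoothness of all orders.\<close>

definition bmp :: "real poly => real => real" where
  "bmp q x = (if x > 0 then poly q (1/x)*exp (- 1/x) else 0)"

lemma poly_exp_tendsto_0: "((%y. poly q y*exp (- y)) \<longlongrightarrow> (0::real)) at_top"
proof -
  have "((%y. \<Sum>i\<le>degree q. coeff q i*(y ^ i/exp y)) \<longlongrightarrow> (\<Sum>i\<le>degree q. coeff q i*0)) at_top"
    by (intro tendsto_sum tendsto_mult tendsto_const tendsto_power_div_exp_0)
  moreover have "(\<Sum>i\<le>degree q. coeff q i*(y ^ i/exp y)) = poly q y*exp (- y)" for y
    by (simp add: poly_altdef sum_distrib_right exp_minus divide_inverse mult.assoc)
  ultimately show ?thesis by simp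
qed

text \<open>In the variable \<open>y = 1/x\<close> the chain rule produces the factor
  \<open>y^2\<close> and replaces \<open>q\<close> by \<open>q - q'\<close>; at 0 the exponential
  beats every power of \<open>1/x\<close>.\<close>

lemma bmp_has_derivative: "(bmp q has_real_derivative bmp ([:0, 0, 1:]*(q - pderiv q)) x) (at x)"
proof -
  consider "x > 0" | "x < 0" | "x = 0" by linarith
  then show ?thesis
  proof cases
    case 1
    have "((%x. poly q (1/x)*exp (- 1/x)) has_real_derivative
        poly q (1/x)*(exp (- 1/x)*(1/x^2)) + poly (pderiv q) (1/x)*(- 1/x^2)*exp (- 1/x)) (at x)"
    proof (rule DERIV_cong[OF DERIV_mult])
      have "((%x. 1/x) has_real_derivative - 1/x^2) (at x)"
        using 1 by (auto intro!: derivative_eq_intros simp: power2_eq_square)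
      from DERIV_chain2[OF poly_DERIV this] show "((%x. poly q (1/x)) has_real_derivative poly (pderiv q) (1/x)*(- 1/x^2)) (at x)" .
      show "((%x. exp (- 1/x)) has_real_derivative exp (- 1/x)*(1/x^2)) (at x)"
        using 1 by (auto intro!: derivative_eq_intros simp: power2_eq_square)
    qed simp
    then have "((%x. poly q (1/x)*exp (- 1/x)) has_real_derivative bmp ([:0, 0, 1:]*(q - pderiv q)) x) (at x)"
      using 1 by (simp add: bmp_def algebra_simps power2_eq_square)
    then show ?thesis
      by (rule has_field_derivative_transform_within_open[of _ _ _ "{0<..}"]) (use 1 in \<open>auto simp: bmp_def\<close>)
  next
    case 2
    have "((%x. 0) has_real_derivative bmp ([:0, 0, 1:]*(q - pderiv q)) x) (at x)" using 2 by (simp add: bmp_def)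
    then show ?thesis
      by (rule has_field_derivative_transform_within_open[of _ _ _ "{..<0}"]) (use 2 in \<open>auto simp: bmp_def\<close>)
  next
    case 3
    have "((%h. bmp q h/h) \<longlongrightarrow> 0) (at 0)"
    proof (rule filterlim_split_at)
      show "((%h. bmp q h/h) \<longlongrightarrow> 0) (at_left 0)"
        by (rule tendsto_eventually) (auto simp: bmp_def eventually_at_left_field intro: exI[of _ "-1"])
      have "((%h. poly (pCons 0 q) (inverse h)*exp (- inverse h)) \<longlongrightarrow> 0) (at_right 0)"
        by (rule filterlim_compose[OF poly_exp_tendsto_0 filterlim_inverse_at_top_right])
      then show "((%h. bmp q h/h) \<longlongrightarrow> 0) (at_right 0)" by (rule Lim_transform_eventually)
          (auto simp: bmp_def eventually_at_right_field field_simps intro!: exI[of _ 1])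
    qed
    then show ?thesis unfolding has_field_derivative_iff using 3 by (simp add: bmp_def)
  qed
qed

text \<open>A class closed under \<open>deriv\<close> and rich enough to contain the cutoffs;
  closure reduces the iterated derivatives in \<open>test_function\<close> to an induction.\<close>

inductive smoothc :: "(real => real) => bool" where
  base: "smoothc (%x. bmp q (a*x + b))"
| add: "smoothc f ==> smoothc g ==> smoothc (%x. f x + g x)"
| mult: "smoothc f ==> smoothc g ==> smoothc (%x. f x*g x)"
| cmult: "smoothc f ==> smoothc (%x. c*f x)"

lemma smoothc_has_derivative: "smoothc f ==> EX f'. smoothc f' & (ALL x. (f has_real_derivative f' x) (at x))"
proof (induction rule: smoothc.induct)
  case (base q a b)
  have "((%x. bmp q (a*x + b)) has_real_derivative a*bmp ([:0, 0, 1:]*(q - pderiv q)) (a*x + b)) (at x)" for x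
    by (rule DERIV_cong[OF DERIV_chain2[OF bmp_has_derivative]]) (auto intro!: derivative_eq_intros)
  then show ?case using smoothc.cmult[OF smoothc.base] by blast
next
  case (add f g)
  then obtain f' g' where "smoothc f'" "!!x. (f has_real_derivative f' x) (at x)" "smoothc g'" "!!x. (g has_real_derivative g' x) (at x)" by blast
  then show ?case by (intro exI[of _ "%x. f' x + g' x"]) (auto intro: smoothc.add DERIV_add)
next
  case (mult f g)
  then obtain f' g' where d: "smoothc f'" "!!x. (f has_real_derivative f' x) (at x)" "smoothc g'" "!!x. (g has_real_derivative g' x) (at x)" by blast
  then show ?case using mult.hyps
    by (intro exI[of _ "%x. f x*g' x + f' x*g x"]) (auto intro!: smoothc.add smoothc.mult DERIV_mult')
next
  case (cmult f c)
  then obtain f' where "smoothc f'" "!!x. (f has_real_derivative f' x) (at x)" by blast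
  then show ?case by (intro exI[of _ "%x. c*f' x"]) (auto intro: smoothc.cmult DERIV_cmult)
qed

lemma smoothc_deriv: assumes "smoothc f" shows "smoothc (deriv f)" "(f has_real_derivative deriv f x) (at x)"
proof -
  obtain f' where f': "smoothc f'" "!!x. (f has_real_derivative f' x) (at x)" using smoothc_has_derivative[OF assms] by blast
  have "deriv f = f'" using DERIV_imp_deriv[OF f'(2)] by auto
  then show "smoothc (deriv f)" "(f has_real_derivative deriv f x) (at x)" using f' by auto
qed

lemma smoothc_iterated: "smoothc f ==> smoothc ((deriv ^^ n) f)" by (induction n) (auto intro: smoothc_deriv)

lemma smoothc_continuous: assumes "smoothc f" shows "continuous_on S f"
  using DERIV_isCont[OF smoothc_deriv(2)[OF assms]] by (simp add: continuous_at_imp_continuous_on)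

lemma test_function_smoothc:
  assumes "smoothc f" "!!x. x \<notin> {a..b} ==> f x = 0" shows "test_function f"
  unfolding test_function_def field_differentiable_def
  using smoothc_deriv(2)[OF smoothc_iterated[OF assms(1)]] assms(2) by blast

lemma test_function_primitive:
  assumes "smoothc f" "!!x. (F has_real_derivative f x) (at x)" "!!x. x \<notin> {a..b} ==> F x = 0"
  shows "test_function F" unfolding test_function_def
proof (intro conjI allI)
  have dF: "deriv F = f" using DERIV_imp_deriv[OF assms(2)] by auto
  show "(deriv ^^ n) F field_differentiable at x" for n x
  proof (cases n)
    case 0 then show ?thesis using assms(2) by (auto simp: field_differentiable_def)
  next
    case (Suc m)
    then have "(deriv ^^ n) F = (deriv ^^ m) f" by (simp add: funpow_swap1 dF)
    then show ?thesis using smoothc_deriv(2)[OF smoothc_iterated[OF assms(1)]] by (auto simp: field_differentiable_def)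
  qed
qed (use assms(3) in blast)

text \<open>Bumps supported in \<open>[a, b]\<close> that tend pointwise to the indicator of the
  open interval, because \<open>exp (- 1/x)\<close> tends to 1 as \<open>x\<close> grows.\<close>

definition cutoff :: "real => real => nat => real => real" where
  "cutoff a b n x = bmp 1 (real n*x + (- (real n*a)))*bmp 1 ((- real n)*x + real n*b)"

lemma bmp_1: "0 <= bmp 1 x" "bmp 1 x <= 1" "x <= 0 ==> bmp 1 x = 0" by (auto simp: bmp_def)

lemma cutoff_props:
  "smoothc (cutoff a b n)" "x \<notin> {a..b} ==> cutoff a b n x = 0" "0 <= cutoff a b n x" "cutoff a b n x <= 1"
proof -
  show "smoothc (cutoff a b n)" unfolding cutoff_def[abs_def] by (intro smoothc.mult smoothc.base)
  show "0 <= cutoff a b n x" "cutoff a b n x <= 1" by (auto simp: cutoff_def bmp_1 mult_le_one)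
  show "cutoff a b n x = 0" if "x \<notin> {a..b}"
  proof -
    have "real n*x <= real n*a | real n*b <= real n*x" using that by (auto intro: mult_left_mono)
    then show ?thesis by (auto simp: cutoff_def bmp_1(3))
  qed
qed

lemma bmp_1_limit: assumes "c > 0" shows "(%n. bmp 1 (real n*c)) \<longlonglongrightarrow> 1"
proof -
  have "(%n. exp (- (1/c)*(1/real n))) \<longlonglongrightarrow> exp (- (1/c)*0)"
    by (intro tendsto_intros lim_1_over_n)
  then have "(%n. exp (- (1/c)*(1/real n))) \<longlonglongrightarrow> 1" by simp
  then show ?thesis
  proof (rule Lim_transform_eventually)
    show "\<forall>\<^sub>F n in sequentially. exp (- (1/c)*(1/real n)) = bmp 1 (real n*c)"
      using eventually_gt_at_top[of 0] by eventually_elim (use assms in \<open>simp add: bmp_def field_simps\<close>)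
  qed
qed

lemma cutoff_limit: "(%n. cutoff a b n x) \<longlonglongrightarrow> (if a < x & x < b then 1 else 0)"
proof (cases "a < x & x < b")
  case True
  have "(%n. bmp 1 (real n*(x - a))*bmp 1 (real n*(b - x))) \<longlonglongrightarrow> 1*1"
    using True by (intro tendsto_mult bmp_1_limit) auto
  moreover have "bmp 1 (real n*(x - a))*bmp 1 (real n*(b - x)) = cutoff a b n x" for n
    by (simp add: cutoff_def algebra_simps)
  ultimately show ?thesis using True by simp
next
  case False
  have "cutoff a b n x = 0" for n
  proof -
    have "real n*x <= real n*a | real n*b <= real n*x" using False by (auto intro: mult_left_mono)
    then show ?thesis by (auto simp: cutoff_def bmp_1(3))
  qed
  then show ?thesis unfolding if_not_P[OF False] by simp
qed

lemma integral_support: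
  fixes f :: "real => 'a::euclidean_space"
  assumes "!!x. x \<notin> {a..b} ==> f x = 0"
  shows "integral UNIV f = integral {a..b} f"
proof -
  have "(%x. if x \<in> {a..b} then f x else 0) = f" using assms by auto
  then show ?thesis using integral_restrict_UNIV[of "{a..b}" f] by simp
qed

lemma test_function_support:
  assumes "test_function ph" obtains a b where "a <= b" "!!x. x \<notin> {a..b} ==> ph x = 0" "!!x. x \<notin> {a..b} ==> deriv ph x = 0"
    "ph a = 0" "ph b = 0"
proof -
  obtain a b where ab: "!!x. x \<notin> {a..b} ==> ph x = 0" using assms by (auto simp: test_function_def)
  define a' b' where "a' = min a 0 - 1" and "b' = max b 0 + 1"
  have out: "a' < a" "b < b'" by (auto simp: a'_def b'_def)
  have sub: "{a..b} <= {a'..b'}" by (auto simp: a'_def b'_def)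
  have d0: "deriv ph x = 0" if x: "x \<notin> {a..b}" for x
  proof -
    have "(ph has_real_derivative 0) (at x)"
      by (rule has_field_derivative_transform_within_open[where S="- {a..b}" and f="%x. 0"]) (use x ab in auto)
    then show ?thesis by (rule DERIV_imp_deriv)
  qed
  show thesis
  proof (rule that[of a' b'])
    show "ph a' = 0" "ph b' = 0" using ab[of a'] ab[of b'] out by simp_all
    show "a' <= b'" by (simp add: a'_def b'_def)
  qed (use ab d0 sub in blast)+
qed

lemma test_function_derivative:
  assumes "test_function ph" shows "(ph has_real_derivative deriv ph x) (at x)" "continuous_on S (deriv ph)" "continuous_on S ph"
proof -
  have d: "(deriv ^^ n) ph field_differentiable at x" for n x using assms by (simp add: test_function_def)
  show "(ph has_real_derivative deriv ph x) (at x)" using d[of 0] by (simp add: DERIV_deriv_iff_field_differentiable)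
  show "continuous_on S (deriv ph)" using d[of 1] by (intro continuous_at_imp_continuous_on ballI field_differentiable_imp_continuous_at) simp
  show "continuous_on S ph" using d[of 0] by (intro continuous_at_imp_continuous_on ballI field_differentiable_imp_continuous_at) simp
qed

lemma test_function_integrable:
  assumes "!!a b. sqint a b g" "test_function ph"
  shows "(%x. g x*complex_of_real (ph x)) integrable_on UNIV" "(%x. g x*complex_of_real (deriv ph x)) integrable_on UNIV"
proof -
  obtain a b where ab: "!!x. x \<notin> {a..b} ==> ph x = 0" "!!x. x \<notin> {a..b} ==> deriv ph x = 0"
    using test_function_support[OF assms(2)] by metis
  have "(%x. g x*complex_of_real (f x)) integrable_on UNIV"
    if "continuous_on {a..b} f" "!!x. x \<notin> {a..b} ==> f x = 0" for f
  proof (rule integrable_on_superset[of _ "{a..b}"])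
    show "(%x. g x*complex_of_real (f x)) integrable_on {a..b}"
      using that(1) by (intro sqint_times_integrable assms sqint_continuous continuous_on_of_real)
  qed (use that(2) in auto)
  then show "(%x. g x*complex_of_real (ph x)) integrable_on UNIV" "(%x. g x*complex_of_real (deriv ph x)) integrable_on UNIV"
    using ab test_function_derivative[OF assms(2)] by blast+
qed

lemma cutoff_test_function: "test_function (cutoff a b n)" by (rule test_function_smoothc[OF cutoff_props(1,2)])

text \<open>Testing with \<open>cutoff\<close> and passing to the limit by dominated convergence
  shows that all integrals over intervals vanish.\<close>

lemma AE_zero_of_smoothc:
  fixes g :: "real => complex"
  assumes s: "!!a b. sqint a b g"
    and z: "!!ph. smoothc ph ==> test_function ph ==> integral UNIV (%x. g x * of_real (ph x)) = 0"
  shows "AE x in lebesgue. g x = 0"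
proof (rule AE_UNIV)
  fix n :: nat
  let ?a = "- real n" and ?b = "real n"
  have "integral {c..d} g = 0" for c d
  proof -
    let ?\<chi> = "%x. if c < x & x < d then 1 else 0"
    have "(%n. integral {c..d} (%x. g x * of_real (cutoff c d n x))) \<longlonglongrightarrow> integral {c..d} (%x. g x * of_real (?\<chi> x))"
    proof (rule dominated_convergence(2)[where h="%x. cmod (g x)"])
      show "(%x. g x * of_real (cutoff c d n x)) integrable_on {c..d}" for n
        by (intro sqint_times_integrable s sqint_continuous continuous_on_of_real smoothc_continuous cutoff_props)
      show "(%x. cmod (g x)) integrable_on {c..d}" using sqint_norm[OF s] by (rule sqint_int)
      show "norm (g x * of_real (cutoff c d n x)) <= cmod (g x)" for n x
        using mult_left_mono[OF cutoff_props(4)[of c d n x], of "cmod (g x)"] cutoff_props(3)[of c d n x] by (simp add: norm_mult)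
      show "(%n. g x * of_real (cutoff c d n x)) \<longlonglongrightarrow> g x * of_real (?\<chi> x)" for x by (intro tendsto_intros cutoff_limit)
    qed
    moreover have "integral {c..d} (%x. g x * of_real (cutoff c d n x)) = 0" for n
      using z[OF cutoff_props(1) cutoff_test_function, of c d n] integral_support[of c d "%x. g x * of_real (cutoff c d n x)"]
        cutoff_props(2)[of _ c d n] by simp
    ultimately have "integral {c..d} (%x. g x * of_real (?\<chi> x)) = 0"
      using LIMSEQ_unique[OF tendsto_const] by fastforce
    moreover have "integral {c..d} (%x. g x * of_real (?\<chi> x)) = integral {c..d} g"
      by (rule integral_spike[of "{c, d}"]) auto
    ultimately show ?thesis by simp
  qed
  then have "((%x. norm (g x)) has_integral 0) {?a..?b}" by (intro norm_integral_zero sqint_int s)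
  then have "AE x in lebesgue. x \<in> {?a..?b} --> norm (g x) = 0" by (rule AE_zero_of_integral) auto
  then show "AE x in lebesgue. x \<in> {?a..?b} --> g x = 0" by simp
qed

text \<open>A test function with integral \<open>M\<close> differs from \<open>M\<close> times a fixed one of integral 1 by the derivative of a test function.\<close>

lemma AE_constant:
  fixes u :: "real => complex"
  assumes s: "!!a b. sqint a b u"
    and z: "!!ph. test_function ph ==> integral UNIV (%x. u x * of_real (deriv ph x)) = 0"
  shows "EX c. AE x in lebesgue. u x = c"
proof -
  obtain ph0 where p0: "smoothc ph0" "!!x. x \<notin> {0..1} ==> ph0 x = 0" "integral UNIV ph0 = 1"
  proof -
    define m where "m = integral {0..1} (cutoff 0 1 1)"
    have "m > 0" unfolding m_def
    proof (rule integral_continuous_pos[where c="1/2"])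
      show "cutoff 0 1 1 (1/2) > 0" by (simp add: cutoff_def bmp_def)
    qed (auto intro: smoothc_continuous cutoff_props)
    have "integral UNIV (cutoff 0 1 1) = m" unfolding m_def by (rule integral_support) (rule cutoff_props(2))
    then have "integral UNIV (%x. (1/m)*cutoff 0 1 1 x) = 1" unfolding integral_mult_right using \<open>m > 0\<close> by simp
    then show thesis
    proof (intro that[of "%x. (1/m)*cutoff 0 1 1 x"] smoothc.cmult cutoff_props(1))
      show "(1/m)*cutoff 0 1 1 x = 0" if "x \<notin> {0..1}" for x using cutoff_props(2)[OF that, of 1] by simp
    qed
  qed
  have t0: "test_function ph0" by (rule test_function_smoothc[OF p0(1,2)])
  define c where "c = integral UNIV (%x. u x * of_real (ph0 x))"
  have sc: "sqint a b (%x. c)" for a b by (intro sqint_continuous continuous_on_const)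
  have "AE x in lebesgue. u x - c = 0"
  proof (rule AE_zero_of_smoothc)
    show "sqint a b (%x. u x - c)" for a b by (intro sqint_diff s sc)
    fix ph assume p: "smoothc ph" "test_function ph"
    obtain a b where ab: "!!x. x \<notin> {a..b} ==> ph x = 0" using p(2) by (auto simp: test_function_def)
    define A B where "A = min a 0 - 1" and "B = max b 1 + 1"
    have AB: "A < 0" "1 < B" "A < a" "b < B" by (auto simp: A_def B_def)
    define M where "M = integral UNIV ph"
    define tht where "tht x = ph x + (- M)*ph0 x" for x
    have th: "smoothc tht" unfolding tht_def[abs_def] by (intro smoothc.add smoothc.cmult p p0)
    have thz: "tht x = 0" if "x <= A | B <= x" for x using that AB ab[of x] p0(2)[of x] by (auto simp: tht_def)
    have i: "ph integrable_on UNIV" "ph0 integrable_on UNIV"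
      using integrable_on_superset[OF integrable_continuous_real[OF smoothc_continuous[OF p(1)]] ab]
        integrable_on_superset[OF integrable_continuous_real[OF smoothc_continuous[OF p0(1)]] p0(2)] by auto
    have th0: "integral UNIV tht = 0"
      unfolding tht_def[abs_def] by (simp only: integral_add integrable_on_mult_right integral_mult_right i p0(3)) (simp add: M_def)
    have "isCont tht x" for x using DERIV_isCont[OF smoothc_deriv(2)[OF th]] .
    from antiderivative_exists[OF this] obtain F where F: "!!x. (F has_real_derivative tht x) (at x)" by metis
    define Th where "Th x = F x - F A" for x
    have dT: "(Th has_real_derivative tht x) (at x)" for x
      unfolding Th_def[abs_def] using DERIV_diff[OF F DERIV_const] by simp
    have FTC: "integral {x..y} tht = Th y - Th x" if "x <= y" for x y using that dT by (intro integral_FTC)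
    have Tz: "Th x = 0" if "x \<notin> {A..B}" for x
    proof (cases "x < A")
      case True
      have "integral {x..A} tht = integral {x..A} (%x. 0)" by (rule integral_cong) (use thz in auto)
      then show ?thesis using FTC[of x A] True by (simp add: Th_def)
    next
      case False
      then have "integral {A..x} tht = integral UNIV tht" using thz that by (intro integral_support[symmetric]) auto
      then show ?thesis using FTC[of A x] th0 False by (simp add: Th_def)
    qed
    have "deriv Th = tht" using DERIV_imp_deriv[OF dT] by auto
    then have "integral UNIV (%x. u x * of_real (tht x)) = 0" using z[OF test_function_primitive[OF th dT Tz]] by simp
    moreover have "u x * of_real (tht x) = u x * of_real (ph x) - of_real M*(u x * of_real (ph0 x))" for x
      by (simp add: tht_def algebra_simps)
    ultimately have "integral UNIV (%x. u x * of_real (ph x)) = of_real M*c"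
      unfolding c_def using test_function_integrable(1)[OF s p(2)] test_function_integrable(1)[OF s t0]
      by (simp add: integral_diff integrable_on_mult_right integral_mult_right)
    moreover have "integral UNIV (%x. of_real (ph x)) = complex_of_real M"
      unfolding M_def using integral_linear[OF i(1), of complex_of_real, OF bounded_linear_of_real] by (simp add: o_def)
    ultimately show "integral UNIV (%x. (u x - c) * of_real (ph x)) = 0" unfolding left_diff_distrib
      using integral_diff[OF test_function_integrable(1)[OF s p(2)] test_function_integrable(1)[OF sc p(2)]] by simp
  qed
  then show ?thesis by (intro exI[of _ c]) simp
qed

lemma L2_loc_sqint: assumes "L2_loc u" shows "sqint a b u"
proof (rule sqintI)
  show "u \<in> borel_measurable (lebesgue_on {a..b})"
    using assms by (intro measurable_restrict_space1) (simp add: L2_loc_def)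
  show "(%x. (cmod (u x))^2) integrable_on {a..b}" using assms by (simp add: L2_loc_def)
qed simp

lemma sqint_L2_loc: assumes "!!a b. sqint a b u" shows "L2_loc u" unfolding L2_loc_def
proof (intro conjI allI)
  show "(%x. (cmod (u x))^2) integrable_on {a..b}" for a b using sqint_sq[OF assms] .
  show "u \<in> borel_measurable lebesgue"
  proof (rule measurable_piecewise_restrict[where C="range (%n. {- real n..real n})"])
    have "EX n. x \<in> {- real n..real n}" for x
    proof -
      obtain n where "\<bar>x\<bar> <= real n" using real_arch_simple by blast
      then have "x \<in> {- real n..real n}" by auto
      then show ?thesis ..
    qed
    then show "space lebesgue <= \<Union> (range (%n. {- real n..real n}))" by auto
  qed (auto intro: sqint_measurable[OF assms])
qed

lemma acd_weak_deriv:
  assumes "!!a b. acd a b u g" shows "has_weak_deriv u g" unfolding has_weak_deriv_def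
proof (intro allI impI)
  fix ph assume t: "test_function ph"
  from test_function_support[OF t] obtain a b where ab: "a <= b" "!!x. x \<notin> {a..b} ==> ph x = 0" "!!x. x \<notin> {a..b} ==> deriv ph x = 0"
    "ph a = 0" "ph b = 0" by metis
  note d = test_function_derivative[OF t]
  have p: "acd a b (%x. complex_of_real (ph x)) (%x. of_real (deriv ph x))"
    by (rule acdI, rule has_vector_derivative_at_within[OF has_vector_derivative_of_real[OF d(1)]], intro continuous_on_of_real d(2))
  have i: "(%x. g x * of_real (ph x)) integrable_on {a..b}" "(%x. u x * of_real (deriv ph x)) integrable_on {a..b}"
    by (intro sqint_times_integrable acd_sqint[OF assms] acd_sqint_fun[OF assms] acd_sqint[OF p] acd_sqint_fun[OF p])+
  have "integral {a..b} (%x. g x * of_real (ph x)) + integral {a..b} (%x. u x * of_real (deriv ph x)) = 0"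
    using acd_parts[OF assms p ab(1)] integral_add[OF i] ab(4,5) by simp
  then show "integral UNIV (%x. u x * of_real (deriv ph x)) = - integral UNIV (%x. g x * of_real (ph x))"
    using integral_support[of a b "%x. u x * of_real (deriv ph x)"] integral_support[of a b "%x. g x * of_real (ph x)"] ab(2,3)
    by (simp add: eq_neg_iff_add_eq_0 add.commute)
qed

lemma weak_deriv_unique:
  assumes "L2_loc g" "L2_loc h" "has_weak_deriv u g" "has_weak_deriv u h"
  shows "AE x in lebesgue. g x = h x"
proof -
  have "AE x in lebesgue. g x - h x = 0"
  proof (rule AE_zero_of_smoothc)
    show "sqint a b (%x. g x - h x)" for a b by (intro sqint_diff L2_loc_sqint assms)
    fix ph assume t: "test_function ph"
    have "- integral UNIV (%x. g x * of_real (ph x)) = - integral UNIV (%x. h x * of_real (ph x))"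
      using assms(3,4) t unfolding has_weak_deriv_def by metis
    then show "integral UNIV (%x. (g x - h x) * of_real (ph x)) = 0" unfolding left_diff_distrib
      using integral_diff[OF test_function_integrable(1)[OF L2_loc_sqint t] test_function_integrable(1)[OF L2_loc_sqint t]] assms by simp
  qed
  then show ?thesis by eventually_elim simp
qed

lemma has_weak_deriv_AE_cong:
  assumes "AE x in lebesgue. u x = v x" "has_weak_deriv u g" shows "has_weak_deriv v g" unfolding has_weak_deriv_def
proof (intro allI impI)
  fix ph assume "test_function ph"
  moreover have "integral UNIV (%x. v x * of_real (deriv ph x)) = integral UNIV (%x. u x * of_real (deriv ph x))"
    by (rule integral_AE_cong) (use assms(1) in eventually_elim, simp)
  ultimately show "integral UNIV (%x. v x * of_real (deriv ph x)) = - integral UNIV (%x. g x * of_real (ph x))"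
    using assms(2) by (simp add: has_weak_deriv_def)
qed

lemma weak_deriv: assumes "H1_loc u" shows "L2_loc (weak_deriv u)" "has_weak_deriv u (weak_deriv u)"
  using someI_ex[of "%g. L2_loc g & has_weak_deriv u g"] assms unfolding H1_loc_def weak_deriv_def by auto

section \<open>Continuous representatives of functions and solutions\<close>

definition rp :: "(real => complex) => h1 => bool" where
  "rp u U \<longleftrightarrow> u \<in> X_space & (AE z in lebesgue. u z = fn U z)"

lemma rpI: assumes "per u" "AE z in lebesgue. u z = fn U z" shows "rp u U"
proof -
  have e: "AE z in lebesgue. fn U z = u z" using assms(2) by eventually_elim simp
  have "has_weak_deriv u (dv U)" by (rule has_weak_deriv_AE_cong[OF e acd_weak_deriv[OF fn_acd]])
  moreover have "L2_loc (dv U)" "L2_loc u" by (rule sqint_L2_loc dv_sqint sqint_AE_cong[OF fn_sqint e])+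
  ultimately show ?thesis using assms by (auto simp: rp_def X_space_def H1_loc_def per_def)
qed

lemma rp_fn: "rp (fn U) U" by (rule rpI[OF fn_per]) simp

lemma rp_weak_deriv: assumes "rp u U" shows "AE z in lebesgue. weak_deriv u z = dv U z"
proof -
  have h: "H1_loc u" using assms by (simp add: rp_def X_space_def)
  have e: "AE z in lebesgue. fn U z = u z" using assms unfolding rp_def by auto
  have "has_weak_deriv u (dv U)" by (rule has_weak_deriv_AE_cong[OF e acd_weak_deriv[OF fn_acd]])
  moreover have "L2_loc (dv U)" by (rule sqint_L2_loc[OF dv_sqint])
  ultimately show ?thesis using weak_deriv_unique weak_deriv[OF h] by blast
qed

lemma rp_per: "rp u U ==> per u" by (simp add: rp_def X_space_def per_def)
lemma rp_AE: "rp u U ==> AE z in lebesgue. u z = fn U z" by (simp add: rp_def)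

lemma rp_norm: assumes "rp u U" shows "X_norm u = norm U"
proof -
  have "integral {0..2*pi} (%z. (cmod (u z))^2 + (cmod (weak_deriv u z))^2) = integral {0..2*pi} (%z. (cmod (fn U z))^2 + (cmod (dv U z))^2)"
    by (rule integral_AE_cong) (use rp_AE[OF assms] rp_weak_deriv[OF assms] in eventually_elim, simp)
  also have "... = sg U U + ta U U" unfolding sg_def ta_def ip_self by (intro integral_add sqint_sq fn_sqint dv_sqint)
  finally show ?thesis by (simp add: X_norm_def norm_h1_def inner_h1)
qed

lemma rp_diff: assumes "rp u U" "rp v V" shows "rp (%z. u z - v z) (U - V)"
proof (rule rpI)
  show "per (%z. u z - v z)" using rp_per[OF assms(1)] rp_per[OF assms(2)] by (simp add: per_def)
  show "AE z in lebesgue. u z - v z = fn (U - V) z"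
    using rp_AE[OF assms(1)] rp_AE[OF assms(2)] by eventually_elim (simp add: fn_minus)
qed

text \<open>\<open>u\<close> minus a primitive \<open>G\<close> of its weak derivative has weak
  derivative 0, hence is constant almost everywhere. The continuous function \<open>G\<close> plus
  this constant is periodic, since periodicity could fail only on an open null set.\<close>

lemma rp_exists: assumes u: "u \<in> X_space" shows "EX U. rp u U"
proof -
  have pu: "per u" and h: "H1_loc u" using u by (auto simp: X_space_def per_def)
  define g where "g = weak_deriv u"
  have g: "L2_loc g" "has_weak_deriv u g" using weak_deriv[OF h] by (auto simp: g_def)
  have su: "sqint a b u" for a b using h by (intro L2_loc_sqint) (simp add: H1_loc_def)
  have sg: "sqint a b g" for a b by (rule L2_loc_sqint[OF g(1)])
  \<comment> \<open>One of the two intervals is empty or a point, so this is the signed primitive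
    from 0.\<close>
  define G where "G x = integral {0..x} g - integral {x..0} g" for x
  have GG: "G y - G x = integral {x..y} g" if "x <= y" for x y
  proof -
    have c: "integral {a..b} g + integral {b..c} g = integral {a..c} g" if "a <= b" "b <= c" for a b c
      using that sqint_int[OF sg] by (intro Henstock_Kurzweil_Integration.integral_combine) auto
    consider "0 <= x" | "x < 0" "0 <= y" | "x < 0" "y < 0" by linarith
    then show ?thesis
    proof cases
      case 1
      have z: "integral {t..0} g = 0" if "0 <= t" for t using that by (cases "t = 0") auto
      show ?thesis using 1 that z[of x] z[of y] by (simp add: G_def c[OF 1 that, symmetric])
    next
      case 2
      have "integral {y..0} g = 0" using 2 by (cases "y = 0") auto
      then show ?thesis using 2 c[of x 0 y, symmetric] by (simp add: G_def)
    next
      case 3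
      then show ?thesis using that c[of x y 0, symmetric] by (simp add: G_def)
    qed
  qed
  have aG: "acd a b G g" for a b unfolding acd_def
  proof (intro conjI ballI sg)
    fix x assume "x \<in> {a..b}"
    then have "G x - G a = integral {a..x} g" by (intro GG) simp
    then show "G x = G a + integral {a..x} g" by (simp add: diff_eq_eq add.commute)
  qed
  have sG: "sqint a b G" for a b by (rule acd_sqint_fun[OF aG])
  have "EX c. AE x in lebesgue. u x - G x = c"
  proof (rule AE_constant)
    show "sqint a b (%x. u x - G x)" for a b by (intro sqint_diff su sG)
    fix ph assume t: "test_function ph"
    then have "integral UNIV (%x. u x * of_real (deriv ph x)) = integral UNIV (%x. G x * of_real (deriv ph x))"
      using g(2) acd_weak_deriv[OF aG] by (simp add: has_weak_deriv_def)
    then show "integral UNIV (%x. (u x - G x) * of_real (deriv ph x)) = 0" unfolding left_diff_distrib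
      using integral_diff[OF test_function_integrable(2)[OF su t] test_function_integrable(2)[OF sG t]] by simp
  qed
  then obtain c where c: "AE x in lebesgue. u x - G x = c" by blast
  define w where "w x = G x + c" for x
  have aw: "acd a b w g" for a b using acd_add[OF aG acd_const[of a b c]] by (simp add: w_def[abs_def])
  have uw: "AE x in lebesgue. u x = w x" using c by eventually_elim (auto simp: w_def)
  have cw: "continuous_on S w" for S by (rule acd_cont[OF aw])
  obtain N where N: "{x. u x ~= w x} <= N" "N \<in> null_sets lebesgue" using uw by (auto elim!: AE_E simp: null_sets_def)
  let ?D = "{x. w (x + 2*pi) ~= w x}"
  have "?D <= N \<union> (+) (- 2*pi) ` N"
  proof
    fix x assume "x \<in> ?D"
    then have "u (x + 2*pi) ~= w (x + 2*pi) | u x ~= w x" using perD[OF pu, of x] by auto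
    then have "x + 2*pi \<in> N | x \<in> N" using N(1) by blast
    then show "x \<in> N \<union> (+) (- 2*pi) ` N" by (auto intro: image_eqI[of _ _ "x + 2*pi"])
  qed
  moreover have "negligible (N \<union> (+) (- 2*pi) ` N)"
    using N(2) by (intro negligible_Un negligible_translation) (simp_all add: negligible_iff_null_sets)
  ultimately have "negligible ?D" using negligible_subset by blast
  moreover have "open ?D" by (intro open_Collect_neq cw continuous_on_compose2[OF cw[of UNIV]] continuous_intros) auto
  ultimately have pw: "per w" unfolding per_def using open_not_negligible by blast
  from hp_extend[OF pw aw] obtain g' where "hp w g'" by blast
  then have "fn (h1_of w) = w" by (rule fn_h1_of)
  then have "rp u (h1_of w)" using uw by (intro rpI pu) simp
  then show ?thesis by blast
qed

lemma cm_integrals: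
  "sg (cm \<i> U) v = - Im (integral {0..2*pi} (%z. fn U z*cnj (fn v z)))"
  "ch (cm \<i> U) v = - Im (integral {0..2*pi} (%z. dv U z*cnj (fn v z)))"
proof -
  have *: "ip (%z. \<i>*f z) (fn v) = - Im (integral {0..2*pi} (%z. f z*cnj (fn v z)))" if "L2 f" for f
  proof -
    have i: "(%z. f z*cnj (fn v z)) integrable_on {0..2*pi}" by (intro mult_cnj_integrable that fn_sqint)
    have "ip (%z. \<i>*f z) (fn v) = integral {0..2*pi} (%z. - Im (f z*cnj (fn v z)))"
      unfolding ip_def by (rule arg_cong[of _ _ "integral _"]) (simp add: fun_eq_iff)
    also have "... = - integral {0..2*pi} (%z. Im (f z*cnj (fn v z)))" by (rule integral_neg)
    finally show ?thesis using integral_Im[OF i] by simp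
  qed
  show "sg (cm \<i> U) v = - Im (integral {0..2*pi} (%z. fn U z*cnj (fn v z)))"
    unfolding sg_def fn_cm[abs_def] by (rule *[OF fn_sqint])
  have "ch (cm \<i> U) v = ip (%z. \<i>*dv U z) (fn v)" unfolding ch_def by (rule ip_AE_cong) (use dv_cm in auto)
  then show "ch (cm \<i> U) v = - Im (integral {0..2*pi} (%z. dv U z*cnj (fn v z)))" using *[OF dv_sqint] by simp
qed

text \<open>The real part of the tested equation becomes a statement about \<open>sg\<close>,
  \<open>ta\<close>, \<open>ch\<close> and \<open>ff\<close>; since \<open>v\<close> ranges over the
  whole space, testing with \<open>cm \<i> v\<close> retains the imaginary part.\<close>

lemma sol_of_solution:
  assumes s: "is_solution k p u" and r: "!!t. rp (u t) (U t)"
  shows "sol k p U"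
proof
  fix t
  have "((%s. X_norm (%z. u s z - u t z)) \<longlongrightarrow> 0) (at t)" using s by (simp add: is_solution_def)
  then have "((%s. norm (U s - U t)) \<longlongrightarrow> 0) (at t)" using rp_norm[OF rp_diff[OF r r]] by simp
  then show "isCont U t" unfolding isCont_def by (simp add: tendsto_norm_zero_iff LIM_zero_iff)
  fix v
  have vX: "fn v \<in> X_space" using rp_fn[of v] by (simp add: rp_def)
  let ?I = "integral {0..2*pi}"
  have e1: "?I (%z. u s z*cnj (fn v z)) = ?I (%z. fn (U s) z*cnj (fn v z))" for s
    by (rule integral_AE_cong) (use rp_AE[OF r[of s]] in eventually_elim, simp)
  have e2: "?I (%z. weak_deriv (u t) z*cnj (fn v z)) = ?I (%z. dv (U t) z*cnj (fn v z))"
    by (rule integral_AE_cong) (use rp_weak_deriv[OF r[of t]] in eventually_elim, simp)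
  have e3: "?I (%z. weak_deriv (u t) z*cnj (weak_deriv (fn v) z)) = ?I (%z. dv (U t) z*cnj (dv v z))"
    by (rule integral_AE_cong) (use rp_weak_deriv[OF r[of t]] rp_weak_deriv[OF rp_fn[of v]] in eventually_elim, simp)
  have e4: "?I (%z. of_real ((cmod (u t z))^2)*u t z*cnj (fn v z)) = ?I (%z. of_real ((cmod (fn (U t) z))^2)*fn (U t) z*cnj (fn v z))"
    by (rule integral_AE_cong) (use rp_AE[OF r[of t]] in eventually_elim, simp)
  from s vX obtain m where m: "((%s. ?I (%z. fn (U s) z*cnj (fn v z))) has_vector_derivative m) (at t)"
    "\<i> * m + 4 * \<i> * of_real (p*k)*?I (%z. dv (U t) z*cnj (fn v z))
        - 4 * of_real (k^2)*?I (%z. dv (U t) z*cnj (dv v z))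
        - of_real (1 + p^2)*?I (%z. fn (U t) z*cnj (fn v z))
        + ?I (%z. of_real ((cmod (fn (U t) z))^2)*fn (U t) z*cnj (fn v z)) = 0"
    unfolding is_solution_def e1[symmetric] e2[symmetric] e3[symmetric] e4[symmetric] by blast
  have "((%s. - Im (?I (%z. fn (U s) z*cnj (fn v z)))) has_vector_derivative - Im m) (at t)"
    by (intro has_vector_derivative_minus bounded_linear.has_vector_derivative[OF bounded_linear_Im m(1)])
  then have d: "((%s. sg (cm \<i> (U s)) v) has_real_derivative - Im m) (at t)"
    unfolding cm_integrals has_real_derivative_iff_has_vector_derivative .
  have "Re (\<i> * m + 4 * \<i> * of_real (p*k)*?I (%z. dv (U t) z*cnj (fn v z))
        - 4 * of_real (k^2)*?I (%z. dv (U t) z*cnj (dv v z))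
        - of_real (1 + p^2)*?I (%z. fn (U t) z*cnj (fn v z))
        + ?I (%z. of_real ((cmod (fn (U t) z))^2)*fn (U t) z*cnj (fn v z))) = 0" unfolding m(2) by simp
  moreover have "Re (\<i> * m + 4 * \<i> * of_real (p*k)*A - 4 * of_real (k^2)*B - of_real (1 + p^2)*C + D)
      = - Im m - 4*(p*k)*Im A - 4*k^2 * Re B - (1 + p^2) * Re C + Re D" for A B C D
  proof -
    have x: "Re (of_real a*c) = a * Re c" for a c by simp
    have "4 * \<i> * of_real (p*k)*A = of_real (4*(p*k))*(\<i>*A)" "4 * of_real (k^2)*B = of_real (4*k^2)*B" by simp_all
    then show ?thesis unfolding plus_complex.sel minus_complex.sel by (simp only: x) simp
  qed
  moreover have "Re (?I (%z. dv (U t) z*cnj (dv v z))) = ta (U t) v" "Re (?I (%z. fn (U t) z*cnj (fn v z))) = sg (U t) v"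
    unfolding ta_def sg_def using ip_Re[OF dv_sqint dv_sqint] ip_Re[OF fn_sqint fn_sqint] by simp_all
  moreover have "Re (?I (%z. of_real ((cmod (fn (U t) z))^2)*fn (U t) z*cnj (fn v z))) = ff (U t) v"
    unfolding ff_ip by (rule ip_Re[symmetric]) (intro sqint_continuous continuous_intros fn_cont fn_sqint)+
  ultimately have "- Im m = BB k p (U t) v" unfolding BB_def aa_def cm_integrals by (simp add: algebra_simps)
  then show "((%s. sg (cm \<i> (U s)) v) has_real_derivative BB k p (U t) v) (at t)" using d by simp
qed

text \<open>A phase and a translation of the wave become a phase and a translation of the profile:
  the shift is scaled by \<open>2*kk\<close>, and the removed phase factor contributes
  \<open>p*x0\<close>.\<close>

lemma (in good_wave) wave_function:
  assumes V: "is_wave (J, E) V"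
  shows "EX be xh. ALL z. exp (- \<i> * of_real (p*(z/(2*kk))))*V (z/(2*kk)) = fn (cm (cis be) (sh xh QH)) z"
proof -
  obtain al x0 where V: "!!x. V x = cis al*W (x + x0)" using wave_unique[OF V] by blast
  have "exp (- \<i> * of_real (p*(z/(2*kk))))*V (z/(2*kk)) = fn (cm (cis (al + p*x0)) (sh (2*kk*x0) QH)) z" for z
  proof -
    have 1: "(z + 2*kk*x0)/(2*kk) = z/(2*kk) + x0" using kk by (simp add: field_simps)
    have 2: "exp (- \<i> * of_real (p*(z/(2*kk)))) = cis (- (p*(z/(2*kk))))" by (simp add: cis_conv_exp)
    have 3: "cis (al + p*x0)*e0 (z + 2*kk*x0) = cis (- (p*(z/(2*kk))))*cis al"
      unfolding e0_def cis_mult using kk by (simp add: field_simps)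
    have "fn (cm (cis (al + p*x0)) (sh (2*kk*x0) QH)) z = cis (al + p*x0)*e0 (z + 2*kk*x0)*W (z/(2*kk) + x0)"
      by (simp only: fn_cm fn_sh fn_QH Qf_def 1) (simp only: mult.assoc)
    then show ?thesis unfolding 3 2 V by (simp add: mult.assoc)
  qed
  then show ?thesis by blast
qed

text \<open>A different point of the orbit as reference only shifts the two parameters over which
  the infimum is taken.\<close>

lemma (in profile) rho_od:
  assumes r: "rp u U" and q: "!!z. q z = fn (cm (cis be) (sh xh0 Q)) z"
  shows "rho u q = od U"
proof -
  have e: "X_norm (%z. u z - exp (- \<i> * of_real ph)*q (z + xh)) = norm (U - orb (ph - be) (xh + xh0))" for ph xh
  proof -
    have "exp (- \<i> * of_real ph)*q (z + xh) = fn (orb (ph - be) (xh + xh0)) z" for z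
    proof -
      have "exp (- \<i> * of_real ph) = cis (- ph)" by (simp add: cis_conv_exp)
      moreover have "cis (- ph)*cis be = cis (- (ph - be))" by (simp add: cis_mult)
      ultimately show ?thesis by (simp add: q orb_def fn_cm fn_sh mult.assoc[symmetric] add.assoc)
    qed
    then have "(%z. u z - exp (- \<i> * of_real ph)*q (z + xh)) = (%z. u z - fn (orb (ph - be) (xh + xh0)) z)" by simp
    then show ?thesis using rp_norm[OF rp_diff[OF r rp_fn]] by simp
  qed
  have "(%(ph, xh). norm (U - orb (ph - be) (xh + xh0))) ` UNIV = (%(ph, xh). norm (U - orb ph xh)) ` UNIV"
  proof -
    have s: "surj (%(ph, xh). (ph - be, xh + xh0))" unfolding surj_def
    proof
      fix y :: "real \<times> real"
      show "EX x. y = (case x of (ph, xh) => (ph - be, xh + xh0))"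
        by (intro exI[of _ "(fst y + be, snd y - xh0)"]) simp
    qed
    have c: "(%(ph, xh). norm (U - orb (ph - be) (xh + xh0))) = (%(ph, xh). norm (U - orb ph xh)) \<circ> (%(ph, xh). (ph - be, xh + xh0))"
      by (auto simp: fun_eq_iff)
    show ?thesis unfolding c image_comp[symmetric] s ..
  qed
  then show ?thesis unfolding rho_def od_def e by simp
qed

theorem proposition4p6:
  fixes J E :: real
  assumes "(J, E) \<in> D_set"
    and "det (H_JE (J, E)) < 0"
  shows "\<exists>C0 > 0. \<exists>\<epsilon>0 > 0. \<forall>\<epsilon> \<le> \<epsilon>0. \<forall>Q0 \<in> X_space.
           rho Q0 (Q_of (J, E) (J, E)) \<le> \<epsilon> \<longrightarrow>
           (\<forall>Q :: real \<Rightarrow> real \<Rightarrow> complex.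
              is_solution (k_of (J, E)) (p_of (J, E) (J, E)) Q \<and>
              (AE z in lebesgue. Q 0 z = Q0 z) \<longrightarrow>
              (\<forall>t. rho (Q t) (Q_of (J, E) (J, E)) \<le> C0 * \<epsilon>))"
proof -
  interpret D: dpoint J E by unfold_locales (rule assms(1))
  let ?k = "k_of (J, E)" and ?p = "p_of (J, E) (J, E)"
  obtain W W1 where W: "good_wave J E D.T ?p W W1" using D.good_wave_ex by blast
  interpret G: good_wave J E D.T ?p W W1 by (rule W)
  have kk: "?k = G.kk" by (simp add: k_of_def G.kk_def D.T_of_eq)
  have "is_wave (J, E) (W_of (J, E))" unfolding W_of_def by (rule someI[of "is_wave (J, E)", OF G.is_wave_W])
  \<comment> \<open>The wave behind \<open>Q_of\<close> is an arbitrary choice; by uniqueness the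
    resulting profile lies on the orbit of the constructed one.\<close>
  from G.wave_function[OF this] obtain be xh where q: "!!z. Q_of (J, E) (J, E) z = fn (cm (cis be) (sh xh G.QH)) z"
    unfolding Q_of_def kk by blast
  interpret P: profile G.kk ?p G.QH G.QH1 by (rule G.profile)
  obtain C0 ep0 where C: "C0 > 0" "ep0 > 0"
    "!!ep U t. ep <= ep0 ==> sol G.kk ?p U ==> P.od (U 0) <= ep ==> P.od (U t) <= C0*ep" using P.h1_stability by blast
  have "rho (Q t) (Q_of (J, E) (J, E)) <= C0*ep"
    if eps: "ep <= ep0" and Q0: "Q0 \<in> X_space" "rho Q0 (Q_of (J, E) (J, E)) <= ep"
      and s: "is_solution ?k ?p Q" and ae: "AE z in lebesgue. Q 0 z = Q0 z" for ep Q0 Q t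
  proof -
    have "ALL t. EX U. rp (Q t) U" using s by (intro allI rp_exists) (simp add: is_solution_def)
    then obtain U where U: "!!t. rp (Q t) (U t)" by metis
    have "AE z in lebesgue. Q0 z = fn (U 0) z" using ae rp_AE[OF U[of 0]] by eventually_elim simp
    then have "rp Q0 (U 0)" using Q0(1) by (simp add: rp_def)
    then have "P.od (U 0) <= ep" using Q0(2) P.rho_od[OF _ q] by metis
    moreover have "sol G.kk ?p U" using sol_of_solution[OF s U] unfolding kk .
    ultimately have "P.od (U t) <= C0*ep" using C(3)[OF eps] by blast
    then show ?thesis using P.rho_od[OF U q] by metis
  qed
  then show ?thesis using C(1,2) by blast
qed

end
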